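(* There exists an action $\beta=(\beta_g)_{g\in G}$ of $G$ on $\mathcal{B}_0$ (a homomorphism $G\to\mathrm{Aut}(\mathcal{B}_0)$) such that for every $g\in G$ one has $\mathfrak{H}_g\cong {}_{\beta_g}\mathfrak{H}_0$ as $\mathcal{B}_0$-$\mathcal{B}_0$-bimodules.
   Context: $\mathcal{M}$ is a type III factor with a faithful normal state $\psi_0$; $\mathrm{End}(\mathcal{M})$ (resp. $\mathrm{End}_0(\mathcal{M})$) is the set of endomorphisms (resp. of finite index endomorphisms). $(\rho,\sigma)=\{T\in\mathcal{M}\mid T\rho(x)=\sigma(x)T\ \forall x\}$. For $\rho\in\mathrm{End}_0(\mathcal{M})$ with conjugate $\bar\rho$ and dimension $d(\rho)$, a solution $(R_\rho,\bar R_\rho)$ of the conjugate equation is fixed: $R_\rho\in(\mathrm{id},\bar\rho\rho)$, $\bar R_\rho\in(\mathrm{id},\rho\bar\rho)$, $R_\rho^*R_\rho=\bar R_\rho^*\bar R_\rho=d(\rho)$, $R_\rho^*\bar\rho(\bar R_\rho)=\bar R_\rho^*\rho(R_\rho)=1$. $\mathcal{C}\subset\mathrm{End}_0(\mathcal{M})$ is a rigid C$^*$-tensor category and $\mathrm{Irr}(\mathcal{C})$ is an (at most countable) set of representatives of irreducible objects. $G$ is a discrete group with neutral element $0$ (operation written multiplicatively). $\mathcal{C}$ is $G$-graded, and $\mathcal{C}_g$ denotes the $g$-component for $g\in G$: $\mathcal{C}=\bigoplus_{g\in G}\mathcal{C}_g$ (every irreducible object lies in exactly one $\mathcal{C}_g$),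 $\mathcal{C}_g\mathcal{C}_h\subset\mathcal{C}_{gh}$, $\overline{\mathcal{C}_g}=\mathcal{C}_{g^{-1}}$. $j:\mathcal{M}\to\mathcal{M}^{\mathrm{op}}$, $j(x)=x^*$ (conjugate linear, multiplicative), $\pi^{\mathrm{op}}=j\pi j^{-1}$, $\mathcal{A}=\mathcal{M}\otimes\mathcal{M}^{\mathrm{op}}$ (von Neumann tensor product). For $\pi,\rho,\sigma\in\mathrm{Irr}(\mathcal{C})$ let $\{T_{\pi,\rho}^{\sigma,e}\}_e$ be an orthonormal basis of $(\sigma,\pi\rho)$ (inner product $\langle T,S\rangle 1=S^*T$), and $\tilde T_{\pi,\rho}^\sigma=\sum_e T_{\pi,\rho}^{\sigma,e}\otimes j(T_{\pi,\rho}^{\sigma,e})$. $\mathcal{A}^0(\mathcal{C})$ is the $*$-algebra generated by $\mathcal{A}$ and $\{\lambda_\pi\}_{\pi\in\mathrm{Irr}(\mathcal{C})}$ with $\lambda_\pi a=(\pi\otimes\pi^{\mathrm{op}})(a)\lambda_\pi$, $\lambda_\pi\lambda_\rho=\sum_\sigma\tilde T_{\pi,\rho}^\sigma\lambda_\sigma$, $\lambda_\pi^*=R_{\pi\otimes\pi^{\mathrm{op}}}^*\lambda_{\bar\pi}$, where $R_{\pi\otimes\pi^{\mathrm{op}}}=R_\pi\otimes j(R_\pi)$. $L^2(\mathcal{A})$ is the standard Hilbert space with modular conjugation $J$; $\chi^{1/2}$ is the vector of the positive cone implementing a positive normal functional $\chi$; $\psi_{\mathcal{A}}=\psi_0\otimes\psi_0^{\mathrm{op}}$;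 the standard implementation $u_\rho$ of a finite index $\rho\in\mathrm{End}(\mathcal{A})$ is $u_\rho(a\psi_{\mathcal{A}}^{1/2})=\rho(a)(\psi_{\mathcal{A}}\circ\phi_\rho)^{1/2}$ with $\phi_\rho(x)=R_\rho^*\bar\rho(x)R_\rho$. On $\mathfrak{H}=\ell^2(\mathrm{Irr}(\mathcal{C}),L^2(\mathcal{A}))$ define, for $a\in\mathcal{A}$, $\pi\in\mathrm{Irr}(\mathcal{C})$, a left action $\gamma_L$ by $(\gamma_L(a)v)(\rho)=(\rho\otimes\rho^{\mathrm{op}})(a)v(\rho)$, $(\gamma_L(\lambda_\pi)v)(\rho)=\sum_\sigma\sqrt{d(\rho)/d(\sigma)}\,\tilde T_{\rho,\pi}^\sigma v(\sigma)$, and a right action $\gamma_R$ by $(\gamma_R(a)v)(\rho)=Ja^*Jv(\rho)$, $\gamma_R(\lambda_\pi)=u_{\pi\otimes\pi^{\mathrm{op}}}^*\kappa_\pi$ ($u^*$ acting componentwise), where $(\kappa_\pi v)(\rho)=\sum_\sigma\sqrt{d(\rho)/d(\sigma)}\,\tilde T_{\pi,\rho}^\sigma v(\sigma)$. These are commuting left and right actions of $\mathcal{A}^0(\mathcal{C})$. $\mathcal{B}=\gamma_L(\mathcal{A}^0(\mathcal{C}))''$ (identified with its abstract version, $\gamma_L$ being omitted), and $\gamma_R$ extends to a right action of $\mathcal{B}$. $\mathcal{B}_0\subset\mathcal{B}$ is the $\sigma$-weak closure of the finite sums $\sum_{\pi\in\mathrm{Irr}(\mathcal{C}_0)}a_\pi\lambda_\pi$,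 $a_\pi\in\mathcal{A}$. $\mathfrak{H}_g=\ell^2(\mathrm{Irr}(\mathcal{C}_g),L^2(\mathcal{A}))\subset\mathfrak{H}$ is a $\mathcal{B}_0$-$\mathcal{B}_0$-bimodule via $\gamma_L,\gamma_R$. ${}_{\beta_g}\mathfrak{H}_0$ denotes $\mathfrak{H}_0$ with left action $b\cdot v=\gamma_L(\beta_g(b))v$ and right action $\gamma_R$.
   Formalization: The grading is additionally assumed to be faithful (every component C_g is nonzero); if some C_g were zero, then H_g = 0 while H_0 is nonzero, and the claimed isomorphism would fail. *)

theory Defs
  imports "HOL-Analysis.Analysis" "HOL-Library.FuncSet" "HOL-Library.Countable"
begin

section \<open>Complex Hilbert spaces\<close>

class scaleC =
  fixes scaleC :: "complex \<Rightarrow> 'a \<Rightarrow> 'a"  (infixr \<open>*\<^sub>C\<close> 75)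

text \<open>Inner products are linear in the \<^emph>\<open>first\<close> argument.\<close>

class chilbert_space = banach + scaleC +
  fixes cinner :: "'a \<Rightarrow> 'a \<Rightarrow> complex"
  assumes scaleC_of_real: "complex_of_real r *\<^sub>C x = r *\<^sub>R x"
    and scaleC_add_right: "c *\<^sub>C (x + y) = c *\<^sub>C x + c *\<^sub>C y"
    and scaleC_add_left: "(c + d) *\<^sub>C x = c *\<^sub>C x + d *\<^sub>C x"
    and scaleC_scaleC: "c *\<^sub>C d *\<^sub>C x = (c * d) *\<^sub>C x"
    and cinner_commute: "cinner x y = cnj (cinner y x)"
    and cinner_add_left: "cinner (x + y) z = cinner x z + cinner y z"
    and cinner_scaleC_left: "cinner (c *\<^sub>C x) y = c * cinner x y"
    and cinner_self: "cinner x x = complex_of_real ((norm x)\<^sup>2)"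

instantiation complex :: scaleC
begin
definition scaleC_complex :: "complex \<Rightarrow> complex \<Rightarrow> complex" where
  "scaleC_complex c z = c * z"
instance ..
end

lemma scaleC_zero [simp]: "c *\<^sub>C (0::'a::chilbert_space) = 0"
  by (metis add_cancel_right_right scaleC_add_right)

lemma cinner_add_right: "cinner x (y + z) = cinner x y + cinner x (z::'a::chilbert_space)"
  by (metis cinner_add_left cinner_commute complex_cnj_add)

lemma cinner_scaleC_right: "cinner x (c *\<^sub>C y) = cnj c * cinner x (y::'a::chilbert_space)"
  by (metis cinner_commute cinner_scaleC_left complex_cnj_mult)

lemma norm_scaleC: "norm (c *\<^sub>C x) = cmod c * norm (x::'a::chilbert_space)"
proof -
  have "complex_of_real ((norm (c *\<^sub>C x))\<^sup>2) = c * cnj c * complex_of_real ((norm x)\<^sup>2)"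
    by (simp only: cinner_self[symmetric] cinner_scaleC_left cinner_scaleC_right mult.assoc mult.left_commute)
  also have "\<dots> = complex_of_real ((cmod c * norm x)\<^sup>2)"
    by (simp add: complex_mult_cnj cmod_power2[symmetric] power_mult_distrib)
  finally have "(norm (c *\<^sub>C x))\<^sup>2 = (cmod c * norm x)\<^sup>2"
    using of_real_eq_iff by blast
  then show ?thesis
    by (simp add: power2_eq_iff_nonneg)
qed

lemma norm_add_sq: "(norm (x + y))\<^sup>2 = (norm x)\<^sup>2 + (norm y)\<^sup>2 + 2 * Re (cinner x (y::'a::chilbert_space))"
proof -
  have "complex_of_real ((norm (x + y))\<^sup>2) = cinner x x + cinner y y + (cinner x y + cnj (cinner x y))"
    by (simp only: cinner_self[symmetric] cinner_add_left cinner_add_right cinner_commute[of y x] add_ac)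
  also have "\<dots> = complex_of_real ((norm x)\<^sup>2 + (norm y)\<^sup>2 + 2 * Re (cinner x y))"
    by (simp add: cinner_self complex_add_cnj)
  finally show ?thesis
    using of_real_eq_iff by blast
qed

text \<open>The bound without square roots suffices for summability below.\<close>

lemma cmod_cinner_le: "cmod (cinner x y) \<le> ((norm x)\<^sup>2 + (norm (y::'a::chilbert_space))\<^sup>2) / 2"
proof -
  obtain c where c: "cmod c = 1" "c * cinner x y = - complex_of_real (cmod (cinner x y))"
  proof (cases "cinner x y = 0")
    case True
    then show ?thesis using that[of 1] by simp
  next
    case False
    let ?z = "cinner x y"
    have "cmod (- cnj ?z / cmod ?z) = 1"
      using False by (simp add: norm_divide)
    moreover have "- cnj ?z / cmod ?z * ?z = - complex_of_real (cmod ?z)"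
      using False by (simp add: mult.commute[of "cnj ?z"] complex_norm_square[symmetric] power2_eq_square)
    ultimately show ?thesis using that by blast
  qed
  have "0 \<le> (norm (c *\<^sub>C x + y))\<^sup>2" by simp
  also have "\<dots> = (norm x)\<^sup>2 + (norm y)\<^sup>2 - 2 * cmod (cinner x y)"
    by (simp add: norm_add_sq norm_scaleC cinner_scaleC_left c)
  finally show ?thesis by simp
qed


section \<open>Square-summable families\<close>

typedef (overloaded) ('i, 'a) ell2 =
  "{f :: 'i \<Rightarrow> 'a::chilbert_space. (\<lambda>i. (norm (f i))\<^sup>2) summable_on UNIV}"
  morphisms coord Abs_ell2
  by (rule exI[of _ "\<lambda>_. 0"]) simp

setup_lifting type_definition_ell2

lemma ell2_bound:
  assumes "\<And>F. finite F \<Longrightarrow> L2_set (\<lambda>i. norm (f i)) F \<le> B"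
  shows "(\<lambda>i. (norm (f i))\<^sup>2) summable_on UNIV"
    and "sqrt (\<Sum>\<^sub>\<infinity>i. (norm (f i))\<^sup>2) \<le> B"
proof -
  have B: "0 \<le> B" using assms[of "{}"] by simp
  have *: "(\<Sum>i\<in>F. (norm (f i))\<^sup>2) \<le> B\<^sup>2" if "finite F" for F
    using assms[OF that] B unfolding L2_set_def
    by (metis real_sqrt_le_iff real_sqrt_abs abs_of_nonneg)
  show s: "(\<lambda>i. (norm (f i))\<^sup>2) summable_on UNIV"
    using * by (intro nonneg_bdd_above_summable_on bdd_aboveI2) auto
  have "(\<Sum>\<^sub>\<infinity>i. (norm (f i))\<^sup>2) \<le> B\<^sup>2"
    using * by (intro infsum_le_finite_sums[OF s]) auto
  then show "sqrt (\<Sum>\<^sub>\<infinity>i. (norm (f i))\<^sup>2) \<le> B"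
    using B by (simp add: real_le_lsqrt)
qed

lemma L2_set_le_ell2:
  assumes "(\<lambda>i. (norm (f i))\<^sup>2) summable_on UNIV" "finite F"
  shows "L2_set (\<lambda>i. norm (f i)) F \<le> sqrt (\<Sum>\<^sub>\<infinity>i. (norm (f i))\<^sup>2)"
  unfolding L2_set_def
  using finite_sum_le_infsum[OF assms] by simp

lemma ell2_triangle:
  fixes f g :: "'i \<Rightarrow> 'a::real_normed_vector"
  assumes "(\<lambda>i. (norm (f i))\<^sup>2) summable_on UNIV" "(\<lambda>i. (norm (g i))\<^sup>2) summable_on UNIV" "finite F"
  shows "L2_set (\<lambda>i. norm (f i + g i)) F
      \<le> sqrt (\<Sum>\<^sub>\<infinity>i. (norm (f i))\<^sup>2) + sqrt (\<Sum>\<^sub>\<infinity>i. (norm (g i))\<^sup>2)"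
proof -
  have "L2_set (\<lambda>i. norm (f i + g i)) F \<le> L2_set (\<lambda>i. norm (f i) + norm (g i)) F"
    by (intro L2_set_mono norm_triangle_ineq) auto
  also have "\<dots> \<le> L2_set (\<lambda>i. norm (f i)) F + L2_set (\<lambda>i. norm (g i)) F"
    by (rule L2_set_triangle_ineq)
  also have "\<dots> \<le> sqrt (\<Sum>\<^sub>\<infinity>i. (norm (f i))\<^sup>2) + sqrt (\<Sum>\<^sub>\<infinity>i. (norm (g i))\<^sup>2)"
    by (intro add_mono L2_set_le_ell2 assms)
  finally show ?thesis .
qed

instantiation ell2 :: (type, chilbert_space) real_normed_vector
begin
lift_definition zero_ell2 :: "('a, 'b) ell2" is "\<lambda>_. 0" by simp
lift_definition plus_ell2 :: "('a, 'b) ell2 \<Rightarrow> ('a, 'b) ell2 \<Rightarrow> ('a, 'b) ell2"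
  is "\<lambda>f g i. f i + g i"
  by (rule ell2_bound(1), rule ell2_triangle)
lift_definition uminus_ell2 :: "('a, 'b) ell2 \<Rightarrow> ('a, 'b) ell2" is "\<lambda>f i. - f i" by simp
lift_definition scaleR_ell2 :: "real \<Rightarrow> ('a, 'b) ell2 \<Rightarrow> ('a, 'b) ell2" is "\<lambda>r f i. r *\<^sub>R f i"
  by (simp add: power_mult_distrib summable_on_cmult_right)
lift_definition norm_ell2 :: "('a, 'b) ell2 \<Rightarrow> real" is "\<lambda>f. sqrt (\<Sum>\<^sub>\<infinity>i. (norm (f i))\<^sup>2)" .
definition minus_ell2 :: "('a, 'b) ell2 \<Rightarrow> ('a, 'b) ell2 \<Rightarrow> ('a, 'b) ell2" where
  "minus_ell2 v w = v + (- w)"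
definition dist_ell2 :: "('a, 'b) ell2 \<Rightarrow> ('a, 'b) ell2 \<Rightarrow> real" where
  "dist_ell2 v w = norm (v - w)"
definition sgn_ell2 :: "('a, 'b) ell2 \<Rightarrow> ('a, 'b) ell2" where
  "sgn_ell2 v = inverse (norm v) *\<^sub>R v"
definition uniformity_ell2 :: "(('a, 'b) ell2 \<times> ('a, 'b) ell2) filter" where
  "uniformity_ell2 = (INF e\<in>{0<..}. principal {(v, w). dist v w < e})"
definition open_ell2 :: "('a, 'b) ell2 set \<Rightarrow> bool" where
  "open_ell2 U = (\<forall>v\<in>U. eventually (\<lambda>(v', w). v' = v \<longrightarrow> w \<in> U) uniformity)"
instance
proof
  fix u v w :: "('a, 'b) ell2" and a b :: real
  show "u + v + w = u + (v + w)" by transfer (simp add: add.assoc)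
  show "u + v = v + u" by transfer (simp add: add.commute)
  show "0 + u = u" by transfer simp
  show "- u + u = 0" by transfer simp
  show "u - v = u + - v" by (rule minus_ell2_def)
  show "a *\<^sub>R (u + v) = a *\<^sub>R u + a *\<^sub>R v" by transfer (simp add: scaleR_add_right)
  show "(a + b) *\<^sub>R u = a *\<^sub>R u + b *\<^sub>R u" by transfer (simp add: scaleR_add_left)
  show "a *\<^sub>R b *\<^sub>R u = (a * b) *\<^sub>R u" by transfer simp
  show "1 *\<^sub>R u = u" by transfer simp
  show "dist u v = norm (u - v)" by (rule dist_ell2_def)
  show "sgn u = inverse (norm u) *\<^sub>R u" by (rule sgn_ell2_def)
  show "uniformity = (INF e\<in>{0<..}. principal {(v :: ('a, 'b) ell2, w). dist v w < e})"
    by (rule uniformity_ell2_def)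
  show "open U = (\<forall>v\<in>U. eventually (\<lambda>(v', w). v' = v \<longrightarrow> w \<in> U) uniformity)"
    for U :: "('a, 'b) ell2 set" by (rule open_ell2_def)
  show "norm (u + v) \<le> norm u + norm v"
    by transfer (rule ell2_bound(2), rule ell2_triangle)
  show "norm (a *\<^sub>R u) = \<bar>a\<bar> * norm u"
    by transfer (simp add: power_mult_distrib infsum_cmult_right' real_sqrt_mult)
  show "(norm u = 0) = (u = 0)"
  proof
    assume "norm u = 0"
    then show "u = 0"
    proof transfer
      fix f :: "'a \<Rightarrow> 'b"
      assume s: "(\<lambda>i. (norm (f i))\<^sup>2) summable_on UNIV" and z: "sqrt (\<Sum>\<^sub>\<infinity>i. (norm (f i))\<^sup>2) = 0"
      have "norm (f i) = 0" for i
        using L2_set_le_ell2[OF s, of "{i}"] z by simp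
      then show "f = (\<lambda>_. 0)" by auto
    qed
  next
    assume "u = 0"
    then show "norm u = 0" by transfer simp
  qed
qed
end

lemma coord_minus: "coord (v - w) i = coord v i - coord w i"
  unfolding minus_ell2_def by transfer simp

lemma norm_coord_le: "norm (coord v i) \<le> norm v"
  by transfer (use L2_set_le_ell2[of _ "{i}" for i] in force)

instance ell2 :: (type, chilbert_space) banach
proof
  fix X :: "nat \<Rightarrow> ('a, 'b) ell2"
  assume X: "Cauchy X"
  have "Cauchy (\<lambda>n. coord (X n) i)" for i
  proof (rule metric_CauchyI)
    fix e :: real assume "0 < e"
    then obtain N where N: "\<forall>m\<ge>N. \<forall>n\<ge>N. dist (X m) (X n) < e"
      using X metric_CauchyD by blast
    have "dist (coord (X m) i) (coord (X n) i) \<le> dist (X m) (X n)" for m n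
      using norm_coord_le[of "X m - X n" i] by (simp add: dist_norm coord_minus)
    then show "\<exists>N. \<forall>m\<ge>N. \<forall>n\<ge>N. dist (coord (X m) i) (coord (X n) i) < e"
      using N le_less_trans by blast
  qed
  then have "\<forall>i. \<exists>l. (\<lambda>n. coord (X n) i) \<longlonglongrightarrow> l"
    using Cauchy_convergent_iff convergent_def by blast
  then obtain L where L: "\<And>i. (\<lambda>n. coord (X n) i) \<longlonglongrightarrow> L i" by metis
  have fin: "\<exists>N. \<forall>m\<ge>N. \<forall>F. finite F \<longrightarrow> L2_set (\<lambda>i. norm (coord (X m) i - L i)) F \<le> e"
    if "0 < e" for e
  proof -
    obtain N where N: "\<forall>m\<ge>N. \<forall>n\<ge>N. dist (X m) (X n) < e"
      using X \<open>0 < e\<close> metric_CauchyD by blast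
    have "L2_set (\<lambda>i. norm (coord (X m) i - L i)) F \<le> e" if m: "m \<ge> N" and F: "finite F" for m F
    proof (rule LIMSEQ_le_const2)
      show "(\<lambda>n. L2_set (\<lambda>i. norm (coord (X m) i - coord (X n) i)) F)
          \<longlonglongrightarrow> L2_set (\<lambda>i. norm (coord (X m) i - L i)) F"
        unfolding L2_set_def by (intro tendsto_intros L)
      have "L2_set (\<lambda>i. norm (coord (X m) i - coord (X n) i)) F \<le> e" if "n \<ge> N" for n
      proof -
        have "L2_set (\<lambda>i. norm (coord (X m - X n) i)) F \<le> norm (X m - X n)"
          using L2_set_le_ell2[OF _ F] coord[of "X m - X n"] by (simp add: norm_ell2.rep_eq)
        then show ?thesis using N m that by (simp add: coord_minus dist_norm) (meson less_imp_le order_trans)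
      qed
      then show "\<exists>N. \<forall>n\<ge>N. L2_set (\<lambda>i. norm (coord (X m) i - coord (X n) i)) F \<le> e" by blast
    qed
    then show ?thesis by blast
  qed
  obtain N1 where N1: "\<forall>m\<ge>N1. \<forall>F. finite F \<longrightarrow> L2_set (\<lambda>i. norm (coord (X m) i - L i)) F \<le> 1"
    using fin[of 1] by auto
  define D where "D = Abs_ell2 (\<lambda>i. coord (X N1) i - L i)"
  have D: "coord D i = coord (X N1) i - L i" for i
    unfolding D_def using N1 by (subst Abs_ell2_inverse) (auto intro!: ell2_bound(1))
  define l where "l = X N1 - D"
  have l: "coord l i = L i" for i by (simp add: l_def coord_minus D)
  have "X \<longlonglongrightarrow> l"
  proof (rule metric_LIMSEQ_I)
    fix e :: real assume e: "0 < e"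
    then obtain N where N: "\<forall>m\<ge>N. \<forall>F. finite F \<longrightarrow> L2_set (\<lambda>i. norm (coord (X m) i - L i)) F \<le> e/2"
      using fin[of "e/2"] by auto
    have "norm (X m - l) \<le> e/2" if "m \<ge> N" for m
      unfolding norm_ell2.rep_eq
      by (rule ell2_bound(2)) (use N that in \<open>simp add: coord_minus l\<close>)
    then show "\<exists>N. \<forall>n\<ge>N. dist (X n) l < e"
      using e by (force simp: dist_norm)
  qed
  then show "convergent X" by (auto simp: convergent_def)
qed

lemma cinner_summable:
  fixes f g :: "'i \<Rightarrow> 'a::chilbert_space"
  assumes "(\<lambda>i. (norm (f i))\<^sup>2) summable_on UNIV" "(\<lambda>i. (norm (g i))\<^sup>2) summable_on UNIV"
  shows "(\<lambda>i. cinner (f i) (g i)) summable_on UNIV"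
proof (rule abs_summable_summable)
  have "(\<lambda>i. ((norm (f i))\<^sup>2 + (norm (g i))\<^sup>2) * (1/2)) summable_on UNIV"
    by (intro summable_on_cmult_left summable_on_add assms)
  then show "(\<lambda>i. norm (cinner (f i) (g i))) summable_on UNIV"
    by (rule summable_on_comparison_test) (use cmod_cinner_le in auto)
qed

instantiation ell2 :: (type, chilbert_space) chilbert_space
begin
lift_definition scaleC_ell2 :: "complex \<Rightarrow> ('a, 'b) ell2 \<Rightarrow> ('a, 'b) ell2" is "\<lambda>c f i. c *\<^sub>C f i"
  by (simp add: norm_scaleC power_mult_distrib summable_on_cmult_right)
lift_definition cinner_ell2 :: "('a, 'b) ell2 \<Rightarrow> ('a, 'b) ell2 \<Rightarrow> complex"
  is "\<lambda>f g. \<Sum>\<^sub>\<infinity>i. cinner (f i) (g i)" .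
instance
proof
  fix u v w :: "('a, 'b) ell2" and c d :: complex and r :: real
  show "complex_of_real r *\<^sub>C u = r *\<^sub>R u" by transfer (simp add: scaleC_of_real)
  show "c *\<^sub>C (u + v) = c *\<^sub>C u + c *\<^sub>C v" by transfer (simp add: scaleC_add_right)
  show "(c + d) *\<^sub>C u = c *\<^sub>C u + d *\<^sub>C u" by transfer (simp add: scaleC_add_left)
  show "c *\<^sub>C d *\<^sub>C u = (c * d) *\<^sub>C u" by transfer (simp add: scaleC_scaleC)
  show "cinner u v = cnj (cinner v u)"
    by transfer (simp add: infsum_cnj[symmetric] cinner_commute[symmetric])
  show "cinner (u + v) w = cinner u w + cinner v w"
    by transfer (simp add: cinner_add_left infsum_add cinner_summable)
  show "cinner (c *\<^sub>C u) v = c * cinner u v"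
    by transfer (simp add: cinner_scaleC_left infsum_cmult_right')
  show "cinner u u = complex_of_real ((norm u)\<^sup>2)"
  proof transfer
    fix f :: "'a \<Rightarrow> 'b"
    assume s: "(\<lambda>i. (norm (f i))\<^sup>2) summable_on UNIV"
    have "(\<Sum>\<^sub>\<infinity>i. complex_of_real ((norm (f i))\<^sup>2)) = complex_of_real (\<Sum>\<^sub>\<infinity>i. (norm (f i))\<^sup>2)"
      by (rule infsumI[OF has_sum_of_real[OF has_sum_infsum[OF s]]])
    moreover have "0 \<le> (\<Sum>\<^sub>\<infinity>i. (norm (f i))\<^sup>2)" by (intro infsum_nonneg) simp
    ultimately show "(\<Sum>\<^sub>\<infinity>i. cinner (f i) (f i)) = complex_of_real ((sqrt (\<Sum>\<^sub>\<infinity>i. (norm (f i))\<^sup>2))\<^sup>2)"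
      by (simp add: cinner_self)
  qed
qed
end


section \<open>Bounded operators\<close>

typedef (overloaded) 'a bop =
  "{f :: 'a::chilbert_space \<Rightarrow> 'a. bounded_linear f \<and> (\<forall>c x. f (c *\<^sub>C x) = c *\<^sub>C f x)}"
  morphisms op_app Abs_bop
  by (rule exI[of _ "\<lambda>x. x"]) (simp add: bounded_linear_ident)

setup_lifting type_definition_bop

text \<open>Multiplication is composition.  The Hilbert space may be zero, so \<open>ring_1\<close> is not available.\<close>

instantiation bop :: (chilbert_space) "{ring, monoid_mult, scaleC}"
begin
lift_definition zero_bop :: "'a bop" is "\<lambda>_. 0" by simp
lift_definition one_bop :: "'a bop" is "\<lambda>x. x" by (simp add: bounded_linear_ident)
lift_definition plus_bop :: "'a bop \<Rightarrow> 'a bop \<Rightarrow> 'a bop" is "\<lambda>S T x. S x + T x"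
  by (simp add: bounded_linear_add scaleC_add_right)
lift_definition uminus_bop :: "'a bop \<Rightarrow> 'a bop" is "\<lambda>T x. - T x"
  by (simp add: bounded_linear_minus) (metis add_eq_0_iff scaleC_add_right scaleC_zero)
lift_definition times_bop :: "'a bop \<Rightarrow> 'a bop \<Rightarrow> 'a bop" is "\<lambda>S T x. S (T x)"
  by (simp add: bounded_linear_compose)
definition minus_bop :: "'a bop \<Rightarrow> 'a bop \<Rightarrow> 'a bop" where "minus_bop S T = S + (- T)"
lift_definition scaleC_bop :: "complex \<Rightarrow> 'a bop \<Rightarrow> 'a bop" is "\<lambda>c T x. c *\<^sub>C T x"
proof
  fix c :: complex and f :: "'a \<Rightarrow> 'a"
  assume f: "bounded_linear f \<and> (\<forall>c x. f (c *\<^sub>C x) = c *\<^sub>C f x)"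
  then interpret bounded_linear f by simp
  have comm: "c *\<^sub>C d *\<^sub>C x = d *\<^sub>C c *\<^sub>C x" for d and x :: 'a
    by (simp add: scaleC_scaleC mult.commute)
  obtain K where K: "\<And>x. norm (f x) \<le> norm x * K" using bounded by blast
  show "bounded_linear (\<lambda>x. c *\<^sub>C f x)"
  proof (rule bounded_linear_intro[where K = "cmod c * K"])
    show "c *\<^sub>C f (x + y) = c *\<^sub>C f x + c *\<^sub>C f y" for x y by (simp add: add scaleC_add_right)
    show "c *\<^sub>C f (r *\<^sub>R x) = r *\<^sub>R c *\<^sub>C f x" for r x
      by (simp only: scaleR) (metis scaleC_of_real comm)
    show "norm (c *\<^sub>C f x) \<le> norm x * (cmod c * K)" for x
      using mult_left_mono[OF K[of x], of "cmod c"] by (simp add: norm_scaleC mult_ac)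
  qed
  show "\<forall>d x. c *\<^sub>C f (d *\<^sub>C x) = d *\<^sub>C c *\<^sub>C f x" using f by (simp add: comm)
qed
instance
proof
  fix a b c :: "'a bop"
  show "a + b + c = a + (b + c)" by transfer (simp add: add.assoc)
  show "a + b = b + a" by transfer (simp add: add.commute)
  show "0 + a = a" by transfer simp
  show "- a + a = 0" by transfer simp
  show "a - b = a + - b" by (rule minus_bop_def)
  show "a * b * c = a * (b * c)" by transfer simp
  show "1 * a = a" by transfer simp
  show "a * 1 = a" by transfer simp
  show "(a + b) * c = a * c + b * c" by transfer simp
  show "a * (b + c) = a * b + a * c"
    by transfer (auto simp: fun_eq_iff linear_add bounded_linear.linear)
qed
end

definition adj :: "'a::chilbert_space bop \<Rightarrow> 'a bop" where
  "adj T = (THE S. \<forall>x y. cinner (op_app T x) y = cinner x (op_app S y))"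

definition pos_op :: "'a::chilbert_space bop \<Rightarrow> bool" where
  "pos_op T \<longleftrightarrow> (\<forall>x. cinner (op_app T x) x \<in> \<real>\<^sub>\<ge>\<^sub>0)"

text \<open>The initial topology of the functionals \<open>\<Sum>\<^sub>n \<langle>T \<xi>\<^sub>n, \<eta>\<^sub>n\<rangle>\<close>.\<close>

definition sigma_weak :: "'a::chilbert_space bop topology" where
  "sigma_weak = topology_generated_by
     {{T. (\<Sum>n. cinner (op_app T (\<xi> n)) (\<eta> n)) \<in> V} | (\<xi> :: nat \<Rightarrow> 'a) (\<eta> :: nat \<Rightarrow> 'a) V.
        summable (\<lambda>n. (norm (\<xi> n))\<^sup>2) \<and> summable (\<lambda>n. (norm (\<eta> n))\<^sup>2) \<and> open V}"


section \<open>Von Neumann algebras\<close>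

definition commutant :: "'a::chilbert_space bop set \<Rightarrow> 'a bop set" where
  "commutant N = {T. \<forall>x\<in>N. T * x = x * T}"

definition von_neumann_algebra :: "'a::chilbert_space bop set \<Rightarrow> bool" where
  "von_neumann_algebra N \<longleftrightarrow> (\<forall>x\<in>N. adj x \<in> N) \<and> commutant (commutant N) = N"

definition factor :: "'a::chilbert_space bop set \<Rightarrow> bool" where
  "factor N \<longleftrightarrow> von_neumann_algebra N \<and> (1::'a bop) \<noteq> 0 \<and> N \<inter> commutant N = range (\<lambda>c. c *\<^sub>C 1)"

definition projections :: "'a::chilbert_space bop set \<Rightarrow> 'a bop set" where
  "projections N = {p \<in> N. adj p = p \<and> p * p = p}"

text \<open>A projection is finite if it is not equivalent to a proper subprojection of itself.\<close>

definition finite_projection :: "'a::chilbert_space bop set \<Rightarrow> 'a bop \<Rightarrow> bool" where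
  "finite_projection N p \<longleftrightarrow> p \<in> projections N \<and>
     (\<forall>v\<in>N. adj v * v = p \<and> p * (v * adj v) = v * adj v \<longrightarrow> v * adj v = p)"

definition type_III_factor :: "'a::chilbert_space bop set \<Rightarrow> bool" where
  "type_III_factor N \<longleftrightarrow> factor N \<and> (\<forall>p. finite_projection N p \<longrightarrow> p = 0)"

definition clinear_on :: "'a::{plus, scaleC} set \<Rightarrow> ('a \<Rightarrow> 'b::{plus, scaleC}) \<Rightarrow> bool" where
  "clinear_on V f \<longleftrightarrow> (\<forall>x\<in>V. \<forall>y\<in>V. f (x + y) = f x + f y) \<and> (\<forall>c. \<forall>x\<in>V. f (c *\<^sub>C x) = c *\<^sub>C f x)"

text \<open>On von Neumann algebras, \<^emph>\<open>normal\<close> means \<open>\<sigma>\<close>-weakly continuous.\<close>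

definition normal_functional :: "'a::chilbert_space bop set \<Rightarrow> ('a bop \<Rightarrow> complex) \<Rightarrow> bool" where
  "normal_functional N \<phi> \<longleftrightarrow> clinear_on N \<phi> \<and> continuous_map (subtopology sigma_weak N) euclidean \<phi>"

definition faithful_normal_state :: "'a::chilbert_space bop set \<Rightarrow> ('a bop \<Rightarrow> complex) \<Rightarrow> bool" where
  "faithful_normal_state N \<psi> \<longleftrightarrow> normal_functional N \<psi> \<and> \<psi> 1 = 1 \<and>
     (\<forall>x\<in>N. \<psi> (adj x * x) \<in> \<real>\<^sub>\<ge>\<^sub>0) \<and> (\<forall>x\<in>N. \<psi> (adj x * x) = 0 \<longrightarrow> x = 0)"

text \<open>Maps on an algebra \<open>N\<close> are made \<open>undefined\<close> outside \<open>N\<close>, so that equality of functions is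
  equality of maps on \<open>N\<close>; composition is \<open>compose N\<close> and the identity is \<open>\<lambda>x\<in>N. x\<close>.\<close>

definition endos :: "'a::chilbert_space bop set \<Rightarrow> ('a bop \<Rightarrow> 'a bop) set" where
  "endos N = {\<rho> \<in> N \<rightarrow>\<^sub>E N. clinear_on N \<rho> \<and> (\<forall>x\<in>N. \<forall>y\<in>N. \<rho> (x * y) = \<rho> x * \<rho> y) \<and>
     (\<forall>x\<in>N. \<rho> (adj x) = adj (\<rho> x)) \<and> \<rho> 1 = 1 \<and>
     continuous_map (subtopology sigma_weak N) sigma_weak \<rho>}"

definition autos :: "'a::chilbert_space bop set \<Rightarrow> ('a bop \<Rightarrow> 'a bop) set" where
  "autos N = {\<alpha> \<in> endos N. bij_betw \<alpha> N N}"

definition group_action :: "('g::group_add \<Rightarrow> 'a::chilbert_space bop \<Rightarrow> 'a bop) \<Rightarrow> 'a bop set \<Rightarrow> bool" where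
  "group_action \<beta> N \<longleftrightarrow> (\<forall>g. \<beta> g \<in> autos N) \<and> (\<forall>g h. \<beta> (g + h) = compose N (\<beta> g) (\<beta> h))"

text \<open>Haagerup's axioms for a standard form \<open>(N, H, J, P)\<close>.\<close>

definition standard_form ::
    "'a::chilbert_space bop set \<Rightarrow> ('a \<Rightarrow> 'a) \<Rightarrow> 'a set \<Rightarrow> bool" where
  "standard_form N J P \<longleftrightarrow> von_neumann_algebra N \<and>
     (\<forall>x y. J (x + y) = J x + J y) \<and> (\<forall>c x. J (c *\<^sub>C x) = cnj c *\<^sub>C J x) \<and>
     (\<forall>x. J (J x) = x) \<and> (\<forall>x y. cinner (J x) (J y) = cinner y x) \<and>
     P = {\<xi>. \<forall>\<eta>\<in>P. cinner \<xi> \<eta> \<in> \<real>\<^sub>\<ge>\<^sub>0} \<and>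
     {y. \<exists>x\<in>N. \<forall>\<xi>. op_app y \<xi> = J (op_app x (J \<xi>))} = commutant N \<and>
     (\<forall>z\<in>N \<inter> commutant N. \<forall>\<xi>. J (op_app z (J \<xi>)) = op_app (adj z) \<xi>) \<and>
     (\<forall>\<xi>\<in>P. J \<xi> = \<xi>) \<and>
     (\<forall>x\<in>N. \<forall>\<xi>\<in>P. op_app x (J (op_app x (J \<xi>))) \<in> P)"

text \<open>The vector \<open>\<phi>\<^sup>1\<^sup>/\<^sup>2\<close> of the positive cone \<open>P\<close>.\<close>

definition cone_vector ::
    "'a::chilbert_space bop set \<Rightarrow> 'a set \<Rightarrow> ('a bop \<Rightarrow> complex) \<Rightarrow> 'a" where
  "cone_vector N P \<phi> = (THE \<xi>. \<xi> \<in> P \<and> (\<forall>x\<in>N. \<phi> x = cinner (op_app x \<xi>) \<xi>))"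


section \<open>Sectors\<close>

definition intertwiners ::
    "'a::chilbert_space bop set \<Rightarrow> ('a bop \<Rightarrow> 'a bop) \<Rightarrow> ('a bop \<Rightarrow> 'a bop) \<Rightarrow> 'a bop set" where
  "intertwiners N \<rho> \<sigma> = {T \<in> N. \<forall>x\<in>N. T * \<rho> x = \<sigma> x * T}"

definition irreducible_endo :: "'a::chilbert_space bop set \<Rightarrow> ('a bop \<Rightarrow> 'a bop) \<Rightarrow> bool" where
  "irreducible_endo N \<rho> \<longleftrightarrow> intertwiners N \<rho> \<rho> = range (\<lambda>c. c *\<^sub>C 1)"

definition equivalent_endos ::
    "'a::chilbert_space bop set \<Rightarrow> ('a bop \<Rightarrow> 'a bop) \<Rightarrow> ('a bop \<Rightarrow> 'a bop) \<Rightarrow> bool" where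
  "equivalent_endos N \<rho> \<sigma> \<longleftrightarrow> (\<exists>u\<in>intertwiners N \<rho> \<sigma>. adj u * u = 1 \<and> u * adj u = 1)"

definition conjugate_solution ::
    "'a::chilbert_space bop set \<Rightarrow> ('a bop \<Rightarrow> 'a bop) \<Rightarrow> ('a bop \<Rightarrow> 'a bop) \<Rightarrow> 'a bop \<Rightarrow> 'a bop \<Rightarrow> bool" where
  "conjugate_solution N \<rho> \<rho>' R R' \<longleftrightarrow>
     R \<in> intertwiners N (\<lambda>x\<in>N. x) (compose N \<rho>' \<rho>) \<and>
     R' \<in> intertwiners N (\<lambda>x\<in>N. x) (compose N \<rho> \<rho>') \<and>
     adj R * \<rho>' R' = 1 \<and> adj R' * \<rho> R = 1"

definition conditional_expectation ::
    "'a::chilbert_space bop set \<Rightarrow> 'a bop set \<Rightarrow> ('a bop \<Rightarrow> 'a bop) \<Rightarrow> bool" where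
  "conditional_expectation N N0 E \<longleftrightarrow> clinear_on N E \<and> E ` N \<subseteq> N0 \<and> (\<forall>x\<in>N0. E x = x) \<and>
     (\<forall>x\<in>N. pos_op x \<longrightarrow> pos_op (E x)) \<and>
     (\<forall>x\<in>N. \<forall>a\<in>N0. \<forall>b\<in>N0. E (a * x * b) = a * E x * b) \<and>
     continuous_map (subtopology sigma_weak N) sigma_weak E"

text \<open>Index in the sense of Pimsner and Popa: the index of a normal conditional expectation \<open>E\<close> is
  the least \<open>c\<close> with \<open>E(x\<^sup>*x) \<ge> c\<^sup>-\<^sup>1 x\<^sup>*x\<close>.  The minimal index is the infimum over all \<open>E\<close>, and the
  dimension of \<open>\<rho>\<close> is the square root of the minimal index of \<open>\<rho>(N) \<subseteq> N\<close>.\<close>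

definition index_bounds :: "'a::chilbert_space bop set \<Rightarrow> 'a bop set \<Rightarrow> real set" where
  "index_bounds N N0 = {c. c > 0 \<and> (\<exists>E. conditional_expectation N N0 E \<and>
     (\<forall>x\<in>N. pos_op (E (adj x * x) - complex_of_real (1 / c) *\<^sub>C (adj x * x))))}"

definition finite_index_endos :: "'a::chilbert_space bop set \<Rightarrow> ('a bop \<Rightarrow> 'a bop) set" where
  "finite_index_endos N = {\<rho> \<in> endos N. index_bounds N (\<rho> ` N) \<noteq> {}}"

definition dimension :: "'a::chilbert_space bop set \<Rightarrow> ('a bop \<Rightarrow> 'a bop) \<Rightarrow> real" where
  "dimension N \<rho> = sqrt (Inf (index_bounds N (\<rho> ` N)))"

text \<open>A full subcategory of the finite index endomorphisms, given by its set \<open>C\<close> of objects: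
  tensor product is composition, and it has subobjects, finite direct sums and conjugates.
  The tensor unit is simple because \<open>N\<close> will be a factor.\<close>

definition rigid_tensor_category ::
    "'a::chilbert_space bop set \<Rightarrow> ('a bop \<Rightarrow> 'a bop) set \<Rightarrow> bool" where
  "rigid_tensor_category N C \<longleftrightarrow> C \<subseteq> finite_index_endos N \<and> (\<lambda>x\<in>N. x) \<in> C \<and>
     (\<forall>\<rho>\<in>C. \<forall>\<sigma>\<in>C. compose N \<rho> \<sigma> \<in> C) \<and>
     (\<forall>\<rho>\<in>C. \<forall>p\<in>intertwiners N \<rho> \<rho>. p \<in> projections N \<and> p \<noteq> 0 \<longrightarrow>
        (\<exists>\<sigma>\<in>C. \<exists>v\<in>intertwiners N \<sigma> \<rho>. adj v * v = 1 \<and> v * adj v = p)) \<and>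
     (\<forall>\<rho>\<in>C. \<forall>\<sigma>\<in>C. \<exists>\<tau>\<in>C. \<exists>v\<in>intertwiners N \<rho> \<tau>. \<exists>w\<in>intertwiners N \<sigma> \<tau>.
        adj v * v = 1 \<and> adj w * w = 1 \<and> v * adj v + w * adj w = 1) \<and>
     (\<forall>\<rho>\<in>C. \<exists>\<rho>'\<in>C. \<exists>R R'. conjugate_solution N \<rho> \<rho>' R R')"

text \<open>\<open>Cg g\<close> is the set of objects of the \<open>g\<close>-component.  The third clause says that an object lies
  in the \<open>g\<close>-component iff all its irreducible constituents do.  The last clause asks the grading to be
  faithful, i.e. no component is zero.\<close>

definition group_grading ::
    "'a::chilbert_space bop set \<Rightarrow> ('a bop \<Rightarrow> 'a bop) set \<Rightarrow> ('g::group_add \<Rightarrow> ('a bop \<Rightarrow> 'a bop) set) \<Rightarrow> bool" where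
  "group_grading N C Cg \<longleftrightarrow>
     (\<forall>g. Cg g \<subseteq> C) \<and>
     (\<forall>\<rho>\<in>C. irreducible_endo N \<rho> \<longrightarrow> (\<exists>!g. \<rho> \<in> Cg g)) \<and>
     (\<forall>g. \<forall>\<rho>\<in>C. \<rho> \<in> Cg g \<longleftrightarrow>
        (\<forall>\<sigma>\<in>C. irreducible_endo N \<sigma> \<and> intertwiners N \<sigma> \<rho> \<noteq> {0} \<longrightarrow> \<sigma> \<in> Cg g)) \<and>
     (\<forall>g h. \<forall>\<rho>\<in>Cg g. \<forall>\<sigma>\<in>Cg h. compose N \<rho> \<sigma> \<in> Cg (g + h)) \<and>
     (\<forall>g. \<forall>\<rho>\<in>Cg g. \<forall>\<rho>'\<in>C. (\<exists>R R'. conjugate_solution N \<rho> \<rho>' R R') \<longrightarrow> \<rho>' \<in> Cg (- g)) \<and>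
     (\<forall>g. Cg g \<noteq> {})"

definition irr_representatives ::
    "'a::chilbert_space bop set \<Rightarrow> ('a bop \<Rightarrow> 'a bop) set \<Rightarrow> ('i \<Rightarrow> 'a bop \<Rightarrow> 'a bop) \<Rightarrow> bool" where
  "irr_representatives N C irr \<longleftrightarrow> (\<forall>i. irr i \<in> C \<and> irreducible_endo N (irr i)) \<and>
     (\<forall>\<rho>\<in>C. irreducible_endo N \<rho> \<longrightarrow> (\<exists>!i. equivalent_endos N \<rho> (irr i)))"

text \<open>Orthonormal bases for the inner product \<open>\<langle>T, S\<rangle> 1 = S\<^sup>* T\<close>.\<close>

definition orthonormal_basis :: "'a::chilbert_space bop set \<Rightarrow> 'a bop set \<Rightarrow> bool" where
  "orthonormal_basis V B \<longleftrightarrow> finite B \<and> B \<subseteq> V \<and>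
     (\<forall>S\<in>B. \<forall>T\<in>B. adj S * T = (if S = T then 1 else 0)) \<and>
     V = {\<Sum>T\<in>B. c T *\<^sub>C T | c. True}"


section \<open>The algebra \<open>\<M> \<otimes> \<M>\<^sup>o\<^sup>p\<close>\<close>

text \<open>
  The opposite algebra of \<open>N \<subseteq> B(H)\<close> acts on the conjugate Hilbert space of \<open>H\<close>, where \<open>j(y)\<close> is
  given by the same map as \<open>y\<close>.  The Hilbert tensor product \<open>K\<close> of \<open>H\<close> with its conjugate is a map
  \<open>t : H \<times> H \<rightarrow> K\<close> which is linear in the first and conjugate linear in the second argument; there the
  operator \<open>x \<otimes> j(y)\<close> sends \<open>t \<xi> \<eta>\<close> to \<open>t (x \<xi>) (y \<eta>)\<close>.
  As \<open>range t\<close> is closed under complex scalars, its real span is its complex span.\<close>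

definition conj_tensor :: "('h::chilbert_space \<Rightarrow> 'h \<Rightarrow> 'k::chilbert_space) \<Rightarrow> bool" where
  "conj_tensor t \<longleftrightarrow>
     (\<forall>x x' y. t (x + x') y = t x y + t x' y) \<and> (\<forall>x y y'. t x (y + y') = t x y + t x y') \<and>
     (\<forall>c x y. t (c *\<^sub>C x) y = c *\<^sub>C t x y) \<and> (\<forall>c x y. t x (c *\<^sub>C y) = cnj c *\<^sub>C t x y) \<and>
     (\<forall>x y x' y'. cinner (t x y) (t x' y') = cinner x x' * cnj (cinner y y')) \<and>
     closure (span {t x y | x y. True}) = UNIV"

definition tensor_j ::
    "('h::chilbert_space \<Rightarrow> 'h \<Rightarrow> 'k::chilbert_space) \<Rightarrow> 'h bop \<Rightarrow> 'h bop \<Rightarrow> 'k bop" where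
  "tensor_j t x y = (THE z. \<forall>\<xi> \<eta>. op_app z (t \<xi> \<eta>) = t (op_app x \<xi>) (op_app y \<eta>))"

definition tensor_op_alg ::
    "('h::chilbert_space \<Rightarrow> 'h \<Rightarrow> 'k::chilbert_space) \<Rightarrow> 'h bop set \<Rightarrow> 'k bop set" where
  "tensor_op_alg t N = commutant (commutant {tensor_j t x y | x y. x \<in> N \<and> y \<in> N})"

text \<open>\<open>\<pi> \<otimes> \<pi>\<^sup>o\<^sup>p\<close>, where \<open>\<pi>\<^sup>o\<^sup>p(j(y)) = j(\<pi>(y))\<close>.\<close>

definition tensor_op_endo ::
    "('h::chilbert_space \<Rightarrow> 'h \<Rightarrow> 'k::chilbert_space) \<Rightarrow> 'h bop set \<Rightarrow> ('h bop \<Rightarrow> 'h bop) \<Rightarrow> 'k bop \<Rightarrow> 'k bop" where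
  "tensor_op_endo t N \<pi> = (THE F. F \<in> endos (tensor_op_alg t N) \<and>
     (\<forall>x\<in>N. \<forall>y\<in>N. F (tensor_j t x y) = tensor_j t (\<pi> x) (\<pi> y)))"

text \<open>\<open>\<psi> \<otimes> \<psi>\<^sup>o\<^sup>p\<close>.  Since \<open>j(y)\<close> is \<open>y\<^sup>*\<close>, the value of \<open>\<psi>\<^sup>o\<^sup>p\<close> at \<open>j(y)\<close> is the conjugate of \<open>\<psi>(y)\<close>.\<close>

definition tensor_op_state ::
    "('h::chilbert_space \<Rightarrow> 'h \<Rightarrow> 'k::chilbert_space) \<Rightarrow> 'h bop set \<Rightarrow> ('h bop \<Rightarrow> complex) \<Rightarrow> 'k bop \<Rightarrow> complex" where
  "tensor_op_state t N \<psi> = (THE \<phi>. \<phi> \<in> extensional (tensor_op_alg t N) \<and>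
     normal_functional (tensor_op_alg t N) \<phi> \<and>
     (\<forall>x\<in>N. \<forall>y\<in>N. \<phi> (tensor_j t x y) = \<psi> x * cnj (\<psi> y)))"

text \<open>The standard implementation on \<open>L\<^sup>2(N)\<close>, with positive cone \<open>P\<close>, of an endomorphism \<open>\<rho>\<close> with
  conjugate \<open>\<rho>'\<close>; the map \<open>x \<mapsto> R\<^sup>* \<rho>'(x) R\<close> is not normalised to be unital.\<close>

definition standard_implementation ::
    "'a::chilbert_space bop set \<Rightarrow> 'a set \<Rightarrow> ('a bop \<Rightarrow> complex) \<Rightarrow>
     ('a bop \<Rightarrow> 'a bop) \<Rightarrow> ('a bop \<Rightarrow> 'a bop) \<Rightarrow> 'a bop \<Rightarrow> 'a bop" where
  "standard_implementation N P \<psi> \<rho> \<rho>' R = (THE u. \<forall>a\<in>N.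
     op_app u (op_app a (cone_vector N P \<psi>)) = op_app (\<rho> a) (cone_vector N P (\<lambda>x. \<psi> (adj R * \<rho>' x * R))))"


section \<open>The crossed product by a graded category and its bimodules\<close>

text \<open>
  Data of the construction.  The set of representatives of irreducible objects is the injective family
  \<open>irr_rep\<close> indexed by the type \<open>'i\<close>; \<open>irr_bar\<close> selects the index of the conjugate representative, and
  \<open>conj_R i \<in> (id, irr_rep (irr_bar i) \<circ> irr_rep i)\<close>.  \<open>onb \<pi> \<rho> \<sigma>\<close> is the set of the
  \<open>T\<^bsub>\<pi>,\<rho>\<^esub>\<^bsup>\<sigma>,e\<^esup>\<close>.  The space \<open>L\<^sup>2(\<A>)\<close> is the type \<open>'k\<close>, which is
  also the tensor product of \<open>'h\<close> with its conjugate; so \<open>alg\<close> has to act on \<open>'h\<close> in such a way that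
  \<open>\<A>\<close> is in standard form there, as is the case for \<open>'h = L\<^sup>2(\<M>)\<close>.\<close>

record (overloaded) ('h, 'k, 'i, 'g) category_data =
  alg :: "'h bop set"
  state :: "'h bop \<Rightarrow> complex"
  objects :: "('h bop \<Rightarrow> 'h bop) set"
  component :: "'g \<Rightarrow> ('h bop \<Rightarrow> 'h bop) set"
  irr_rep :: "'i \<Rightarrow> 'h bop \<Rightarrow> 'h bop"
  irr_bar :: "'i \<Rightarrow> 'i"
  conj_R :: "'i \<Rightarrow> 'h bop"
  conj_Rbar :: "'i \<Rightarrow> 'h bop"
  onb :: "'i \<Rightarrow> 'i \<Rightarrow> 'i \<Rightarrow> 'h bop set"
  tens :: "'h \<Rightarrow> 'h \<Rightarrow> 'k"
  mod_conj :: "'k \<Rightarrow> 'k"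
  pos_cone :: "'k set"

type_synonym ('h, 'k, 'i, 'g) cat = "('h, 'k, 'i, 'g) category_data"

definition dim_irr :: "('h::chilbert_space, 'k::chilbert_space, 'i, 'g) cat \<Rightarrow> 'i \<Rightarrow> real" where
  "dim_irr D i = dimension (alg D) (irr_rep D i)"

definition conjugation_data :: "('h::chilbert_space, 'k::chilbert_space, 'i, 'g) cat \<Rightarrow> bool" where
  "conjugation_data D \<longleftrightarrow> (\<forall>i.
     conjugate_solution (alg D) (irr_rep D i) (irr_rep D (irr_bar D i)) (conj_R D i) (conj_Rbar D i) \<and>
     adj (conj_R D i) * conj_R D i = complex_of_real (dim_irr D i) *\<^sub>C 1 \<and>
     adj (conj_Rbar D i) * conj_Rbar D i = complex_of_real (dim_irr D i) *\<^sub>C 1)"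

definition basis_data :: "('h::chilbert_space, 'k::chilbert_space, 'i, 'g) cat \<Rightarrow> bool" where
  "basis_data D \<longleftrightarrow> (\<forall>i j k. orthonormal_basis
     (intertwiners (alg D) (irr_rep D k) (compose (alg D) (irr_rep D i) (irr_rep D j))) (onb D i j k))"

definition algA :: "('h::chilbert_space, 'k::chilbert_space, 'i, 'g) cat \<Rightarrow> 'k bop set" where
  "algA D = tensor_op_alg (tens D) (alg D)"

definition endA :: "('h::chilbert_space, 'k::chilbert_space, 'i, 'g) cat \<Rightarrow> 'i \<Rightarrow> 'k bop \<Rightarrow> 'k bop" where
  "endA D i = tensor_op_endo (tens D) (alg D) (irr_rep D i)"

definition Ttilde :: "('h::chilbert_space, 'k::chilbert_space, 'i, 'g) cat \<Rightarrow> 'i \<Rightarrow> 'i \<Rightarrow> 'i \<Rightarrow> 'k bop" where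
  "Ttilde D i j k = (\<Sum>T\<in>onb D i j k. tensor_j (tens D) T T)"

definition implA :: "('h::chilbert_space, 'k::chilbert_space, 'i, 'g) cat \<Rightarrow> 'i \<Rightarrow> 'k bop" where
  "implA D i = standard_implementation (algA D) (pos_cone D)
     (tensor_op_state (tens D) (alg D) (state D))
     (endA D i) (endA D (irr_bar D i)) (tensor_j (tens D) (conj_R D i) (conj_R D i))"

definition ell2_op ::
    "(('i, 'k::chilbert_space) ell2 \<Rightarrow> 'i \<Rightarrow> 'k) \<Rightarrow> ('i, 'k) ell2 bop" where
  "ell2_op f = (THE T. \<forall>v i. coord (op_app T v) i = f v i)"

text \<open>The sums over \<open>\<sigma>\<close> are finite, since \<open>\<sigma>\<close> runs over the irreducible constituents of \<open>\<rho>\<pi>\<close>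
  (resp. \<open>\<pi>\<rho>\<close>).\<close>

definition gammaL_alg ::
    "('h::chilbert_space, 'k::chilbert_space, 'i, 'g) cat \<Rightarrow> 'k bop \<Rightarrow> ('i, 'k) ell2 bop" where
  "gammaL_alg D a = ell2_op (\<lambda>v \<rho>. op_app (endA D \<rho> a) (coord v \<rho>))"

definition gammaL_lambda ::
    "('h::chilbert_space, 'k::chilbert_space, 'i, 'g) cat \<Rightarrow> 'i \<Rightarrow> ('i, 'k) ell2 bop" where
  "gammaL_lambda D \<pi> = ell2_op (\<lambda>v \<rho>. \<Sum>\<sigma> | onb D \<rho> \<pi> \<sigma> \<noteq> {}.
     complex_of_real (sqrt (dim_irr D \<rho> / dim_irr D \<sigma>)) *\<^sub>C op_app (Ttilde D \<rho> \<pi> \<sigma>) (coord v \<sigma>))"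

definition gammaR_alg ::
    "('h::chilbert_space, 'k::chilbert_space, 'i, 'g) cat \<Rightarrow> 'k bop \<Rightarrow> ('i, 'k) ell2 bop" where
  "gammaR_alg D a = ell2_op (\<lambda>v \<rho>. mod_conj D (op_app (adj a) (mod_conj D (coord v \<rho>))))"

definition kappa ::
    "('h::chilbert_space, 'k::chilbert_space, 'i, 'g) cat \<Rightarrow> 'i \<Rightarrow> ('i, 'k) ell2 bop" where
  "kappa D \<pi> = ell2_op (\<lambda>v \<rho>. \<Sum>\<sigma> | onb D \<pi> \<rho> \<sigma> \<noteq> {}.
     complex_of_real (sqrt (dim_irr D \<rho> / dim_irr D \<sigma>)) *\<^sub>C op_app (Ttilde D \<pi> \<rho> \<sigma>) (coord v \<sigma>))"

definition gammaR_lambda ::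
    "('h::chilbert_space, 'k::chilbert_space, 'i, 'g) cat \<Rightarrow> 'i \<Rightarrow> ('i, 'k) ell2 bop" where
  "gammaR_lambda D \<pi> = ell2_op (\<lambda>v \<rho>. op_app (adj (implA D \<pi>)) (coord v \<rho>)) * kappa D \<pi>"

inductive_set star_algebra_gen :: "'a::chilbert_space bop set \<Rightarrow> 'a bop set" for S where
  gen: "x \<in> S \<Longrightarrow> x \<in> star_algebra_gen S"
| add: "x \<in> star_algebra_gen S \<Longrightarrow> y \<in> star_algebra_gen S \<Longrightarrow> x + y \<in> star_algebra_gen S"
| scale: "x \<in> star_algebra_gen S \<Longrightarrow> c *\<^sub>C x \<in> star_algebra_gen S"
| mult: "x \<in> star_algebra_gen S \<Longrightarrow> y \<in> star_algebra_gen S \<Longrightarrow> x * y \<in> star_algebra_gen S"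
| star: "x \<in> star_algebra_gen S \<Longrightarrow> adj x \<in> star_algebra_gen S"

text \<open>\<open>\<B>\<close> is realised on \<open>\<HH> = \<ell>\<^sup>2('i, L\<^sup>2(\<A>))\<close> through \<open>\<gamma>\<^sub>L\<close>.  The image under \<open>\<gamma>\<^sub>L\<close> of the
  \<open>*\<close>-algebra generated by \<open>\<A>\<close> and the \<open>\<lambda>\<^sub>\<pi>\<close> is generated by the images of these generators.\<close>

definition algB :: "('h::chilbert_space, 'k::chilbert_space, 'i, 'g) cat \<Rightarrow> ('i, 'k) ell2 bop set" where
  "algB D = commutant (commutant (star_algebra_gen (gammaL_alg D ` algA D \<union> range (gammaL_lambda D))))"

definition irr_component :: "('h::chilbert_space, 'k::chilbert_space, 'i, 'g) cat \<Rightarrow> 'g \<Rightarrow> 'i set" where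
  "irr_component D g = {i. irr_rep D i \<in> component D g}"

definition algB0 ::
    "('h::chilbert_space, 'k::chilbert_space, 'i, 'g::group_add) cat \<Rightarrow> ('i, 'k) ell2 bop set" where
  "algB0 D = sigma_weak closure_of
     {\<Sum>\<pi>\<in>F. gammaL_alg D (a \<pi>) * gammaL_lambda D \<pi> | F a.
        finite F \<and> F \<subseteq> irr_component D 0 \<and> (\<forall>\<pi>\<in>F. a \<pi> \<in> algA D)}"

text \<open>The normal extension of \<open>\<gamma>\<^sub>R\<close> to a right action of \<open>\<B>\<close>.\<close>

definition gammaR ::
    "('h::chilbert_space, 'k::chilbert_space, 'i, 'g) cat \<Rightarrow> ('i, 'k) ell2 bop \<Rightarrow> ('i, 'k) ell2 bop" where
  "gammaR D = (THE r. r \<in> extensional (algB D) \<and> clinear_on (algB D) r \<and>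
     (\<forall>x\<in>algB D. \<forall>y\<in>algB D. r (x * y) = r y * r x) \<and>
     (\<forall>x\<in>algB D. r (adj x) = adj (r x)) \<and> r 1 = 1 \<and>
     continuous_map (subtopology sigma_weak (algB D)) sigma_weak r \<and>
     (\<forall>a\<in>algA D. r (gammaL_alg D a) = gammaR_alg D a) \<and>
     (\<forall>\<pi>. r (gammaL_lambda D \<pi>) = gammaR_lambda D \<pi>))"

definition frakH ::
    "('h::chilbert_space, 'k::chilbert_space, 'i, 'g) cat \<Rightarrow> 'g \<Rightarrow> ('i, 'k) ell2 set" where
  "frakH D g = {v. \<forall>i. i \<notin> irr_component D g \<longrightarrow> coord v i = 0}"

text \<open>Unitary equivalence of the \<open>N\<close>-\<open>N\<close>-bimodules with underlying spaces \<open>E\<^sub>1\<close>, \<open>E\<^sub>2\<close>, left actions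
  \<open>l\<^sub>1\<close>, \<open>l\<^sub>2\<close> and right actions \<open>r\<^sub>1\<close>, \<open>r\<^sub>2\<close>.\<close>

definition bimodule_iso ::
    "'b set \<Rightarrow> 'a::chilbert_space set \<Rightarrow> ('b \<Rightarrow> 'a bop) \<Rightarrow> ('b \<Rightarrow> 'a bop) \<Rightarrow>
     'a set \<Rightarrow> ('b \<Rightarrow> 'a bop) \<Rightarrow> ('b \<Rightarrow> 'a bop) \<Rightarrow> bool" where
  "bimodule_iso N E\<^sub>1 l\<^sub>1 r\<^sub>1 E\<^sub>2 l\<^sub>2 r\<^sub>2 \<longleftrightarrow> (\<exists>U. bij_betw U E\<^sub>1 E\<^sub>2 \<and> clinear_on E\<^sub>1 U \<and>
     (\<forall>v\<in>E\<^sub>1. \<forall>w\<in>E\<^sub>1. cinner (U v) (U w) = cinner v w) \<and>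
     (\<forall>b\<in>N. \<forall>v\<in>E\<^sub>1. U (op_app (l\<^sub>1 b) v) = op_app (l\<^sub>2 b) (U v) \<and>
        U (op_app (r\<^sub>1 b) v) = op_app (r\<^sub>2 b) (U v)))"

end

theory Submission imports Defs begin

text \<open>Every \<open>\<pi> \<otimes> \<pi>\<^sup>o\<^sup>p\<close> has a standard implementation \<open>U\<^sub>\<pi>\<close> that commutes with \<open>J\<close> (Takesaki), and
  \<open>T\<^sup>* U\<^sub>\<pi> U\<^sub>\<rho> = J T J U\<^sub>\<sigma>\<close> for the fusion operators \<open>T\<close>, because both sides map a cone vector to the cone vector
  of the same functional. Twisting \<open>J\<close> by the unitaries \<open>U\<^sub>\<pi>\<^sup>* R'\<^sub>\<pi>\<close> therefore gives a conjugation of \<open>\<HH>\<close> that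
  exchanges the left and the right action, and the right action commutes with the left one.

  The \<open>\<lambda>\<^sub>\<pi>\<close> are multiples of isometries. Multiplying them by isometries of \<open>\<A>\<close> with orthogonal ranges
  and completing the family by a Schroeder--Bernstein argument yields isometries \<open>T\<^sub>h \<in> \<B>\<close> of degree \<open>h\<close>
  with \<open>\<Sum>\<^sub>h T\<^sub>h T\<^sub>h\<^sup>* = 1\<close>. The unitaries \<open>w\<^sub>g = \<Sum>\<^sub>h T\<^bsub>gh\<^esub> T\<^sub>h\<^sup>*\<close> form a representation of the group, so \<open>\<beta>\<^sub>g = Ad w\<^sub>g\<close>
  is an action on the degree-zero part of \<open>\<B>\<close>, and \<open>w\<^sub>g\<close> maps \<open>\<HH>\<^sub>0\<close> onto \<open>\<HH>\<^sub>g\<close>, commuting with the right action.\<close>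

section \<open>Hilbert spaces and operators\<close>

text \<open>Most objects of the statement are definite descriptions: \<open>endA\<close>,
  \<open>implA\<close>, the matrix operators \<open>ell2_op\<close> and the right action
  \<open>gammaR\<close>. Each has to be shown to exist and to be unique before it can be used, and
  this shapes the development: cone vectors call for the theory of standard forms, and
  \<open>gammaR\<close> calls for a normal extension from the generators to the whole algebra. The
  twist of \<open>J\<close> comes from there. Componentwise \<open>J\<close> turns the left action
  of \<open>adj a\<close> into \<open>SF.jop (FA rho (adj a))\<close> on the component
  \<open>rho\<close>, whereas the right action is \<open>SF.jop (adj a)\<close>; the unitary
  \<open>V rho\<close> removes the endomorphism and passes to the conjugate index. Conjugation by an
  antiunitary is automatically normal, so the extension is obtained for free. Arbitrary unitaries of
  degree \<open>g\<close> also implement automorphisms of the degree-zero part, but these compose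
  only up to inner ones, which gives a cocycle action. The partition by the isometries
  \<open>T h\<close> removes the cocycle: \<open>w g\<close> merely permutes the labels
  \<open>h\<close>, so \<open>w g * w h = w (g + h)\<close> holds exactly.\<close>

notation op_app (infixr \<open>$$\<close> 74)
notation scaleC (infixr \<open>*.\<close> 75)
abbreviation tends_to :: "(nat => 'a::topological_space) => 'a => bool" (infix \<open>---->\<close> 60) where "X ----> L == X \<longlonglongrightarrow> L"
abbreviation cor :: "real => complex" where "cor == complex_of_real"

lemma scaleC_one [simp]: "(1::complex)*.x = (x::'a::chilbert_space)"
 using scaleC_of_real[of 1 x] by simp

lemma scaleC_real [simp]: "cor r*.x = r *\<^sub>R (x::'a::chilbert_space)"
 by(rule scaleC_of_real)

lemma bounded_linear_scaleC: "bounded_linear (%x::'a::chilbert_space. c*.x)"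
proof(rule bounded_linear_intro[where K = "cmod c"])
 show "c*.(r *\<^sub>R x) = r *\<^sub>R c*.x" for r and x :: 'a
  by(metis mult.commute scaleC_of_real scaleC_scaleC)
qed (simp_all add: scaleC_add_right norm_scaleC mult.commute)

lemmas scaleC_minus_right [simp] = bounded_linear.linear[OF bounded_linear_scaleC, THEN linear_neg]
lemmas scaleC_diff_right = bounded_linear.linear[OF bounded_linear_scaleC, THEN linear_diff]
lemmas scaleC_sum_right = bounded_linear.linear[OF bounded_linear_scaleC, THEN linear_sum]
lemmas tendsto_scaleC = bounded_linear.tendsto[OF bounded_linear_scaleC]

lemma scaleC_zero_left [simp]: "0*.(x::'a::chilbert_space) = 0"
 using scaleC_of_real[of 0 x] by simp

lemma scaleC_minus_left [simp]: "(- c)*.(x::'a::chilbert_space) = - (c*.x)"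
 using scaleC_add_left[of c "- c" x] by(simp add: eq_neg_iff_add_eq_0 add.commute)

lemma scaleC_eq_0_iff [simp]: "c*.(x::'a::chilbert_space) = 0 \<longleftrightarrow> c = 0 | x = 0"
 by(metis mult_eq_0_iff norm_eq_zero norm_scaleC)

lemma cmod_cinner_mult_le: "cmod (cinner x y) <= norm x*norm (y::'a::chilbert_space)"
proof -
 have *: "cmod (cinner x y) <= norm x*norm y" if "norm x = 1" "norm y = 1" for x y :: 'a
  using cmod_cinner_le[of x y] that by simp
 show ?thesis
 proof(cases "x = 0 | y = 0")
  case True
  have "cinner 0 y = 0" "cinner x 0 = 0"
   using cinner_scaleC_left[of 0 x y] cinner_scaleC_right[of x 0 y] by simp_all
  thus ?thesis using True by auto
 next
  case False
  let ?x = "cor (1 / norm x)*.x" and ?y = "cor (1 / norm y)*.y"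
  have n: "norm ?x = 1" "norm ?y = 1" using False by(simp_all only: norm_scaleC) (simp_all add: norm_divide)
  have "cmod (cinner ?x ?y) = cmod (cinner x y) / (norm x*norm y)" by(simp add: cinner_scaleC_left cinner_scaleC_right complex_cnj_complex_of_real mult.assoc mult.left_commute norm_mult norm_divide)
  hence "cmod (cinner x y) / (norm x*norm y) <= 1" using *[OF n] n by simp
  thus ?thesis using False by(simp add: divide_le_eq)
 qed
qed

lemma bounded_bilinear_cinner: "bounded_bilinear (cinner :: 'a::chilbert_space => 'a => complex)"
proof
 fix r :: real and a b :: 'a
 show "cinner (r *\<^sub>R a) b = r *\<^sub>R cinner a b"
  by(simp add: scaleC_of_real[symmetric] cinner_scaleC_left scaleR_conv_of_real del: scaleC_real)
 show "cinner a (r *\<^sub>R b) = r *\<^sub>R cinner a b"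
  by(simp add: scaleC_of_real[symmetric] cinner_scaleC_right scaleR_conv_of_real del: scaleC_real)
 show "EX K. ALL a b. cmod (cinner (a::'a) b) <= norm a*norm b*K"
  by(rule exI[of _ 1]) (simp add: cmod_cinner_mult_le)
qed (simp_all add: cinner_add_left cinner_add_right)

lemmas tendsto_cinner = bounded_bilinear.tendsto[OF bounded_bilinear_cinner]
lemmas continuous_on_cinner = bounded_bilinear.continuous_on[OF bounded_bilinear_cinner]
lemmas cinner_zero_left [simp] = bounded_bilinear.zero_left[OF bounded_bilinear_cinner]
lemmas cinner_zero_right [simp] = bounded_bilinear.zero_right[OF bounded_bilinear_cinner]
lemmas cinner_minus_left [simp] = bounded_bilinear.minus_left[OF bounded_bilinear_cinner]
lemmas cinner_minus_right [simp] = bounded_bilinear.minus_right[OF bounded_bilinear_cinner]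
lemmas cinner_diff_left = bounded_bilinear.diff_left[OF bounded_bilinear_cinner]
lemmas cinner_diff_right = bounded_bilinear.diff_right[OF bounded_bilinear_cinner]
lemmas cinner_sum_left = bounded_bilinear.sum_left[OF bounded_bilinear_cinner]
lemmas cinner_sum_right = bounded_bilinear.sum_right[OF bounded_bilinear_cinner]

lemma cinner_scaleR_left: "cinner (r *\<^sub>R a) b = r * cinner a (b::'a::chilbert_space)"
 using bounded_bilinear.scaleR_left[OF bounded_bilinear_cinner] by(simp add: scaleR_conv_of_real)

lemma cinner_scaleR_right: "cinner a (r *\<^sub>R b) = r * cinner a (b::'a::chilbert_space)"
 using bounded_bilinear.scaleR_right[OF bounded_bilinear_cinner] by(simp add: scaleR_conv_of_real)

lemmas cinner_simps = cinner_add_left cinner_add_right cinner_diff_left cinner_diff_right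
 cinner_scaleC_left cinner_scaleC_right cinner_scaleR_left cinner_scaleR_right

lemma cinner_eq_zero_iff [simp]: "cinner x x = 0 \<longleftrightarrow> x = (0::'a::chilbert_space)"
 by(simp add: cinner_self)

lemma Re_cinner_self: "Re (cinner x x) = (norm (x::'a::chilbert_space))^2"
 by(simp add: cinner_self)

lemma Re_cinner_commute: "Re (cinner x y) = Re (cinner y (x::'a::chilbert_space))"
 by(subst cinner_commute) simp

lemma Re_cinner_le: "Re (cinner x y) <= norm x*norm (y::'a::chilbert_space)"
 using cmod_cinner_mult_le[of x y] complex_Re_le_cmod[of "cinner x y"] by linarith

lemma cinner_ext: "(!!z. cinner x z = cinner y z) ==> x = (y::'a::chilbert_space)"
 by(metis cinner_diff_left cinner_eq_zero_iff eq_iff_diff_eq_0)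

lemma norm_diff_sq: "(norm (x - y))^2 = (norm x)^2 + (norm y)^2 - 2*Re (cinner x (y::'a::chilbert_space))"
 using norm_add_sq[of x "- y"] by simp

lemma parallelogram: "(norm (x + y))^2 + (norm (x - y))^2 = 2*(norm x)^2 + 2*(norm (y::'a::chilbert_space))^2"
 by(simp add: norm_add_sq norm_diff_sq)

text \<open>Minimising \<open>|y|\<^sup>2 - 2s\<close> over a convex cone of pairs \<open>(y, s)\<close> yields the Riesz representation
 theorem, the projection onto closed real subspaces and the projection onto closed convex cones.\<close>

lemma cone_minimum:
 fixes X :: "('a::chilbert_space \<times> real) set"
 assumes X0: "(0, 0):X" and Xadd: "!!x y. x:X ==> y:X ==> x + y:X"
  and Xscale: "!!x r. x:X ==> 0 <= r ==> r *\<^sub>R x:X"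
  and bound: "!!y s. (y, s):X ==> s <= C*norm y" and C: "0 <= C"
 obtains eta y s where "!!n::nat. (y n, s n):X" "y ----> eta" "s ----> (norm eta)\<^sup>2" "norm eta <= C"
  "!!z t. (z, t):X ==> t <= Re (cinner eta z)"
proof -
 define F where "F x = (norm (fst x))^2 - 2 * snd x" for x :: "'a \<times> real"
 have F_ge: "- C\<^sup>2 <= F x" if "x:X" for x
 proof -
  have "0 <= (norm (fst x) - C)^2" by simp
  thus ?thesis using bound[of "fst x" "snd x"] that
   by(simp add: F_def power2_diff mult.commute)
 qed
 define m where "m = Inf (F ` X)"
 have bdd: "bdd_below (F ` X)" by(rule bdd_belowI2[of X "- C\<^sup>2"]) (rule F_ge)
 have m_le: "m <= F x" if "x:X" for x
  unfolding m_def using bdd that by(simp add: cInf_lower)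
 have "EX x:X. F x < m + inverse (real (Suc n))" for n
 proof -
  have "F ` X ~= {}" using X0 by auto
  hence "EX z:F ` X. z < m + inverse (real (Suc n))"
   using bdd unfolding m_def by(intro cInf_lessD) auto
  thus ?thesis by auto
 qed
 then obtain x where x: "!!n. x n:X" "!!n. F (x n) < m + inverse (real (Suc n))" by metis
 define y s where "y n = fst (x n)" and "s n = snd (x n)" for n
 have ys: "(y n, s n):X" for n using x(1) by(simp add: y_def s_def)
 have Fx: "F (x n) = (norm (y n))^2 - 2 * s n" for n by(simp add: F_def y_def s_def)
 have Fm: "(%n. F (x n)) ----> m"
 by(use tendsto_sandwich[of "%_. m" _ _ "%n. m + inverse (real (Suc n))"] m_le x(1) x(2) tendsto_add[OF tendsto_const LIMSEQ_inverse_real_of_nat, of m] in \<open>simp add: less_imp_le\<close>)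
 \<comment> \<open>Parallelogram law at the midpoint of \<open>x i\<close> and \<open>x j\<close>,
   which lies in the cone: near-minimisers have close first components although \<open>X\<close>
   need not be closed.\<close>
 have dist: "(norm (y i - y j))^2 <= 2*(F (x i) - m) + 2*(F (x j) - m)" for i j
 proof -
  have "m <= F ((1/2) *\<^sub>R (x i + x j))" by(use Xscale Xadd x m_le in \<open>simp\<close>)
  also have "... = (norm (y i + y j))^2 / 4 - s i - s j"
   by(simp add: F_def y_def s_def power_divide add_divide_distrib)
  finally show ?thesis using parallelogram[of "y i" "y j"] by(simp add: Fx)
 qed
 have "Cauchy y"
 proof(rule metric_CauchyI)
  fix e :: real assume e: "0 < e"
  hence "\<forall>\<^sub>F n in sequentially. F (x n) < m + e^2 / 4"
   by(intro order_tendstoD[OF Fm]) simp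
  then obtain N where N: "!!n. n >= N ==> F (x n) < m + e^2 / 4"
   by(auto simp: eventually_sequentially)
  have "dist (y i) (y j) < e" if "i >= N" "j >= N" for i j
  proof -
   have "(norm (y i - y j))^2 < e^2"
   proof -
    have "A < E" if "A <= 2*(B - M) + 2*(C - M)" "B < M + E / 4" "C < M + E / 4" for A B C E M :: real
     using that by(simp add: field_simps)
    thus ?thesis using dist[of i j] N[OF that(1)] N[OF that(2)] by blast
   qed
   thus ?thesis using e by(simp add: dist_norm power2_less_imp_less)
  qed
  thus "EX M. ALL i>=M. ALL j>=M. dist (y i) (y j) < e" by blast
 qed
 then obtain eta where eta: "y ----> eta" using Cauchy_convergent_iff convergent_def by blast
 define S where "S = ((norm eta)^2 - m) / 2"
 have sS: "s ----> S"
 proof -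
  have "(%n. ((norm (y n))^2 - F (x n)) / 2) ----> ((norm eta)^2 - m) / 2"
   by(intro tendsto_intros eta Fm) simp
  thus ?thesis by(simp add: Fx S_def)
 qed
 have small: "0 <= a" if "!!eps. 0 < eps ==> eps < 1 ==> 0 <= 2*eps*a + eps^2*b" for a b :: real
 proof(rule ccontr)
  assume a: "~ 0 <= a"
  define e where "e = min (1/2) (- a / (\<bar>b\<bar> + 1))"
  have e: "0 < e" "e < 1" using a by(auto simp: e_def intro!: divide_neg_pos)
  have "e*(\<bar>b\<bar> + 1) <= - a / (\<bar>b\<bar> + 1)*(\<bar>b\<bar> + 1)" by(intro mult_right_mono) (auto simp: e_def)
  hence "e*(\<bar>b\<bar> + 1) <= - a" by simp
  moreover have "e*b <= e*(\<bar>b\<bar> + 1)" using e by(intro mult_left_mono) auto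
  ultimately have "2*a + e*b < 0" using a by linarith
  hence "e*(2*a + e*b) < 0" using e by(simp add: mult_less_0_iff)
  thus False using that[OF e] by(simp add: algebra_simps power2_eq_square)
 qed
 \<comment> \<open>First variation in the direction \<open>(z, t)\<close>. A cone admits only
   positive \<open>eps\<close>, hence an inequality.\<close>
 have var: "t <= Re (cinner eta z)" if zt: "(z, t):X" for z t
 proof -
  have "0 <= 2*eps*(Re (cinner eta z) - t) + eps^2*(norm z)^2" if e: "0 < eps" for eps
  proof -
   have "m <= F (x n) + (2*eps*(Re (cinner (y n) z) - t) + eps^2*(norm z)^2)" for n
   proof -
    have "x n + eps *\<^sub>R (z, t):X" using e zt by(intro Xadd Xscale x) auto
    hence "m <= F (x n + eps *\<^sub>R (z, t))" by(rule m_le)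
    thus ?thesis
     by(simp add: F_def y_def s_def norm_add_sq power_mult_distrib cinner_scaleR_right algebra_simps)
   qed
   moreover have "(%n. F (x n) + (2*eps*(Re (cinner (y n) z) - t) + eps^2*(norm z)^2))
     ----> m + (2*eps*(Re (cinner eta z) - t) + eps^2*(norm z)^2)"
    by(intro tendsto_intros Fm tendsto_cinner eta)
   ultimately have "m <= m + (2*eps*(Re (cinner eta z) - t) + eps^2*(norm z)^2)"
    using LIMSEQ_le_const by blast
   thus ?thesis by simp
  qed
  thus ?thesis using small by(metis diff_ge_0_iff_ge)
 qed
 \<comment> \<open>Along the ray through \<open>x n\<close> itself \<open>eps\<close> may have
   either sign, so the radial variation vanishes and gives \<open>S = (norm eta)^2\<close>.\<close>
 have e1: "0 <= 2*eps*((norm eta)^2 - S) + eps^2*(norm eta)^2" if e: "- 1 < eps" for eps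
 proof -
  have "m <= F (x n) + (2*eps*((norm (y n))^2 - s n) + eps^2*(norm (y n))^2)" for n
  proof -
   have "(1 + eps) *\<^sub>R x n:X" using e by(intro Xscale x) auto
   hence "m <= F ((1 + eps) *\<^sub>R x n)" by(rule m_le)
   also have "F ((1 + eps) *\<^sub>R x n) = (1 + eps)^2*(norm (y n))^2 - 2*((1 + eps) * s n)"
    unfolding F_def y_def s_def fst_scaleR snd_scaleR norm_scaleR power_mult_distrib by simp
   finally show ?thesis by(simp add: Fx power2_sum algebra_simps)
  qed
  moreover have "(%n. F (x n) + (2*eps*((norm (y n))^2 - s n) + eps^2*(norm (y n))^2))
    ----> m + (2*eps*((norm eta)^2 - S) + eps^2*(norm eta)^2)"
   by(intro tendsto_intros Fm eta sS)
  ultimately have "m <= m + (2*eps*((norm eta)^2 - S) + eps^2*(norm eta)^2)"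
   using LIMSEQ_le_const by blast
  thus ?thesis by simp
 qed
 have "0 <= (norm eta)^2 - S" by(rule small[of _ "(norm eta)^2"]) (use e1 in auto)
 moreover have "0 <= - ((norm eta)^2 - S)"
 proof(rule small[of _ "(norm eta)^2"])
  show "0 <= 2*eps * - ((norm eta)^2 - S) + eps^2*(norm eta)^2" if "0 < eps" "eps < 1" for eps
   using e1[of "- eps"] that by(simp add: algebra_simps)
 qed
 ultimately have S: "S = (norm eta)^2" by simp
 have "S <= C*norm eta"
  by(rule tendsto_le[OF _ tendsto_mult[OF tendsto_const tendsto_norm[OF eta]] sS])
   (use bound ys in auto)
 hence "norm eta <= C" using C mult_right_le_imp_le[of "norm eta" "norm eta" C] by(force simp: S power2_eq_square)
 thus thesis using that[OF ys eta _ _ var] sS S by simp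
qed

text \<open>The functional is given by its graph \<open>X\<close>, so that well-definedness follows
  from the bound instead of being an obligation. In a subspace the variational inequality holds for
  \<open>(z, t)\<close> and for \<open>(- z, - t)\<close>, hence with equality.\<close>

lemma real_riesz:
 fixes X :: "('a::chilbert_space \<times> real) set"
 assumes X: "subspace X" and bound: "!!y s. (y, s):X ==> s <= C*norm y" and C: "0 <= C"
 obtains eta where "eta:closure (fst ` X)" "norm eta <= C" "!!z t. (z, t):X ==> Re (cinner eta z) = t"
proof -
 have 0: "(0, 0):X" using subspace_0[OF X] by(simp add: zero_prod_def)
 obtain eta y s where *: "!!n::nat. (y n, s n):X" "y ----> eta" "norm eta <= C"
  "!!z t. (z, t):X ==> t <= Re (cinner eta z)"
  using cone_minimum[OF 0 subspace_add[OF X] subspace_scale[OF X] bound C] by metis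
 have "y n:fst ` X" for n using *(1)[of n] by(metis fst_conv image_eqI)
 hence "eta:closure (fst ` X)" using *(2) closure_sequential by blast
 moreover have "Re (cinner eta z) = t" if "(z, t):X" for z t
  using *(4)[OF that] *(4)[of "- z" "- t"] subspace_neg[OF X that] by simp
 ultimately show thesis using that *(3) by blast
qed

lemma closure_subspace:
 fixes S :: "'a::real_normed_vector set"
 assumes "subspace S"
 shows "subspace (closure S)"
proof(rule subspaceI)
 show "0:closure S" using subspace_0[OF assms] closure_subset by blast
 fix x y and c :: real
 assume x: "x:closure S"
 then obtain a where a: "!!n::nat. a n:S" "a ----> x" by(auto simp: closure_sequential)
 show "c *\<^sub>R x:closure S"
  using a by(auto simp: closure_sequential intro!: exI[of _ "%n. c *\<^sub>R a n"] tendsto_intros subspace_scale[OF assms])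
 assume "y:closure S"
 then obtain b where b: "!!n::nat. b n:S" "b ----> y" by(auto simp: closure_sequential)
 show "x + y:closure S"
  using a b by(auto simp: closure_sequential intro!: exI[of _ "%n. a n + b n"] tendsto_intros subspace_add[OF assms])
qed

text \<open>Orthogonality is tested with the real part, because projections onto closed real
  subspaces such as \<open>sa_space\<close> are used later; for complex subspaces this is the usual
  projection, see \<open>cproj_orth\<close>.\<close>

definition rproj :: "'a::chilbert_space set => 'a => 'a" where
 "rproj K x = (SOME p. p:K & (ALL k:K. Re (cinner (x - p) k) = 0))"

lemma rproj:
 assumes "subspace K" "closed K"
 shows rproj_in: "rproj K x:K" and rproj_orth: "k:K ==> Re (cinner (x - rproj K x) k) = 0"
proof -
 let ?X = "(%k. (k, Re (cinner x k))) ` K"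
 have "subspace ?X"
  using assms(1) by(intro linear_subspace_image) (auto intro!: linearI simp: cinner_simps)
 then obtain eta where eta: "eta:closure (fst ` ?X)" "!!z t. (z, t):?X ==> Re (cinner eta z) = t"
  by(rule real_riesz[where C = "norm x"]) (auto simp: Re_cinner_le)
 have "eta:K" using eta(1) assms(2) by(simp add: image_image)
 moreover have "ALL k:K. Re (cinner (x - eta) k) = 0" using eta(2) by(fastforce simp: cinner_simps)
 ultimately have "EX p. p:K & (ALL k:K. Re (cinner (x - p) k) = 0)" by blast
 from someI_ex[OF this] show "rproj K x:K" "k:K ==> Re (cinner (x - rproj K x) k) = 0"
  by(auto simp: rproj_def)
qed

lemma rproj_unique:
 assumes K: "subspace K" "closed K" and "p:K" "!!k. k:K ==> Re (cinner (x - p) k) = 0"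
 shows "rproj K x = p"
proof -
 have d: "p - rproj K x:K" using assms rproj_in[OF K] by(simp add: subspace_diff)
 have "Re (cinner (p - rproj K x) (p - rproj K x)) = Re (cinner (x - rproj K x) (p - rproj K x)) - Re (cinner (x - p) (p - rproj K x))"
  by(simp add: cinner_simps)
 also have "... = 0" using rproj_orth[OF K d] assms(4)[OF d] by simp
 finally show ?thesis by(simp add: Re_cinner_self)
qed

lemma rproj_id: "subspace K ==> closed K ==> k:K ==> rproj K k = k"
 by(rule rproj_unique) auto

lemma rproj_add:
 assumes "subspace K" "closed K"
 shows "rproj K (x + y) = rproj K x + rproj K y"
proof(rule rproj_unique[OF assms])
 show "rproj K x + rproj K y:K" by(intro subspace_add rproj_in assms)
 show "Re (cinner (x + y - (rproj K x + rproj K y)) k) = 0" if "k:K" for k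
  using rproj_orth[OF assms that, of x] rproj_orth[OF assms that, of y] by(simp add: cinner_simps)
qed

lemma rproj_scaleR:
 assumes "subspace K" "closed K"
 shows "rproj K (r *\<^sub>R x) = r *\<^sub>R rproj K x"
proof(rule rproj_unique[OF assms])
 show "r *\<^sub>R rproj K x:K" by(intro subspace_scale rproj_in assms)
 show "Re (cinner (r *\<^sub>R x - r *\<^sub>R rproj K x) k) = 0" if "k:K" for k
  using rproj_orth[OF assms that, of x] by(simp add: cinner_simps algebra_simps)
qed

lemma rproj_minus: "subspace K ==> closed K ==> rproj K (- x) = - rproj K x"
 using rproj_scaleR[of K "-1" x] by simp

lemma rproj_diff: "subspace K ==> closed K ==> rproj K (x - y) = rproj K x - rproj K y"
 using rproj_add[of K x "- y"] by(simp add: rproj_minus)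

lemma rproj_sym:
 assumes "subspace K" "closed K"
 shows "Re (cinner (rproj K x) y) = Re (cinner (rproj K x) (rproj K y))"
 using rproj_orth[OF assms rproj_in[OF assms], of y x] Re_cinner_commute[of "rproj K x"]
 by(simp add: cinner_simps)

lemma norm_rproj_le:
 assumes "subspace K" "closed K"
 shows "norm (rproj K x) <= norm x"
proof -
 have "(norm (rproj K x))^2 = Re (cinner (rproj K x) x)"
  by(simp add: rproj_sym[OF assms, of x x] Re_cinner_self)
 also have "... <= norm (rproj K x)*norm x" by(rule Re_cinner_le)
 finally show ?thesis by(cases "rproj K x = 0") (auto simp: power2_eq_square)
qed

subsection \<open>Bounded operators\<close>

lemma op_app_bounded: "bounded_linear (op_app T)" and op_app_scaleC [simp]: "T$$(c*.x) = c*.(T$$x)"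
 using op_app[of T] by auto

lemmas op_app_linear = bounded_linear.linear[OF op_app_bounded]
lemmas op_app_add [simp] = linear_add[OF op_app_linear]
lemmas op_app_diff [simp] = linear_diff[OF op_app_linear]
lemmas op_app_neg [simp] = linear_neg[OF op_app_linear]
lemmas op_app_0 [simp] = linear_0[OF op_app_linear]
lemmas op_app_scaleR [simp] = linear_scale[OF op_app_linear]
lemmas op_app_sum = linear_sum[OF op_app_linear]
lemmas tendsto_op_app = bounded_linear.tendsto[OF op_app_bounded]

lemma plus_op_app [simp]: "(S + T)$$x = S$$x + T$$x" by transfer simp
lemma zero_op_app [simp]: "(0::'a::chilbert_space bop)$$x = 0" by transfer simp
lemma one_op_app [simp]: "(1::'a::chilbert_space bop)$$x = x" by transfer simp
lemma uminus_op_app [simp]: "(- T)$$x = - (T$$x)" by transfer simp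
lemma times_op_app [simp]: "(S*T)$$x = S$$T$$x" by transfer simp
lemma scaleC_op_app [simp]: "(c*.T)$$x = c*.(T$$x)" by transfer simp
lemma minus_op_app [simp]: "(S - T)$$x = S$$x - T$$x" unfolding minus_bop_def plus_op_app uminus_op_app by simp
lemma sum_op_app: "(SUM i:I. T i)$$x = (SUM i:I. T i$$x)"
 by(induction I rule: infinite_finite_induct) auto

lemma bop_eqI: "(!!x. S$$x = T$$x) ==> S = T"
 by(metis ext op_app_inject)

lemma bop_cinner_eqI: "(!!x y. cinner (S$$x) y = cinner (T$$x) y) ==> S = T"
 by(rule bop_eqI, rule cinner_ext)

lemma cinner_ext_right: "(!!z. cinner z x = cinner z y) ==> x = (y::'a::chilbert_space)"
 by(rule cinner_ext, subst (1 2) cinner_commute) simp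

lemma bop_cinner_eqI': "(!!x y. cinner x (S$$y) = cinner x (T$$y)) ==> S = T"
 by(rule bop_eqI, rule cinner_ext_right)

lemma bop_scaleC_simps:
 fixes S T :: "'a::chilbert_space bop"
 shows "c*.(S + T) = c*.S + c*.T" "(c + d)*.S = c*.S + d*.S"
  "c*.(S - T) = c*.S - c*.T" "c*.d*.S = (c*d)*.S"
  "(1::complex)*.S = S" "(0::complex)*.S = 0" "c*.(0::'a bop) = 0" "(- c)*.S = - (c*.S)"
  "c*.(- S) = - (c*.S)"
 by(rule bop_eqI; simp add: scaleC_add_right scaleC_add_left scaleC_diff_right scaleC_scaleC)+

lemma bop_scaleC_mult [simp]:
 fixes S T :: "'a::chilbert_space bop"
 shows "(c*.S)*T = c*.(S*T)" "S*(c*.T) = c*.(S*T)"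
 by(rule bop_eqI; simp)+

lemma bop_scaleC_sum: "c*.(SUM i:I. T i) = (SUM i:I. c*.(T i :: 'a::chilbert_space bop))"
 by(rule bop_eqI) (simp add: sum_op_app scaleC_sum_right)

definition opn :: "'a::chilbert_space bop => real" where "opn T = onorm (op_app T)"

lemma norm_op_le: "norm (T$$x) <= opn T*norm x"
 unfolding opn_def by(rule onorm[OF op_app_bounded])

lemma opn_ge_0: "0 <= opn T"
 unfolding opn_def by(rule onorm_pos_le[OF op_app_bounded])

lemma bop_exists:
 assumes "!!x y. f (x + y) = f x + f y" "!!c x. f (c*.x) = c*.f x"
  and "!!x. norm (f x) <= K*norm x"
 obtains T where "op_app T = (f :: 'a::chilbert_space => 'a)"
proof -
 have "bounded_linear f"
 proof(rule bounded_linear_intro[where K = K])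
  show "f (r *\<^sub>R x) = r *\<^sub>R f x" for r x using assms(2)[of "cor r" x] by simp
 qed (use assms in \<open>auto simp: mult.commute\<close>)
 hence "op_app (Abs_bop f) = f" using assms(2) by(intro Abs_bop_inverse) auto
 thus thesis using that by blast
qed

text \<open>The real version is applied to \<open>Re (f x)\<close>; testing at
  \<open>\<i>*.x\<close> recovers the imaginary part.\<close>

lemma riesz:
 assumes "!!x y. f (x + y) = f x + f y" "!!c x. f (c*.x) = c*f x"
  and "!!x. cmod (f x) <= K*norm x" and K: "0 <= K"
 obtains eta where "!!x. f x = cinner (x::'a::chilbert_space) eta" "norm eta <= K"
proof -
 let ?X = "range (%x. (x, Re (f x)))"
 have "f (r *\<^sub>R x) = r*f x" for r x using assms(2)[of "cor r" x] by simp
 hence "subspace ?X"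
  by(intro linear_subspace_image) (auto intro!: linearI simp: assms(1))
 moreover have "s <= K*norm y" if "(y, s):?X" for y s
  using that assms(3)[of y] complex_Re_le_cmod[of "f y"] by auto
 ultimately obtain eta where eta: "norm eta <= K" "!!x. Re (cinner eta x) = Re (f x)"
  by(rule real_riesz[OF _ _ K]) auto
 have "f x = cinner x eta" for x
 proof -
  have "Re (f x) = Re (cinner x eta)" using eta(2)[of x] Re_cinner_commute by metis
  moreover have "Re (f (\<i>*.x)) = Re (cinner (\<i>*.x) eta)" using eta(2) Re_cinner_commute by metis
  ultimately show ?thesis by(simp add: assms(2) cinner_simps complex_eq_iff)
 qed
 thus thesis using that eta(1) by blast
qed

lemma bop_form:
 assumes add1: "!!x x' y. B (x + x') y = B x y + B x' y" and add2: "!!x y y'. B x (y + y') = B x y + B x y'"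
  and sc1: "!!c x y. B (c*.x) y = c*B x y" and sc2: "!!c x y. B x (c*.y) = cnj c*B x y"
  and bd: "!!x y. cmod (B x y) <= K*norm x*norm y" and K: "0 <= K"
 obtains T :: "'a::chilbert_space bop" where "!!x y. cinner x (T$$y) = B x y" "!!x. norm (T$$x) <= K*norm x"
proof -
 have "EX eta. (ALL x. B x y = cinner x eta) & norm eta <= K*norm y" for y
  by(rule riesz[of "%x. B x y" "K*norm y"]) (use assms in \<open>auto simp: mult_ac\<close>)
 then obtain f where f: "!!x y. B x y = cinner x (f y)" "!!y. norm (f y) <= K*norm y" by metis
 obtain T where "op_app T = f"
 by(metis bop_exists cinner_ext_right f(1)[symmetric] add2 cinner_add_right sc2 cinner_scaleC_right f(2))
 thus thesis using that f by metis
qed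

lemma cinner_adj: "cinner (T$$x) y = cinner x (adj T$$y)"
proof -
 obtain S where S: "!!x y. cinner x (S$$y) = cinner (T$$x) y"
 proof(rule bop_form[of "%x y. cinner (T$$x) y" "opn T"])
  show "cmod (cinner (T$$x) y) <= opn T*norm x*norm y" for x y
   by(rule order_trans[OF cmod_cinner_mult_le mult_right_mono]) (auto simp: norm_op_le)
 qed (auto simp: cinner_simps opn_ge_0)
 have "ALL x y. cinner (T$$x) y = cinner x (adj T$$y)"
  unfolding adj_def
 proof(rule theI[of _ S])
  show "S' = S" if "ALL x y. cinner (T$$x) y = cinner x (S'$$y)" for S'
   by(rule bop_cinner_eqI') (simp add: S that)
 qed (simp add: S)
 thus ?thesis by blast
qed

lemma cinner_adj': "cinner x (T$$y) = cinner (adj T$$x) y"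
 using cinner_adj[of T y x] cinner_commute[of x "T$$y"] cinner_commute[of "adj T$$x" y] by simp

lemma adj_unique: "(!!x y. cinner (T$$x) y = cinner x (S$$y)) ==> adj T = S"
 by(rule bop_cinner_eqI') (simp add: cinner_adj[symmetric])

lemma adj_adj [simp]: "adj (adj T) = T"
 by(rule adj_unique) (rule cinner_adj'[symmetric])

lemma adj_add [simp]: "adj (S + T) = adj S + adj T"
 by(rule adj_unique) (simp add: cinner_simps cinner_adj)
lemma adj_diff [simp]: "adj (S - T) = adj S - adj T"
 by(rule adj_unique) (simp add: cinner_simps cinner_adj)
lemma adj_mult [simp]: "adj (S*T) = adj T*adj S"
 by(rule adj_unique) (simp add: cinner_adj)
lemma adj_scaleC [simp]: "adj (c*.T) = cnj c*.adj T"
 by(rule adj_unique) (simp add: cinner_simps cinner_adj)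
lemma adj_one [simp]: "adj 1 = (1::'a::chilbert_space bop)"
 by(rule adj_unique) simp
lemma adj_zero [simp]: "adj 0 = (0::'a::chilbert_space bop)"
 by(rule adj_unique) simp
lemma adj_sum: "adj (SUM i:I. T i) = (SUM i:I. adj (T i :: 'a::chilbert_space bop))"
 by(induction I rule: infinite_finite_induct) auto

section \<open>Total sets and extension of partially defined operators\<close>

definition total :: "'a::chilbert_space set => bool" where
 "total S \<longleftrightarrow> (ALL y. (ALL x:S. cinner x y = 0) --> y = 0)"

lemma totalD: "total S ==> (!!x. x:S ==> cinner x y = 0) ==> y = 0"
 by(auto simp: total_def)

lemma bop_eq_on_total:
 assumes "total S" and eq: "!!x. x:S ==> T$$x = T'$$x"
 shows "T = T'"
proof -
 have "adj (T - T')$$y = 0" for y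
  by(rule totalD[OF assms(1)], subst cinner_adj[symmetric]) (simp add: eq)
 hence "adj (T - T') = 0" by(intro bop_eqI) simp
 thus ?thesis by(metis adj_adj adj_zero eq_iff_diff_eq_0)
qed

text \<open>The graph of the map \<open>f x \<mapsto> g x\<close> on the complex span, kept as a
  relation: that it is single-valued will follow from a Gram identity.\<close>

inductive_set gspan :: "('x => 'a::chilbert_space) => ('x => 'a) => 'x set => ('a \<times> 'a) set" for f g X where
 zero: "(0, 0):gspan f g X"
| step: "(a, b):gspan f g X ==> x:X ==> (a + c*.f x, b + c*.g x):gspan f g X"

lemma gspan_add: "(a, b):gspan f g X ==> (a', b'):gspan f g X ==> (a' + a, b' + b):gspan f g X"
 by(induction rule: gspan.induct) (auto simp: add.assoc[symmetric] intro: gspan.intros)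

lemma gspan_scaleC: "(a, b):gspan f g X ==> (d*.a, d*.b):gspan f g X"
 by(induction rule: gspan.induct) (auto simp: scaleC_add_right scaleC_scaleC intro: gspan.intros)

lemma gspan_gen: "x:X ==> (f x, g x):gspan f g X"
 using gspan.step[OF gspan.zero, of x X 1 f g] by simp

lemma gspan_gram:
 assumes gram: "!!x y. x:X ==> y:X ==> cinner (g x) (g y) = cor k * cinner (f x) (f y)"
  and "(a, b):gspan f g X" "(a', b'):gspan f g X"
 shows "cinner b b' = cor k * cinner a a'"
proof -
 have 1: "cinner b (g y) = cor k * cinner a (f y)" if y: "y:X" for y
  using assms(2)
 proof induction
  case (step a b x c)
  show ?case
   by(simp only: cinner_add_left cinner_scaleC_left gram[OF step(2) y] step(3) distrib_left mult.left_commute)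
 qed simp
 show ?thesis using assms(3)
 proof induction
  case (step p q x c)
  thus ?case by(simp add: cinner_simps 1 distrib_left mult.left_commute)
 qed simp
qed

text \<open>The adjoint is built first. For each \<open>y\<close>, Riesz yields the vector
  \<open>S y\<close> in the closed domain \<open>L\<close> that represents
  \<open>a \<mapsto> cinner b y\<close>; uniqueness inside \<open>L\<close> makes \<open>S\<close>
  linear, and the adjoint of \<open>S\<close> extends the graph and vanishes on the complement of
  \<open>L\<close>.\<close>

lemma graph_ext:
 fixes G :: "('a::chilbert_space \<times> 'a) set"
 assumes G0: "(0, 0):G" and Gadd: "!!a b a' b'. (a, b):G ==> (a', b'):G ==> (a + a', b + b'):G"
  and G_sc: "!!c a b. (a, b):G ==> (c*.a, c*.b):G"
  and nb: "!!a b. (a, b):G ==> norm b <= K*norm a" and k: "0 <= K"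
 obtains u where "!!a b. (a, b):G ==> u$$a = b" "!!v. (!!a b. (a, b):G ==> cinner a v = 0) ==> u$$v = 0"
  "!!v. norm (u$$v) <= K*norm v"
proof -
 define L where "L = closure (fst ` G)"
 have G_add: "p + q:G" if "p:G" "q:G" for p q
  using Gadd[of "fst p" "snd p" "fst q" "snd q"] that by(simp add: plus_prod_def)
 have G: "subspace G"
 proof(rule subspaceI)
  show "0:G" using G0 by(simp add: zero_prod_def)
  show "r *\<^sub>R p:G" if "p:G" for r p
   using G_sc[of "fst p" "snd p" "cor r"] that by(simp add: scaleR_prod_def)
 qed (rule G_add)
 hence fG: "subspace (fst ` G)" by(intro linear_subspace_image) (auto intro: linearI)
 have L: "subspace L" "closed L" unfolding L_def using closure_subspace[OF fG] by auto
 have Lc: "c*.a:L" if "a:L" for a c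
 proof -
  have "(%x. c*.x) ` closure (fst ` G) \<subseteq> closure ((%x. c*.x) ` fst ` G)"
   by(rule closure_bounded_linear_image_subset[OF bounded_linear_scaleC])
  also have "... \<subseteq> L" unfolding L_def by(intro closure_mono) (use G_sc in force)
  finally show ?thesis using that by(auto simp: L_def)
 qed
 have "EX eta:L. norm eta <= K*norm y & (ALL a b. (a, b):G --> Re (cinner eta a) = Re (cinner b y))" for y
 proof -
  let ?Y = "(%p. (fst p, Re (cinner (snd p) y))) ` G"
  have "subspace ?Y" using G by(intro linear_subspace_image) (auto intro!: linearI simp: cinner_simps)
  moreover have "s <= (K*norm y)*norm a" if "(a, s):?Y" for a s
  proof -
   obtain b where b: "(a, b):G" "s = Re (cinner b y)" using \<open>(a, s) \<in> ?Y\<close> by auto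
   show ?thesis
    using Re_cinner_le[of b y] mult_right_mono[OF nb[OF b(1)], of "norm y"] b(2) by(simp add: mult_ac)
  qed
  ultimately obtain eta where "eta:closure (fst ` ?Y)" "norm eta <= K*norm y"
    "!!z t. (z, t):?Y ==> Re (cinner eta z) = t"
   by(rule real_riesz) (use k in auto)
  thus ?thesis by(force simp: L_def image_image)
 qed
 then obtain S where S: "!!y. S y:L" "!!y. norm (S y) <= K*norm y"
  "!!y a b. (a, b):G ==> Re (cinner (S y) a) = Re (cinner b y)" by metis
 have Sc: "cinner (S y) a = cinner y b" if "(a, b):G" for a b y
 proof -
  have "Re (cinner (S y) (\<i>*.a)) = Re (cinner (\<i>*.b) y)" by(rule S(3)[OF G_sc[OF that]])
  hence "Im (cinner (S y) a) = - Im (cinner b y)" by(simp add: cinner_simps)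
  with S(3)[OF that, of y] show ?thesis by(subst (2) cinner_commute) (simp add: complex_eq_iff)
 qed
 have uniq: "eta = S y" if "eta:L" "!!a b. (a, b):G ==> cinner eta a = cinner y b" for eta y
 proof -
  have d: "eta - S y:L" using that S(1) L(1) by(simp add: subspace_diff)
  have "cinner (eta - S y) a = 0" if "a:fst ` G" for a using that Sc by(auto simp: cinner_simps \<open>\<And>a b. (a, b) \<in> G \<Longrightarrow> cinner eta a = cinner y b\<close>)
  hence "fst ` G \<subseteq> {a. cinner (eta - S y) a = 0}" by blast
  hence "L \<subseteq> {a. cinner (eta - S y) a = 0}" unfolding L_def
   by(rule closure_minimal) (intro closed_Collect_eq continuous_on_cinner continuous_intros)
  thus ?thesis using d by auto
 qed
 obtain T where T: "op_app T = S"
 proof(rule bop_exists)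
  show "S (x + y) = S x + S y" for x y
   by(rule uniq[symmetric]) (auto simp: S(1) L(1) subspace_add Sc cinner_add_left)
  show "S (c*.x) = c*.S x" for c x
   by(rule uniq[symmetric]) (auto simp: S(1) Lc Sc cinner_scaleC_left)
 qed (rule S(2))
 show thesis
 proof(rule that[of "adj T"])
  show "adj T$$a = b" if ab: "(a, b):G" for a b
  proof(rule cinner_ext)
   fix y
   have "cinner (adj T$$a) y = cinner a (S y)" by(simp add: cinner_adj T)
   also have "... = cnj (cinner y b)" using Sc[OF ab] by(subst cinner_commute) simp
   also have "... = cinner b y" by(rule cinner_commute[symmetric])
   finally show "cinner (adj T$$a) y = cinner b y" .
  qed
  show "adj T$$v = 0" if v: "!!a b. (a, b):G ==> cinner a v = 0" for v
  proof -
   have "fst ` G \<subseteq> {a. cinner a v = 0}" using v by auto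
   hence "L \<subseteq> {a. cinner a v = 0}" unfolding L_def
    by(rule closure_minimal) (intro closed_Collect_eq continuous_on_cinner continuous_intros)
   hence "cinner (adj T$$v) y = 0" for y
    using S(1)[of y] by(subst cinner_commute) (auto simp: cinner_adj' T)
   thus ?thesis using cinner_eq_zero_iff by blast
  qed
  show "norm (adj T$$v) <= K*norm v" for v
  proof -
   have "(norm (adj T$$v))^2 = Re (cinner v (T$$adj T$$v))" by(simp add: cinner_adj[of "adj T", simplified, symmetric] Re_cinner_self)
   also have "... <= norm v * norm (T$$adj T$$v)" by(rule Re_cinner_le)
   also have "... <= norm v * (K*norm (adj T$$v))" by(intro mult_left_mono) (use S(2) T in auto)
   finally show ?thesis by(cases "adj T$$v = 0") (use k in \<open>auto simp: power2_eq_square mult_ac\<close>)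
  qed
 qed
qed

text \<open>Proportional Gram matrices make \<open>f x \<mapsto> g x\<close> a multiple of a partial
  isometry. Implementing operators and shift unitaries are later obtained in this way.\<close>

lemma gram_ext:
 fixes f g :: "'x => 'a::chilbert_space"
 assumes gram: "!!x y. x:X ==> y:X ==> cinner (g x) (g y) = cor k * cinner (f x) (f y)"
  and k: "0 <= k"
 obtains u where "!!x. x:X ==> u$$f x = g x" "!!v. (!!x. x:X ==> cinner (f x) v = 0) ==> u$$v = 0"
  "!!v. norm (u$$v) <= sqrt k*norm v"
proof(rule graph_ext[of "gspan f g X" "sqrt k"])
 show "norm b <= sqrt k*norm a" if "(a, b):gspan f g X" for a b
 proof -
  have "cor ((norm b)^2) = cor (k*(norm a)^2)"
   using gspan_gram[OF gram, where a = a and b = b and a' = a and b' = b] that by(simp add: cinner_self)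
  hence "(norm b)^2 = k*(norm a)^2" using of_real_eq_iff by blast
  hence "sqrt ((norm b)^2) = sqrt (k*(norm a)^2)" by simp
  thus ?thesis by(simp add: real_sqrt_mult)
 qed
 show "(a + a', b + b'):gspan f g X" if "(a, b):gspan f g X" "(a', b'):gspan f g X" for a b a' b'
  using gspan_add[OF that(2,1)] by simp
next
 fix u
 assume u: "!!a b. (a, b):gspan f g X ==> u$$a = b"
  "!!v. (!!a b. (a, b):gspan f g X ==> cinner a v = 0) ==> u$$v = 0" "!!v. norm (u$$v) <= sqrt k*norm v"
 show thesis
 proof(rule that[of u])
  show "u$$f x = g x" if "x:X" for x by(rule u(1)[OF gspan_gen[OF that]])
  show "u$$v = 0" if v: "!!x. x:X ==> cinner (f x) v = 0" for v
  proof(rule u(2))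
   show "cinner a v = 0" if "(a, b):gspan f g X" for a b
    using that by induction (auto simp: cinner_simps v)
  qed
 qed (rule u(3))
qed (use k in \<open>auto intro: gspan.zero gspan_scaleC\<close>)

subsection \<open>Closed subspaces and projections\<close>

definition ccsubspace :: "'a::chilbert_space set => bool" where
 "ccsubspace L \<longleftrightarrow> subspace L & closed L & (ALL c. ALL x:L. c*.x:L)"

definition cproj :: "'a::chilbert_space set => 'a bop" where "cproj L = Abs_bop (rproj L)"

lemma ccsubspaceI:
 assumes "0:L" "!!x y. x:L ==> y:L ==> x + y:L" "!!c x. x:L ==> c*.x:L" "closed L"
 shows "ccsubspace L"
 unfolding ccsubspace_def subspace_def using assms assms(3)[of _ "cor r" for r] by auto

lemma ccsubspace_closure:
 assumes "0:L" "!!x y. x:L ==> y:L ==> x + y:L" "!!c x. x:L ==> c*.x:L"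
 shows "ccsubspace (closure L)"
proof -
 have "subspace L" unfolding subspace_def using assms assms(3)[of _ "cor r" for r] by auto
 moreover have "c*.x:closure L" if "x:closure L" for c x
 proof -
  have "(%x. c*.x) ` closure L \<subseteq> closure ((%x. c*.x) ` L)"
   by(rule closure_bounded_linear_image_subset[OF bounded_linear_scaleC])
  also have "... \<subseteq> closure L" by(intro closure_mono) (use assms(3) in force)
  finally show ?thesis using that by auto
 qed
 ultimately show ?thesis by(auto simp: ccsubspace_def closure_subspace)
qed

lemma cproj_app:
 assumes "ccsubspace L"
 shows "cproj L$$x = rproj L x"
proof -
 have L: "subspace L" "closed L" and Lc: "!!c x. x:L ==> c*.x:L"
  using assms by(auto simp: ccsubspace_def)
 obtain T where T: "op_app T = rproj L"
 proof(rule bop_exists[of "rproj L" 1])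
  show "rproj L (c*.x) = c*.rproj L x" for c x
  proof(rule rproj_unique[OF L])
   show "c*.rproj L x:L" by(intro Lc rproj_in L)
   fix k assume "k:L"
   hence "Re (cinner (x - rproj L x) (cnj c*.k)) = 0" by(intro rproj_orth L Lc)
   thus "Re (cinner (c*.x - c*.rproj L x) k) = 0" by(simp add: cinner_simps algebra_simps)
  qed
 qed (use rproj_add[OF L] norm_rproj_le[OF L] in auto)
 thus ?thesis by(metis cproj_def op_app_inverse T)
qed

context
 fixes L :: "'a::chilbert_space set"
 assumes L: "ccsubspace L"
begin

lemma cproj_in: "cproj L$$x:L"
 using L by(simp add: cproj_app rproj_in ccsubspace_def)

lemma cproj_id: "x:L ==> cproj L$$x = x"
 using L by(simp add: cproj_app rproj_id ccsubspace_def)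

lemma cproj_idem [simp]: "cproj L * cproj L = cproj L"
 by(rule bop_eqI) (simp add: cproj_id cproj_in)

lemma cproj_orth:
 assumes k: "k:L"
 shows "cinner (x - cproj L$$x) k = 0"
proof -
 have K: "subspace L" "closed L" "!!c x. x:L ==> c*.x:L"
  using L by(auto simp: ccsubspace_def)
 have "Re (cinner (x - rproj L x) k) = 0" "Re (cinner (x - rproj L x) (\<i>*.k)) = 0"
  by(intro rproj_orth K k)+
 thus ?thesis by(simp add: cproj_app[OF L] cinner_simps complex_eq_iff)
qed

lemma cproj_adj [simp]: "adj (cproj L) = cproj L"
proof(rule adj_unique)
 fix x y
 have "cinner (cproj L$$x) (y - cproj L$$y) = 0"
  using cproj_orth[OF cproj_in, of y x] by(subst cinner_commute) simp
 moreover have "cinner (x - cproj L$$x) (cproj L$$y) = 0"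
  by(rule cproj_orth[OF cproj_in])
 ultimately show "cinner (cproj L$$x) y = cinner x (cproj L$$y)"
  by(simp add: cinner_simps)
qed

lemma cproj_eq_0: "(!!k. k:L ==> cinner k x = 0) ==> cproj L$$x = 0"
 using cproj_orth[OF cproj_in, of x x] cproj_in[of x] cinner_adj[of "cproj L" x x]
 by(metis cinner_adj' cproj_adj cproj_id cproj_in cinner_eq_zero_iff)

lemma cproj_commute:
 assumes "!!x. x:L ==> T$$x:L" "!!x. x:L ==> adj T$$x:L"
 shows "T * cproj L = cproj L*T"
proof -
 have *: "cproj L*S * cproj L = S * cproj L" if "!!x. x:L ==> S$$x:L" for S
  by(rule bop_eqI) (simp add: cproj_id that cproj_in)
 have "adj (cproj L*adj T * cproj L) = adj (adj T * cproj L)" using *[OF assms(2)] by simp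
 hence "cproj L*T * cproj L = cproj L*T" by(simp add: mult.assoc)
 thus ?thesis using *[OF assms(1)] by simp
qed

end

lemma total_closure:
 assumes "total L" "0:L" "!!x y. x:L ==> y:L ==> x + y:L" "!!c x. x:L ==> c*.x:L"
 shows "closure L = UNIV"
proof -
 have L: "ccsubspace (closure L)" by(rule ccsubspace_closure[OF assms(2-4)])
 have "x:closure L" for x
 proof -
  have "x - cproj (closure L)$$x = 0"
  proof(rule totalD[OF assms(1)])
   fix k assume "k:L"
   hence "cinner (x - cproj (closure L)$$x) k = 0"
    using closure_subset by(intro cproj_orth[OF L]) blast
   thus "cinner k (x - cproj (closure L)$$x) = 0" by(subst cinner_commute) simp
  qed
  thus ?thesis using cproj_in[OF L, of x] by simp
 qed
 thus ?thesis by blast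
qed

subsection \<open>Positive operators\<close>

lemma nonneg_Reals_iff: "z:\<real>\<^sub>\<ge>\<^sub>0 \<longleftrightarrow> Im z = 0 & 0 <= Re z"
 by(auto simp: complex_nonneg_Reals_iff)

lemma pos_op_iff: "pos_op T \<longleftrightarrow> (ALL x. Im (cinner (T$$x) x) = 0 & 0 <= Re (cinner (T$$x) x))"
 by(simp add: pos_op_def nonneg_Reals_iff)

lemma adj_eq_if_real:
 assumes "!!x. Im (cinner (T$$x) x) = 0"
 shows "adj T = T"
proof(rule adj_unique)
 fix x y
 have 1: "Im (cinner (T$$x) y) = - Im (cinner (T$$y) x)" for x y
  using assms[of "x + y"] assms[of x] assms[of y] by(simp add: cinner_simps)
 have "Im (cinner (T$$(\<i>*.x)) y) = - Im (cinner (T$$y) (\<i>*.x))" by(rule 1)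
 hence 2: "Re (cinner (T$$x) y) = Re (cinner (T$$y) x)" by(simp add: cinner_simps)
 show "cinner (T$$x) y = cinner x (T$$y)"
  using 1[of x y] 2 by(subst (2) cinner_commute) (simp add: complex_eq_iff)
qed

lemma pos_op_adj: "pos_op T ==> adj T = T"
 by(rule adj_eq_if_real) (simp add: pos_op_iff)

lemma pos_op_adj_mult: "pos_op (adj T*T)"
 by(simp add: pos_op_iff cinner_adj'[symmetric] cinner_self)

lemma adj_mult_self_app: "cinner ((adj T*T)$$x) x = cor ((norm (T$$x))^2)"
 by(simp only: times_op_app cinner_adj'[symmetric] cinner_self)

lemma pos_op_add: "pos_op S ==> pos_op T ==> pos_op (S + T)"
 by(simp add: pos_op_iff cinner_simps)

lemma pos_op_scale: "pos_op S ==> 0 <= r ==> pos_op (cor r*.S)"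
 by(simp add: pos_op_iff cinner_simps)

lemma pos_op_conj: "pos_op S ==> pos_op (adj T*S*T)"
 by(simp add: pos_op_iff cinner_adj'[symmetric])

lemma pos_op_zero [simp]: "pos_op 0"
 by(simp add: pos_op_iff)

lemma pos_op_contraction:
 assumes X: "pos_op X" and le: "!!v. Re (cinner (X$$v) v) <= (norm v)^2"
 shows "(norm (X$$v))^2 <= Re (cinner (X$$v) v)" and "norm (X$$v) <= norm v"
proof -
 let ?w = "v - X$$v"
 have eq: "cinner (X$$X$$v) v = cinner (X$$v) (X$$v)"
  by(subst cinner_adj) (simp add: pos_op_adj[OF X])
 have "0 <= Re (cinner (X$$?w) ?w)" using X unfolding pos_op_iff by blast
 also have "... = Re (cinner (X$$v) v) - 2*(norm (X$$v))^2 + Re (cinner (X$$X$$v) (X$$v))"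
  by(simp add: cinner_simps eq Re_cinner_self)
 also have "... <= Re (cinner (X$$v) v) - (norm (X$$v))^2" using le[of "X$$v"] by simp
 finally show 1: "(norm (X$$v))^2 <= Re (cinner (X$$v) v)" by simp
 hence "(norm (X$$v))^2 <= (norm v)^2" using le[of v] by linarith
 thus "norm (X$$v) <= norm v" by(simp add: power2_le_iff_abs_le)
qed

text \<open>The difference of two members is a positive contraction, so by
  \<open>pos_op_contraction\<close> the squared norm of its value at \<open>v\<close> is at most a
  difference of the bounded increasing numbers \<open>Re (cinner (T n$$v) v)\<close>.\<close>

lemma monotone_limit:
 fixes T :: "nat => 'a::chilbert_space bop"
 assumes pos: "pos_op (T 0)" and mono: "!!n. pos_op (T (Suc n) - T n)"
  and le: "!!n v. Re (cinner (T n$$v) v) <= (norm v)^2"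
 obtains S where "!!v. (%n. T n$$v) ----> S$$v"
proof -
 have diff: "pos_op (T (n + k) - T n)" for n k
 proof(induction k)
  case (Suc k)
  have "T (n + Suc k) - T n = (T (Suc (n + k)) - T (n + k)) + (T (n + k) - T n)" by simp
  thus ?case using pos_op_add[OF mono Suc] by metis
 qed simp
 have Tpos: "pos_op (T n)" for n
  using pos_op_add[OF diff[of 0 n] pos] by simp
 have sq: "(norm (T (n + k)$$v - T n$$v))^2 <= Re (cinner (T (n + k)$$v) v) - Re (cinner (T n$$v) v)" for n k v
 proof -
  have "Re (cinner ((T (n + k) - T n)$$w) w) <= (norm w)^2" for w
   using le[of "n + k" w] Tpos[of n] unfolding pos_op_iff
   by(simp add: cinner_simps) (smt (verit))
  from pos_op_contraction(1)[OF diff this, of v] show ?thesis by(simp add: cinner_simps)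
 qed
 have conv: "EX l. (%n. T n$$v) ----> l" for v
 proof -
  define r where "r n = Re (cinner (T n$$v) v)" for n
  have "incseq r"
  proof(rule incseq_SucI)
   show "r n <= r (Suc n)" for n
    using mono[of n] by(simp add: pos_op_iff r_def cinner_simps)
  qed
  hence "convergent r"
   using le by(intro Bseq_mono_convergent BseqI'[of _ "(norm v)^2"])
    (use Tpos in \<open>auto simp: r_def pos_op_iff incseq_def\<close>)
  hence C: "Cauchy r" by(simp add: Cauchy_convergent_iff)
  have "Cauchy (%n. T n$$v)"
  proof(rule CauchyI')
   fix e :: real assume e: "0 < e"
   then obtain N where N: "!!m n. m >= N ==> n >= N ==> \<bar>r m - r n\<bar> < e^2"
    using CauchyD[OF C, of "e^2"] by auto
   have "norm (T m$$v - T n$$v) < e" if "m >= N" "n > m" for m n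
   proof -
    show ?thesis using sq[of m "n - m" v] that N[of n m] e by(simp add: r_def norm_minus_commute power2_less_imp_less)
   qed
   thus "EX M. ALL m>=M. ALL n>m. dist (T m$$v) (T n$$v) < e" unfolding dist_norm by blast
  qed
  thus ?thesis using Cauchy_convergent_iff convergent_def by blast
 qed
 then obtain f where f: "!!v. (%n. T n$$v) ----> f v" by metis
 obtain S where "op_app S = f"
 proof(rule bop_exists[of f 1])
  show "f (x + y) = f x + f y" for x y
   using tendsto_add[OF f[of x] f[of y]] f[of "x + y"] LIMSEQ_unique by simp
  show "f (c*.x) = c*.f x" for c x
   by(rule LIMSEQ_unique[OF f]) (simp add: tendsto_scaleC f)
  show "norm (f x) <= 1*norm x" for x
  by(use pos_op_contraction[OF Tpos le] Lim_bounded[OF tendsto_norm[OF f[of x]], of 0] in \<open>simp\<close>)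
 qed
 thus thesis using f that by metis
qed

lemma limit_op_eq:
 assumes "!!v. (%n. S n$$v) ----> S'$$v" "!!v. (%n. S n$$v) ----> T'$$v"
 shows "S' = T'"
 by(rule bop_eqI) (use assms LIMSEQ_unique in blast)

text \<open>Polynomials in \<open>X\<close> with nonnegative coefficients: closed under products,
  and positive because all powers of a positive operator are. This avoids products of general
  commuting positive operators in the square root iteration.\<close>

inductive_set pos_polys :: "'a::chilbert_space bop => 'a bop set" for X where
 zero: "0:pos_polys X"
| step: "p:pos_polys X ==> 0 <= r ==> p + cor r*.X ^ n:pos_polys X"

lemma pos_polys_add: "p:pos_polys X ==> q:pos_polys X ==> q + p:pos_polys X"
 by(induction rule: pos_polys.induct) (auto simp: add.assoc[symmetric] intro: pos_polys.intros)

lemma pos_polys_scale: "p:pos_polys X ==> 0 <= r ==> cor r*.p:pos_polys X"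
proof(induction rule: pos_polys.induct)
 case (step p s n)
 show ?case using pos_polys.step[OF step.IH[OF step.prems], of "r * s" n] step by(simp add: bop_scaleC_simps)
qed (simp add: bop_scaleC_simps pos_polys.zero)

lemma pos_polys_gen: "X:pos_polys X"
 using pos_polys.step[OF pos_polys.zero, of 1 X 1] by(simp add: bop_scaleC_simps)

lemma pos_polys_mult_power: "p:pos_polys X ==> p*X ^ m:pos_polys X"
proof(induction rule: pos_polys.induct)
 case (step p r n)
 thus ?case using pos_polys.step[of "p*X ^ m" X r "n + m"] by(simp add: distrib_right power_add)
qed (simp add: pos_polys.zero)

lemma pos_polys_mult: "p:pos_polys X ==> q:pos_polys X ==> q*p:pos_polys X"
proof(induction rule: pos_polys.induct)
 case (step p r n)
 thus ?case
  using pos_polys_add[OF pos_polys_scale[OF pos_polys_mult_power, of q X r n]] by(simp add: distrib_left)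
qed (simp add: pos_polys.zero)

lemma pos_polys_commute: "p:pos_polys X ==> R*X = X*R ==> R*p = p*R"
proof(induction rule: pos_polys.induct)
 case (step p r n)
 have "R*X ^ n = X ^ n*R" using step(4) by(metis power_commuting_commutes)
 thus ?case using step by(simp add: distrib_left distrib_right)
qed simp

lemma pos_polys_pos: "p:pos_polys X ==> pos_op X ==> pos_op p"
proof(induction rule: pos_polys.induct)
 case (step p r n)
 have X: "adj X = X" by(rule pos_op_adj[OF step(4)])
 have adjp: "adj (X ^ k) = X ^ k" for k
  by(induction k) (simp_all add: X power_commutes)
 have "pos_op (X ^ n)"
 proof(cases "even n")
  case True
  then obtain k where "n = k + k" by(metis evenE mult_2)
  thus ?thesis using pos_op_adj_mult[of "X ^ k"] by(simp add: adjp power_add)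
 next
  case False
  then obtain k where "n = k + (1 + k)" by(metis oddE mult_2 add.assoc add.commute)
  thus ?thesis using pos_op_conj[OF step(4), of "X ^ k"] by(simp only: adjp power_add power_one_right mult.assoc)
 qed
 thus ?case using step by(intro pos_op_add pos_op_scale) auto
qed simp

text \<open>The iteration \<open>Y (Suc n) = (X + Y n*Y n) / 2\<close> with \<open>X = 1 - T\<close>
  increases inside \<open>pos_polys X\<close>. Its limit satisfies \<open>2 Z = X + Z*Z\<close>,
  that is \<open>(1 - Z)^2 = T\<close>, and as a strong limit of polynomials it commutes with
  whatever commutes with \<open>T\<close>.\<close>

lemma pos_op_sqrt_contraction:
 assumes T: "pos_op T" and le: "!!v. Re (cinner (T$$v) v) <= (norm v)^2"
 obtains S where "pos_op S" "S*S = T" "!!R. R*T = T*R ==> R*S = S*R"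
proof -
 define h where "h = cor (1/2)"
 define X where "X = 1 - T"
 define Y where "Y = rec_nat 0 (%_ y. h*.(X + y*y))"
 have Y0: "Y 0 = 0" and YS: "Y (Suc n) = h*.(X + Y n*Y n)" for n by(simp_all add: Y_def)
 have X: "pos_op X" and Xle: "Re (cinner (X$$v) v) <= (norm v)^2" for v
  using T le by(auto simp: X_def pos_op_iff cinner_simps cinner_self)
 have PC: "Y n:pos_polys X" for n
  by(induction n) (simp_all add: Y0 YS h_def pos_polys.zero pos_polys_scale pos_polys_add pos_polys_mult pos_polys_gen del: of_real_divide)
 have comm: "p*q = q*p" if "p:pos_polys X" "q:pos_polys X" for p q
  by(rule pos_polys_commute[OF that(2)]) (rule pos_polys_commute[OF that(1), symmetric], rule refl)
 have dPC: "Y (Suc n) - Y n:pos_polys X" for n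
 proof(induction n)
  case 0
  show ?case by(simp add: Y0 YS h_def pos_polys_scale pos_polys_gen del: of_real_divide)
 next
  case (Suc n)
  have "Y (Suc (Suc n)) - Y (Suc n) = h*.(Y (Suc n)*Y (Suc n) - Y n*Y n)"
   unfolding YS[of "Suc n"] YS[of n] bop_scaleC_simps(3)[symmetric] by simp
  also have "Y (Suc n)*Y (Suc n) - Y n*Y n = (Y (Suc n) - Y n)*(Y (Suc n) + Y n)"
   using comm[OF PC[of "Suc n"] PC[of n]] by(simp add: algebra_simps)
  finally show ?case
   unfolding h_def by(simp add: Suc PC pos_polys_scale pos_polys_add pos_polys_mult del: of_real_divide)
 qed
 have Ynorm: "norm (Y n$$v) <= norm v" for n v
 proof(induction n arbitrary: v)
  case (Suc n)
  have "norm (Y n$$Y n$$v) <= norm v" using Suc order_trans by blast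
  moreover have "norm (X$$v) <= norm v" by(rule pos_op_contraction[OF X Xle])
  ultimately have "norm (X$$v + Y n$$Y n$$v) <= 2*norm v"
   using norm_triangle_ineq[of "X$$v" "Y n$$Y n$$v"] by linarith
  thus ?case by(simp add: YS h_def norm_scaleC)
 qed (simp add: Y0)
 have Yle: "Re (cinner (Y n$$v) v) <= (norm v)^2" for n v
 proof -
  have "Re (cinner (Y n$$v) v) <= norm (Y n$$v)*norm v" by(rule Re_cinner_le)
  also have "... <= norm v * norm v" by(intro mult_right_mono Ynorm) simp
  finally show ?thesis by(simp add: power2_eq_square)
 qed
 obtain Z where Z: "!!v. (%n. Y n$$v) ----> Z$$v"
  by(rule monotone_limit[of Y]) (use Y0 dPC Yle pos_polys_pos[OF _ X] in auto)
 have ZZ: "(%n. Y n$$Y n$$v) ----> Z$$Z$$v" for v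
 proof -
  have "(%n. Y n$$(Y n$$v - Z$$v)) ----> 0"
  proof(rule Lim_null_comparison)
   show "\<forall>\<^sub>F n in sequentially. norm (Y n$$(Y n$$v - Z$$v)) <= norm (Y n$$v - Z$$v)"
    by(intro always_eventually allI Ynorm)
   show "(%n. norm (Y n$$v - Z$$v)) ----> 0"
    using Z[of v] by(simp add: LIM_zero tendsto_norm_zero)
  qed
  from tendsto_add[OF this Z[of "Z$$v"]] show ?thesis by simp
 qed
 have fix': "h*.(X + Z*Z) = Z"
 proof(rule limit_op_eq[of "%n. Y (Suc n)"])
  show "(%n. Y (Suc n)$$v) ----> h*.(X + Z*Z)$$v" for v
   unfolding YS by(simp add: scaleC_add_right) (intro tendsto_intros tendsto_scaleC ZZ)
  show "(%n. Y (Suc n)$$v) ----> Z$$v" for v by(rule LIMSEQ_Suc[OF Z])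
 qed
 have "cor 2*.h*.(X + Z*Z) = cor 2*.Z" by(simp add: fix')
 hence two: "X + Z*Z = Z + Z"
  unfolding h_def bop_scaleC_simps(4) of_real_mult[symmetric] by(simp add: bop_scaleC_simps(5)) (metis bop_scaleC_simps(2,5) one_add_one)
 show thesis
 proof(rule that[of "1 - Z"])
  have "adj Z = Z"
  proof(rule adj_eq_if_real)
   fix v
   have "(%n. Im (cinner (Y n$$v) v)) ----> Im (cinner (Z$$v) v)"
    by(intro tendsto_intros tendsto_cinner Z)
   moreover have "Im (cinner (Y n$$v) v) = 0" for n
    using pos_polys_pos[OF PC X] by(simp add: pos_op_iff)
   ultimately show "Im (cinner (Z$$v) v) = 0" by(simp add: LIMSEQ_const_iff)
  qed
  hence "Im (cinner (Z$$v) v) = 0" for v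
   using cinner_adj[of Z v v] cinner_commute[of "Z$$v" v] by(simp add: complex_eq_iff)
  moreover have "Re (cinner (Z$$v) v) <= (norm v)^2" for v
   by(rule Lim_bounded[of "%n. Re (cinner (Y n$$v) v)"]) (auto intro!: tendsto_intros tendsto_cinner Z Yle)
  ultimately show "pos_op (1 - Z)" by(simp add: pos_op_iff cinner_simps cinner_self)
  show "(1 - Z)*(1 - Z) = T" using two by(simp add: algebra_simps X_def)
  show "R*(1 - Z) = (1 - Z)*R" if "R*T = T*R" for R
  proof -
   have "R*X = X*R" using that by(simp add: X_def algebra_simps)
   hence c: "R*Y n = Y n*R" for n using pos_polys_commute[OF PC] by blast
   have "R*Z = Z*R"
   proof(rule limit_op_eq[of "%n. R*Y n"])
    show "(%n. (R*Y n)$$v) ----> (R*Z)$$v" for v by(simp add: tendsto_op_app Z)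
    show "(%n. (R*Y n)$$v) ----> (Z*R)$$v" for v by(simp add: c Z)
   qed
   thus ?thesis by(simp add: algebra_simps)
  qed
 qed
qed

lemma pos_op_sqrt:
 assumes T: "pos_op T"
 obtains S where "pos_op S" "S*S = T" "!!R. R*T = T*R ==> R*S = S*R"
proof -
 define K where "K = opn T + 1"
 have K: "0 < K" using opn_ge_0[of T] by(simp add: K_def)
 define T' where "T' = cor (1 / K)*.T"
 have T': "pos_op T'" unfolding T'_def using T K by(intro pos_op_scale) auto
 have le: "Re (cinner (T'$$v) v) <= (norm v)^2" for v
 proof -
  have "Re (cinner (T$$v) v) <= norm (T$$v)*norm v" by(rule Re_cinner_le)
  also have "... <= opn T*norm v * norm v" by(intro mult_right_mono norm_op_le) simp
  also have "... <= K*(norm v)^2" by(simp add: K_def power2_eq_square algebra_simps)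
  finally have "Re (cinner (T$$v) v) / K <= (norm v)^2" using K by(simp add: pos_divide_le_eq mult.commute)
  thus ?thesis by(simp add: T'_def cinner_scaleC_left Re_divide_of_real)
 qed
 obtain S where S: "pos_op S" "S*S = T'" "!!R. R*T' = T'*R ==> R*S = S*R"
  by(rule pos_op_sqrt_contraction[OF T' le]) (rule that)
 show thesis
 proof(rule that[of "cor (sqrt K)*.S"])
  show "pos_op (cor (sqrt K)*.S)" using S(1) K by(intro pos_op_scale) auto
  have "(cor (sqrt K)*.S)*(cor (sqrt K)*.S) = cor (sqrt K * sqrt K*(1 / K))*.T"
   by(simp only: bop_scaleC_mult bop_scaleC_simps S(2) T'_def of_real_mult mult.assoc)
  also have "... = T" using K by(simp add: bop_scaleC_simps)
  finally show "(cor (sqrt K)*.S)*(cor (sqrt K)*.S) = T" .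
  show "R*(cor (sqrt K)*.S) = (cor (sqrt K)*.S)*R" if "R*T = T*R" for R
   using S(3)[of R] that by(simp add: T'_def)
 qed
qed

subsection \<open>Square-summable families\<close>

lemma coord_add [simp]: "coord (v + w) i = coord v i + coord w i" by transfer simp
lemma coord_uminus [simp]: "coord (- v) i = - coord v i" by transfer simp
lemma coord_zero [simp]: "coord 0 i = 0" by transfer simp
lemma coord_scaleC [simp]: "coord (c*.v) i = c*.coord v i" by transfer simp
lemma coord_scaleR [simp]: "coord (r *\<^sub>R v) i = r *\<^sub>R coord v i" by transfer simp
lemmas coord_diff [simp] = coord_minus

lemma ell2_eqI: "(!!i. coord v i = coord w i) ==> v = w"
 by(metis coord_inject ext)

lemma coord_summable: "(%i. (norm (coord v i))\<^sup>2) summable_on UNIV"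
 using coord[of v] by simp

lemma cinner_ell2: "cinner v w = (\<Sum>\<^sub>\<infinity>i. cinner (coord v i) (coord w i))"
 by(rule cinner_ell2.rep_eq)

lemma cinner_coord_summable: "(%i. cinner (coord v i) (coord w i)) summable_on UNIV"
 by(rule cinner_summable) (rule coord_summable)+

lemma norm_ell2_sq: "(norm v)^2 = (\<Sum>\<^sub>\<infinity>i. (norm (coord v i))\<^sup>2)"
 unfolding norm_ell2.rep_eq by(simp add: infsum_nonneg)

lemma Abs_ell2: "(%i. (norm (f i))\<^sup>2) summable_on UNIV ==> coord (Abs_ell2 f) = f"
 by(rule Abs_ell2_inverse) simp

lemma sum_norm_coord_le: "finite F ==> (SUM i:F. (norm (coord v i))\<^sup>2) <= (norm v)^2"
 unfolding norm_ell2_sq by(rule finite_sum_le_infsum[OF coord_summable]) auto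

lemma ell2_op_coord:
 fixes f :: "('i, 'a::chilbert_space) ell2 => 'i => 'a"
 assumes add: "!!v w i. f (v + w) i = f v i + f w i" and sc: "!!c v i. f (c*.v) i = c*.f v i"
  and bd: "!!v F. finite F ==> (SUM i:F. (norm (f v i))\<^sup>2) <= K*(norm v)^2" and K: "0 <= K"
 shows "coord (ell2_op f$$v) i = f v i"
proof -
 have L2: "L2_set (%i. norm (f v i)) F <= sqrt K*norm v" if "finite F" for F v
 proof -
  have "L2_set (%i. norm (f v i)) F <= sqrt (K*(norm v)^2)"
   unfolding L2_set_def by(rule real_sqrt_le_mono) (rule bd[OF that])
  thus ?thesis by(simp add: real_sqrt_mult)
 qed
 have c: "coord (Abs_ell2 (f v)) = f v" for v
  by(rule Abs_ell2) (rule ell2_bound(1)[OF L2])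
 obtain T where "op_app T = (%v. Abs_ell2 (f v))"
 proof(rule bop_exists[of "%v. Abs_ell2 (f v)" "sqrt K"])
  show "norm (Abs_ell2 (f x)) <= sqrt K*norm x" for x
   unfolding norm_ell2.rep_eq[of "Abs_ell2 (f x)"] c by(rule ell2_bound(2)[OF L2])
 qed (rule ell2_eqI, simp add: c add sc)+
 hence T: "ALL v i. coord (T$$v) i = f v i" by(simp add: c)
 have "ALL v i. coord (ell2_op f$$v) i = f v i"
  unfolding ell2_op_def
 proof(rule theI[of _ T])
  show "T' = T" if "ALL v i. coord (T'$$v) i = f v i" for T'
   by(rule bop_eqI, rule ell2_eqI) (simp add: T that)
 qed (rule T)
 thus ?thesis by blast
qed

definition amp :: "'a::chilbert_space bop => ('i, 'a) ell2 bop" where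
 "amp T = ell2_op (%v i. T$$coord v i)"

lemma coord_amp [simp]: "coord (amp T$$v) i = T$$coord v i"
 unfolding amp_def
proof(rule ell2_op_coord[where K = "(opn T)^2"])
 fix v :: "('i, 'a) ell2" and F :: "'i set"
 assume F: "finite F"
 have "(SUM i:F. (norm (T$$coord v i))\<^sup>2) <= (SUM i:F. (opn T)\<^sup>2*(norm (coord v i))^2)"
  by(intro sum_mono) (metis norm_ge_zero norm_op_le power_mono power_mult_distrib)
 also have "... <= (opn T)^2*(norm v)^2"
  unfolding sum_distrib_left[symmetric] by(intro mult_left_mono sum_norm_coord_le F) simp
 finally show "(SUM i:F. (norm (T$$coord v i))\<^sup>2) <= (opn T)^2*(norm v)^2" .
qed auto

lemma amp_simps:
 "amp (S + T) = amp S + amp T" "amp (S - T) = amp S - amp T" "amp (S*T) = amp S*amp T"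
 "amp (c*.T) = c*.amp T" "amp 1 = 1" "amp 0 = 0" "amp (- T) = - amp T"
 by(rule bop_eqI, rule ell2_eqI, simp)+

lemma adj_amp [simp]: "adj (amp T) = amp (adj T)"
 by(rule adj_unique) (simp add: cinner_ell2 cinner_adj)

lift_definition single :: "'i => 'a::chilbert_space => ('i, 'a) ell2" is "%i x j. if j = i then x else 0"
proof -
 fix i :: 'i and x :: 'a
 have "(%j. (norm (if j = i then x else 0))\<^sup>2) summable_on UNIV \<longleftrightarrow> (%j. (norm x)\<^sup>2) summable_on {i}"
  by(rule summable_on_cong_neutral) auto
 thus "(%j. (norm (if j = i then x else 0))\<^sup>2) summable_on UNIV" by simp
qed

lemma coord_single: "coord (single i x) j = (if j = i then x else 0)" by transfer simp

lemma cinner_single: "cinner (single i x) v = cinner x (coord v i)"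
proof -
 have "cinner (single i x) v = (\<Sum>\<^sub>\<infinity>j\<in>{i}. cinner x (coord v i))"
  unfolding cinner_ell2 by(rule infsum_cong_neutral) (auto simp: coord_single)
 thus ?thesis by simp
qed

lemma cinner_single_right: "cinner v (single i x) = cinner (coord v i) x"
 by(metis cinner_commute cinner_single)

lemma amp_single [simp]: "amp T$$single i x = single i (T$$x)"
 by(rule ell2_eqI) (simp add: coord_single)

lemma total_single: "total {single i x :: ('i, 'a::chilbert_space) ell2 | i x. True}"
 unfolding total_def
proof(intro allI impI)
 fix y :: "('i, 'a) ell2"
 assume *: "ALL x:{single i x | i x. True}. cinner x y = 0"
 have "coord y i = 0" for i
 proof -
  have "cinner (single i (coord y i)) y = 0" using * by blast
  thus ?thesis by(simp add: cinner_single)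
 qed
 thus "y = 0" by(intro ell2_eqI) simp
qed

definition reindex :: "('i => 'j) => ('i, 'a::chilbert_space) ell2 => ('j, 'a) ell2" where
 "reindex e v = Abs_ell2 (%j. if j:range e then coord v (inv e j) else 0)"

lemma coord_reindex:
 assumes "inj e"
 shows "coord (reindex e v) j = (if j:range e then coord v (inv e j) else 0)"
proof -
 have "(%j. (norm (if j:range e then coord v (inv e j) else 0))\<^sup>2) summable_on UNIV \<longleftrightarrow>
   (%j. (norm (coord v (inv e j)))\<^sup>2) summable_on range e"
  by(rule summable_on_cong_neutral) auto
 also have "... \<longleftrightarrow> ((%j. (norm (coord v (inv e j)))\<^sup>2) \<circ> e) summable_on UNIV"
  by(rule summable_on_reindex[OF assms])
 finally show ?thesis unfolding reindex_def
  using coord_summable[of v] assms by(subst Abs_ell2) (auto simp: o_def)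
qed

lemma cinner_reindex:
 assumes "inj e"
 shows "cinner (reindex e v) (reindex e w) = cinner v w"
proof -
 have "cinner (reindex e v) (reindex e w) = (\<Sum>\<^sub>\<infinity>j\<in>range e. cinner (coord v (inv e j)) (coord w (inv e j)))"
  unfolding cinner_ell2 by(rule infsum_cong_neutral) (auto simp: coord_reindex[OF assms])
 also have "... = (\<Sum>\<^sub>\<infinity>i. ((%j. cinner (coord v (inv e j)) (coord w (inv e j))) \<circ> e) i)"
  by(rule infsum_reindex[OF assms])
 finally show ?thesis using assms by(simp add: cinner_ell2 o_def)
qed

lemma amp_reindex: "inj e ==> amp T$$reindex e v = reindex e (amp T$$v)"
 by(rule ell2_eqI) (simp add: coord_reindex)

lemma cinner_reindex_disjoint:
 "inj e ==> inj e' ==> range e \<inter> range e' = {} ==> cinner (reindex e v) (reindex e' w) = 0"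
 unfolding cinner_ell2 by(rule infsum_0) (auto simp: coord_reindex)

subsection \<open>Normal functionals\<close>

text \<open>A countable sum of vector functionals is one vector functional of the amplification
  \<open>amp T\<close>, so arguments about single vectors carry over to normal functionals.\<close>

definition nfun :: "(nat, 'a::chilbert_space) ell2 => (nat, 'a) ell2 => 'a bop => complex" where
 "nfun v w T = cinner (amp T$$v) w"

lemma nfun_simps:
 "nfun v w (S + T) = nfun v w S + nfun v w T" "nfun v w (S - T) = nfun v w S - nfun v w T"
 "nfun v w (c*.T) = c*nfun v w T" "nfun v w 0 = 0"
 "nfun v w (A*T*B) = nfun (amp B$$v) (amp (adj A)$$w) T"
 by(simp_all add: nfun_def amp_simps cinner_simps cinner_adj)

lemma nfun_index:
 fixes v w :: "('j::countable, 'a::chilbert_space) ell2"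
 obtains v' w' where "!!T. nfun v' w' T = cinner (amp T$$v) w"
proof
 show "nfun (reindex to_nat v) (reindex to_nat w) T = cinner (amp T$$v) w" for T
  by(simp add: nfun_def amp_reindex cinner_reindex)
qed

lemma nfun_single: "nfun (single 0 x) (single 0 y) T = cinner (T$$x) y"
 by(simp add: nfun_def cinner_single coord_single)

text \<open>Even and odd positions hold the two families, which keeps the index type
  \<open>nat\<close>; thus the functionals \<open>nfun v w\<close> form a vector space.\<close>

lemma nfun_add:
 obtains v'' w'' where "!!T. nfun v w T + c*nfun v' w' T = nfun v'' w'' T"
proof
 define e e' where "e = (%n::nat. 2*n)" and "e' = (%n::nat. 2*n + 1)"
 have ne: "e m ~= e' n" for m n unfolding e_def e'_def by presburger
 have e: "inj e" "inj e'" by(auto simp: e_def e'_def intro!: injI)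
 have d: "range e \<inter> range e' = {}" "range e' \<inter> range e = {}" using ne by(metis (no_types) disjoint_iff imageE)+
 show "nfun v w T + c*nfun v' w' T = nfun (reindex e v + c*.reindex e' v') (reindex e w + reindex e' w') T" for T
  by(simp add: nfun_def amp_reindex cinner_simps cinner_reindex cinner_reindex_disjoint e d)
qed

lemma suminf_eq_infsum:
 fixes f :: "nat => 'b::real_normed_vector"
 assumes "f summable_on UNIV"
 shows "suminf f = infsum f UNIV"
 using has_sum_imp_sums[OF has_sum_infsum[OF assms]] by(rule sums_unique[symmetric])

lemma sigma_weak_eq:
 "(sigma_weak :: 'a::chilbert_space bop topology) = topology_generated_by {{T. nfun v w T:V} | v w V. open V}"
proof -
 have 1: "(\<Sum>n. cinner (T$$coord v n) (coord w n)) = nfun v w T" for T and v w :: "(nat, 'a) ell2"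
  using suminf_eq_infsum[OF cinner_coord_summable[of "amp T$$v" w]] by(simp add: nfun_def cinner_ell2)
 have sum: "summable (%n. (norm (coord v n))\<^sup>2)" for v :: "(nat, 'a) ell2"
  by(rule summable_on_imp_summable[OF coord_summable])
 have 2: "EX v. coord v = xi" if "summable (%n. (norm (xi n))\<^sup>2)" for xi :: "nat => 'a"
  using that by(intro exI[of _ "Abs_ell2 xi"] Abs_ell2) (simp add: summable_on_UNIV_nonneg_real_iff)
 have "{{T. (\<Sum>n. cinner (op_app T (xi n)) (eta n)):V} | (xi :: nat => 'a) (eta :: nat => 'a) V.
    summable (%n. (norm (xi n))\<^sup>2) & summable (%n. (norm (eta n))\<^sup>2) & open V} =
   {{T. nfun v w T:V} | v w V. open V}" (is "?A = ?B")
 proof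
  show "?A \<subseteq> ?B"
  proof
   fix U assume "U:?A"
   then obtain xi eta V where U: "U = {T. (\<Sum>n. cinner (op_app T (xi n)) (eta n)):V}" "open V"
    and s: "summable (%n. (norm (xi n))\<^sup>2)" "summable (%n. (norm (eta n))\<^sup>2)" by blast
   obtain v w where vw: "coord v = xi" "coord w = eta" using 2[OF s(1)] 2[OF s(2)] by blast
   have "U = {T. nfun v w T:V}" unfolding U(1) vw[symmetric] 1 ..
   thus "U:?B" using U(2) by blast
  qed
  show "?B \<subseteq> ?A"
  proof
   fix U assume "U:?B"
   then obtain v w V where U: "U = {T. nfun v w T:V}" "open V" by blast
   have "U = {T. (\<Sum>n. cinner (op_app T (coord v n)) (coord w n)):V}" unfolding U(1) 1 ..
   thus "U:?A" using U(2) sum[of v] sum[of w] by blast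
  qed
 qed
 thus ?thesis by(simp only: sigma_weak_def)
qed

lemma openin_nfun: "open V ==> openin sigma_weak {T. nfun v w T:V}"
 unfolding sigma_weak_eq by(rule topology_generated_by_Basis) blast

lemma topspace_sigma_weak [simp]: "topspace sigma_weak = UNIV"
proof -
 have "openin sigma_weak {T::'a bop. nfun 0 0 T:UNIV}" by(rule openin_nfun) simp
 from openin_subset[OF this] show ?thesis by auto
qed

lemma continuous_nfun: "continuous_map (subtopology sigma_weak N) euclidean (nfun v w)"
by(use continuous_map_from_subtopology openin_nfun in \<open>force simp: continuous_map_def\<close>)

lemma continuous_map_sigma_weakI:
 fixes f :: "'t => 'a::chilbert_space bop"
 assumes "!!v w. continuous_map X euclidean (%t. nfun v w (f t))"
 shows "continuous_map X sigma_weak f"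
 unfolding sigma_weak_eq continuous_on_generated_topo_iff
proof(intro conjI allI impI)
 fix U :: "'a bop set" assume "U:{{T. nfun v w T:V} | v w V. open V}"
 then obtain v w V where U: "U = {T. nfun v w T:V}" "open V" by blast
 have "openin X {x:topspace X. nfun v w (f x):V}"
  using assms U(2) by(auto simp: continuous_map_def)
 also have "{x:topspace X. nfun v w (f x):V} = f -` U \<inter> topspace X" using U by auto
 finally show "openin X (f -` U \<inter> topspace X)" .
next
 have "UNIV = {T. nfun 0 0 T:UNIV}" by simp
 thus "f ` topspace X \<subseteq> \<Union> {{T. nfun v w T:V} | v w V. open V}" using open_UNIV by blast
qed

text \<open>The topology is given by generators; induction over the generation of an open set
  collects finitely many functionals and one common tolerance.\<close>

lemma sigma_weak_nhd:
 assumes "openin sigma_weak U" "x:U"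
 shows "EX F e. finite F & 0 < e & (ALL y. (ALL (v, w):F. cmod (nfun v w y - nfun v w x) < e) --> y:U)"
proof -
 have "generate_topology_on {{T. nfun v w T:V} | v w V. open V} U"
  using assms(1) unfolding sigma_weak_eq by(rule openin_topology_generated_by)
 thus ?thesis using assms(2)
 proof(induction)
  case (Int a b)
  obtain F e where F: "finite F & 0 < e & (ALL y. (ALL (v, w):F. cmod (nfun v w y - nfun v w x) < e) --> y:a)"
   using Int.IH(1)[OF IntD1[OF Int.prems]] by(elim exE) (rule that)
  obtain F' e' where F': "finite F' & 0 < e' & (ALL y. (ALL (v, w):F'. cmod (nfun v w y - nfun v w x) < e') --> y:b)"
   using Int.IH(2)[OF IntD2[OF Int.prems]] by(elim exE) (rule that)
  have "y:a \<inter> b" if "ALL (v, w):F \<union> F'. cmod (nfun v w y - nfun v w x) < min e e'" for y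
   using F F' that by(simp add: ball_Un split_def)
  thus ?case using F F'
   by(intro exI[of _ "F \<union> F'"] exI[of _ "min e e'"]) (auto simp: min_def)
 next
  case (UN K)
  then obtain k where k: "k:K" "x:k" by blast
  obtain F e where "finite F & 0 < e & (ALL y. (ALL (v, w):F. cmod (nfun v w y - nfun v w x) < e) --> y:k)"
   using UN.IH[OF k] by(elim exE) (rule that)
  thus ?case using k(1) by(intro exI[of _ F] exI[of _ e]) auto
 next
  case (Basis s)
  then obtain v w V where s: "s = {T. nfun v w T:V}" "open V" by blast
  hence "nfun v w x:V" using Basis by simp
  then obtain e where e: "0 < e" "ball (nfun v w x) e \<subseteq> V" using s(2) openE by blast
  show ?case
  proof(intro exI[of _ "{(v, w)}"] exI[of _ e] conjI allI impI)
   fix y assume "ALL (v, w):{(v, w)}. cmod (nfun v w y - nfun v w x) < e"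
   thus "y:s" using e(2) by(auto simp: s dist_norm norm_minus_commute mem_ball)
  qed (use e in auto)
 qed simp
qed

subsection \<open>Subspaces of operators\<close>

definition op_subspace :: "'a::chilbert_space bop set => bool" where
 "op_subspace S \<longleftrightarrow> 0:S & (ALL x:S. ALL y:S. x + y:S) & (ALL c. ALL x:S. c*.x:S)"

lemma op_subspaceD:
 assumes "op_subspace S"
 shows "0:S" "x:S ==> y:S ==> x + y:S" "x:S ==> c*.x:S" "x:S ==> - x:S"
  "x:S ==> y:S ==> x - y:S" "(!!i. i:I ==> f i:S) ==> (SUM i:I. f i):S"
proof -
 have 1: "0:S" and 2: "!!x y. x:S ==> y:S ==> x + y:S" and 3: "!!x c. x:S ==> c*.x:S"
  using assms by(auto simp: op_subspace_def)
 have 4: "!!x. x:S ==> - x:S" using 3[of _ "- 1"] by(simp add: bop_scaleC_simps)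
 have 5: "!!x y. x:S ==> y:S ==> x - y:S" using 2[of _ "- y" for y] 4 by simp
 have 6: "(!!i. i:I ==> f i:S) ==> (SUM i:I. f i):S"
  by(induction I rule: infinite_finite_induct) (auto intro: 1 2)
 show "0:S" "x:S ==> y:S ==> x + y:S" "x:S ==> c*.x:S" "x:S ==> - x:S"
  "x:S ==> y:S ==> x - y:S" "(!!i. i:I ==> f i:S) ==> (SUM i:I. f i):S"
  by(fact 1 2 3 4 5 6)+
qed

lemma op_subspace_kernel: "op_subspace S ==> op_subspace {s:S. nfun v w s = 0}"
 by(auto simp: op_subspace_def nfun_simps)

text \<open>Gaussian elimination: a functional that does not vanish on \<open>S\<close> is
  normalised at some \<open>s0\<close>, the remaining ones are matched on its kernel, and a multiple
  of \<open>s0\<close> corrects its value.\<close>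

lemma nfun_interpolation:
 assumes "finite F" and "op_subspace S"
  and "!!v w. (!!s. s:S ==> nfun v w s = 0) ==> nfun v w x = 0"
 shows "EX s:S. ALL (v, w):F. nfun v w s = nfun v w x"
 using assms
proof(induction F arbitrary: S x rule: finite_induct)
 case empty
 thus ?case using op_subspaceD(1) by blast
next
 case (insert p F)
 obtain v0 w0 where p: "p = (v0, w0)" by force
 show ?case
 proof(cases "ALL s:S. nfun v0 w0 s = 0")
  case True
  obtain s where "s:S" "ALL (v, w):F. nfun v w s = nfun v w x"
   using insert.IH[OF insert.prems] by blast
  thus ?thesis using True insert.prems(2)[of v0 w0] p by(intro bexI[of _ s]) auto
 next
  case False
  then obtain s1 where s1: "s1:S" "nfun v0 w0 s1 ~= 0" by blast
  define s0 where "s0 = (1 / nfun v0 w0 s1)*.s1"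
  have s0: "s0:S" "nfun v0 w0 s0 = 1"
   using s1 op_subspaceD(3)[OF insert.prems(1)] by(auto simp: s0_def nfun_simps)
  define S' where "S' = {s:S. nfun v0 w0 s = 0}"
  define x' where "x' = x - nfun v0 w0 x*.s0"
  have "nfun v w x' = 0" if vw: "!!s. s:S' ==> nfun v w s = 0" for v w
  proof -
   obtain v2 w2 where g: "!!T. nfun v w T + (- nfun v w s0)*nfun v0 w0 T = nfun v2 w2 T"
    by(rule nfun_add[of v w "- nfun v w s0" v0 w0]) (rule that)
   have "nfun v2 w2 x = 0"
   proof(rule insert.prems(2))
    fix s assume s: "s:S"
    have "s - nfun v0 w0 s*.s0:S'"
     using s s0 op_subspaceD[OF insert.prems(1)] by(simp add: S'_def nfun_simps)
    hence "nfun v w (s - nfun v0 w0 s*.s0) = 0" by(rule vw)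
    thus "nfun v2 w2 s = 0"
     by(simp add: g[symmetric] nfun_simps mult.commute)
   qed
   thus ?thesis by(simp add: g[symmetric] x'_def nfun_simps mult.commute)
  qed
  then obtain s where s: "s:S'" "ALL (v, w):F. nfun v w s = nfun v w x'"
   using insert.IH[of S' x'] op_subspace_kernel[OF insert.prems(1)] unfolding S'_def by blast
  show ?thesis
  proof(intro bexI[of _ "s + nfun v0 w0 x*.s0"] ballI)
   show "s + nfun v0 w0 x*.s0:S" using s(1) s0(1) op_subspaceD[OF insert.prems(1)] by(auto simp: S'_def)
   fix q assume "q:insert p F"
   thus "case q of (v, w) => nfun v w (s + nfun v0 w0 x*.s0) = nfun v w x"
    using s s0 by(auto simp: p S'_def x'_def nfun_simps)
  qed
 qed
qed

text \<open>A basic neighbourhood tests only finitely many functionals, and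
  \<open>nfun_interpolation\<close> matches these exactly. This is the Hahn-Banach statement for
  subspaces.\<close>

lemma sigma_weak_closure_iff:
 assumes S: "op_subspace S"
 shows "x:sigma_weak closure_of S \<longleftrightarrow> (ALL v w. (ALL s:S. nfun v w s = 0) --> nfun v w x = 0)"
proof
 assume x: "x:sigma_weak closure_of S"
 show "ALL v w. (ALL s:S. nfun v w s = 0) --> nfun v w x = 0"
 proof(intro allI impI, rule ccontr)
  fix v w assume v: "ALL s:S. nfun v w s = 0" "nfun v w x ~= 0"
  have "openin sigma_weak {T. nfun v w T:- {0}}" by(intro openin_nfun) auto
  thus False using x v by(auto simp: in_closure_of)
 qed
next
 assume *: "ALL v w. (ALL s:S. nfun v w s = 0) --> nfun v w x = 0"
 show "x:sigma_weak closure_of S"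
  unfolding in_closure_of
 proof(intro conjI allI impI)
  fix U assume U: "x:U & openin sigma_weak U"
  then obtain F e where F: "finite F" "0 < e" "!!y. ALL (v, w):F. cmod (nfun v w y - nfun v w x) < e ==> y:U"
   using sigma_weak_nhd by blast
  obtain s where "s:S" "ALL (v, w):F. nfun v w s = nfun v w x"
   using nfun_interpolation[OF F(1) S] * by blast
  thus "EX y. y:S & y:U" using F(2) by(intro exI[of _ s] conjI F(3)) auto
 qed simp
qed

text \<open>Continuity at \<open>0\<close> provides finitely many functionals on whose common kernel
  \<open>phi\<close> vanishes; elimination writes \<open>phi\<close> as their linear
  combination.\<close>

lemma normal_functional_nfun:
 assumes N: "op_subspace N" and phi: "normal_functional N phi"
 obtains v w where "!!x. x:N ==> phi x = nfun v w x"
proof -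
 have add: "phi (x + y) = phi x + phi y" and sc: "phi (c*.x) = c*phi x" if "x:N" "y:N" for x y c
  using phi that by(auto simp: normal_functional_def clinear_on_def scaleC_complex_def)
 have "open V ==> openin (subtopology sigma_weak N) {x:N. phi x:V}" for V
  using phi by(auto simp: normal_functional_def continuous_map_def)
 from this[OF open_ball[of 0 1]]
 have "openin (subtopology sigma_weak N) {x:N. phi x:ball 0 1}" .
 then obtain U where U: "openin sigma_weak U" "{x:N. phi x:ball 0 1} = U \<inter> N"
  by(auto simp: openin_subtopology)
 have "0:U" using sc[of 0 0 0] op_subspaceD(1)[OF N] U(2) by(force simp: bop_scaleC_simps)
 then obtain F e where F: "finite F" "0 < e" "!!y. ALL (v, w):F. cmod (nfun v w y - nfun v w 0) < e ==> y:U"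
  using sigma_weak_nhd[OF U(1)] by blast
 have kill: "phi x = 0" if x: "x:N" "ALL (v, w):F. nfun v w x = 0" for x
 proof(rule ccontr)
  assume "phi x ~= 0"
  define y where "y = (2 / phi x)*.x"
  have "y:U" by(rule F(3)) (use x F(2) in \<open>auto simp: y_def nfun_simps\<close>)
  hence "phi y:ball 0 1" using x op_subspaceD(3)[OF N] U(2) by(auto simp: y_def)
  moreover have "phi y = 2" using sc[OF x(1) x(1)] \<open>phi x \<noteq> 0\<close> by(simp add: y_def)
  ultimately show False by simp
 qed
 have "EX v w. ALL x:M. phi x = nfun v w x"
  if "finite F" "op_subspace M" "M \<subseteq> N" "!!x. x:M ==> ALL (v, w):F. nfun v w x = 0 ==> phi x = 0" for F M
  using that
 proof(induction F arbitrary: M rule: finite_induct)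
  case empty
  thus ?case by(intro exI[of _ 0]) (auto simp: nfun_def)
 next
  case (insert p F)
  obtain v0 w0 where p: "p = (v0, w0)" by force
  define M' where "M' = {x:M. nfun v0 w0 x = 0}"
  have "EX v w. ALL x:M'. phi x = nfun v w x"
   by(rule insert.IH) (use insert.prems op_subspace_kernel[OF insert.prems(1)] p in \<open>auto simp: M'_def\<close>)
  then obtain v w where vw: "!!x. x:M' ==> phi x = nfun v w x" by blast
  show ?case
  proof(cases "ALL x:M. nfun v0 w0 x = 0")
   case True
   thus ?thesis using vw by(auto simp: M'_def)
  next
   case False
   then obtain s1 where s1: "s1:M" "nfun v0 w0 s1 ~= 0" by blast
   define s0 where "s0 = (1 / nfun v0 w0 s1)*.s1"
   have s0: "s0:M" "nfun v0 w0 s0 = 1"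
    using s1 op_subspaceD(3)[OF insert.prems(1)] by(auto simp: s0_def nfun_simps)
   define k where "k = phi s0 - nfun v w s0"
   obtain v2 w2 where g: "!!T. nfun v w T + k*nfun v0 w0 T = nfun v2 w2 T"
    by(rule nfun_add[of v w k v0 w0]) (rule that)
   have "phi x = nfun v2 w2 x" if x: "x:M" for x
   proof -
    define y where "y = x + (- nfun v0 w0 x)*.s0"
    have m: "(- nfun v0 w0 x)*.s0:M" using s0 op_subspaceD(3)[OF insert.prems(1)] by blast
    hence "y:M'" using x s0 op_subspaceD(2)[OF insert.prems(1)] by(simp add: M'_def nfun_simps y_def)
    hence "phi y = nfun v w y" by(rule vw)
    moreover have "phi y = phi x - nfun v0 w0 x*phi s0"
     unfolding y_def using add[of x] sc[of s0 s0] x m s0 insert.prems(2) by(simp add: subset_eq)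
    moreover have "nfun v w y = nfun v w x - nfun v0 w0 x*nfun v w s0"
     by(simp add: y_def nfun_simps)
    ultimately have "phi x = nfun v w x - nfun v0 w0 x*nfun v w s0 + nfun v0 w0 x*phi s0"
     by(metis diff_add_cancel)
    thus ?thesis by(simp add: g[symmetric] k_def algebra_simps)
   qed
   thus ?thesis by blast
  qed
 qed
 from this[OF F(1) N order_refl kill] that show thesis by blast
qed

subsection \<open>Von Neumann algebras\<close>

definition star_alg :: "'a::chilbert_space bop set => bool" where
 "star_alg S \<longleftrightarrow> op_subspace S & 1:S & (ALL x:S. ALL y:S. x*y:S) & (ALL x:S. adj x:S)"

lemma star_algD:
 assumes "star_alg S"
 shows "op_subspace S" "1:S" "x:S ==> y:S ==> x*y:S" "x:S ==> adj x:S"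
 using assms by(auto simp: star_alg_def)

lemma star_alg_ops:
 assumes "star_alg S"
 shows "0:S" "x:S ==> y:S ==> x + y:S" "x:S ==> c*.x:S" "x:S ==> - x:S"
  "x:S ==> y:S ==> x - y:S" "(!!i. i:I ==> f i:S) ==> (SUM i:I. f i):S"
 by(fact op_subspaceD[OF star_algD(1)[OF assms]])+

lemma commutantD: "T:commutant S ==> x:S ==> T*x = x*T"
 by(simp add: commutant_def)

lemma op_subspace_commutant: "op_subspace (commutant S)"
 by(auto simp: op_subspace_def commutant_def algebra_simps)

lemma one_in_commutant: "1:commutant S"
 by(simp add: commutant_def)

lemma commutant_mult: "x:commutant S ==> y:commutant S ==> x*y:commutant S"
 by(auto simp: commutant_def) (metis mult.assoc)

lemma commutant_adj:
 assumes "!!x. x:S ==> adj x:S" "x:commutant S"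
 shows "adj x:commutant S"
 unfolding commutant_def
proof(intro CollectI ballI)
 fix y assume "y:S"
 hence "adj (x*adj y) = adj (adj y*x)" using assms by(simp add: commutant_def)
 thus "adj x*y = y*adj x" by simp
qed

lemma commutant_antimono: "S \<subseteq> T ==> commutant T \<subseteq> commutant S"
 by(auto simp: commutant_def)

lemma commutant_commutant: "S \<subseteq> commutant (commutant S)"
 by(auto simp: commutant_def)

lemma commutant_triple: "commutant (commutant (commutant S)) = commutant S"
 using commutant_antimono[OF commutant_commutant[of S]] commutant_commutant[of "commutant S"] by blast

lemma star_alg_commutant: "(!!x. x:S ==> adj x:S) ==> star_alg (commutant S)"
 unfolding star_alg_def by(auto simp: op_subspace_commutant one_in_commutant commutant_mult commutant_adj)

lemma star_alg_bicommutant: "(!!x. x:S ==> adj x:S) ==> star_alg (commutant (commutant S))"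
 by(intro star_alg_commutant commutant_adj)

lemma von_neumann_bicommutant: "(!!x. x:S ==> adj x:S) ==> von_neumann_algebra (commutant (commutant S))"
 unfolding von_neumann_algebra_def using star_algD(4)[OF star_alg_bicommutant] by(auto simp: commutant_triple)

lemma vn_star_alg: "von_neumann_algebra N ==> star_alg N"
 unfolding von_neumann_algebra_def using star_alg_bicommutant by metis

lemma vn_commutant: "von_neumann_algebra N ==> commutant (commutant N) = N"
 by(simp add: von_neumann_algebra_def)

lemma vnI: "von_neumann_algebra N ==> (!!y. y:commutant N ==> x*y = y*x) ==> x:N"
 using vn_commutant[of N] by(auto simp: commutant_def)

lemma cproj_in_commutant:
 assumes "ccsubspace L" "!!x. x:S ==> adj x:S" "!!x xi. x:S ==> xi:L ==> x$$xi:L"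
 shows "cproj L:commutant S"
 unfolding commutant_def using cproj_commute[OF assms(1)] assms(2,3) by auto

lemma ccsubspace_orbit:
 assumes "star_alg S"
 shows "ccsubspace (closure ((%s. s$$x) ` S))" "x:closure ((%s. s$$x) ` S)"
  "s:S ==> xi:closure ((%s. s$$x) ` S) ==> s$$xi:closure ((%s. s$$x) ` S)"
proof -
 note S = star_alg_ops[OF assms] star_algD[OF assms]
 show "ccsubspace (closure ((%s. s$$x) ` S))"
 proof(rule ccsubspace_closure)
  show "0:(%s. s$$x) ` S" using S(1) by force
  show "a + b:(%s. s$$x) ` S" if "a:(%s. s$$x) ` S" "b:(%s. s$$x) ` S" for a b
   using that S(2) by(auto simp flip: plus_op_app)
  show "c*.a:(%s. s$$x) ` S" if "a:(%s. s$$x) ` S" for c a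
   using that S(3) by(auto simp flip: scaleC_op_app)
 qed
 have "x:(%s. s$$x) ` S" by(rule image_eqI[OF _ S(8)]) simp
 thus "x:closure ((%s. s$$x) ` S)" by(rule closure_subset[THEN subsetD])
 assume s: "s:S" and xi: "xi:closure ((%s. s$$x) ` S)"
 have "op_app s ` closure ((%s. s$$x) ` S) \<subseteq> closure (op_app s ` (%s. s$$x) ` S)"
  by(rule closure_bounded_linear_image_subset[OF op_app_bounded])
 also have "... \<subseteq> closure ((%s. s$$x) ` S)"
  by(intro closure_mono) (auto simp flip: times_op_app intro!: imageI S(9) s)
 finally show "s$$xi:closure ((%s. s$$x) ` S)" using xi by auto
qed

text \<open>Density form of the bicommutant theorem. The projection \<open>p\<close> onto the closed
  orbit of \<open>v\<close> under the amplified algebra commutes with it, so the matrix entries of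
  \<open>p\<close> lie in the commutant of \<open>S\<close>. Hence \<open>amp x\<close> commutes
  with \<open>p\<close> and keeps \<open>v\<close> in the orbit closure, to which \<open>w\<close>
  is orthogonal.\<close>

lemma bicommutant_nfun:
 fixes S :: "'a::chilbert_space bop set"
 assumes S: "star_alg S" and x: "x:commutant (commutant S)" and v: "!!s. s:S ==> nfun v w s = 0"
 shows "nfun v w x = 0"
proof -
 define S' :: "(nat, 'a) ell2 bop set" where "S' = amp ` S"
 have S': "star_alg S'"
  using S unfolding star_alg_def op_subspace_def S'_def
  by(auto simp flip: amp_simps(1,3,4)) (metis amp_simps(5,6) imageI)+
 define L where "L = closure ((%s. s$$v) ` S')"
 note L = ccsubspace_orbit[OF S', where x = v, folded L_def]
 define p where "p = cproj L"
 have p: "p:commutant S'"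
  unfolding p_def by(rule cproj_in_commutant[OF L(1) star_algD(4)[OF S'] L(3)])
 \<comment> \<open>\<open>T\<close> is the matrix entry of \<open>p\<close> at
   \<open>(m, n)\<close>, an operator on the original space.\<close>
 have ent: "EX T. ALL z y. cinner z (T$$y) = cinner (single m z) (p$$single n y)" for m n
 proof -
  obtain T where "!!x y. cinner x (T$$y) = cinner (single m x) (p$$single n y)"
  proof(rule bop_form[of "%x y. cinner (single m x) (p$$single n y)" "opn p"])
   have add: "single k (x + y) = single k x + single k y" "single k (c*.x) = c*.single k x" for k c and x y :: 'a
    by(rule ell2_eqI, simp add: coord_single)+
   show "cinner (single m (x + x')) (p$$single n y) = cinner (single m x) (p$$single n y) + cinner (single m x') (p$$single n y)" for x x' y
    by(simp add: add cinner_simps)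
   show "cinner (single m x) (p$$single n (y + y')) = cinner (single m x) (p$$single n y) + cinner (single m x) (p$$single n y')" for x y y'
    by(simp add: add cinner_simps)
   show "cinner (single m (c*.x)) (p$$single n y) = c * cinner (single m x) (p$$single n y)" for c x y
    by(simp add: add cinner_simps)
   show "cinner (single m x) (p$$single n (c*.y)) = cnj c * cinner (single m x) (p$$single n y)" for c x y
    by(simp add: add cinner_simps)
   have ns: "norm (single k x) = norm x" for k :: nat and x :: 'a
   proof -
    have "(norm (single k x))^2 = (norm x)^2" using cinner_single[of k x "single k x"] of_real_eq_iff by(metis cinner_self coord_single)
    thus ?thesis by simp
   qed
   show "cmod (cinner (single m x) (p$$single n y)) <= opn p*norm x*norm y" for x y
   proof -
    have "cmod (cinner (single m x) (p$$single n y)) <= norm x*norm (p$$single n y)"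
     using cmod_cinner_mult_le[of "single m x" "p$$single n y"] by(simp add: ns)
    also have "... <= norm x*(opn p*norm y)"
     using norm_op_le[of p "single n y"] by(intro mult_left_mono) (auto simp: ns)
    finally show ?thesis by(simp add: mult_ac)
   qed
  qed (auto simp: opn_ge_0)
  thus ?thesis by blast
 qed
 have comm: "amp x*p = p*amp x"
 proof(rule bop_eq_on_total[OF total_single])
  fix q :: "(nat, 'a) ell2" assume "q:{single i x | i x. True}"
  then obtain n y where q: "q = single n y" by blast
  have "cinner (single m z) (amp x$$p$$single n y) = cinner (single m z) (p$$amp x$$single n y)" for m z
  proof -
   obtain T where T: "ALL z y. cinner z (T$$y) = cinner (single m z) (p$$single n y)" using ent by blast
   have "T:commutant S"
    unfolding commutant_def
   proof(intro CollectI ballI bop_cinner_eqI')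
    fix s z y assume s: "s:S"
    have "p*amp s = amp s*p" using p s by(auto simp: commutant_def S'_def)
    hence "p$$amp s$$single n y = amp s$$p$$single n y" by(metis times_op_app)
    hence "cinner z (T$$s$$y) = cinner (single m z) (amp s$$p$$single n y)" by(simp add: T)
    also have "... = cinner z (s$$T$$y)" by(simp add: cinner_adj'[of _ "amp s"] adj_amp amp_single T[rule_format, symmetric] cinner_adj'[of _ s])
    finally show "cinner z ((T * s)$$y) = cinner z ((s*T)$$y)" by simp
   qed
   hence "x*T = T*x" using x by(simp add: commutant_def)
   hence "cinner (adj x$$z) (T$$y) = cinner z (T$$x$$y)" by(metis times_op_app cinner_adj')
   thus ?thesis by(simp add: T cinner_adj'[of _ "amp x"] adj_amp amp_single)
  qed
  hence "coord (amp x$$p$$single n y) m = coord (p$$amp x$$single n y) m" for m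
   by(intro cinner_ext_right) (simp only: cinner_single)
  thus "(amp x*p)$$q = (p*amp x)$$q" unfolding q times_op_app by(rule ell2_eqI)
 qed
 have "amp x$$v:L" using comm cproj_id[OF L(1) L(2)] cproj_in[OF L(1)] by(metis p_def times_op_app)
 moreover have "L \<subseteq> {u. cinner u w = 0}"
  unfolding L_def using v
  by(intro closure_minimal closed_Collect_eq continuous_on_cinner continuous_intros) (auto simp: S'_def nfun_def)
 ultimately show ?thesis by(auto simp: nfun_def)
qed

subsection \<open>Normal maps\<close>

text \<open>Normality as pullback of normal functionals; for linear maps on operator subspaces it
  amounts to \<sigma>-weak continuity by \<open>nmap_on_continuous\<close> and
  \<open>nmap_onI_continuous\<close>. In this form compositions and two-sided multiplications are
  immediate.\<close>

definition nmap_on :: "'a::chilbert_space bop set => ('a bop => 'b::chilbert_space bop) => bool" where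
 "nmap_on N g \<longleftrightarrow> (ALL v w. EX v' w'. ALL x:N. nfun v w (g x) = nfun v' w' x)"

lemma nmap_onE:
 assumes "nmap_on N g"
 obtains v' w' where "!!x. x:N ==> nfun v w (g x) = nfun v' w' x"
 using assms unfolding nmap_on_def by blast

lemma nmap_on_cong: "nmap_on N g ==> (!!x. x:N ==> g x = h x) ==> nmap_on N h"
 unfolding nmap_on_def by metis

lemma nmap_on_id: "nmap_on N (%x. x)"
 unfolding nmap_on_def by blast

lemma nmap_on_sandwich:
 assumes "nmap_on N g"
 shows "nmap_on N (%x. A*g x*B)"
 unfolding nmap_on_def nfun_simps(5) using assms unfolding nmap_on_def by blast

lemma nmap_on_left: "nmap_on N g ==> nmap_on N (%x. A*g x)"
 using nmap_on_sandwich[of N g A 1] by simp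

lemma nmap_on_right: "nmap_on N g ==> nmap_on N (%x. g x*B)"
 using nmap_on_sandwich[of N g 1 B] by simp

lemma nmap_on_diff:
 assumes "nmap_on N g" "nmap_on N h"
 shows "nmap_on N (%x. g x - h x)"
 unfolding nmap_on_def
proof(intro allI)
 fix v w
 obtain v1 w1 where 1: "!!x. x:N ==> nfun v w (g x) = nfun v1 w1 x" by(rule nmap_onE[OF assms(1), where v = v and w = w]) (rule that)
 obtain v2 w2 where 2: "!!x. x:N ==> nfun v w (h x) = nfun v2 w2 x" by(rule nmap_onE[OF assms(2), where v = v and w = w]) (rule that)
 obtain v3 w3 where 3: "!!x. nfun v1 w1 x + - 1*nfun v2 w2 x = nfun v3 w3 x" by(rule nfun_add) (rule that)
 show "EX v' w'. ALL x:N. nfun v w (g x - h x) = nfun v' w' x"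
  using 3 by(intro exI[of _ v3] exI[of _ w3]) (simp add: nfun_simps 1 2)
qed

lemma nmap_on_comp:
 assumes "nmap_on N g" "nmap_on M f" "!!x. x:M ==> f x:N"
 shows "nmap_on M (%x. g (f x))"
 using assms unfolding nmap_on_def by metis

lemma nmap_on_continuous:
 assumes "nmap_on N g"
 shows "continuous_map (subtopology sigma_weak N) sigma_weak g"
proof(rule continuous_map_sigma_weakI)
 fix v w
 obtain v' w' where *: "!!x. x:N ==> nfun v w (g x) = nfun v' w' x" by(rule nmap_onE[OF assms, where v = v and w = w]) (rule that)
 show "continuous_map (subtopology sigma_weak N) euclidean (%t. nfun v w (g t))"
  by(rule continuous_map_eq[OF continuous_nfun[of N v' w']]) (simp add: *)
qed

lemma nmap_onI_continuous:
 assumes "op_subspace N" "clinear_on N g" and g: "continuous_map (subtopology sigma_weak N) sigma_weak g"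
 shows "nmap_on N g"
 unfolding nmap_on_def
proof(intro allI)
 fix v w
 have "normal_functional N (%x. nfun v w (g x))" using continuous_map_compose[OF g] continuous_nfun[of UNIV v w] assms(2) by(auto simp: normal_functional_def clinear_on_def nfun_simps o_def scaleC_complex_def)
 from normal_functional_nfun[OF assms(1) this]
 show "EX v' w'. ALL x:N. nfun v w (g x) = nfun v' w' x" by metis
qed

lemma nmap_on_eq:
 assumes S: "star_alg S" and g: "nmap_on (commutant (commutant S)) g" and h: "nmap_on (commutant (commutant S)) h"
  and eq: "!!s. s:S ==> g s = h s" and x: "x:commutant (commutant S)"
 shows "g x = h x"
proof(rule bop_cinner_eqI)
 fix a b
 obtain v w where vw: "!!x. x:commutant (commutant S) ==> nfun (single 0 a) (single 0 b) (g x - h x) = nfun v w x"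
  by(rule nmap_onE[OF nmap_on_diff[OF g h], where v = "single 0 a" and w = "single 0 b"]) (rule that)
 have "nfun v w x = 0"
 proof(rule bicommutant_nfun[OF S x])
  show "nfun v w s = 0" if "s:S" for s
   using vw[of s] eq[OF that] that commutant_commutant[of S] by(auto simp: nfun_simps)
 qed
 thus "cinner (g x$$a) b = cinner (h x$$a) b"
  using vw[OF x] by(simp add: nfun_single cinner_simps)
qed

lemma nfun_eq:
 assumes S: "star_alg S" and eq: "!!s. s:S ==> nfun v w s = nfun v' w' s" and x: "x:commutant (commutant S)"
 shows "nfun v w x = nfun v' w' x"
proof -
 obtain v2 w2 where g: "!!T. nfun v w T + - 1*nfun v' w' T = nfun v2 w2 T" by(rule nfun_add) (rule that)
 have "nfun v2 w2 x = 0"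
  by(rule bicommutant_nfun[OF S x]) (simp add: g[symmetric] eq)
 thus ?thesis by(simp add: g[symmetric])
qed

lemma endosD:
 assumes "rho:endos N"
 shows "!!x. x:N ==> rho x:N" "!!x y. x:N ==> y:N ==> rho (x + y) = rho x + rho y"
  "!!c x. x:N ==> rho (c*.x) = c*.rho x" "!!x y. x:N ==> y:N ==> rho (x*y) = rho x*rho y"
  "!!x. x:N ==> rho (adj x) = adj (rho x)" "rho 1 = 1"
 using assms by(auto simp: endos_def clinear_on_def)

lemma endos_nmap: "op_subspace N ==> rho:endos N ==> nmap_on N rho"
 by(rule nmap_onI_continuous) (auto simp: endos_def)

subsection \<open>Positive normal functionals are countable sums of vector functionals\<close>

text \<open>As \<open>phi\<close> is hermitian, polarisation writes \<open>4 * phi x\<close> as the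
  difference of the functionals of \<open>tht = v + w\<close> and \<open>de = v - w\<close>.
  Positivity makes \<open>amp x$$tht \<mapsto> amp x$$de\<close> a contraction \<open>u\<close> that
  commutes with the amplified algebra; the square root \<open>s\<close> of
  \<open>(1 - adj u*u) / 4\<close> does so too, and \<open>s$$tht\<close> represents
  \<open>phi\<close>.\<close>

lemma vector_representation:
 fixes N :: "'a::chilbert_space bop set"
 assumes N: "star_alg N" and phi: "!!x. x:N ==> phi x = nfun v w x"
  and pos: "!!x. x:N ==> phi (adj x*x):\<real>\<^sub>\<ge>\<^sub>0"
 obtains tht where "!!x. x:N ==> phi x = nfun tht tht x"
proof -
 note N' = star_alg_ops[OF N] star_algD[OF N]
 have real: "Im (phi (adj x*x)) = 0" "0 <= Re (phi (adj x*x))" if "x:N" for x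
  using pos[OF that] by(simp_all add: nonneg_Reals_iff)
 have herm: "phi (adj x) = cnj (phi x)" if x: "x:N" for x
 proof -
  have "phi (adj (1 + c*.x)*(1 + c*.x)) = phi 1 + c*phi x + cnj c*(phi (adj x) + c*phi (adj x*x))" for c
   using x by(simp add: phi N' nfun_simps distrib_left distrib_right)
  hence "Im (c*phi x + cnj c*(phi (adj x) + c*phi (adj x*x))) = 0" for c
   using real(1)[of "1 + c*.x"] real(1)[of 1] x N' by simp
  from this[of 1] this[of \<i>] show ?thesis using real(1)[OF x] by(simp add: complex_eq_iff)
 qed
 define tht de where "tht = v + w" and "de = v - w"
 define G where "G = {(amp x$$tht, amp x$$de) | x. x:N}"
 have G: "(amp x$$tht, amp x$$de):G" if "x:N" for x using that by(auto simp: G_def)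
 obtain u where u: "!!a b. (a, b):G ==> u$$a = b" "!!y. (!!a b. (a, b):G ==> cinner a y = 0) ==> u$$y = 0"
  "!!y. norm (u$$y) <= 1*norm y"
 proof(rule graph_ext[of G 1])
  show "(0, 0):G" using G[OF N'(1)] by(simp add: amp_simps)
  show "(a + a', b + b'):G" if "(a, b):G" "(a', b'):G" for a b a' b'
  proof -
   obtain x y where "x:N" "y:N" "(a, b) = (amp x$$tht, amp x$$de)" "(a', b') = (amp y$$tht, amp y$$de)"
    using \<open>(a, b) \<in> G\<close> \<open>(a', b') \<in> G\<close> unfolding G_def by blast
   thus ?thesis using G[OF N'(2)[of x y]] by(simp add: amp_simps)
  qed
  show "(c*.a, c*.b):G" if "(a, b):G" for c a b
  proof -
   obtain x where "x:N" "(a, b) = (amp x$$tht, amp x$$de)" using \<open>(a, b) \<in> G\<close> unfolding G_def by blast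
   thus ?thesis using G[OF N'(3)[of x c]] by(simp add: amp_simps)
  qed
  show "norm b <= 1*norm a" if "(a, b):G" for a b
  proof -
   obtain x where "x:N" "a = amp x$$tht" "b = amp x$$de" using \<open>(a, b) \<in> G\<close> unfolding G_def by blast
   hence x: "x:N" "a = amp x$$v + amp x$$w" "b = amp x$$v - amp x$$w" by(simp_all add: tht_def de_def)
   have "phi (adj x*x) = cinner (amp x$$v) (amp x$$w)"
    unfolding phi[OF N'(9)[OF N'(10)[OF x(1)] x(1)]] nfun_def amp_simps(3) times_op_app adj_amp[symmetric]
    by(simp only: cinner_adj adj_adj)
   hence "(norm b)^2 <= (norm a)^2" using real(2)[OF x(1)] unfolding x(2,3) norm_add_sq norm_diff_sq by simp
   thus ?thesis by simp
  qed
 qed (use that in auto)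
 have comm: "amp z*u = u*amp z" if z: "z:N" for z
 proof(rule bop_eq_on_total)
  let ?Y = "{y. ALL x:N. cinner (amp x$$tht) y = 0}"
  have u0: "u$$y = 0" if "y:?Y" for y by(rule u(2)) (use that in \<open>auto simp: G_def\<close>)
  show "total ((%x. amp x$$tht) ` N \<union> ?Y)"
  proof -
   have "y = 0" if "ALL x:(%x. amp x$$tht) ` N \<union> ?Y. cinner x y = 0" for y
   proof -
    have "cinner y y = 0" using that by blast
    thus ?thesis by simp
   qed
   thus ?thesis unfolding total_def by blast
  qed
  fix y assume "y:(%x. amp x$$tht) ` N \<union> ?Y"
  thus "(amp z*u)$$y = (u*amp z)$$y"
  proof
   assume "y:(%x. amp x$$tht) ` N"
   then obtain x where x: "x:N" "y = amp x$$tht" by blast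
   show ?thesis using u(1)[OF G[OF x(1)]] u(1)[OF G[OF N'(9)[OF z x(1)]]] by(simp only: x(2) amp_simps(3) times_op_app)
  next
   assume y: "y:?Y"
   have "cinner (amp x$$tht) (amp z$$y) = 0" if "x:N" for x
   proof -
    have "cinner (amp (adj z*x)$$tht) y = 0" using y N'(9)[OF N'(10)[OF z] that] by blast
    thus ?thesis by(simp only: amp_simps(3) times_op_app adj_amp[symmetric] cinner_adj adj_adj)
   qed
   thus ?thesis using u0 y by simp
  qed
 qed
 define T where "T = cor (1/4)*.(1 - adj u*u)"
 have "(norm (u$$y))^2 <= (norm y)^2" for y using u(3)[of y] by(simp add: power_mono)
 hence "pos_op T" by(simp add: pos_op_iff cinner_simps cinner_adj cinner_self T_def)
 then obtain s where s: "pos_op s" "s * s = T" "!!R. R*T = T*R ==> R * s = s*R"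
  by(rule pos_op_sqrt) (rule that)
 have "amp z*T = T*amp z" if z: "z:N" for z
 proof -
  have "adj (amp (adj z)*u) = adj (u*amp (adj z))" by(simp only: comm[OF N'(10)[OF z]])
  hence uz: "amp z*adj u = adj u*amp z" by simp
  have "amp z*(adj u*u) = (amp z*adj u)*u" by(rule mult.assoc[symmetric])
  also have "... = (adj u*u)*amp z" unfolding uz mult.assoc comm[OF z] by(rule refl)
  finally have "amp z*(1 - adj u*u) = (1 - adj u*u)*amp z" unfolding right_diff_distrib left_diff_distrib by simp
  thus ?thesis by(simp add: T_def del: of_real_divide)
 qed
 note sc = s(3)[OF this]
 show thesis
 proof(rule that[of "s$$tht"])
  fix x assume x: "x:N"
  have "nfun (s$$tht) (s$$tht) x = cinner ((s * s)$$amp x$$tht) tht" using sc[OF x] by(metis times_op_app nfun_def cinner_adj pos_op_adj[OF s(1)])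
  also have "... = cor (1/4)*(cinner (amp x$$tht) tht - cinner (u$$amp x$$tht) (u$$amp 1$$tht))"
   unfolding s(2) T_def by(simp add: cinner_simps cinner_adj amp_simps)
  also have "... = cor (1/4)*(cinner (amp x$$tht) tht - cinner (amp x$$de) de)"
   by(simp only: u(1)[OF G[OF x]] u(1)[OF G[OF N'(8)]]) (simp add: amp_simps)
  also have "... = (phi x + cinner (amp x$$w) v) / 2" by(simp add: phi x nfun_def tht_def de_def cinner_simps)
  also have "cinner (amp x$$w) v = cnj (phi (adj x))"
   using x cinner_commute[of "amp x$$w" v] by(simp add: phi N' nfun_def cinner_adj' adj_amp)
  finally show "phi x = nfun (s$$tht) (s$$tht) x" by(simp add: herm[OF x])
 qed
qed

section \<open>Standard forms\<close>

lemma linear_term_zero: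
 fixes b c :: real
 assumes "!!t. 0 <= t*b + t^2 * c"
 shows "b = 0"
proof -
 have "0 <= t*(b + t * c)" for t using assms[of t] by(simp add: algebra_simps power2_eq_square)
 hence 1: "0 < t ==> 0 <= b + t * c" and 2: "t < 0 ==> b + t * c <= 0" for t
  by(simp_all add: zero_le_mult_iff) (metis add.right_neutral linorder_not_less mult_zero_left order_less_imp_le)+
 have "((%t. b + t * c) \<longlongrightarrow> b + 0 * c) (at_right 0)" "((%t. b + t * c) \<longlongrightarrow> b + 0 * c) (at_left 0)"
  by(intro tendsto_intros)+
 moreover have "\<forall>\<^sub>F t in at_right 0. 0 <= b + t * c" using 1 by(auto simp: eventually_at_right_field intro: exI[of _ 1])
 moreover have "\<forall>\<^sub>F t in at_left 0. b + t * c <= 0" using 2 by(auto simp: eventually_at_left_field intro: exI[of _ "-1"])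
 ultimately have "0 <= b" "b <= 0"
  using tendsto_lowerbound[of "%t. b + t * c" b "at_right 0" 0] tendsto_upperbound[of "%t. b + t * c" b "at_left 0" 0] by auto
 thus ?thesis by simp
qed

definition vfun :: "'a::chilbert_space => 'a bop => complex" where
 "vfun xi a = cinner (a$$xi) xi"

lemma vfun_simps:
 "vfun xi (a + b) = vfun xi a + vfun xi b" "vfun xi (a - b) = vfun xi a - vfun xi b" "vfun xi (c*.a) = c * vfun xi a"
 "vfun xi 0 = 0"
 by(simp_all add: vfun_def cinner_simps)

lemma vfun_adj_mult: "vfun xi (adj a*a) = cor ((norm (a$$xi))^2)"
 by(simp add: vfun_def adj_mult_self_app flip: times_op_app)

lemma vfun_contraction: "(!!v. norm (a$$v) <= norm v) ==> cmod (vfun xi a) <= (norm xi)^2"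
 unfolding vfun_def power2_eq_square
 by(rule order_trans[OF cmod_cinner_mult_le]) (simp add: mult_right_mono)

lemma self_adjoint_parts:
 assumes "star_alg N" "a:N"
 obtains b c where "b:N" "c:N" "adj b = b" "adj c = c" "a = b + \<i>*.c"
proof
 note N = star_alg_ops[OF assms(1)] star_algD[OF assms(1)]
 show "(1/2)*.(a + adj a):N" "(- \<i>/2)*.(a - adj a):N" using assms(2) by(intro N; simp add: N)+
 show "adj ((1/2)*.(a + adj a)) = (1/2)*.(a + adj a)" by(simp add: add.commute)
 show "adj ((- \<i>/2)*.(a - adj a)) = (- \<i>/2)*.(a - adj a)"
  by(simp add: bop_scaleC_simps)
 have "\<i>*.(- \<i>/2)*.(a - adj a) = (1/2)*.(a - adj a)" by(simp add: bop_scaleC_simps(4))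
 moreover have "(1/2)*.(a + adj a) + (1/2)*.(a - adj a) = (1/2 + 1/2)*.a"
  by(simp only: bop_scaleC_simps(1,2,3)) simp
 ultimately show "a = (1/2)*.(a + adj a) + \<i>*.(- \<i>/2)*.(a - adj a)" by(simp add: bop_scaleC_simps(5))
qed

section \<open>Geometry of the positive cone\<close>

locale std_form =
 fixes N :: "'a::chilbert_space bop set" and J :: "'a => 'a" and P :: "'a set"
 assumes sf: "standard_form N J P"
begin

lemma vn: "von_neumann_algebra N" using sf by(simp add: standard_form_def)
lemma Nalg: "star_alg N" by(rule vn_star_alg[OF vn])
lemmas N_ops = star_alg_ops[OF Nalg]
lemmas N_alg = star_algD[OF Nalg]

lemma J_add [simp]: "J (x + y) = J x + J y"
 and J_scaleC [simp]: "J (c*.x) = cnj c*.J x"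
 and J_J [simp]: "J (J x) = x"
 and J_cinner: "cinner (J x) (J y) = cinner y x"
 using sf by(auto simp: standard_form_def)

lemma J_scaleR [simp]: "J (r *\<^sub>R x) = r *\<^sub>R J x" using J_scaleC[of "cor r" x] by simp
lemma J_0 [simp]: "J 0 = 0" using J_scaleR[of 0 0] by simp
lemma J_minus [simp]: "J (- x) = - J x" using J_scaleR[of "-1" x] by simp
lemma J_diff [simp]: "J (x - y) = J x - J y" using J_add[of x "- y"] by simp
lemma norm_J [simp]: "norm (J x) = norm x"
proof -
 have "(norm (J x))^2 = (norm x)^2" using J_cinner[of x x] of_real_eq_iff by(metis cinner_self)
 thus ?thesis by simp
qed
lemma bounded_linear_J: "bounded_linear J"
 by(rule bounded_linear_intro[of _ 1]) auto
lemma J_swap: "cinner (J x) y = cinner (J y) x"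
 using J_cinner[of x "J y"] by simp
lemma J_swap_right: "cinner x (J y) = cinner y (J x)"
 using J_cinner[of "J x" y] by simp

definition jop :: "'a bop => 'a bop" where "jop T = Abs_bop (%x. J (T$$J x))"

lemma jop_app: "jop T$$x = J (T$$J x)"
proof -
 obtain S where "op_app S = (%x. J (T$$J x))"
  by(rule bop_exists[of "%x. J (T$$J x)" "opn T"]) (use norm_op_le[of T "J x" for x] in auto)
 thus ?thesis unfolding jop_def by(metis op_app_inverse)
qed

lemma jop_simps: "jop (S + T) = jop S + jop T" "jop (S - T) = jop S - jop T" "jop (S*T) = jop S*jop T"
 "jop (c*.T) = cnj c*.jop T" "jop 1 = 1" "jop (jop T) = T"
 by(rule bop_eqI; simp add: jop_app)+

lemma adj_jop: "adj (jop T) = jop (adj T)"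
 by(rule adj_unique) (simp add: jop_app J_swap[of "T$$_"] J_swap_right[of _ "adj T$$_"] cinner_adj')

lemma commutant_eq: "commutant N = jop ` N"
proof -
 have "commutant N = {y. EX x:N. ALL xi. y$$xi = J (x$$J xi)}" using sf by(simp add: standard_form_def)
 also have "... = jop ` N" by(auto simp: image_iff jop_app intro!: bop_eqI)
 finally show ?thesis .
qed

lemma jop_commutant: "a:N ==> jop a:commutant N" by(simp add: commutant_eq)

lemma jop_commute: "a:N ==> b:N ==> jop a*b = b*jop a"
 using jop_commutant[of a] by(simp add: commutant_def)

lemma P_J: "xi:P ==> J xi = xi" using sf by(simp add: standard_form_def)

lemma P_iff: "xi:P \<longleftrightarrow> (ALL eta:P. cinner xi eta:\<real>\<^sub>\<ge>\<^sub>0)"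
 using sf unfolding standard_form_def by blast

lemma P_D: "xi:P ==> eta:P ==> Im (cinner xi eta) = 0 & 0 <= Re (cinner xi eta)"
 using P_iff[THEN iffD1] unfolding nonneg_Reals_iff by blast

lemma P_I: "(!!eta. eta:P ==> Im (cinner xi eta) = 0 & 0 <= Re (cinner xi eta)) ==> xi:P"
 by(rule P_iff[THEN iffD2]) (simp add: nonneg_Reals_iff)

lemma P_pos: "xi:P ==> eta:P ==> 0 <= Re (cinner xi eta)"
 using P_D by blast

lemma P_conj: "a:N ==> xi:P ==> a$$jop a$$xi:P"
 using sf unfolding standard_form_def jop_app by blast

lemma P_0: "0:P" by(rule P_I) simp
lemma P_add: "x:P ==> y:P ==> x + y:P"
 by(rule P_I) (simp add: cinner_simps P_D)
lemma P_scale: "x:P ==> 0 <= r ==> r *\<^sub>R x:P"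
 by(rule P_I) (simp add: cinner_simps P_D)

lemma P_limit_closed:
 assumes x: "!!n. x n:P" and lim: "x ----> y"
 shows "y:P"
proof(rule P_I)
 fix eta assume eta: "eta:P"
 have l: "(%n. cinner (x n) eta) ----> cinner y eta" by(intro tendsto_cinner lim tendsto_const)
 have "(%n. Im (cinner (x n) eta)) ----> Im (cinner y eta)" by(rule tendsto_Im[OF l])
 hence "Im (cinner y eta) = 0" using P_D[OF x eta] by(simp add: LIMSEQ_const_iff)
 moreover have "0 <= Re (cinner y eta)" by(rule LIMSEQ_le_const[OF tendsto_Re[OF l]]) (use P_D[OF x eta] in blast)
 ultimately show "Im (cinner y eta) = 0 & 0 <= Re (cinner y eta)" ..
qed

lemma real_iff: "J x = x ==> J y = y ==> Im (cinner x y) = 0"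
 using J_cinner[of x y] cinner_commute[of x y] by(simp add: complex_eq_iff)

text \<open>\<open>p\<close> is the nearest point of the cone, found by \<open>cone_minimum\<close>.
  The variational inequality puts \<open>p - ze\<close> into the self-dual cone, and the radial
  condition gives the orthogonality.\<close>

lemma decompose:
 assumes "J ze = ze"
 obtains p m where "p:P" "m:P" "ze = p - m" "cinner p m = 0"
proof -
 let ?X = "{(y, Re (cinner ze y)) | y. y:P}"
 obtain p y s where *: "!!n::nat. (y n, s n):?X" "y ----> p" "s ----> (norm p)\<^sup>2" "!!z t. (z, t):?X ==> t <= Re (cinner p z)"
 proof(rule cone_minimum[of ?X "norm ze"])
  show "(0, 0):?X" using P_0 by force
  show "a + b:?X" if "a:?X" "b:?X" for a b
  proof -
   from that obtain y z where "a = (y, Re (cinner ze y))" "b = (z, Re (cinner ze z))" "y:P" "z:P" by blast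
   hence "a + b = (y + z, Re (cinner ze (y + z)))" "y + z:P" by(auto simp: cinner_simps P_add)
   thus ?thesis by blast
  qed
  show "r *\<^sub>R a:?X" if "a:?X" "0 <= r" for a r
  proof -
   from that obtain y where "a = (y, Re (cinner ze y))" "y:P" by blast
   hence "r *\<^sub>R a = (r *\<^sub>R y, Re (cinner ze (r *\<^sub>R y)))" "r *\<^sub>R y:P" using that(2) by(auto simp: cinner_simps P_scale)
   thus ?thesis by blast
  qed
 qed (auto simp: Re_cinner_le)
 have yP: "y n:P" and sy: "s n = Re (cinner ze (y n))" for n using *(1)[of n] by auto
 have p: "p:P" using P_limit_closed[OF yP *(2)] .
 have "(%n. Re (cinner ze (y n))) ----> Re (cinner ze p)" by(intro tendsto_intros tendsto_cinner *(2))
 moreover have "s = (%n. Re (cinner ze (y n)))" by(rule ext) (rule sy)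
 ultimately have "s ----> Re (cinner ze p)" by simp
 hence eq: "(norm p)^2 = Re (cinner ze p)" by(rule LIMSEQ_unique[OF *(3)])
 define m where "m = p - ze"
 have Jm: "J m = m" using assms P_J[OF p] by(simp add: m_def)
 have m: "m:P"
 proof(rule P_I)
  fix eta assume eta: "eta:P"
  have "Re (cinner ze eta) <= Re (cinner p eta)" by(rule *(4)) (use eta in blast)
  thus "Im (cinner m eta) = 0 & 0 <= Re (cinner m eta)" using real_iff[OF Jm P_J[OF eta]] by(simp add: m_def cinner_simps)
 qed
 have "cinner p m = 0" using eq Re_cinner_commute[of p ze] real_iff[OF P_J[OF p] Jm] by(simp add: m_def cinner_simps Re_cinner_self complex_eq_iff)
 thus thesis using that[OF p m] by(simp add: m_def)
qed

text \<open>\<open>P_conj\<close> at \<open>1 + cor t*.a\<close>, paired with \<open>m\<close>, is a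
  nonnegative quadratic polynomial in \<open>t\<close> without constant term, so its linear
  coefficient, twice the real part of \<open>cinner (a$$p) m\<close>, vanishes.\<close>

lemma orth_supports:
 assumes p: "p:P" and m: "m:P" and 0: "cinner p m = 0" and a: "a:N"
 shows "cinner (a$$p) m = 0"
proof -
 have re: "Re (cinner (a$$p) m) = 0" if a: "a:N" for a
 proof -
  have sw: "cinner (jop a$$p) m = cnj (cinner (a$$p) m)"
   using J_swap[of "a$$p" m] P_J[OF p] P_J[OF m] cinner_commute[of m "a$$p"] by(simp add: jop_app)
  have "0 <= t*(2*Re (cinner (a$$p) m)) + t^2*Re (cinner (a$$jop a$$p) m)" for t
  proof -
   let ?b = "1 + cor t*.a"
   have "0 <= Re (cinner (?b$$jop ?b$$p) m)" using a P_pos[OF P_conj[OF _ p] m] by(metis N_ops N_alg)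
   also have "... = Re (cinner p m) + t*Re (cinner (a$$p) m + cinner (jop a$$p) m) + t^2*Re (cinner (a$$jop a$$p) m)"
    by(simp add: jop_simps cinner_simps algebra_simps power2_eq_square)
   finally show ?thesis by(simp add: 0 sw algebra_simps)
  qed
  thus ?thesis by(smt (verit) linear_term_zero)
 qed
 have "Re (cinner ((\<i>*.a)$$p) m) = 0" by(rule re) (rule N_ops(3)[OF a])
 thus ?thesis using re[OF a] by(simp add: cinner_simps complex_eq_iff)
qed

lemma orth_supports_commutant:
 assumes p: "p:P" and m: "m:P" and 0: "cinner p m = 0" and x: "x:commutant N"
 shows "cinner (x$$p) m = 0"
proof -
 obtain a where a: "a:N" "x = jop a" using x by(auto simp: commutant_eq)
 have "cinner (jop a$$p) m = cinner m (a$$p)"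
  using J_swap[of "a$$p" m] P_J[OF p] P_J[OF m] by(simp add: jop_app)
 also have "... = 0" using orth_supports[OF p m 0 a(1)] by(subst cinner_commute) simp
 finally show ?thesis by(simp add: a(2))
qed

text \<open>By \<open>orth_supports\<close> the cross terms vanish, so \<open>p + m\<close> and
  \<open>p - m\<close> induce the same functional.\<close>

lemma absolute_value:
 assumes "J ze = ze"
 obtains xi where "xi:P" "!!a. a:N ==> vfun xi a = vfun ze a"
proof -
 obtain p m where pm: "p:P" "m:P" "ze = p - m" "cinner p m = 0" using decompose[OF assms] .
 have mp: "cinner m p = 0" using pm(4) by(subst cinner_commute) simp
 show thesis
 proof(rule that[of "p + m"])
  show "vfun (p + m) a = vfun ze a" if "a:N" for a
   using orth_supports[OF pm(1,2,4) that] orth_supports[OF pm(2,1) mp that]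
   by(simp add: vfun_def pm(3) cinner_simps)
 qed (intro P_add pm)
qed

text \<open>The inequality of Araki, Powers and Stormer; \<open>e\<close> is the difference of the support projections
 of the positive and the negative part of \<open>\<xi> - \<eta>\<close>.\<close>

lemma powers_stormer:
 assumes xi: "xi:P" and eta: "eta:P"
 obtains e where "e:N" "!!v. norm (e$$v) <= norm v" "(norm (xi - eta))^2 <= Re (vfun xi e - vfun eta e)"
proof -
 have "J (xi - eta) = xi - eta" using P_J[OF xi] P_J[OF eta] by simp
 then obtain p m where pm: "p:P" "m:P" "xi - eta = p - m" "cinner p m = 0" using decompose by blast
 have mp: "cinner m p = 0" using pm(4) by(subst cinner_commute) simp
 have N': "star_alg (commutant N)" by(rule star_alg_commutant[OF N_alg(4)])
 define L where "L x = closure ((%s. s$$x) ` commutant N)" for x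
 note L = ccsubspace_orbit[OF N', folded L_def]
 have eN: "cproj (L x):N" for x
  using cproj_in_commutant[OF L(1) star_algD(4)[OF N'] L(3)] vn_commutant[OF vn] by blast
 have perp: "cinner l m = 0" if "l:L p" for l
 proof -
  have "L p \<subseteq> {l. cinner l m = 0}" unfolding L_def
   by(intro closure_minimal closed_Collect_eq continuous_on_cinner continuous_intros)
    (auto simp: orth_supports_commutant[OF pm(1,2,4)])
  thus ?thesis using that by auto
 qed
 have perp2: "cinner l k = 0" if l: "l:L p" and k: "k:L m" for l k
 proof -
  have "cinner l (x$$m) = 0" if x: "x:commutant N" for x
   using perp[OF L(3)[OF star_algD(4)[OF N' x] l]] by(simp add: cinner_adj)
  hence "L m \<subseteq> {k. cinner l k = 0}" unfolding L_def
   by(intro closure_minimal closed_Collect_eq continuous_on_cinner continuous_intros) auto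
  thus ?thesis using k by auto
 qed
 define e where "e = cproj (L p) - cproj (L m)"
 have norm_cproj: "cinner v (cproj (L x)$$v) = cor ((norm (cproj (L x)$$v))^2)"
  "cinner (cproj (L x)$$v) v = cor ((norm (cproj (L x)$$v))^2)" for x v
  using cproj_idem[OF L(1), of x] cinner_adj[of "cproj (L x)" v "cproj (L x)$$v"] cinner_adj[of "cproj (L x)" "cproj (L x)$$v" v]
  by(simp_all add: cproj_adj[OF L(1)] cinner_self flip: times_op_app)
 have ce: "norm (e$$v) <= norm v" for v
 proof -
  define a b where "a = cproj (L p)$$v" and "b = cproj (L m)$$v"
  have ab: "cinner a b = 0" "cinner b a = 0"
  proof -
   show "cinner a b = 0" unfolding a_def b_def by(rule perp2[OF cproj_in[OF L(1)] cproj_in[OF L(1)]])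
   thus "cinner b a = 0" by(subst cinner_commute) simp
  qed
  have "0 <= (norm (v - (a + b)))^2" by simp
  also have "... = (norm v)^2 - (norm a)^2 - (norm b)^2"
   using norm_cproj[of v p] norm_cproj[of v m] ab
   by(simp add: norm_diff_sq norm_add_sq a_def[symmetric] b_def[symmetric] cinner_simps)
  finally have "(norm (a - b))^2 <= (norm v)^2" by(simp add: norm_diff_sq ab)
  thus ?thesis by(simp add: e_def a_def b_def power2_le_iff_abs_le)
 qed
 have e_adj: "adj e = e" by(simp add: e_def cproj_adj[OF L(1)])
 have "cproj (L p)$$m = 0" by(rule cproj_eq_0[OF L(1)]) (rule perp)
 moreover have "cproj (L m)$$p = 0"
 proof(rule cproj_eq_0[OF L(1)])
  show "cinner k p = 0" if "k:L m" for k using perp2[OF L(2) that] by(subst cinner_commute) simp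
 qed
 ultimately have ed: "e$$(xi - eta) = p + m"
  unfolding pm(3) e_def by(simp add: cproj_id[OF L(1) L(2)])
 hence ed': "e$$xi - e$$eta = p + m" by simp
 have "vfun xi e - vfun eta e = cinner (e$$xi - e$$eta) (xi + eta) - cinner (e$$xi) eta + cinner (e$$eta) xi"
  by(simp add: vfun_def cinner_simps)
 moreover have "Re (cinner (e$$xi) eta) = Re (cinner (e$$eta) xi)"
  using cinner_adj[of e xi eta] e_adj Re_cinner_commute by metis
 ultimately have "Re (vfun xi e - vfun eta e) = Re (cinner (p + m) (xi + eta))" by(simp add: ed')
 \<comment> \<open>Against \<open>p\<close> the vector \<open>xi + eta\<close> is written as
   \<open>(xi - eta) + 2 eta\<close>, against \<open>m\<close> as \<open>2 xi - (xi - eta)\<close>;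
   the additional terms are nonnegative on the cone.\<close>
 also have "... = Re (cinner (p - m) (xi - eta)) + 2*Re (cinner p eta) + 2*Re (cinner m xi)"
  by(simp add: cinner_simps)
 also have "... >= Re (cinner (p - m) (xi - eta))"
  using P_pos[OF pm(1) eta] P_pos[OF pm(2) xi] by simp
 finally have "(norm (xi - eta))^2 <= Re (vfun xi e - vfun eta e)" by(simp add: pm(3) Re_cinner_self)
 moreover have "e:N" unfolding e_def by(intro N_ops eN)
 ultimately show thesis using that ce by blast
qed

lemma cone_unique:
 assumes "xi:P" "eta:P" "!!a. a:N ==> vfun xi a = vfun eta a"
 shows "xi = eta"
by(use powers_stormer[OF assms(1,2)] assms(3) in \<open>auto\<close>)

text \<open>By \<open>powers_stormer\<close>, cone vectors with uniformly close functionals are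
  close in norm, so the sequence is Cauchy.\<close>

lemma cone_limit:
 assumes xi: "!!n. xi n:P" and eps: "eps ----> (0::real)"
  and close: "!!n a. a:N ==> (!!v. norm (a$$v) <= norm v) ==> cmod (vfun (xi n) a - phi a) <= eps n"
  and lim: "!!a. a:N ==> (%n. vfun (xi n) a) ----> phi a"
 obtains ze where "ze:P" "!!a. a:N ==> vfun ze a = phi a"
proof -
 have le: "(norm (xi m - xi n))^2 <= eps m + eps n" for m n
 proof -
  obtain e where e: "e:N" "!!v. norm (e$$v) <= norm v" "(norm (xi m - xi n))^2 <= Re (vfun (xi m) e - vfun (xi n) e)"
   by(rule powers_stormer[OF xi[of m] xi[of n]]) (rule that)
  have "Re (vfun (xi m) e - vfun (xi n) e) <= cmod ((vfun (xi m) e - phi e) - (vfun (xi n) e - phi e))"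
   using complex_Re_le_cmod[of "vfun (xi m) e - vfun (xi n) e"] by simp
  also have "... <= eps m + eps n"
   by(rule order_trans[OF norm_triangle_ineq4 add_mono[OF close[OF e(1,2)] close[OF e(1,2)]]])
  finally show ?thesis using e(3) by linarith
 qed
 have "Cauchy xi"
 proof(rule metric_CauchyI)
  fix r :: real assume r: "0 < r"
  have "0 < r^2 / 2" using r by simp
  from order_tendstoD(2)[OF eps this] obtain M where M: "!!n. n >= M ==> eps n < r^2 / 2"
   by(auto simp: eventually_sequentially)
  have "dist (xi m) (xi n) < r" if "m >= M" "n >= M" for m n
  proof -
   have "(norm (xi m - xi n))^2 < r^2" using le[of m n] M[OF that(1)] M[OF that(2)] by simp
   thus ?thesis using r by(simp add: dist_norm power2_less_imp_less)
  qed
  thus "EX M. ALL m>=M. ALL n>=M. dist (xi m) (xi n) < r" by blast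
 qed
 then obtain ze where ze: "xi ----> ze" using Cauchy_convergent_iff convergent_def by blast
 show thesis
 proof(rule that)
  show "ze:P" by(rule P_limit_closed[OF xi ze])
  show "vfun ze a = phi a" if "a:N" for a
  proof(rule LIMSEQ_unique[OF _ lim[OF that]])
   show "(%n. vfun (xi n) a) ----> vfun ze a" unfolding vfun_def by(intro tendsto_cinner tendsto_op_app ze)
  qed
 qed
qed

lemma cinner_J_pos:
 assumes xi: "xi:P" and a: "a:N" "adj a = a"
 shows "0 <= Re (cinner (J (a$$xi)) (a$$xi))"
by(metis cinner_adj[of a "jop a$$xi" xi] P_J[OF xi] a(2) jop_app P_pos[OF P_conj[OF a(1) xi] xi])

text \<open>One step of Newton's iteration \<open>\<xi> \<mapsto> |\<xi> + \<eta>|\<close> for the equation \<open>\<omega>\<^sub>\<xi> = \<phi>\<close>, where \<open>\<eta>\<close> solves the linearised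
 equation \<open>2 Re \<langle>a\<xi>, \<eta>\<rangle> = \<phi>(a) - \<omega>\<^sub>\<xi>(a)\<close>.\<close>

lemma newton_step:
 assumes xi: "xi:P"
  and add: "!!a b. a:N ==> b:N ==> phi (a + b) = phi a + phi b" and sc: "!!c a. a:N ==> phi (c*.a) = c*phi a"
  and pos: "!!a. a:N ==> phi (adj a*a):\<real>\<^sub>\<ge>\<^sub>0" "!!a. a:N ==> vfun xi (adj a*a) - phi (adj a*a):\<real>\<^sub>\<ge>\<^sub>0"
 shows "EX xi' eta. xi':P & (ALL a:N. vfun xi' a = phi a + vfun eta a) & (norm eta)\<^sup>2 <= Re (vfun xi 1 - phi 1) / 2"
proof -
 define tau where "tau a = vfun xi a - phi a" for a
 have tau: "!!a b. a:N ==> b:N ==> tau (a + b) = tau a + tau b" "!!a c. a:N ==> tau (c*.a) = c*tau a"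
  by(simp_all add: tau_def vfun_simps add sc algebra_simps)
 define T where "T = Re (tau 1)"
 have T0: "0 <= T" using pos(2)[OF N_alg(2)] by(simp add: T_def tau_def nonneg_Reals_iff)
 have sq: "0 <= Re (tau (a*a))" "Re (tau (a*a)) <= (norm (a$$xi))^2" if "a:N" "adj a = a" for a
  using pos(1)[OF that(1)] pos(2)[OF that(1)] that(2) vfun_adj_mult[of xi a] by(auto simp: tau_def nonneg_Reals_iff)
 have tau_real: "Im (tau a) = 0" and tau_quad: "0 <= T + t*(2*Re (tau a)) + t^2*Re (tau (a*a))"
  if a: "a:N" "adj a = a" for a t
 proof -
  have q: "tau ((1 + cor t*.a)*(1 + cor t*.a)) = tau 1 + cor (2*t)*tau a + cor (t^2)*tau (a*a)" for t
  by(use bop_scaleC_simps(2) mult_2 add.assoc N_ops in \<open>simp add: distrib_left distrib_right bop_scaleC_simps power2_eq_square tau(1) tau(2) N_alg a\<close>)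
  have nn: "tau ((1 + cor t*.a)*(1 + cor t*.a)):\<real>\<^sub>\<ge>\<^sub>0" for t
  proof -
   have "1 + cor t*.a:N" by(intro N_ops N_alg a)
   from pos(2)[OF this] show ?thesis by(simp add: tau_def a)
  qed
  from nn[of t] show "0 <= T + t*(2*Re (tau a)) + t^2*Re (tau (a*a))"
   unfolding q nonneg_Reals_iff by(simp add: T_def algebra_simps)
  have "tau 1:\<real>\<^sub>\<ge>\<^sub>0" "tau (a*a):\<real>\<^sub>\<ge>\<^sub>0" using pos(2)[OF N_alg(2)] pos(2)[OF a(1)] by(simp_all add: tau_def a)
  thus "Im (tau a) = 0" using nn[of 1] unfolding q by(simp add: nonneg_Reals_iff)
 qed
 \<comment> \<open>Cauchy-Schwarz for the positive form induced by \<open>tau\<close>, obtained by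
   optimising \<open>tau_quad\<close> over \<open>t\<close>.\<close>
 have cs: "\<bar>Re (tau a)\<bar> <= sqrt T*norm (a$$xi)" if a: "a:N" "adj a = a" for a
 proof -
  define r s where "r = Re (tau a)" and "s = Re (tau (a*a))"
  have "r^2 <= T * s"
  proof(cases "s = 0")
   case True
   hence q: "0 <= T + t*(2*r)" for t using tau_quad[OF a, of t] by(simp add: r_def s_def)
   have "r = 0"
   by(use ccontr q[of "- (T + 1) / (2*r)"] in \<open>force\<close>)
   thus ?thesis using True by simp
  next
   case False
   hence s: "0 < s" using sq(1)[OF a] by(simp add: s_def)
   have "0 <= T + (- r / s)*(2*r) + (- r / s)^2 * s" unfolding r_def s_def by(rule tau_quad[OF a])
   also have "... = T - r^2 / s" using s by(simp add: power2_eq_square field_simps)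
   finally show ?thesis using s by(simp add: field_simps)
  qed
  also have "... <= T*(norm (a$$xi))^2" using sq(2)[OF a] T0 by(simp add: s_def mult_left_mono)
  also have "... = (sqrt T*norm (a$$xi))^2" using T0 by(simp add: power_mult_distrib)
  finally have "\<bar>r\<bar> <= \<bar>sqrt T*norm (a$$xi)\<bar>" by(simp only: abs_le_square_iff)
  thus ?thesis using T0 by(simp add: r_def)
 qed
 let ?X = "{(a$$xi + J (a$$xi), - Re (tau a)) | a. a:N & adj a = a}"
 have X: "subspace ?X"
 proof(rule subspaceI)
  have "tau 0 = 0" using tau(2)[OF N_alg(2), of 0] by(simp add: bop_scaleC_simps)
  thus "0:?X" using N_ops(1) by(force simp: zero_prod_def)
  show "x + y:?X" if "x:?X" "y:?X" for x y
  proof -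
   from that obtain a b where ab: "a:N" "adj a = a" "b:N" "adj b = b"
    "x = (a$$xi + J (a$$xi), - Re (tau a))" "y = (b$$xi + J (b$$xi), - Re (tau b))" by blast
   hence "x + y = ((a + b)$$xi + J ((a + b)$$xi), - Re (tau (a + b)))" "a + b:N" "adj (a + b) = a + b"
    by(auto simp: tau N_ops)
   thus ?thesis by blast
  qed
  show "r *\<^sub>R x:?X" if "x:?X" for r x
  proof -
   from that obtain a where a: "a:N" "adj a = a" "x = (a$$xi + J (a$$xi), - Re (tau a))" by blast
   let ?b = "cor r*.a"
   have "r *\<^sub>R x = (?b$$xi + J (?b$$xi), - Re (tau ?b))" "?b:N" "adj ?b = ?b"
    using a by(auto simp: tau(2)[OF a(1)] N_ops scaleR_add_right)
   thus ?thesis by blast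
  qed
 qed
 \<comment> \<open>The vectors \<open>a$$xi\<close> and \<open>J (a$$xi)\<close> have an inner
   product with nonnegative real part, so \<open>norm y\<close> is at least
   \<open>sqrt 2*norm (a$$xi)\<close>. The factor gained here is what makes the iteration
   contract.\<close>
 have bound: "s <= sqrt (T / 2)*norm y" if "(y, s):?X" for y s
 proof -
  from that obtain a where a: "a:N" "adj a = a" "y = a$$xi + J (a$$xi)" "s = - Re (tau a)" by blast
  have "2*(norm (a$$xi))^2 <= (norm y)^2"
   using cinner_J_pos[OF xi a(1,2)] Re_cinner_commute[of "a$$xi" "J (a$$xi)"] by(simp add: a(3) norm_add_sq)
  hence "sqrt (2*(norm (a$$xi))^2) <= norm y" by(intro real_le_lsqrt) auto
  hence le: "sqrt 2*norm (a$$xi) <= norm y" by(simp add: real_sqrt_mult)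
  have "s <= sqrt T*norm (a$$xi)" using cs[OF a(1,2)] a(4) by simp
  also have "... = sqrt (T / 2)*(sqrt 2*norm (a$$xi))" by(simp add: real_sqrt_divide)
  also have "... <= sqrt (T / 2)*norm y" using le T0 by(intro mult_left_mono) auto
  finally show ?thesis .
 qed
 obtain eta where eta: "eta:closure (fst ` ?X)" "norm eta <= sqrt (T / 2)" "!!z t. (z, t):?X ==> Re (cinner eta z) = t"
  by(rule real_riesz[OF X bound]) (use T0 in auto)
 have Jeta: "J eta = eta"
 proof -
  have "fst ` ?X \<subseteq> {x. J x = x}" by(auto simp: add.commute)
  hence "closure (fst ` ?X) \<subseteq> {x. J x = x}"
   by(rule closure_minimal) (intro closed_Collect_eq continuous_intros bounded_linear.continuous_on[OF bounded_linear_J])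
  thus ?thesis using eta(1) by auto
 qed
 have key: "vfun (xi + eta) a = phi a + vfun eta a" if a: "a:N" for a
 proof -
  have s: "vfun (xi + eta) b = phi b + vfun eta b" if b: "b:N" "adj b = b" for b
  proof -
   have "Re (cinner eta (b$$xi + J (b$$xi))) = - Re (tau b)" by(rule eta(3)) (use b in blast)
   moreover have "Re (cinner eta (J (b$$xi))) = Re (cinner eta (b$$xi))"
    using J_swap_right[of eta "b$$xi"] Jeta Re_cinner_commute by metis
   ultimately have 1: "2*Re (cinner eta (b$$xi)) = - Re (tau b)" by(simp add: cinner_simps)
   have 2: "cinner (b$$eta) xi = cinner eta (b$$xi)" using cinner_adj[of b eta xi] b(2) by simp
   have 3: "cinner (b$$xi) eta = cnj (cinner eta (b$$xi))" by(rule cinner_commute)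
   have "cinner (b$$xi) eta + cinner (b$$eta) xi = - tau b"
    using 1 tau_real[OF b] by(simp add: 2 3 complex_eq_iff)
   thus ?thesis by(simp add: vfun_def cinner_simps tau_def)
    (metis (no_types, lifting) add.assoc add.commute add_diff_cancel_left' diff_add_cancel)
  qed
  obtain b c where bc: "b:N" "c:N" "adj b = b" "adj c = c" "a = b + \<i>*.c"
   by(rule self_adjoint_parts[OF Nalg a]) (rule that)
  show ?thesis using s[OF bc(1,3)] s[OF bc(2,4)] bc
   by(simp add: vfun_simps add sc N_ops algebra_simps)
 qed
 have "J (xi + eta) = xi + eta" by(simp add: P_J[OF xi] Jeta)
 then obtain xi' where "xi':P" "!!a. a:N ==> vfun xi' a = vfun (xi + eta) a" using absolute_value by blast
 moreover have "(norm eta)^2 <= Re (vfun xi 1 - phi 1) / 2"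
 proof -
  have "(norm eta)^2 <= (sqrt (T / 2))^2" using eta(2) by(rule power_mono) simp
  thus ?thesis using T0 by(simp add: T_def tau_def)
 qed
 ultimately show ?thesis using key by(intro exI[of _ xi'] exI[of _ eta]) simp
qed

text \<open>After one step the excess over \<open>phi\<close> is the functional of
  \<open>eta\<close>, whose value at \<open>1\<close> is \<open>(norm eta)^2\<close>; the next
  correction has at most half that squared norm. The excess decays geometrically and
  \<open>cone_limit\<close> applies.\<close>

lemma newton:
 assumes xi: "xi:P"
  and add: "!!a b. a:N ==> b:N ==> phi (a + b) = phi a + phi b" and sc: "!!c a. a:N ==> phi (c*.a) = c*phi a"
  and pos: "!!a. a:N ==> phi (adj a*a):\<real>\<^sub>\<ge>\<^sub>0" "!!a. a:N ==> vfun xi (adj a*a) - phi (adj a*a):\<real>\<^sub>\<ge>\<^sub>0"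
 obtains ze where "ze:P" "!!a. a:N ==> vfun ze a = phi a"
proof -
 define Q where "Q s \<longleftrightarrow> fst s:P & (ALL a:N. vfun (fst s) a = phi a + vfun (snd s) a)" for s :: "'a \<times> 'a"
 have "EX xi' eta. xi':P & (ALL a:N. vfun xi' a = phi a + vfun eta a) & (norm eta)\<^sup>2 <= Re (vfun xi 1 - phi 1) / 2"
  by(rule newton_step) (fact xi add sc pos)+
 then obtain xi1 eta1 where 1: "xi1:P" "ALL a:N. vfun xi1 a = phi a + vfun eta1 a" by blast
 have step: "EX s'. Q s' & (norm (snd s'))\<^sup>2 <= (norm (snd s))^2 / 2" if "Q s" for s
 proof -
  have s: "fst s:P" "!!a. a:N ==> vfun (fst s) a = phi a + vfun (snd s) a" using that by(auto simp: Q_def)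
  have p: "vfun (fst s) (adj a*a) - phi (adj a*a):\<real>\<^sub>\<ge>\<^sub>0" if "a:N" for a
   using s(2)[of "adj a*a"] N_alg(3,4) that by(simp add: vfun_adj_mult nonneg_Reals_iff)
  have "EX xi' eta. xi':P & (ALL a:N. vfun xi' a = phi a + vfun eta a) & (norm eta)\<^sup>2 <= Re (vfun (fst s) 1 - phi 1) / 2"
   by(rule newton_step) (fact s(1) add sc pos(1) p)+
  then obtain xi' eta where *: "xi':P" "ALL a:N. vfun xi' a = phi a + vfun eta a" "(norm eta)^2 <= Re (vfun (fst s) 1 - phi 1) / 2" by blast
  have "vfun (fst s) 1 - phi 1 = cor ((norm (snd s))^2)" using s(2)[OF N_alg(2)] by(simp add: vfun_def cinner_self)
  thus ?thesis using * by(intro exI[of _ "(xi', eta)"]) (auto simp: Q_def)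
 qed
 have "EX f. ALL n. Q (f n) & (norm (snd (f (Suc n))))\<^sup>2 <= (norm (snd (f n)))^2 / 2"
 proof(rule dependent_nat_choice)
  show "EX s. Q s" using 1 by(intro exI[of _ "(xi1, eta1)"]) (auto simp: Q_def)
 qed (use step in blast)
 then obtain f where f: "!!n. Q (f n)" "!!n. (norm (snd (f (Suc n))))\<^sup>2 <= (norm (snd (f n)))^2 / 2" by blast
 define c where "c = (norm (snd (f 0)))^2"
 have small: "(norm (snd (f n)))^2 <= c*(1/2) ^ n" for n
 proof(induction n)
  case (Suc n)
  thus ?case using f(2)[of n] by simp
 qed (simp add: c_def)
 have lim0: "(%n. c*(1/2) ^ n) ----> 0"
  by(rule tendsto_mult_right_zero) (rule LIMSEQ_power_zero, simp)
 have fQ: "fst (f n):P" "!!a. a:N ==> vfun (fst (f n)) a - phi a = vfun (snd (f n)) a" for n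
  using f(1)[of n] by(auto simp: Q_def)
 show thesis
 proof(rule cone_limit[of "%n. fst (f n)" "%n. c*(1/2) ^ n" phi])
  show "cmod (vfun (fst (f n)) a - phi a) <= c*(1/2) ^ n" if "a:N" "!!v. norm (a$$v) <= norm v" for n a
   using vfun_contraction[OF that(2), of "snd (f n)"] small[of n] fQ(2)[OF that(1), of n] by simp
  show "(%n. vfun (fst (f n)) a) ----> phi a" if a: "a:N" for a
  proof(rule LIM_zero_cancel, rule Lim_null_comparison)
   show "\<forall>\<^sub>F n in sequentially. cmod (vfun (fst (f n)) a - phi a) <= opn a*(c*(1/2) ^ n)"
   proof(intro always_eventually allI)
    fix n
    let ?v = "snd (f n)"
    have "cmod (vfun ?v a) <= norm (a$$?v)*norm ?v" unfolding vfun_def by(rule cmod_cinner_mult_le)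
    also have "... <= opn a*norm ?v * norm ?v" by(intro mult_right_mono norm_op_le) simp
    also have "... <= opn a*(c*(1/2) ^ n)"
     using mult_left_mono[OF small[of n] opn_ge_0[of a]] by(simp add: power2_eq_square mult.assoc)
    finally show "cmod (vfun (fst (f n)) a - phi a) <= opn a*(c*(1/2) ^ n)" by(simp add: fQ(2)[OF a])
   qed
   show "(%n. opn a*(c*(1/2) ^ n)) ----> 0" by(rule tendsto_mult_right_zero[OF lim0])
  qed
 qed (use fQ lim0 that in auto)
qed

end

lemma norm_amp_le:
 fixes v :: "('i, 'a::chilbert_space) ell2"
 assumes "!!x. norm (a$$x) <= norm x"
 shows "norm (amp a$$v) <= norm v"
proof -
 have "(norm (amp a$$v))^2 <= (norm v)^2"
  unfolding norm_ell2_sq by(rule infsum_mono[OF coord_summable coord_summable]) (simp add: assms power_mono)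
 thus ?thesis by(rule power2_le_imp_le) simp
qed

lemma nfun_adj_mult: "nfun v v (adj a*a) = cor ((norm (amp a$$v))^2)"
 by(simp only: nfun_def amp_simps(3) adj_amp[symmetric] adj_mult_self_app)

context std_form
begin

section \<open>Separating vectors and cone vectors of normal functionals\<close>

definition separating :: "'a => bool" where
 "separating xi \<longleftrightarrow> (ALL a:N. a$$xi = 0 --> a = 0)"

lemma separatingD: "separating xi ==> a:N ==> a$$xi = 0 ==> a = 0"
 by(simp add: separating_def)

lemma star_alg_N': "star_alg (commutant N)"
 by(rule star_alg_commutant[OF N_alg(4)])

text \<open>The projection onto the closed commutant orbit lies in \<open>N\<close>, and its
  complement annihilates \<open>xi\<close>.\<close>

lemma total_commutant:
 assumes "separating xi"
 shows "total ((%x. x$$xi) ` commutant N)"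
proof -
 define L where "L = closure ((%s. s$$xi) ` commutant N)"
 note L = ccsubspace_orbit[OF star_alg_N', where x = xi, folded L_def]
 have b: "1 - cproj L:N" using cproj_in_commutant[OF L(1) star_algD(4)[OF star_alg_N'] L(3)] vn_commutant[OF vn] by(metis N_ops N_alg)
 have b0: "1 - cproj L = 0" by(use separatingD[OF assms b] in \<open>simp add: cproj_id[OF L(1) L(2)]\<close>)
 show ?thesis
  unfolding total_def
 proof(intro allI impI)
  fix y assume y: "ALL x:(%x. x$$xi) ` commutant N. cinner x y = 0"
  have "L \<subseteq> {k. cinner k y = 0}" unfolding L_def
   by(intro closure_minimal closed_Collect_eq continuous_on_cinner continuous_intros) (use y in auto)
  hence "cproj L$$y = 0" by(intro cproj_eq_0[OF L(1)]) auto
  moreover have "(1 - cproj L)$$y = 0" by(simp add: b0)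
  ultimately show "y = 0" by simp
 qed
qed

lemma total_orbit:
 assumes xi: "xi:P" and "separating xi"
 shows "total ((%a. a$$xi) ` N)"
 unfolding total_def
proof(intro allI impI)
 fix y assume y: "ALL x:(%a. a$$xi) ` N. cinner x y = 0"
 have "J y = 0"
 proof(rule totalD[OF total_commutant[OF assms(2)]])
  fix z assume "z:(%x. x$$xi) ` commutant N"
  then obtain a where a: "a:N" "z = jop a$$xi" by(auto simp: commutant_eq)
  have "cinner z (J y) = cinner y (a$$xi)" using J_cinner[of "a$$xi" y] by(simp add: a(2) jop_app P_J[OF xi])
  also have "... = 0" using y a(1) by(subst cinner_commute) simp
  finally show "cinner z (J y) = 0" .
 qed
 hence "J (J y) = 0" by simp
 thus "y = 0" by(simp only: J_J)
qed

text \<open>\<open>D\<close> consists of the families whose functional is dominated by a multiple of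
  that of \<open>Om\<close>; for these, \<open>newton\<close> starts from a multiple of
  \<open>Om\<close>. It is dense since commutant elements applied to \<open>Om\<close> give
  dominated vectors, and \<open>cone_limit\<close> does the rest.\<close>

lemma cone_vector_exists:
 assumes Om: "Om:P" "separating Om"
 obtains ze where "ze:P" "!!a. a:N ==> vfun ze a = nfun tht tht a"
proof -
 define D :: "(nat, 'a) ell2 set" where "D = {y. EX C>=0. ALL a:N. norm (amp a$$y) <= C*norm (a$$Om)}"
 have "total D"
  unfolding total_def
 proof(intro allI impI)
  fix z :: "(nat, 'a) ell2" assume z: "ALL x:D. cinner x z = 0"
  have "coord z n = 0" for n
  proof(rule totalD[OF total_commutant[OF Om(2)]])
   fix w assume "w:(%x. x$$Om) ` commutant N"
   then obtain x where x: "x:commutant N" "w = x$$Om" by blast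
   have ns: "norm (single n y) = norm y" for y :: 'a
   proof -
    have "(norm (single n y))^2 = (norm y)^2" using cinner_single[of n y "single n y"] of_real_eq_iff by(metis cinner_self coord_single)
    thus ?thesis by simp
   qed
   have "norm (amp a$$single n w) <= opn x*norm (a$$Om)" if a: "a:N" for a
   proof -
    have "x*a = a*x" using x(1) a by(simp add: commutant_def)
    hence "x$$a$$Om = a$$w" unfolding x(2) by(metis times_op_app)
    thus ?thesis using norm_op_le[of x "a$$Om"] by(simp add: ns)
   qed
   hence "cinner (single n w) z = 0" using opn_ge_0[of x] z by(force simp: D_def)
   thus "cinner w (coord z n) = 0" by(simp add: cinner_single)
  qed
  thus "z = 0" by(intro ell2_eqI) simp
 qed
 moreover have "0:D" unfolding D_def by(intro CollectI exI[of _ 0]) simp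
 moreover have "x + y:D" if "x:D" "y:D" for x y
 proof -
  from that obtain C C' where C: "0 <= C" "0 <= C'" "ALL a:N. norm (amp a$$x) <= C*norm (a$$Om)"
   "ALL a:N. norm (amp a$$y) <= C'*norm (a$$Om)" unfolding D_def by blast
  have "norm (amp a$$(x + y)) <= (C + C')*norm (a$$Om)" if "a:N" for a
   using C(3,4) that norm_triangle_ineq[of "amp a$$x" "amp a$$y"] by(fastforce simp: distrib_right)
  thus ?thesis unfolding D_def using C(1,2) by(intro CollectI exI[of _ "C + C'"]) simp
 qed
 moreover have "c*.x:D" if "x:D" for c x
 proof -
  from that obtain C where C: "0 <= C" "ALL a:N. norm (amp a$$x) <= C*norm (a$$Om)" unfolding D_def by blast
  have "norm (amp a$$(c*.x)) <= (cmod c*C)*norm (a$$Om)" if "a:N" for a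
   using mult_left_mono[OF C(2)[rule_format, OF that], of "cmod c"] by(simp add: norm_scaleC mult.assoc)
  thus ?thesis unfolding D_def using C(1) by(intro CollectI exI[of _ "cmod c*C"]) simp
 qed
 ultimately have "closure D = UNIV" by(rule total_closure)
 hence "tht:closure D" by simp
 then obtain y where y: "!!n. y n:D" "y ----> tht" unfolding closure_sequential by blast
 have ex: "EX ze. ze:P & (ALL a:N. vfun ze a = nfun u u a)" if u: "u:D" for u
 proof -
  obtain C where C: "0 <= C" "!!a. a:N ==> norm (amp a$$u) <= C*norm (a$$Om)" using u unfolding D_def by blast
  obtain ze where "ze:P" "!!a. a:N ==> vfun ze a = nfun u u a"
  by(use newton[of "C *\<^sub>R Om" "nfun u u"] P_scale Om(1) C(1) C in \<open>auto simp: nfun_adj_mult nonneg_Reals_iff vfun_adj_mult of_real_diff[symmetric] nfun_simps\<close>)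
  thus ?thesis by blast
 qed
 have "ALL n. EX ze. ze:P & (ALL a:N. vfun ze a = nfun (y n) (y n) a)" using ex y(1) by blast
 then obtain ze where ze: "!!n. ze n:P" "!!n a. a:N ==> vfun (ze n) a = nfun (y n) (y n) a" by metis
 show thesis
 proof(rule cone_limit[of ze "%n. norm (y n - tht)*(norm (y n) + norm tht)" "nfun tht tht"])
  have "(%n. norm (y n - tht)*(norm (y n) + norm tht)) ----> norm (tht - tht)*(norm tht + norm tht)"
   by(intro tendsto_intros y(2))
  thus "(%n. norm (y n - tht)*(norm (y n) + norm tht)) ----> 0" by simp
  show "cmod (vfun (ze n) a - nfun tht tht a) <= norm (y n - tht)*(norm (y n) + norm tht)"
   if a: "a:N" "!!v. norm (a$$v) <= norm v" for n a
  proof -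
   have "vfun (ze n) a - nfun tht tht a = cinner (amp a$$(y n - tht)) (y n) + cinner (amp a$$tht) (y n - tht)"
    by(simp add: ze(2)[OF a(1)] nfun_def cinner_simps)
   also have "cmod ... <= norm (amp a$$(y n - tht))*norm (y n) + norm (amp a$$tht)*norm (y n - tht)"
    by(rule order_trans[OF norm_triangle_ineq add_mono[OF cmod_cinner_mult_le cmod_cinner_mult_le]])
   also have "... <= norm (y n - tht)*norm (y n) + norm tht*norm (y n - tht)"
    by(intro add_mono mult_right_mono norm_amp_le a(2)) auto
   finally show ?thesis by(simp add: algebra_simps)
  qed
  show "(%n. vfun (ze n) a) ----> nfun tht tht a" if "a:N" for a
   unfolding ze(2)[OF that] nfun_def by(intro tendsto_cinner tendsto_op_app y(2))
 qed (use ze(1) that in auto)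
qed

text \<open>Positivity of the cone vector conjugated by \<open>c + cor s*.b\<close> with
  \<open>c = 1 - b\<close>: the quadratic term is zero by assumption, so the mixed term, a sum of
  two squared norms, vanishes as well.\<close>

lemma projection_kills:
 assumes ze: "ze:P" and b: "b:N" "adj b = b" "b*b = b" and 0: "b$$jop b$$ze = 0"
 shows "b$$ze = 0"
proof -
 define c where "c = 1 - b"
 have c: "c:N" "adj c = c" "c * c = c" using b by(auto simp: c_def N_ops N_alg algebra_simps)
 have nsq: "cinner (x$$jop y$$ze) ze = cor ((norm (x$$jop y$$ze))^2)"
  if x: "x:N" "adj x = x" "x*x = x" and y: "y:N" "adj y = y" "y*y = y" for x y
 proof -
  define e where "e = x*jop y"
  have comm: "jop y*x = x*jop y" by(rule jop_commute[OF y(1) x(1)])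
  have e_adj: "adj e = e" by(simp add: e_def adj_jop x(2) y(2) comm)
  show ?thesis using comm cinner_adj[of e "e$$ze" ze] e_adj by(metis e_def mult.assoc x(3) y(3) jop_simps(3) times_op_app cinner_self)
 qed
 have "0 <= s*Re (cinner (b$$jop c$$ze + c$$jop b$$ze) ze) + Re (cinner (c$$jop c$$ze) ze)" for s
 proof -
  let ?a = "c + cor s*.b"
  have "0 <= Re (cinner (?a$$jop ?a$$ze) ze)" using b c P_pos[OF P_conj[OF _ ze] ze] by(metis N_ops)
  also have "?a$$jop ?a$$ze = c$$jop c$$ze + cor s*.(b$$jop c$$ze + c$$jop b$$ze)"
   using 0 by(simp add: jop_simps scaleC_add_right scaleR_add_right)
  finally show ?thesis by(simp add: cinner_simps algebra_simps)
 qed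
 hence q: "0 <= s*r + k" if "r = Re (cinner (b$$jop c$$ze + c$$jop b$$ze) ze)" "k = Re (cinner (c$$jop c$$ze) ze)" for s r k
  using that by simp
 have "Re (cinner (b$$jop c$$ze + c$$jop b$$ze) ze) = 0" (is "?r = 0")
 proof(rule ccontr)
  assume "?r ~= 0"
  hence "(- (Re (cinner (c$$jop c$$ze) ze) + 1) / ?r)*?r = - (Re (cinner (c$$jop c$$ze) ze) + 1)" by simp
  thus False using q[OF refl refl, of "- (Re (cinner (c$$jop c$$ze) ze) + 1) / ?r"] by linarith
 qed
 hence "b$$jop c$$ze = 0" using nsq[OF b c] nsq[OF c b] by(simp add: cinner_simps)
 thus ?thesis using 0 by(simp add: c_def jop_simps)
qed

text \<open>The compressions of \<open>p\<close> and \<open>q\<close> lie in the cone and add up to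
  zero, so their inner product is nonnegative and at the same time minus a squared norm.\<close>

lemma projection_kills_summand:
 assumes p: "p:P" and q: "q:P" and b: "b:N" "adj b = b" "b*b = b" and 0: "b$$(p + q) = 0"
 shows "b$$p = 0"
proof(rule projection_kills[OF p b])
 have "b$$jop b$$(p + q) = jop b$$b$$(p + q)" using jop_commute[OF b(1) b(1)] by(metis times_op_app)
 also have "... = 0" by(simp only: 0 op_app_0)
 finally have "b$$jop b$$p + b$$jop b$$q = 0" by simp
 hence eq: "b$$jop b$$p = - (b$$jop b$$q)" by(simp add: eq_neg_iff_add_eq_0)
 have "0 <= Re (cinner (b$$jop b$$p) (b$$jop b$$q))" by(intro P_pos P_conj b p q)
 thus "b$$jop b$$p = 0" by(simp add: eq Re_cinner_self)
qed

text \<open>Each coordinate of \<open>tht\<close> splits into two \<open>J\<close>-real vectors; a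
  projection of \<open>N\<close> that kills the sum of their absolute values kills the coordinate. A
  weighted sum of these cone vectors detects all coordinates at once, and a general \<open>a\<close>
  reduces to a projection through the closed commutant orbit of \<open>Om\<close>.\<close>

lemma separating_exists:
 fixes tht :: "(nat, 'a) ell2"
 assumes tht: "!!a. a:N ==> amp a$$tht = 0 ==> a = 0"
 obtains Om where "Om:P" "separating Om"
proof -
 have "EX q:P. ALL b:N. adj b = b --> b*b = b --> b$$q = 0 --> b$$x = 0" for x
 proof -
  define r s where "r = (1/2) *\<^sub>R (x + J x)" and "s = (1/2) *\<^sub>R (\<i>*.(J x - x))"
  have "J r = r" "J s = s" by(simp_all add: r_def s_def add.commute scaleC_diff_right)
  then obtain p p' where p: "p:P" "!!a. a:N ==> vfun p a = vfun r a" "p':P" "!!a. a:N ==> vfun p' a = vfun s a"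
   using absolute_value by metis
  have x: "x = r + \<i>*.s"
   by(simp add: r_def s_def scaleC_diff_right scaleC_add_right scaleC_scaleC scaleR_diff_right scaleR_add_right
     flip: scaleC_of_real) (simp flip: scaleC_add_left)
  have "b$$x = 0" if b: "b:N" "adj b = b" "b*b = b" "b$$(p + p') = 0" for b
  proof -
   have "b$$p = 0" "b$$p' = 0"
    using projection_kills_summand[OF p(1,3) b] projection_kills_summand[OF p(3,1) b(1-3)] b(4) by(simp_all add: add.commute)
   hence "vfun r b = 0" "vfun s b = 0" using p(2)[OF b(1)] p(4)[OF b(1)] by(simp_all add: vfun_def)
   moreover have "vfun y b = cor ((norm (b$$y))^2)" for y using vfun_adj_mult[of y b] b(2,3) by simp
   ultimately show ?thesis by(simp add: x)
  qed
  thus ?thesis using P_add[OF p(1,3)] by blast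
 qed
 then obtain q where q: "!!x. q x:P" "!!x b. b:N ==> adj b = b ==> b*b = b ==> b$$q x = 0 ==> b$$x = 0" by metis
 \<comment> \<open>The weights bound \<open>norm (z n)\<close> by \<open>(1/2) ^ n\<close>; being
   positive, they let a projection that kills \<open>z n\<close> also kill
   \<open>q (coord tht n)\<close>.\<close>
 define z where "z n = ((1/2) ^ n / (1 + norm (q (coord tht n)))) *\<^sub>R q (coord tht n)" for n
 have zP: "z n:P" for n unfolding z_def by(intro P_scale q(1)) (simp add: add_nonneg_nonneg)
 have nz: "norm (z n) <= (1/2) ^ n" for n
 proof -
  define t where "t = norm (q (coord tht n))"
  have t: "0 <= t" by(simp add: t_def)
  have "norm (z n) = (1/2) ^ n*(t / (1 + t))" using t by(simp add: z_def norm_scaleR t_def abs_of_nonneg)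
  also have "... <= (1/2) ^ n*1" using t by(intro mult_left_mono) (auto simp: divide_le_eq)
  finally show ?thesis by simp
 qed
 have sz: "summable z" by(rule summable_comparison_test[of _ "%n. (1/2) ^ n"]) (use nz in auto)
 define Om where "Om = suminf z"
 have lim: "(%n. SUM k<n. z k) ----> Om" unfolding Om_def by(rule summable_LIMSEQ[OF sz])
 have sumP: "(SUM k:F. z k):P" for F
  by(induction F rule: infinite_finite_induct) (auto intro: P_0 P_add zP)
 have OmP: "Om:P" by(rule P_limit_closed[OF sumP lim])
 have rest: "Om - z n:P" for n
 proof(rule P_limit_closed)
  show "(SUM k:{..<m + Suc n} - {n}. z k):P" for m by(rule sumP)
  have "(%m. (SUM k<m + Suc n. z k) - z n) ----> Om - z n" by(intro tendsto_intros LIMSEQ_ignore_initial_segment lim)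
  moreover have "(SUM k<m + Suc n. z k) - z n = (SUM k:{..<m + Suc n} - {n}. z k)" for m
   by(subst sum.remove[of _ n]) auto
  ultimately show "(%m. SUM k:{..<m + Suc n} - {n}. z k) ----> Om - z n" by simp
 qed
 have kill: "b = 0" if b: "b:N" "adj b = b" "b*b = b" "b$$Om = 0" for b
 proof(rule tht[OF b(1)], rule ell2_eqI)
  fix n
  have "b$$z n = 0" by(rule projection_kills_summand[OF zP rest b(1-3)]) (use b(4) in simp)
  moreover have "0 < (1/2) ^ n / (1 + norm (q (coord tht n)))" by(simp add: add_pos_nonneg)
  ultimately have "b$$q (coord tht n) = 0" by(auto simp: z_def)
  thus "coord (amp b$$tht) n = coord 0 n" using q(2)[OF b(1-3)] by simp
 qed
 have "separating Om"
  unfolding separating_def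
 proof(intro ballI impI)
  fix a assume a: "a:N" "a$$Om = 0"
  define L where "L = closure ((%s. s$$Om) ` commutant N)"
  note L = ccsubspace_orbit[OF star_alg_N', where x = Om, folded L_def]
  have "cproj L:N"
   using cproj_in_commutant[OF L(1) star_algD(4)[OF star_alg_N'] L(3)] vn_commutant[OF vn] by blast
  hence "1 - cproj L = 0"
   by(intro kill) (auto intro: N_ops N_alg simp: cproj_adj[OF L(1)] cproj_idem[OF L(1)] algebra_simps cproj_id[OF L(1) L(2)])
  moreover have "a * cproj L = 0"
  proof(rule bop_eqI)
   have "L \<subseteq> {l. a$$l = 0}" unfolding L_def
   proof(rule closure_minimal)
    show "(%s. s$$Om) ` commutant N \<subseteq> {l. a$$l = 0}"
    proof clarify
     fix s assume "s:commutant N"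
     hence "a * s = s*a" using a by(simp add: commutant_def)
     hence "a$$s$$Om = s$$a$$Om" by(metis times_op_app)
     thus "a$$s$$Om = 0" using a(2) by simp
    qed
    show "closed {l. a$$l = 0}" by(intro closed_Collect_eq bounded_linear.continuous_on[OF op_app_bounded] continuous_intros)
   qed
   thus "(a * cproj L)$$x = 0$$x" for x using cproj_in[OF L(1), of x] by auto
  qed
  ultimately show "a = 0" by simp
 qed
 thus thesis using that OmP by blast
qed

text \<open>The real standard subspace of \<open>xi\<close>. Together with \<open>J\<close> it
  carries the modular theory in bounded form, in place of the unbounded Tomita operator.\<close>

definition sa_space :: "'a => 'a set" where
 "sa_space xi = closure {a$$xi | a. a:N & adj a = a}"

lemma sa_space: "subspace (sa_space xi)" "closed (sa_space xi)"
proof -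
 have "subspace {a$$xi | a. a:N & adj a = a}"
 proof(rule subspaceI)
  show "0:{a$$xi | a. a:N & adj a = a}" using N_ops(1) by force
  show "x + y:{a$$xi | a. a:N & adj a = a}"
   if "x:{a$$xi | a. a:N & adj a = a}" "y:{a$$xi | a. a:N & adj a = a}" for x y
  proof -
   from that obtain a b where "x = a$$xi" "y = b$$xi" "a:N" "b:N" "adj a = a" "adj b = b" by blast
   hence "x + y = (a + b)$$xi" "a + b:N" "adj (a + b) = a + b" by(simp_all add: N_ops)
   thus ?thesis by blast
  qed
  show "r *\<^sub>R x:{a$$xi | a. a:N & adj a = a}" if "x:{a$$xi | a. a:N & adj a = a}" for r x
  proof -
   from that obtain a where "x = a$$xi" "a:N" "adj a = a" by blast
   hence "r *\<^sub>R x = (cor r*.a)$$xi" "cor r*.a:N" "adj (cor r*.a) = cor r*.a"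
    by(simp_all add: N_ops)
   thus ?thesis by blast
  qed
 qed
 thus "subspace (sa_space xi)" "closed (sa_space xi)" by(simp_all add: sa_space_def closure_subspace)
qed

lemma sa_space_gen: "a:N ==> adj a = a ==> a$$xi:sa_space xi"
 unfolding sa_space_def by(rule closure_subset[THEN subsetD]) blast

lemma sa_space_induct:
 assumes "x:sa_space xi" "closed {x. Q x}" "!!a. a:N ==> adj a = a ==> Q (a$$xi)"
 shows "Q x"
proof -
 have "sa_space xi \<subseteq> {x. Q x}" unfolding sa_space_def using assms(2,3) by(intro closure_minimal) auto
 thus ?thesis using assms(1) by auto
qed

lemmas closed_rules = closed_Collect_eq closed_Collect_le continuous_on_cinner continuous_intros
 bounded_linear.continuous_on[OF bounded_linear_J] bounded_linear.continuous_on[OF op_app_bounded]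

text \<open>\<open>N\<^sub>s\<^sub>a \<xi> + i N'\<^sub>s\<^sub>a \<xi>\<close> is dense: a vector \<open>\<zeta>\<close> orthogonal to it in the real sense satisfies
 \<open>\<omega>\<^bsub>\<xi>+\<zeta>\<^esub> = \<omega>\<^bsub>\<xi>-\<zeta>\<^esub>\<close> on \<open>N\<close>, which yields a partial isometry \<open>v\<close> in the commutant with
 \<open>v(\<xi> + \<zeta>) = \<xi> - \<zeta>\<close>.\<close>

lemma real_density:
 assumes xi: "xi:P" "separating xi"
  and re: "!!a. a:N ==> adj a = a ==> Re (cinner ze (a$$xi)) = 0"
  and im: "!!a. a:N ==> adj a = a ==> Im (cinner ze (J (a$$xi))) = 0"
 shows "ze = 0"
proof -
 have sum0: "cinner (a$$ze) xi + cinner (a$$xi) ze = 0" if a: "a:N" for a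
 proof -
  have s: "cinner (b$$ze) xi + cinner (b$$xi) ze = 0" if b: "b:N" "adj b = b" for b
  proof -
   have "cinner (b$$ze) xi = cinner ze (b$$xi)" using cinner_adj[of b ze xi] b(2) by simp
   moreover have "cinner (b$$xi) ze = cnj (cinner ze (b$$xi))" by(rule cinner_commute)
   ultimately show ?thesis using re[OF b] by(simp add: complex_eq_iff)
  qed
  obtain b c where bc: "b:N" "c:N" "adj b = b" "adj c = c" "a = b + \<i>*.c"
   by(rule self_adjoint_parts[OF Nalg a]) (rule that)
  have "cinner (a$$ze) xi + cinner (a$$xi) ze =
    (cinner (b$$ze) xi + cinner (b$$xi) ze) + \<i>*(cinner (c$$ze) xi + cinner (c$$xi) ze)"
   unfolding bc(5) by(simp add: cinner_simps algebra_simps)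
  thus ?thesis using s[OF bc(1,3)] s[OF bc(2,4)] by simp
 qed
 have swap: "cinner (x$$ze) xi = cinner (x$$xi) ze" if x: "x:commutant N" for x
 proof -
  have s: "cinner (jop b$$ze) xi = cinner (jop b$$xi) ze" if b: "b:N" "adj b = b" for b
  proof -
   have "cinner (jop b$$ze) xi = cinner ze (jop b$$xi)" using cinner_adj[of "jop b" ze xi] b(2) by(simp add: adj_jop)
   moreover have "cinner (jop b$$xi) ze = cnj (cinner ze (jop b$$xi))" by(rule cinner_commute)
   moreover have "Im (cinner ze (jop b$$xi)) = 0" using im[OF b] by(simp add: jop_app P_J[OF xi(1)])
   ultimately show ?thesis by(simp add: complex_eq_iff)
  qed
  obtain a where a: "a:N" "x = jop a" using x by(auto simp: commutant_eq)
  obtain b c where bc: "b:N" "c:N" "adj b = b" "adj c = c" "a = b + \<i>*.c"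
   by(rule self_adjoint_parts[OF Nalg a(1)]) (rule that)
  show ?thesis using s[OF bc(1,3)] s[OF bc(2,4)]
   unfolding a(2) bc(5) by(simp add: jop_simps cinner_simps)
 qed
 define al be where "al = xi + ze" and "be = xi - ze"
 have gram: "cinner (a$$be) (b$$be) = cor 1 * cinner (a$$al) (b$$al)" if "a:N" "b:N" for a b
 proof -
  have c: "cinner (a$$x) (b$$y) = cinner ((adj b*a)$$x) y" for x y by(simp add: cinner_adj')
  show ?thesis using sum0[of "adj b*a"] N_alg(3,4) that
   unfolding c al_def be_def by(simp add: cinner_simps algebra_simps add_eq_0_iff)
 qed
 obtain v where v: "!!a. a:N ==> v$$a$$al = a$$be" "!!y. (!!a. a:N ==> cinner (a$$al) y = 0) ==> v$$y = 0"
  "!!y. norm (v$$y) <= sqrt 1*norm y"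
  by(rule gram_ext[of N "%a. a$$be" 1 "%a. a$$al"]) (use gram that in auto)
 define S where "S = (%a. a$$al) ` N \<union> {y. ALL a:N. cinner (a$$al) y = 0}"
 have S: "total S"
  unfolding total_def
 proof(intro allI impI)
  fix y assume y: "ALL x:S. cinner x y = 0"
  hence "y:S" by(auto simp: S_def)
  thus "y = 0" using y by auto
 qed
 have comm: "v * b = b * v" if b: "b:N" for b
 proof(rule bop_eq_on_total[OF S])
  fix x assume "x:S"
  then consider a where "a:N" "x = a$$al" | "!!a. a:N ==> cinner (a$$al) x = 0" by(auto simp: S_def)
  thus "(v * b)$$x = (b * v)$$x"
  proof cases
   case (1 a)
   thus ?thesis using v(1)[of "b*a"] v(1)[of a] N_alg(3)[OF b] by simp
  next
   case 2
   have "cinner (a$$al) (b$$x) = 0" if "a:N" for a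
    using 2[of "adj b*a"] N_alg(3,4) that b by(simp add: cinner_adj')
   thus ?thesis using v(2)[of "b$$x"] v(2)[of x] 2 by simp
  qed
 qed
 hence vN': "v:commutant N" by(auto simp: commutant_def)
 have v1: "v$$al = be" using v(1)[OF N_alg(2)] by simp
 have v2: "adj v$$be = al"
 proof -
  have "adj v$$be - al = 0"
  proof(rule totalD[OF S])
   fix y assume "y:S"
   then consider a where "a:N" "y = a$$al" | "!!a. a:N ==> cinner (a$$al) y = 0" by(auto simp: S_def)
   thus "cinner y (adj v$$be - al) = 0"
   proof cases
    case (1 a)
    thus ?thesis using v(1)[OF 1(1)] gram[OF 1(1) N_alg(2)] by(simp add: cinner_simps flip: cinner_adj)
   next
    case 2
    have "cinner al y = 0" using 2[OF N_alg(2)] by simp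
    hence "cinner y al = 0" by(subst cinner_commute) simp
    thus ?thesis using v(2)[OF 2] by(simp add: cinner_simps flip: cinner_adj)
   qed
  qed
  thus ?thesis by simp
 qed
 have e1: "ze + v$$ze = xi - v$$xi" using v1 by(simp add: al_def be_def algebra_simps)
 have e2: "ze + adj v$$ze = - (xi - adj v$$xi)" using v2 by(simp add: al_def be_def algebra_simps)
 \<comment> \<open>Swapping \<open>1 + v\<close> across the pairing of \<open>ze\<close> and
   \<open>xi\<close>, with \<open>ze\<close> eliminated by \<open>e1\<close> and \<open>e2\<close>,
   leaves \<open>cinner (v$$xi) xi = cinner xi xi\<close>; a contraction then fixes
   \<open>xi\<close>.\<close>
 have "1 + v:commutant N" by(intro star_alg_ops[OF star_alg_N'] star_algD[OF star_alg_N'] vN')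
 from swap[OF this] have "cinner (ze + v$$ze) xi = cinner xi (ze + adj v$$ze)"
  by(simp add: cinner_simps cinner_adj)
 hence "cinner (v$$xi) xi = cinner xi xi"
  unfolding e1 e2 by(simp add: cinner_simps cinner_adj)
 moreover have "norm (v$$xi) <= norm xi" using v(3)[of xi] by simp
 hence "(norm (v$$xi))^2 <= (norm xi)^2" by(rule power_mono) simp
 ultimately have "(norm (v$$xi - xi))^2 <= 0" by(simp add: norm_diff_sq Re_cinner_self)
 hence vxi: "v$$xi = xi" by simp
 have "v = 1"
 proof(rule bop_eq_on_total[OF total_orbit[OF xi]])
  fix x assume "x:(%a. a$$xi) ` N"
  then obtain a where a: "a:N" "x = a$$xi" by blast
  have "v$$a$$xi = a$$v$$xi" using comm[OF a(1)] by(metis times_op_app)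
  thus "v$$x = 1$$x" by(simp add: a(2) vxi)
 qed
 hence "2 *\<^sub>R ze = 0" using v1 by(simp add: al_def be_def algebra_simps scaleR_2)
 thus ?thesis by simp
qed

text \<open>One direction is the commutation of \<open>N\<close> with its mirror images
  \<open>jop a\<close>. Conversely, the difference of \<open>y\<close> and \<open>J\<close> applied
  to the projection of \<open>J y\<close> satisfies, after multiplication by \<open>\<i>\<close>,
  both conditions of \<open>real_density\<close>.\<close>

lemma sa_space_J_iff:
 assumes xi: "xi:P" "separating xi"
 shows "J y:sa_space xi \<longleftrightarrow> (ALL k:sa_space xi. Im (cinner y k) = 0)"
proof
 have 1: "Im (cinner (J k') k) = 0" if k': "k':sa_space xi" and k: "k:sa_space xi" for k k'
 proof(rule sa_space_induct[OF k'])
  show "closed {x. Im (cinner (J x) k) = 0}" by(intro closed_rules)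
  fix a assume a: "a:N" "adj a = a"
  show "Im (cinner (J (a$$xi)) k) = 0"
  proof(rule sa_space_induct[OF k])
   show "closed {x. Im (cinner (J (a$$xi)) x) = 0}" by(intro closed_rules)
   fix b assume b: "b:N" "adj b = b"
   have "jop a$$b$$xi = b$$jop a$$xi" using jop_commute[OF a(1) b(1)] by(metis times_op_app)
   thus "Im (cinner (J (a$$xi)) (b$$xi)) = 0" using cinner_adj[of "jop a" xi "b$$xi"] cinner_adj[of b xi "jop a$$xi"] a b cinner_commute[of "jop a$$xi" "b$$xi"] by(simp add: jop_app P_J[OF xi(1)] adj_jop complex_eq_iff)
  qed
 qed
 show "ALL k:sa_space xi. Im (cinner y k) = 0" if "J y:sa_space xi" using 1[OF that] by simp
 assume y: "ALL k:sa_space xi. Im (cinner y k) = 0"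
 define z where "z = rproj (sa_space xi) (J y)"
 have z: "z:sa_space xi" "!!k. k:sa_space xi ==> Re (cinner (J y - z) k) = 0"
  unfolding z_def using rproj[OF sa_space] by auto
 have "\<i>*.(y - J z) = 0"
 proof(rule real_density[OF xi])
  fix a assume a: "a:N" "adj a = a"
  note k = sa_space_gen[OF a, of xi]
  show "Re (cinner (\<i>*.(y - J z)) (a$$xi)) = 0"
   using y k 1[OF z(1) k] by(simp add: cinner_simps)
  have "cinner (y - J z) (J (a$$xi)) = cinner (a$$xi) (J y - z)"
   using J_cinner[of "J y - z" "a$$xi"] by simp
  hence "Re (cinner (y - J z) (J (a$$xi))) = 0" using z(2)[OF k] Re_cinner_commute by metis
  thus "Im (cinner (\<i>*.(y - J z)) (J (a$$xi))) = 0" by(simp add: cinner_simps)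
 qed
 thus "J y:sa_space xi" using z(1) by simp
qed

text \<open>The compression of \<open>J\<close> to the real subspace, where it is a symmetric
  positive contraction; it takes the place of the modular operator.\<close>

definition dmap :: "'a => 'a => 'a" where "dmap xi k = rproj (sa_space xi) (J k)"

lemma dmap_in: "dmap xi k:sa_space xi" unfolding dmap_def by(rule rproj_in[OF sa_space])
lemma dmap_diff: "dmap xi (k - l) = dmap xi k - dmap xi l" by(simp add: dmap_def rproj_diff[OF sa_space])
lemma norm_dmap: "norm (dmap xi k) <= norm k"
 using norm_rproj_le[OF sa_space, of xi "J k"] by(simp add: dmap_def)

lemma dmap_inner: "l:sa_space xi ==> Re (cinner (dmap xi k) l) = Re (cinner (J k) l)"
 using rproj_orth[OF sa_space, of l xi "J k"] by(simp add: dmap_def cinner_simps)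

lemma dmap_sym:
 assumes "k:sa_space xi" "l:sa_space xi"
 shows "Re (cinner (dmap xi k) l) = Re (cinner k (dmap xi l))"
by(metis assms dmap_inner J_swap[of k l] Re_cinner_commute)

lemma dmap_pos:
 assumes xi: "xi:P" and k: "k:sa_space xi"
 shows "0 <= Re (cinner (dmap xi k) k)"
 unfolding dmap_inner[OF k]
 by(rule sa_space_induct[OF k, where Q = "%k. 0 <= Re (cinner (J k) k)"]) (intro closed_rules, rule cinner_J_pos[OF xi])

text \<open>Positivity at \<open>k - dmap xi k\<close>, with the cubic term bounded by
  contractivity.\<close>

lemma dmap_sq:
 assumes xi: "xi:P" and k: "k:sa_space xi"
 shows "(norm (dmap xi k))^2 <= Re (cinner (dmap xi k) k)"
proof -
 let ?d = "dmap xi"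
 have "0 <= Re (cinner (?d (k - ?d k)) (k - ?d k))" by(metis subspace_diff[OF sa_space(1) k dmap_in] dmap_pos[OF xi])
 also have "... = Re (cinner (?d k) k) - 2*(norm (?d k))^2 + Re (cinner (?d (?d k)) (?d k))"
  using dmap_sym[OF dmap_in k, of k] by(simp add: dmap_diff cinner_simps Re_cinner_self)
 also have "Re (cinner (?d (?d k)) (?d k)) <= norm (?d k)*norm (?d k)"
  by(rule order_trans[OF Re_cinner_le]) (simp add: mult_right_mono norm_dmap)
 finally show ?thesis by(simp add: power2_eq_square)
qed

text \<open>Against the mirrored self-adjoint orbit of \<open>xi\<close> the real part vanishes
  because \<open>dmap xi k = 0\<close> and the imaginary part by \<open>sa_space_J_iff\<close>; that
  orbit spans a total set.\<close>

lemma dmap_inj: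
 assumes xi: "xi:P" "separating xi" and k: "k:sa_space xi" and 0: "dmap xi k = 0"
 shows "k = 0"
proof(rule totalD[OF total_commutant[OF xi(2)]])
 fix x assume "x:(%x. x$$xi) ` commutant N"
 then obtain a where a: "a:N" "x = jop a$$xi" by(auto simp: commutant_eq)
 have s: "cinner (J (b$$xi)) k = 0" if b: "b:N" "adj b = b" for b
 proof -
  note bk = sa_space_gen[OF b, of xi]
  have "Im (cinner (J (b$$xi)) k) = 0"
   using sa_space_J_iff[OF xi, of "J (b$$xi)"] bk k by simp
  moreover have "Re (cinner (J (b$$xi)) k) = 0"
   using dmap_inner[OF bk, of k] 0 J_swap[of k "b$$xi"] by simp
  ultimately show ?thesis by(simp add: complex_eq_iff)
 qed
 obtain b c where bc: "b:N" "c:N" "adj b = b" "adj c = c" "a = b + \<i>*.c"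
  by(rule self_adjoint_parts[OF Nalg a(1)]) (rule that)
 show "cinner x k = 0" using s[OF bc(1,3)] s[OF bc(2,4)]
  by(simp add: a(2) bc(5) jop_app P_J[OF xi(1)] cinner_simps)
qed

lemma total_dmap:
 assumes xi: "xi:P" "separating xi"
 shows "total (dmap xi ` sa_space xi)"
 unfolding total_def
proof(intro allI impI)
 fix y assume y: "ALL x:dmap xi ` sa_space xi. cinner x y = 0"
 have z0: "rproj (sa_space xi) z = 0" if z: "!!k. k:sa_space xi ==> Re (cinner (dmap xi k) z) = 0" for z
 proof(rule dmap_inj[OF xi rproj_in[OF sa_space]])
  let ?p = "rproj (sa_space xi) z"
  have "Re (cinner (dmap xi ?p) (dmap xi ?p)) = Re (cinner ?p (dmap xi (dmap xi ?p)))"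
   by(rule dmap_sym[OF rproj_in[OF sa_space] dmap_in])
  also have "... = Re (cinner z (dmap xi (dmap xi ?p)))"
   using rproj_orth[OF sa_space dmap_in, of z xi "dmap xi ?p"] by(simp add: cinner_simps)
  also have "... = 0" using z[OF dmap_in, of ?p] Re_cinner_commute by metis
  finally show "dmap xi ?p = 0" by(simp add: Re_cinner_self)
 qed
 have "rproj (sa_space xi) y = 0" by(rule z0) (use y in simp)
 moreover have "rproj (sa_space xi) (\<i>*.y) = 0" by(rule z0) (use y in \<open>simp add: cinner_simps\<close>)
 ultimately have yk: "Re (cinner y k) = 0" "Re (cinner (\<i>*.y) k) = 0" if "k:sa_space xi" for k
  using rproj_orth[OF sa_space that, of y] rproj_orth[OF sa_space that, of "\<i>*.y"] by simp_all
 have k0: "cinner k y = 0" if "k:sa_space xi" for k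
  using yk[OF that] by(subst cinner_commute) (simp add: cinner_simps complex_eq_iff)
 show "y = 0"
 proof(rule totalD[OF total_orbit[OF xi]])
  fix x assume "x:(%a. a$$xi) ` N"
  then obtain a where a: "a:N" "x = a$$xi" by blast
  obtain b c where bc: "b:N" "c:N" "adj b = b" "adj c = c" "a = b + \<i>*.c"
   by(rule self_adjoint_parts[OF Nalg a(1)]) (rule that)
  show "cinner x y = 0" using k0[OF sa_space_gen[OF bc(1,3)]] k0[OF sa_space_gen[OF bc(2,4)]]
   by(simp add: a(2) bc(5) cinner_simps)
 qed
qed

text \<open>Telescoping: by \<open>dmap_sq\<close> the squared norm of \<open>dmap xi (y n)\<close>
  is at most the drop from \<open>(norm (y n))^2\<close> to the next term, so these numbers are
  summable.\<close>

lemma dmap_iterate: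
 assumes xi: "xi:P" and k: "k:sa_space xi"
 shows "(%n. dmap xi (((%x. x - dmap xi x) ^^ n) k)) ----> 0"
proof -
 define y where "y n = ((%x. x - dmap xi x) ^^ n) k" for n
 have yS: "y (Suc n) = y n - dmap xi (y n)" for n by(simp add: y_def)
 have yK: "y n:sa_space xi" for n
  by(induction n) (simp_all add: y_def k subspace_diff[OF sa_space(1)] dmap_in)
 have step: "(norm (dmap xi (y n)))^2 <= (norm (y n))^2 - (norm (y (Suc n)))^2" for n
  using dmap_sq[OF xi yK[of n]] Re_cinner_commute[of "y n" "dmap xi (y n)"] by(simp add: yS norm_diff_sq)
 have sum: "(SUM i<n. (norm (dmap xi (y i)))\<^sup>2) <= (norm (y 0))^2 - (norm (y n))^2" for n
 proof(induction n)
  case (Suc n)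
  thus ?case using step[of n] by simp
 qed simp
 have "summable (%n. (norm (dmap xi (y n)))\<^sup>2)"
 proof(rule summableI_nonneg_bounded)
  show "(SUM i<n. (norm (dmap xi (y i)))\<^sup>2) <= (norm (y 0))^2" for n
   using sum[of n] zero_le_power2[of "norm (y n)"] by linarith
 qed simp
 hence "(%n. (norm (dmap xi (y n)))\<^sup>2) ----> 0" by(rule summable_LIMSEQ_zero)
 thus ?thesis by(simp add: y_def tendsto_norm_zero_iff)
qed

lemma rproj_intertwine:
 assumes "subspace K" "closed K" "subspace L" "closed L"
  and "!!k. k:K ==> u$$k:L" "!!l. l:L ==> adj u$$l:K"
 shows "rproj L (u$$y) = u$$rproj K y"
proof(rule rproj_unique[OF assms(3,4)])
 show "u$$rproj K y:L" by(intro assms rproj_in)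
 show "Re (cinner (u$$y - u$$rproj K y) l) = 0" if "l:L" for l
  using rproj_orth[OF assms(1,2) assms(6)[OF that], of y] by(simp add: cinner_adj flip: op_app_diff)
qed

text \<open>A bounded form of Takesaki's theorem on conditional expectations: \<open>u\<close> intertwines the squares
 of the positive maps \<open>dmap \<Omega>\<close> and \<open>dmap \<xi>\<close>, hence the maps themselves, hence it commutes with \<open>J\<close>.\<close>

theorem takesaki:
 assumes Om: "Om:P" "separating Om" and xi: "xi:P" "separating xi"
  and F: "!!a. a:N ==> adj a = a ==> EX b:N. adj b = b & u$$a$$Om = b$$xi"
  and Phi: "!!a. a:N ==> adj a = a ==> EX b:N. adj b = b & adj u$$a$$xi = b$$Om"
 shows "jop u = u"
proof -
 let ?K = "sa_space Om" and ?L = "sa_space xi"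
 have uK: "u$$k:?L" if "k:?K" for k
 proof(rule sa_space_induct[OF that])
  show "closed {x. u$$x:?L}"
   using continuous_closed_vimage[OF sa_space(2) linear_continuous_at[OF op_app_bounded]] by(simp only: vimage_def)
  show "u$$a$$Om:?L" if "a:N" "adj a = a" for a using F[OF that] sa_space_gen by metis
 qed
 have uL: "adj u$$k:?K" if "k:?L" for k
 proof(rule sa_space_induct[OF that])
  show "closed {x. adj u$$x:?K}"
   using continuous_closed_vimage[OF sa_space(2) linear_continuous_at[OF op_app_bounded]] by(simp only: vimage_def)
  show "adj u$$a$$xi:?K" if "a:N" "adj a = a" for a using Phi[OF that] sa_space_gen by metis
 qed
 have uJ: "J (u$$y):?L" if "J y:?K" for y
  using that uL by(simp add: sa_space_J_iff[OF Om] sa_space_J_iff[OF xi] cinner_adj)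
 have uJ': "J (adj u$$y):?K" if "J y:?L" for y
  using that uK by(simp add: sa_space_J_iff[OF Om] sa_space_J_iff[OF xi] cinner_adj)
 have Pu: "rproj ?L (u$$y) = u$$rproj ?K y" for y
  by(rule rproj_intertwine[OF sa_space sa_space uK uL])
 have JPJ: "J (rproj ?L (J (u$$y))) = u$$J (rproj ?K (J y))" for y
 proof -
  have "rproj ?L (J (u$$y)) = J (u$$J (rproj ?K (J y)))"
  proof(rule rproj_unique[OF sa_space])
   show "J (u$$J (rproj ?K (J y))):?L" by(rule uJ) (simp add: rproj_in[OF sa_space])
   fix l assume l: "l:?L"
   let ?z = "J (adj u$$J l)"
   have z: "?z:?K" by(rule uJ') (simp add: l)
   have "cinner (J (u$$y) - J (u$$J (rproj ?K (J y)))) l = cinner (J (u$$(y - J (rproj ?K (J y))))) l" by simp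
   also have "... = cinner (adj u$$J l) (y - J (rproj ?K (J y)))" by(metis J_swap cinner_adj')
   also have "... = cinner (J y - rproj ?K (J y)) ?z" using J_cinner[of "?z" "J y - rproj ?K (J y)"] by simp
   finally show "Re (cinner (J (u$$y) - J (u$$J (rproj ?K (J y)))) l) = 0"
    using rproj_orth[OF sa_space z, of "J y"] by simp
  qed
  thus ?thesis by simp
 qed
 \<comment> \<open>The square of \<open>dmap\<close> applies \<open>J\<close>, the projection,
   \<open>J\<close> and the projection; \<open>JPJ\<close> and \<open>Pu\<close> move
   \<open>u\<close> through these blocks.\<close>
 have ddu: "dmap xi (dmap xi (u$$k)) = u$$dmap Om (dmap Om k)" for k
  unfolding dmap_def by(simp add: JPJ Pu)
 define X where "X k = dmap xi (u$$k) - u$$dmap Om k" for k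
 have XL: "X k:?L" for k
  unfolding X_def by(intro subspace_diff[OF sa_space(1)] dmap_in uK)
 have Xd: "X (dmap Om k) = - dmap xi (X k)" for k by(simp add: X_def dmap_diff ddu)
 have Xdiff: "X (k - l) = X k - X l" for k l by(simp add: X_def dmap_diff)
 have Xbd: "norm (X k) <= 2 * opn u*norm k" for k
 proof -
  have "norm (X k) <= norm (dmap xi (u$$k)) + norm (u$$dmap Om k)" unfolding X_def by(rule norm_triangle_ineq4)
  also have "... <= norm (u$$k) + opn u*norm (dmap Om k)" by(intro add_mono norm_dmap norm_op_le)
  also have "... <= opn u*norm k + opn u*norm k" by(intro add_mono norm_op_le mult_left_mono norm_dmap opn_ge_0)
  finally show ?thesis unfolding mult_2 distrib_right .
 qed
 \<comment> \<open>As \<open>X\<close> anticommutes with the positive maps,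
   \<open>w (Suc n) = w n + dmap xi (w n)\<close> never decreases in norm, while
   \<open>dmap_iterate\<close> drives the arguments of \<open>X\<close> to zero; so
   \<open>w 0 = 0\<close>. This replaces the uniqueness of positive square roots.\<close>
 have Xd0: "X (dmap Om m) = 0" if m: "m:?K" for m
 proof -
  define y where "y n = ((%x. x - dmap Om x) ^^ n) m" for n
  define w where "w n = X (dmap Om (y n))" for n
  have wS: "w (Suc n) = w n + dmap xi (w n)" for n
  proof -
   have "w (Suc n) = X (dmap Om (y n)) - X (dmap Om (dmap Om (y n)))" by(simp add: w_def y_def dmap_diff Xdiff)
   thus ?thesis unfolding w_def Xd[of "dmap Om (y n)"] by simp
  qed
  have le: "norm (w n) <= norm (w (Suc n))" for n
  proof(rule power2_le_imp_le)
   have "0 <= Re (cinner (dmap xi (w n)) (w n))" unfolding w_def by(rule dmap_pos[OF xi(1) XL])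
   thus "(norm (w n))^2 <= (norm (w (Suc n)))^2"
    unfolding wS norm_add_sq by(subst Re_cinner_commute) simp
  qed simp
  have mono: "norm (w 0) <= norm (w n)" for n
  proof(induction n)
   case (Suc n)
   thus ?case using le[of n] by(rule order_trans)
  qed simp
  have "(%n. 2 * opn u*norm (dmap Om (y n))) ----> 0"
   unfolding y_def by(intro tendsto_mult_right_zero tendsto_norm_zero dmap_iterate[OF Om(1) m])
  hence "norm (w 0) <= 0"
  proof(rule LIMSEQ_le_const, intro exI allI impI)
   show "norm (w 0) <= 2 * opn u*norm (dmap Om (y n))" for n
    by(rule order_trans[OF mono[of n]]) (simp only: w_def Xbd)
  qed
  thus ?thesis by(simp add: w_def y_def)
 qed
 have X0: "X k = 0" if k: "k:?K" for k
 by(use dmap_inj[OF xi XL] Xd[of k] Xd0[OF k] in \<open>simp\<close>)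
 have "total (J ` dmap Om ` ?K)"
  unfolding total_def
 proof(intro allI impI)
  fix y assume y: "ALL x:J ` dmap Om ` ?K. cinner x y = 0"
  have "J y = 0"
  proof(rule totalD[OF total_dmap[OF Om]])
   fix x assume "x:dmap Om ` ?K"
   thus "cinner x (J y) = 0" using y J_cinner[of "J x" y] cinner_commute[of y "J x"] by auto
  qed
  hence "J (J y) = 0" by simp
  thus "y = 0" by(simp only: J_J)
 qed
 thus ?thesis
 proof(rule bop_eq_on_total)
  fix x assume "x:J ` dmap Om ` ?K"
  then obtain k where k: "k:?K" "x = J (dmap Om k)" by blast
  have "jop u$$x = J (dmap xi (u$$k))" using X0[OF k(1)] by(simp add: jop_app k(2) X_def)
  also have "... = u$$x" by(simp add: k(2) dmap_def JPJ)
  finally show "jop u$$x = u$$x" .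
 qed
qed

text \<open>The commutation condition places \<open>y = x$$xi\<close> in the symplectic complement
  of the real subspace, so \<open>J y\<close> lies in that subspace along with \<open>y\<close>.
  Then \<open>dmap\<close> exchanges \<open>y\<close> and \<open>J y\<close>, and its positivity at
  \<open>J y - y\<close> yields minus a squared norm.\<close>

lemma centralizer:
 assumes xi: "xi:P" "separating xi" and x: "x:N" "adj x = x"
  and c: "!!a. a:N ==> vfun xi (x*a) = vfun xi (a*x)"
 shows "J (x$$xi) = x$$xi"
proof -
 define y where "y = x$$xi"
 have yK: "y:sa_space xi" unfolding y_def by(rule sa_space_gen[OF x])
 have "Im (cinner y k) = 0" if "k:sa_space xi" for k
 proof(rule sa_space_induct[OF that])
  show "closed {k. Im (cinner y k) = 0}" by(intro closed_rules)
  fix a assume a: "a:N" "adj a = a"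
  have "cinner y (a$$xi) = vfun xi (a*x)" using cinner_adj[of a y xi] by(simp add: vfun_def y_def a(2))
  moreover have "cinner (a$$xi) y = vfun xi (x*a)" using cinner_adj[of x "a$$xi" xi] by(simp add: vfun_def y_def x(2))
  ultimately show "Im (cinner y (a$$xi)) = 0"
   using c[OF a(1)] cinner_commute[of y "a$$xi"] by(simp add: complex_eq_iff)
 qed
 hence JK: "J y:sa_space xi" by(simp add: sa_space_J_iff[OF xi])
 have dJy: "dmap xi (J y) = y" unfolding dmap_def by(simp add: rproj_id[OF sa_space yK])
 have "J y - y:sa_space xi" by(rule subspace_diff[OF sa_space(1) JK yK])
 from dmap_pos[OF xi(1) this] have "0 <= Re (cinner (y - J y) (J y - y))" by(metis dmap_def rproj_id[OF sa_space JK] dmap_diff dJy)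
 also have "... = - (norm (J y - y))\<^sup>2"
  using Re_cinner_self[of "J y - y"] by(simp add: cinner_simps)
 finally show ?thesis by(simp add: y_def)
qed

end

section \<open>Intertwiners between endomorphisms of a factor\<close>

locale factor_algebra =
 fixes M :: "'a::chilbert_space bop set"
 assumes fac: "factor M"
begin

lemma vnM: "von_neumann_algebra M" and one_neq_zero: "(1::'a bop) ~= 0"
 and center: "M \<inter> commutant M = range (%c. c*.1)"
 using fac by(auto simp: factor_def)

lemma Malg: "star_alg M" by(rule vn_star_alg[OF vnM])

lemmas M_sub [simp] = star_algD(2-4)[OF Malg] star_alg_ops(1-5)[OF Malg]
lemmas M_sum = star_alg_ops(6)[OF Malg]

lemma scalar_inject: "a*.(1::'a bop) = b*.1 \<longleftrightarrow> a = b"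
proof
 assume *: "a*.(1::'a bop) = b*.1"
 obtain x :: 'a where x: "x ~= 0" using one_neq_zero by(metis bop_eqI one_op_app zero_op_app)
 show "a = b" using arg_cong[OF *, of "%T. T$$x"] scaleC_add_left[of "a - b" b x] x by simp
qed simp

definition hom :: "('a bop => 'a bop) => bool" where
 "hom rho \<longleftrightarrow> (ALL x:M. rho x:M & rho (adj x) = adj (rho x) & (ALL c. rho (c*.x) = c*.rho x)) &
  (ALL x:M. ALL y:M. rho (x + y) = rho x + rho y & rho (x*y) = rho x*rho y) & rho 1 = 1"

lemma homD:
 assumes "hom rho"
 shows "x:M ==> rho x:M" "x:M ==> rho (adj x) = adj (rho x)" "x:M ==> rho (c*.x) = c*.rho x"
  "x:M ==> y:M ==> rho (x + y) = rho x + rho y" "x:M ==> y:M ==> rho (x*y) = rho x*rho y" "rho 1 = 1"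
 using assms by(auto simp: hom_def)

lemma hom_scalar: "hom rho ==> rho (c*.1) = c*.1"
 using homD(3)[of rho 1 c] homD(6)[of rho] by simp

lemma hom_endos: "rho:endos M ==> hom rho"
 unfolding hom_def using endosD[of rho M] by blast

lemma hom_comp: "hom rho ==> hom sig ==> hom (%x. rho (sig x))"
 unfolding hom_def by auto

lemma hom_id: "hom (%x. x)"
 unfolding hom_def by auto

lemma hom_minus: "hom rho ==> x:M ==> y:M ==> rho (x - y) = rho x - rho y"
 using homD(4)[of rho x "(- 1)*.y"] homD(3)[of rho y "-1"] by(simp add: bop_scaleC_simps)

lemma hom_zero: "hom rho ==> rho 0 = 0"
 using hom_minus[of rho 1 1] by simp

lemma hom_sum:
 assumes "hom rho" "!!i. i:I ==> f i:M"
 shows "rho (SUM i:I. f i) = (SUM i:I. rho (f i))"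
 using assms(2)
proof(induction I rule: infinite_finite_induct)
 case (insert i I)
 hence "(SUM i:I. f i):M" by(intro M_sum) auto
 thus ?case using insert homD(4)[OF assms(1)] by simp
qed (auto simp: hom_zero[OF assms(1)])

definition Hom :: "('a bop => 'a bop) => ('a bop => 'a bop) => 'a bop set" where
 "Hom rho sig = {T:M. ALL x:M. T*rho x = sig x*T}"

text \<open>Bridge from \<open>compose\<close> and the restricted identity to plain composition of
  functions: \<open>Hom\<close> sees only the values on \<open>M\<close>.\<close>

lemma intertwiners_Hom:
 "intertwiners M sig (compose M rho \<pi>) = Hom sig (%x. rho (\<pi> x))"
 "intertwiners M (compose M rho \<pi>) sig = Hom (%x. rho (\<pi> x)) sig"
 "intertwiners M (\<lambda>x\<in>M. x) (compose M rho \<pi>) = Hom (%x. x) (%x. rho (\<pi> x))"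
 "intertwiners M (compose M rho \<pi>) (compose M rho \<pi>) = Hom (%x. rho (\<pi> x)) (%x. rho (\<pi> x))"
 "intertwiners M rho sig = Hom rho sig"
 "intertwiners M (\<lambda>x\<in>M. x) (\<lambda>x\<in>M. x) = Hom (%x. x) (%x. x)"
 by(auto simp: intertwiners_def Hom_def compose_def)

lemma HomI: "T:M ==> (!!x. x:M ==> T*rho x = sig x*T) ==> T:Hom rho sig"
 by(simp add: Hom_def)

lemma HomD: "T:Hom rho sig ==> T:M" "T:Hom rho sig ==> x:M ==> T*rho x = sig x*T"
 by(simp_all add: Hom_def)

lemma Hom_shift: "T:Hom rho sig ==> x:M ==> T*(rho x*z) = sig x*(T*z)"
 using HomD(2)[of T rho sig x] by(simp flip: mult.assoc)

lemma Hom_adj: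
 assumes "T:Hom rho sig" "hom rho" "hom sig"
 shows "adj T:Hom sig rho"
proof(rule HomI)
 fix x assume x: "x:M"
 have "adj (T*rho (adj x)) = adj (sig (adj x)*T)" using HomD(2)[OF assms(1), of "adj x"] x by simp
 thus "adj T * sig x = rho x*adj T" using x by(simp add: homD[OF assms(2)] homD[OF assms(3)])
qed (use HomD(1)[OF assms(1)] in simp)

lemma Hom_mult: "S:Hom sig tau ==> T:Hom rho sig ==> S*T:Hom rho tau"
 by(rule HomI) (simp_all add: HomD(1), simp add: HomD(2)[of T] Hom_shift[of S] mult.assoc)

lemma Hom_lift: "hom \<pi> ==> hom rho ==> hom sig ==> T:Hom rho sig ==> \<pi> T:Hom (%x. \<pi> (rho x)) (%x. \<pi> (sig x))"
 by(rule HomI) (simp_all add: HomD(1) homD, simp add: HomD homD flip: homD(5))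

lemma Hom_restrict: "T:Hom rho sig ==> hom \<pi> ==> T:Hom (%x. rho (\<pi> x)) (%x. sig (\<pi> x))"
 unfolding Hom_def by(auto simp: homD)

lemma Hom_op_subspace: "op_subspace (Hom rho sig)"
 unfolding op_subspace_def Hom_def by(auto simp: algebra_simps)

lemma Hom_one: "1:Hom rho rho" by(simp add: Hom_def)

definition irr :: "('a bop => 'a bop) => bool" where
 "irr rho \<longleftrightarrow> Hom rho rho = range (%c. c*.1)"

lemma irrD: "irr rho ==> T:Hom rho rho ==> EX c. T = c*.1"
 by(auto simp: irr_def)

lemma irr_id: "irr (%x. x)"
 unfolding irr_def center[symmetric] by(auto simp: Hom_def commutant_def)

lemma adj_mult_scalar:
 assumes "adj T*T = c*.(1::'a bop)"
 shows "Im c = 0" "0 <= Re c" "(norm (T$$x))^2 = Re c*(norm x)^2" "T ~= 0 ==> 0 < Re c"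
proof -
 have *: "cor ((norm (T$$x))^2) = c * cor ((norm x)^2)" for x
  using adj_mult_self_app[of T x] assms by(simp add: cinner_scaleC_left cinner_self)
 obtain y :: 'a where y: "y ~= 0" using one_neq_zero by(metis bop_eqI one_op_app zero_op_app)
 have "c = cor ((norm (T$$y))^2 / (norm y)^2)" using *[of y] y by(simp add: field_simps)
 hence c: "c = cor (Re c)" and c0: "0 <= Re c" by(metis Re_complex_of_real, metis Re_complex_of_real zero_le_power2 divide_nonneg_nonneg)
 show 1: "(norm (T$$x))^2 = Re c*(norm x)^2" for x
  using *[of x] c by(metis of_real_eq_iff of_real_mult)
 show "Im c = 0" "0 <= Re c" using c c0 by(metis Im_complex_of_real, simp)
 show "0 < Re c" if "T ~= 0"
 proof(rule ccontr)
  assume "~ 0 < Re c"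
  hence "T$$x = 0" for x using 1[of x] c0 by(simp add: power2_eq_square)
  thus False using that by(metis bop_eqI zero_op_app)
 qed
qed

section \<open>Conjugate equations and partial traces\<close>

definition conj_eqs :: "('a bop => 'a bop) => ('a bop => 'a bop) => 'a bop => 'a bop => bool" where
 "conj_eqs rho rho' R R' \<longleftrightarrow> hom rho & hom rho' & R:Hom (%x. x) (%x. rho' (rho x)) & R':Hom (%x. x) (%x. rho (rho' x)) &
  adj R*rho' R' = 1 & adj R'*rho R = 1"

lemma conj_eqsD:
 assumes "conj_eqs rho rho' R R'"
 shows "hom rho" "hom rho'" "R:M" "R':M" "adj R*rho' R' = 1" "adj R'*rho R = 1"
  "x:M ==> R*x = rho' (rho x)*R" "x:M ==> R'*x = rho (rho' x)*R'"
  "x:M ==> adj R*rho' (rho x) = x*adj R" "x:M ==> adj R'*rho (rho' x) = x*adj R'"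
  "adj (rho' R')*R = 1" "adj (rho R)*R' = 1"
proof -
 note d = assms[unfolded conj_eqs_def]
 from d show h: "hom rho" "hom rho'" "R:M" "R':M" "adj R*rho' R' = 1" "adj R'*rho R = 1"
  "x:M ==> R*x = rho' (rho x)*R" "x:M ==> R'*x = rho (rho' x)*R'" by(simp_all add: Hom_def)
 show "x:M ==> adj R*rho' (rho x) = x*adj R"
  using HomD(2)[OF Hom_adj[OF _ hom_id hom_comp[OF h(2,1)]]] d by blast
 show "x:M ==> adj R'*rho (rho' x) = x*adj R'"
  using HomD(2)[OF Hom_adj[OF _ hom_id hom_comp[OF h(1,2)]]] d by blast
 show "adj (rho' R')*R = 1" using arg_cong[OF h(5), of adj] by simp
 show "adj (rho R)*R' = 1" using arg_cong[OF h(6), of adj] by simp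
qed

lemma conj_eqs_sym: "conj_eqs rho rho' R R' ==> conj_eqs rho' rho R' R"
 unfolding conj_eqs_def by simp

lemma conj_eqs_comp:
 assumes a: "conj_eqs a a' Ra Ra'" and b: "conj_eqs b b' Rb Rb'"
 shows "conj_eqs (%x. a (b x)) (%x. b' (a' x)) (b' Ra*Rb) (a Rb'*Ra')"
proof -
 note A = conj_eqsD[OF a] and B = conj_eqsD[OF b]
 have *: "b' Ra*Rb:Hom (%x. x) (%x. b' (a' (a (b x))))"
  if a: "conj_eqs a a' Ra Ra'" and b: "conj_eqs b b' Rb Rb'" for a a' Ra Ra' b b' Rb Rb'
 proof(rule HomI)
  note A = conj_eqsD[OF a] and B = conj_eqsD[OF b]
  show "b' Ra*Rb:M" by(simp add: A B homD(1)[OF B(2)])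
  fix x assume x: "x:M"
  have "b' Ra*Rb*x = b' Ra*(b' (b x)*Rb)" using B(7)[OF x] by(simp add: mult.assoc)
  also have "b' Ra*(b' (b x)*Rb) = b' (Ra*b x)*Rb" using x by(simp add: homD[OF B(2)] homD[OF B(1)] A(3) mult.assoc)
  also have "Ra*b x = a' (a (b x))*Ra" using x by(intro A homD[OF B(1)])
  also have "b' (a' (a (b x))*Ra)*Rb = b' (a' (a (b x)))*(b' Ra*Rb)"
   using x by(simp add: homD[OF B(2)] homD[OF B(1)] homD[OF A(1)] homD[OF A(2)] A(3) mult.assoc)
  finally show "b' Ra*Rb*x = b' (a' (a (b x)))*(b' Ra*Rb)" .
 qed
 have **: "adj (b' Ra*Rb)*b' (a' (a Rb'*Ra')) = 1"
  if a: "conj_eqs a a' Ra Ra'" and b: "conj_eqs b b' Rb Rb'" for a a' Ra Ra' b b' Rb Rb'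
 proof -
  note A = conj_eqsD[OF a] and B = conj_eqsD[OF b]
  have "adj (b' Ra*Rb)*b' (a' (a Rb'*Ra')) = adj Rb*b' (adj Ra*a' (a Rb')*a' Ra')"
   by(simp add: homD[OF B(2)] homD[OF A(2)] homD[OF A(1)] A(3,4) B(3,4) mult.assoc)
  also have "adj Ra*a' (a Rb') = Rb'*adj Ra" by(rule A(9)[OF B(4)])
  also have "Rb'*adj Ra*a' Ra' = Rb'" using A(5) by(simp add: mult.assoc)
  finally show ?thesis using B(5) by simp
 qed
 show ?thesis
  unfolding conj_eqs_def
  using *[OF a b] *[OF conj_eqs_sym[OF b] conj_eqs_sym[OF a]] **[OF a b] **[OF conj_eqs_sym[OF b] conj_eqs_sym[OF a]]
  by(simp add: hom_comp A B)
qed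

text \<open>\<open>W\<close> and \<open>W'\<close> are the two rotations of \<open>T\<close>,
  bending its legs to opposite sides. The zigzag equations express cups composed with
  \<open>T\<close> through them and turn \<open>adj T*T = 1\<close> into
  \<open>adj W'*W = 1\<close>.\<close>

lemma transposed_isometry:
 assumes t: "conj_eqs t t' R R'" and c: "conj_eqs c c' S S'" and T: "T:Hom c t" and iso: "adj T*T = 1"
 defines "W \<equiv> t' (adj S'*adj T)*R" and "W' \<equiv> adj S * c' (adj T*R')"
 shows "W:Hom c' t'" "W':Hom c' t'" "t' (adj T)*R = W*S" "adj T*R' = c W'*S'"
  "adj W'*W = 1" "adj W'*R = c' T*S"
proof -
 note t' = conj_eqsD[OF t] and c' = conj_eqsD[OF c]
 note h = homD[OF t'(1)] homD[OF t'(2)] homD[OF c'(1)] homD[OF c'(2)]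
 have TM [simp]: "T:M" by(rule HomD[OF T])
 note Ms [simp] = t'(3,4) c'(3,4)
 have Ta: "adj T:Hom t c" by(rule Hom_adj[OF T c'(1) t'(1)])
 have shift: "adj T*t x = c x*adj T" "T * c x = t x*T" if "x:M" for x
  using HomD(2)[OF Ta that] HomD(2)[OF T that] by auto
 show "W:Hom c' t'"
 proof(rule HomI)
  show "W:M" by(simp add: W_def h)
  fix x assume x [simp]: "x:M"
  have "W * c' x = t' (adj S'*adj T)*(R * c' x)" by(simp add: W_def mult.assoc)
  also have "R * c' x = t' (t (c' x))*R" by(rule t') (simp add: h)
  also have "t' (adj S'*adj T)*(t' (t (c' x))*R) = t' (adj S'*(adj T*t (c' x)))*R"
   by(simp add: h mult.assoc)
  also have "adj T*t (c' x) = c (c' x)*adj T" by(rule shift) (simp add: h)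
  also have "adj S'*(c (c' x)*adj T) = x*(adj S'*adj T)" using c'(10)[OF x] by(simp add: mult.assoc[symmetric])
  also have "t' (x*(adj S'*adj T))*R = t' x*W" by(simp add: W_def h mult.assoc)
  finally show "W * c' x = t' x*W" .
 qed
 show "W':Hom c' t'"
 proof(rule HomI)
  show "W':M" by(simp add: W'_def h)
  fix x assume x [simp]: "x:M"
  have "W' * c' x = adj S * c' (adj T*(R'*x))" by(simp add: W'_def h mult.assoc)
  also have "R'*x = t (t' x)*R'" by(rule t') simp
  also have "adj T*(t (t' x)*R') = c (t' x)*(adj T*R')" using shift(1)[of "t' x"] by(simp add: h mult.assoc[symmetric])
  also have "adj S * c' (c (t' x)*(adj T*R')) = (adj S * c' (c (t' x))) * c' (adj T*R')" by(simp add: h mult.assoc)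
  also have "adj S * c' (c (t' x)) = t' x*adj S" by(rule c') (simp add: h)
  finally show "W' * c' x = t' x*W'" by(simp add: W'_def mult.assoc)
 qed
 have "W*S = t' (adj S'*adj T)*(R*S)" by(simp add: W_def mult.assoc)
 also have "R*S = t' (t S)*R" by(rule t') simp
 also have "t' (adj S'*adj T)*(t' (t S)*R) = t' (adj S'*(adj T*t S))*R" by(simp add: h mult.assoc)
 also have "adj T*t S = c S*adj T" by(rule shift) simp
 also have "adj S'*(c S*adj T) = adj T" using c'(6) by(simp add: mult.assoc[symmetric])
 finally show "t' (adj T)*R = W*S" by simp
 have "c W'*S' = adj (c S)*(c (c' (adj T*R'))*S')" by(simp add: W'_def h mult.assoc)
 also have "c (c' (adj T*R'))*S' = S'*(adj T*R')" by(rule c'(8)[symmetric]) simp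
 also have "adj (c S)*(S'*(adj T*R')) = adj T*R'" using c'(12) by(simp add: mult.assoc[symmetric])
 finally show "adj T*R' = c W'*S'" by simp
 have "adj W'*R = c' (adj R'*T)*(S*R)" by(simp add: W'_def h mult.assoc)
 also have "S*R = c' (c R)*S" by(rule c') simp
 also have "c' (adj R'*T)*(c' (c R)*S) = c' (adj R'*(T * c R))*S" by(simp add: h mult.assoc)
 also have "T * c R = t R*T" by(rule shift) simp
 also have "adj R'*(t R*T) = T" using t'(6) by(simp add: mult.assoc[symmetric])
 finally show 6: "adj W'*R = c' T*S" .
 have "adj W'*W = (adj W'*t' (adj S'*adj T))*R" by(simp add: W_def mult.assoc)
 also have "adj W'*t' (adj S'*adj T) = c' (adj S'*adj T)*adj W'"
  using HomD(2)[OF Hom_adj[OF \<open>W' \<in> Hom c' t'\<close> c'(2) t'(2)], of "adj S'*adj T"] by simp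
 also have "c' (adj S'*adj T)*adj W'*R = c' (adj S'*adj T)*(c' T*S)" by(simp add: 6 mult.assoc)
 also have "... = c' (adj S'*(adj T*T))*S" by(simp add: h mult.assoc)
 also have "... = 1" using c'(11) by(simp add: iso h)
 finally show "adj W'*W = 1" .
qed

text \<open>The left partial trace; \<open>right_trace_Hom\<close> is its mirror image, and by
  \<open>traces_eq\<close> the order of the two does not matter.\<close>

lemma left_trace_Hom:
 assumes a: "conj_eqs a a' Ra Ra'" and b: "hom b" and X: "X:Hom (%x. a (b x)) (%x. a (b x))"
 shows "adj Ra*a' X*Ra:Hom b b"
proof(rule HomI)
 note A = conj_eqsD[OF a]
 have XM [simp]: "X:M" by(rule HomD[OF X])
 note h = homD[OF A(1)] homD[OF A(2)] homD[OF b]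
 show "adj Ra*a' X*Ra:M" by(simp add: A h)
 fix x assume x [simp]: "x:M"
 have "adj Ra*a' X*Ra*b x = adj Ra*a' (X*a (b x))*Ra" using A(7)[of "b x"] by(simp add: h mult.assoc)
 also have "X*a (b x) = a (b x)*X" by(rule HomD(2)[OF X x])
 also have "adj Ra*a' (a (b x)*X)*Ra = (adj Ra*a' (a (b x)))*a' X*Ra" by(simp add: h mult.assoc)
 also have "adj Ra*a' (a (b x)) = b x*adj Ra" by(rule A) (simp add: h)
 finally show "adj Ra*a' X*Ra*b x = b x*(adj Ra*a' X*Ra)" by(simp add: mult.assoc)
qed

lemma right_trace_Hom:
 assumes a: "hom a" and b: "conj_eqs b b' Rb Rb'" and X: "X:Hom (%x. a (b x)) (%x. a (b x))"
 shows "adj (a Rb')*X*a Rb':Hom a a"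
proof(rule HomI)
 note B = conj_eqsD[OF b]
 have XM [simp]: "X:M" by(rule HomD[OF X])
 note h = homD[OF a] homD[OF B(1)] homD[OF B(2)]
 show "adj (a Rb')*X*a Rb':M" by(simp add: B(4) h)
 fix x assume x [simp]: "x:M"
 have "adj (a Rb')*X*a Rb'*a x = adj (a Rb')*X*a (Rb'*x)" by(simp add: B(4) h mult.assoc)
 also have "Rb'*x = b (b' x)*Rb'" by(rule B) simp
 also have "adj (a Rb')*X*a (b (b' x)*Rb') = adj (a Rb')*(X*a (b (b' x)))*a Rb'" by(simp add: B(4) h mult.assoc)
 also have "X*a (b (b' x)) = a (b (b' x))*X" by(rule HomD(2)[OF X]) (simp add: h)
 also have "adj (a Rb')*(a (b (b' x))*X)*a Rb' = a (adj Rb'*b (b' x))*X*a Rb'" by(simp add: B(4) h mult.assoc)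
 also have "adj Rb'*b (b' x) = x*adj Rb'" by(rule B) simp
 finally show "adj (a Rb')*X*a Rb'*a x = a x*(adj (a Rb')*X*a Rb')" by(simp add: B(4) h mult.assoc)
qed

lemma traces_eq:
 assumes a: "conj_eqs a a' Ra Ra'" and b: "conj_eqs b b' Rb Rb'" and X: "X:Hom (%x. a (b x)) (%x. a (b x))"
 shows "adj Ra*a' (adj (a Rb')*X*a Rb')*Ra = adj Rb'*(adj Ra*a' X*Ra)*Rb'"
proof -
 note A = conj_eqsD[OF a] and B = conj_eqsD[OF b]
 have XM [simp]: "X:M" by(rule HomD[OF X])
 note h = homD[OF A(1)] homD[OF A(2)]
 have 1: "a' (a Rb')*Ra = Ra*Rb'" by(rule A(7)[symmetric]) (rule B)
 have 2: "adj Ra*adj (a' (a Rb')) = adj Rb'*adj Ra" using arg_cong[OF 1, of adj] by simp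
 have "adj Ra*a' (adj (a Rb')*X*a Rb')*Ra = (adj Ra*adj (a' (a Rb')))*a' X*(a' (a Rb')*Ra)"
  by(simp add: h B mult.assoc)
 thus ?thesis by(simp add: 1 2 mult.assoc)
qed

section \<open>Normalised solutions and the trace formula\<close>

definition std :: "('a bop => 'a bop) => ('a bop => 'a bop) => 'a bop => 'a bop => real => bool" where
 "std rho rho' R R' d \<longleftrightarrow> conj_eqs rho rho' R R' & irr rho & irr rho' &
  adj R*R = cor d*.1 & adj R'*R' = cor d*.1"

lemma stdD:
 assumes "std rho rho' R R' d"
 shows "conj_eqs rho rho' R R'" "irr rho" "irr rho'" "adj R*R = cor d*.1" "adj R'*R' = cor d*.1"
 using assms by(simp_all add: std_def)

lemma std_sym: "std rho rho' R R' d ==> std rho' rho R' R d"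
 unfolding std_def using conj_eqs_sym by auto

text \<open>Cauchy-Schwarz for the zigzag equation, both factors of which have squared norm
  \<open>d\<close>.\<close>

lemma std_ge_1:
 assumes "std rho rho' R R' d"
 shows "1 <= d"
proof -
 note s = stdD[OF assms] and C = conj_eqsD[OF stdD(1)[OF assms]]
 obtain x :: 'a where x: "x ~= 0" using one_neq_zero by(metis bop_eqI one_op_app zero_op_app)
 have n1: "(norm (R$$x))^2 = d*(norm x)^2" using adj_mult_scalar(3)[OF s(4)] by simp
 have n2: "(norm (rho' R'$$x))^2 = d*(norm x)^2" using arg_cong[OF s(5), of rho'] homD[OF C(2)] C(4) hom_scalar[OF C(2)] adj_mult_scalar(3) by fastforce
 have d: "0 <= d" using adj_mult_scalar(2)[OF s(4)] by simp
 have "cor ((norm x)^2) = cinner ((adj R*rho' R')$$x) x" using C(5) by(simp add: cinner_self)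
 also have "... = cinner (rho' R'$$x) (R$$x)" by(simp add: cinner_adj)
 finally have "(norm x)^2 = cmod (cinner (rho' R'$$x) (R$$x))" by(metis norm_of_real abs_of_nonneg zero_le_power2)
 also have "... <= norm (rho' R'$$x)*norm (R$$x)" by(rule cmod_cinner_mult_le)
 also have "... = sqrt (d*(norm x)^2) * sqrt (d*(norm x)^2)" using n1 n2 by(metis norm_ge_zero real_sqrt_unique)
 also have "... = d*(norm x)^2" using d by simp
 finally show ?thesis using x by simp
qed

text \<open>The squared distance of \<open>W'$$x\<close> and \<open>W$$x\<close> is
  \<open>2*(w - 1)*(norm x)^2\<close>, which gives the bound and its equality case.\<close>

lemma isometry_product:
 assumes W: "adj W*W = cor w*.(1::'a bop)" and W': "adj W'*W' = cor w*.1" and one: "adj W'*W = 1"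
 shows "1 <= w" "w = 1 ==> W' = W"
proof -
 obtain x :: 'a where x: "x ~= 0" using one_neq_zero by(metis bop_eqI one_op_app zero_op_app)
 have n: "(norm (W$$x))^2 = w*(norm x)^2" "(norm (W'$$x))^2 = w*(norm x)^2" for x
  using adj_mult_scalar(3)[OF W] adj_mult_scalar(3)[OF W'] by simp_all
 have i: "cinner (W'$$x) (W$$x) = cor ((norm x)^2)" for x
 proof -
  have "cinner (W$$x) (W'$$x) = cinner ((adj W'*W)$$x) x" by(simp add: cinner_adj)
  thus ?thesis by(subst cinner_commute) (simp add: one cinner_self)
 qed
 have dn: "(norm (W'$$x - W$$x))^2 = 2*(w - 1)*(norm x)^2" for x
  by(simp add: norm_diff_sq n i algebra_simps)
 hence "0 <= 2*(w - 1)*(norm x)^2" by(metis zero_le_power2)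
 thus "1 <= w" using x by(simp add: zero_le_mult_iff)
 show "W' = W" if "w = 1"
  by(rule bop_eqI) (use dn that in simp)
qed

text \<open>Irreducibility turns \<open>adj W*W\<close>, \<open>adj W'*W'\<close> and both partial
  traces of \<open>T*adj T\<close> into scalars. Evaluating the full trace from either side relates
  them, and \<open>traces_eq\<close> shows that the two rotations have the same squared norm
  \<open>w\<close>; \<open>isometry_product\<close> then gives \<open>1 <= w\<close>.\<close>

lemma trace_lower_bound:
 assumes a: "std a a' Ra Ra' da" and b: "std b b' Rb Rb' db" and c: "std c c' Rc Rc' dc"
  and T: "T:Hom c (%x. a (b x))" and iso: "adj T*T = 1"
 obtains W W' l th w where "W:Hom c' (%x. b' (a' x))" "W':Hom c' (%x. b' (a' x))"
  "adj W*W = cor w*.1" "adj W'*W' = cor w*.1" "adj W'*W = 1"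
  "b' (a' (adj T))*(b' Ra*Rb) = W*Rc" "adj T*(a Rb'*Ra') = c W'*Rc'" "adj W'*(b' Ra*Rb) = c' T*Rc"
  "adj Ra*a' (T*adj T)*Ra = cor l*.1" "adj (a Rb')*(T*adj T)*a Rb' = cor th*.1"
  "l*db = w*dc" "th*da = w*dc"
proof -
 note A = conj_eqsD[OF stdD(1)[OF a]] and B = conj_eqsD[OF stdD(1)[OF b]] and C = conj_eqsD[OF stdD(1)[OF c]]
 define R where "R = b' Ra*Rb"
 define R' where "R' = a Rb'*Ra'"
 have t: "conj_eqs (%x. a (b x)) (%x. b' (a' x)) R R'" unfolding R_def R'_def by(rule conj_eqs_comp[OF stdD(1)[OF a] stdD(1)[OF b]])
 define W where "W = b' (a' (adj Rc'*adj T))*R"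
 define W' where "W' = adj Rc * c' (adj T*R')"
 note tr = transposed_isometry[OF t stdD(1)[OF c] T iso, folded W_def W'_def]
 have TM [simp]: "T:M" by(rule HomD[OF T])
 note Ms [simp] = A(3,4) B(3,4) C(3,4)
 note h = homD[OF A(1)] homD[OF A(2)] homD[OF B(1)] homD[OF B(2)] homD[OF C(1)] homD[OF C(2)]
 have [simp]: "W:M" "W':M" using HomD[OF tr(1)] HomD[OF tr(2)] by auto
 have hh: "hom (%x. b' (a' x))" "hom (%x. a (b x))" using A B by(auto intro: hom_comp)
 have TT: "T*adj T:Hom (%x. a (b x)) (%x. a (b x))"
  by(rule Hom_mult[OF T Hom_adj[OF T C(1) hh(2)]])
 obtain w where w: "adj W*W = w*.1" using irrD[OF stdD(3)[OF c] Hom_mult[OF Hom_adj[OF tr(1) C(2) hh(1)] tr(1)]] by auto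
 obtain w' where w': "adj W'*W' = w'*.1" using irrD[OF stdD(3)[OF c] Hom_mult[OF Hom_adj[OF tr(2) C(2) hh(1)] tr(2)]] by auto
 obtain l where l: "adj Ra*a' (T*adj T)*Ra = l*.1" using irrD[OF stdD(2)[OF b] left_trace_Hom[OF stdD(1)[OF a] B(1) TT]] by auto
 obtain th where th: "adj (a Rb')*(T*adj T)*a Rb' = th*.1" using irrD[OF stdD(2)[OF a] right_trace_Hom[OF A(1) stdD(1)[OF b] TT]] by auto
 note sc = bop_scaleC_simps bop_scaleC_mult scalar_inject
 have l2: "adj R*b' (a' (T*adj T))*R = adj Rb*b' (adj Ra*a' (T*adj T)*Ra)*Rb"
  by(simp add: R_def h mult.assoc)
 have "adj R*b' (a' (T*adj T))*R = adj (b' (a' (adj T))*R)*(b' (a' (adj T))*R)" by(simp add: h mult.assoc)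
 also have "... = adj Rc*(adj W*W)*Rc" using tr(3) by(simp add: mult.assoc)
 also have "... = (w*dc)*.1" using stdD(4)[OF c] by(simp add: w sc)
 finally have "adj R*b' (a' (T*adj T))*R = (w*dc)*.1" .
 moreover have "adj R*b' (a' (T*adj T))*R = (l*db)*.1"
  unfolding l2 l using stdD(4)[OF b] by(simp add: hom_scalar[OF B(2)] sc)
 ultimately have e1: "l*db = w*dc" by(simp add: sc)
 have "adj R'*(T*adj T)*R' = adj (adj T*R')*(adj T*R')" by(simp add: mult.assoc)
 also have "... = adj Rc' * c (adj W'*W')*Rc'" using tr(4) by(simp add: h mult.assoc)
 also have "... = (w'*dc)*.1" using stdD(5)[OF c] by(simp add: w' hom_scalar[OF C(1)] sc)
 finally have "adj Ra'*(adj (a Rb')*(T*adj T)*a Rb')*Ra' = (w'*dc)*.1" by(simp add: R'_def mult.assoc)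
 hence e2: "th*da = w'*dc" using stdD(5)[OF a] by(simp add: th sc)
 have d: "1 <= da" "1 <= db" "1 <= dc" by(rule std_ge_1, fact)+
 have "w' = w" using traces_eq[OF stdD(1)[OF a] stdD(1)[OF b] TT] stdD(4)[OF a] stdD(5)[OF b] e1 e2 d by(simp add: l th hom_scalar[OF A(2)] sc)
 have wr: "w = cor (Re w)" using adj_mult_scalar(1)[OF w] by(simp add: complex_eq_iff)
 have lr: "l = cor (Re w*dc / db)" using e1 d wr by(simp add: field_simps)
 have thr: "th = cor (Re w*dc / da)" using e2 d wr \<open>w' = w\<close> by(simp add: field_simps)
 show thesis
 proof(rule that)
  show "W:Hom c' (%x. b' (a' x))" "W':Hom c' (%x. b' (a' x))" "adj W'*W = 1" by fact+
  show "adj W*W = cor (Re w)*.1" using w wr by simp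
  show "adj W'*W' = cor (Re w)*.1" using w' wr \<open>w' = w\<close> by simp
  show "b' (a' (adj T))*(b' Ra*Rb) = W*Rc" "adj T*(a Rb'*Ra') = c W'*Rc'" "adj W'*(b' Ra*Rb) = c' T*Rc"
   using tr(3,4,6) by(simp_all add: R_def R'_def)
  show "adj Ra*a' (T*adj T)*Ra = cor (Re w*dc / db)*.1" using l lr by simp
  show "adj (a Rb')*(T*adj T)*a Rb' = cor (Re w*dc / da)*.1" using th thr by simp
  show "Re w*dc / db*db = Re w*dc" "Re w*dc / da*da = Re w*dc" using d by simp_all
 qed
qed

text \<open>Rotating \<open>T\<close> to an intertwiner from \<open>a\<close> to \<open>c b'\<close> gives the lower bound for the inverse ratio.\<close>

lemma trace_isometry:
 assumes a: "std a a' Ra Ra' da" and b: "std b b' Rb Rb' db" and c: "std c c' Rc Rc' dc"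
  and T: "T:Hom c (%x. a (b x))" and iso: "adj T*T = 1"
 obtains W where "W:Hom c' (%x. b' (a' x))" "adj W*W = 1"
  "b' (a' (adj T))*(b' Ra*Rb) = W*Rc" "adj T*(a Rb'*Ra') = c W*Rc'" "adj W*(b' Ra*Rb) = c' T*Rc"
  "adj Ra*a' (T*adj T)*Ra = cor (dc / db)*.1"
  "adj (a Rb')*(T*adj T)*a Rb' = cor (dc / da)*.1"
proof -
 note A = conj_eqsD[OF stdD(1)[OF a]] and B = conj_eqsD[OF stdD(1)[OF b]] and C = conj_eqsD[OF stdD(1)[OF c]]
 have TM [simp]: "T:M" by(rule HomD[OF T])
 note Ms [simp] = A(3,4) B(3,4) C(3,4)
 note h = homD[OF A(1)] homD[OF A(2)] homD[OF B(1)] homD[OF B(2)] homD[OF C(1)] homD[OF C(2)]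
 have d: "1 <= da" "1 <= db" "1 <= dc" by(rule std_ge_1, fact)+
 obtain W W' l th w where W: "W:Hom c' (%x. b' (a' x))" "W':Hom c' (%x. b' (a' x))"
  "adj W*W = cor w*.1" "adj W'*W' = cor w*.1" "adj W'*W = 1"
  "b' (a' (adj T))*(b' Ra*Rb) = W*Rc" "adj T*(a Rb'*Ra') = c W'*Rc'" "adj W'*(b' Ra*Rb) = c' T*Rc"
  and l: "adj Ra*a' (T*adj T)*Ra = cor l*.1" and th: "adj (a Rb')*(T*adj T)*a Rb' = cor th*.1"
  and e: "l*db = w*dc" "th*da = w*dc"
  by(rule trace_lower_bound[OF a b c T iso]) (rule that)
 have w1: "1 <= w" by(rule isometry_product(1)[OF W(3-5)])
 \<comment> \<open>The rotated intertwiner has squared norm \<open>th\<close>, the right trace;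
   hence the normalisation \<open>1 / sqrt th\<close> of \<open>T1\<close>.\<close>
 define Z where "Z = adj T*a Rb'"
 have Ta: "adj T:Hom (%x. a (b x)) c" using Hom_adj[OF T C(1)] hom_comp[OF A(1) B(1)] by simp
 have ZZ: "adj Z*Z = cor th*.1" using th by(simp add: Z_def mult.assoc)
 have Rb'H: "Rb':Hom (%x. x) (%x. b (b' x))" using stdD(1)[OF b] by(simp add: conj_eqs_def)
 have Z: "Z:Hom a (%x. c (b' x))"
  unfolding Z_def using Hom_mult[OF Hom_restrict[OF Ta B(2)] Hom_lift[OF A(1) hom_id hom_comp[OF B(1,2)] Rb'H]] by simp
 have th0: "0 < th" using e(2) w1 d by(smt (verit) mult_pos_pos zero_less_mult_pos2)
 define r where "r = cor (1 / sqrt th)"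
 have r: "cnj r*r = cor (1 / th)" "r * cnj r = cor (1 / th)"
  using th0 by(simp_all add: r_def of_real_mult[symmetric] del: of_real_mult of_real_divide)
 define T1 where "T1 = r*.Z"
 have T1: "T1:Hom a (%x. c (b' x))" unfolding T1_def by(rule op_subspaceD(3)[OF Hom_op_subspace Z])
 have T1iso: "adj T1*T1 = 1" using ZZ th0 by(simp add: T1_def bop_scaleC_simps r mult.assoc[symmetric] of_real_mult[symmetric] del: of_real_mult of_real_divide)
 obtain w2 th2 where th2: "adj (c Rb)*(T1*adj T1) * c Rb = cor th2*.1" "th2*dc = w2*da" and w2: "1 <= w2"
 proof(rule trace_lower_bound[OF c std_sym[OF b] a T1 T1iso])
  fix W W' :: "'a bop" and l th' w
  assume *: "adj W*W = cor w*.1" "adj W'*W' = cor w*.1" "adj W'*W = 1"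
   "adj (c Rb)*(T1*adj T1) * c Rb = cor th'*.1" "th'*dc = w*da"
  show thesis by(rule that[OF *(4,5)]) (rule isometry_product(1)[OF *(1-3)])
 qed
 \<comment> \<open>Rotating back recovers \<open>adj T\<close>, so the trace belonging to
   \<open>T1\<close> is the reciprocal of \<open>th\<close>.\<close>
 have "adj (c Rb)*Z = c (adj Rb)*adj T*a Rb'" by(simp add: Z_def h mult.assoc)
 also have "c (adj Rb)*adj T = adj T*a (b (adj Rb))" using HomD(2)[OF Ta, of "adj Rb"] by simp
 also have "adj T*a (b (adj Rb))*a Rb' = adj T*a (adj (b Rb)*Rb')" by(simp add: h mult.assoc)
 also have "... = adj T" using B(12) by(simp add: h)
 finally have cZ: "adj (c Rb)*Z = adj T" .
 have "adj (c Rb)*(T1*adj T1) * c Rb = cor (1 / th)*.((adj (c Rb)*Z)*adj (adj (c Rb)*Z))"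
  by(simp add: T1_def bop_scaleC_simps r mult.assoc)
 also have "... = cor (1 / th)*.1" by(simp add: cZ iso)
 finally have "cor th2 = cor (1 / th)" using th2(1) by(simp only: scalar_inject)
 hence "th2 = 1 / th" by(simp only: of_real_eq_iff)
 hence "th2*th = 1" using th0 by simp
 moreover have "w2*th*da = dc*(th2*th)" using th2(2) by(simp add: mult_ac)
 ultimately have "dc = w2*th*da" by simp
 also have "... = w2 * w*dc" using e(2) by simp
 \<comment> \<open>Both factors are at least \<open>1\<close>, so both lower bounds are
   attained.\<close>
 finally have "w2 * w = 1" using d by simp
 moreover have "1 * w <= w2 * w" by(rule mult_right_mono) (use w1 w2 in auto)
 ultimately have "w = 1" using w1 by simp
 have "W' = W" by(rule isometry_product(2)[OF W(3-5) \<open>w = 1\<close>])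
 have ll: "l = dc / db" "th = dc / da" using e d \<open>w = 1\<close> by(simp_all add: field_simps)
 show thesis
 proof(rule that)
  show "W:Hom c' (%x. b' (a' x))" "b' (a' (adj T))*(b' Ra*Rb) = W*Rc" by(fact W)+
  show "adj W*W = 1" using W(3) unfolding \<open>w = 1\<close> by(simp add: bop_scaleC_simps)
  show "adj T*(a Rb'*Ra') = c W*Rc'" by(rule W(7)[unfolded \<open>W' = W\<close>])
  show "adj W*(b' Ra*Rb) = c' T*Rc" by(rule W(8)[unfolded \<open>W' = W\<close>])
  show "adj Ra*a' (T*adj T)*Ra = cor (dc / db)*.1" using l unfolding ll .
  show "adj (a Rb')*(T*adj T)*a Rb' = cor (dc / da)*.1" using th unfolding ll .
 qed
qed

end

lemma bessel:
 assumes "finite A" and T: "!!i j. i:A ==> j:A ==> adj (T i)*T j = (if i = j then 1 else (0::'a::chilbert_space bop))"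
 shows "(SUM i:A. (norm (adj (T i)$$y))\<^sup>2) <= (norm y)^2"
  and "y = (SUM i:A. T i$$adj (T i)$$y) ==> (norm y)^2 = (SUM i:A. (norm (adj (T i)$$y))\<^sup>2)"
proof -
 define z where "z = (SUM i:A. T i$$adj (T i)$$y)"
 have Tz: "adj (T i)$$z = adj (T i)$$y" if "i:A" for i
 proof -
  have "adj (T i)$$z = (SUM j:A. (adj (T i)*T j)$$adj (T j)$$y)" by(simp add: z_def op_app_sum)
  also have "... = (SUM j:A. if j = i then adj (T j)$$y else 0)" by(intro sum.cong) (auto simp: T that simp flip: times_op_app)
  finally show ?thesis using assms(1) that by simp
 qed
 have yz: "Re (cinner y z) = (SUM i:A. (norm (adj (T i)$$y))\<^sup>2)" by(simp add: z_def cinner_sum_right cinner_adj' cinner_self)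
 have "cinner z z = (SUM i:A. cinner (adj (T i)$$z) (adj (T i)$$y))" by(subst (2) z_def) (simp add: cinner_sum_right cinner_adj')
 also have "... = (SUM i:A. cinner (adj (T i)$$y) (adj (T i)$$y))" by(intro sum.cong) (simp_all add: Tz)
 finally have zz: "(norm z)^2 = (SUM i:A. (norm (adj (T i)$$y))\<^sup>2)"
  unfolding Re_cinner_self[symmetric] by(simp add: cinner_self)
 have "0 <= (norm (y - z))^2" by simp
 thus "(SUM i:A. (norm (adj (T i)$$y))\<^sup>2) <= (norm y)^2" by(simp add: norm_diff_sq yz zz)
 show "(norm y)^2 = (SUM i:A. (norm (adj (T i)$$y))\<^sup>2)" if "y = (SUM i:A. T i$$adj (T i)$$y)"
  using zz that by(simp add: z_def[symmetric])
qed

text \<open>Stands in for the spectral theorem. If only \<open>0\<close> and \<open>1\<close> were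
  projections, the kernel projection of \<open>B + c\<close>, with \<open>B\<close> the absolute
  value of \<open>c\<close>, would make every self-adjoint \<open>c\<close> positive or negative;
  then a self-adjoint element equals its greatest scalar lower bound, and the commutant is
  scalar.\<close>

lemma nontrivial_projection:
 fixes S :: "'a::chilbert_space bop set"
 assumes S: "!!x. x:S ==> adj x:S" and ns: "commutant S ~= range (%c. c*.1)" and ne: "(1::'a bop) ~= 0"
 obtains e where "e:commutant S" "adj e = e" "e*e = e" "e ~= 0" "e ~= 1"
proof(rule ccontr)
 assume "~ thesis"
 hence triv: "e = 0 | e = 1" if "e:commutant S" "adj e = e" "e*e = e" for e
  using that \<open>\<And>e. \<lbrakk>e \<in> commutant S; adj e = e; e * e = e; e \<noteq> 0; e \<noteq> 1\<rbrakk> \<Longrightarrow> thesis\<close> by blast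
 have SA: "star_alg (commutant S)" by(rule star_alg_commutant) (rule S)
 note N = star_algD[OF SA] star_alg_ops[OF SA]
 have dich: "pos_op c | pos_op (- c)" if c: "c:commutant S" "adj c = c" for c
 proof -
  obtain B where B: "pos_op B" "B*B = adj c * c" "!!R. R*(adj c * c) = (adj c * c)*R ==> R*B = B*R"
   by(rule pos_op_sqrt[OF pos_op_adj_mult[of c]]) (rule that)
  have cc: "adj c * c = c * c" by(simp add: c)
  have BN: "B:commutant S"
   unfolding commutant_def
  proof(intro CollectI ballI)
   fix x assume x: "x:S"
   show "B*x = x*B" using commutantD[OF c(1) x] B(3)[of x] cc by(metis mult.assoc)
  qed
  define L where "L = {v. (B + c)$$v = 0}"
  have L: "ccsubspace L"
  proof(rule ccsubspaceI)
   show "closed L" unfolding L_def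
    by(intro closed_Collect_eq linear_continuous_on op_app_bounded continuous_on_const)
  qed (auto simp: L_def op_app_add[of "B + c"] simp del: plus_op_app)
  have e: "cproj L:commutant S"
  proof(rule cproj_in_commutant[OF L S])
   fix x v assume x: "x:S" and v: "v:L"
   have "(B + c)$$x$$v = x$$(B + c)$$v" by(metis commutantD[OF _ x] N BN c times_op_app)
   thus "x$$v:L" using v by(simp add: L_def del: plus_op_app)
  qed
  have zero: "(B + c)*(B - c) = 0" by(use B(3) in \<open>simp add: c mult.assoc algebra_simps B(2) cc\<close>)
  from triv[OF e] consider "cproj L = 0" | "cproj L = 1" using L by auto
  thus ?thesis
  proof cases
   case 1
   have "(B - c)$$v = 0" for v
   proof -
    have "(B + c)$$(B - c)$$v = 0" using zero by(metis times_op_app zero_op_app)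
    hence "(B - c)$$v:L" by(simp add: L_def del: plus_op_app)
    hence "cproj L$$(B - c)$$v = (B - c)$$v" by(rule cproj_id[OF L])
    thus ?thesis using 1 by simp
   qed
   hence "B - c = 0" by(intro bop_eqI) simp
   thus ?thesis using B(1) by simp
  next
   case 2
   have "(B + c)$$v = 0" for v using cproj_in[OF L, of v] 2 by(simp add: L_def)
   hence "B + c = 0" by(intro bop_eqI) simp
   thus ?thesis using B(1) by(metis add_eq_0_iff2)
  qed
 qed
 obtain x0 :: 'a where x0: "x0 ~= 0" using ne by(metis bop_eqI one_op_app zero_op_app)
 have sc: "EX l. b = l*.1" if b: "b:commutant S" "adj b = b" for b
 proof -
  define q where "q v = Re (cinner (b$$v) v)" for v
  have qi: "Im (cinner (b$$v) v) = 0" for v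
   using cinner_adj[of b v v] b(2) cinner_commute[of "b$$v" v] by(metis cnj.sel(2) neg_equal_zero)
  have qb: "\<bar>q v\<bar> <= opn b*(norm v)^2" for v
  proof -
   have "\<bar>q v\<bar> <= cmod (cinner (b$$v) v)" unfolding q_def by(rule abs_Re_le_cmod)
   also have "... <= norm (b$$v)*norm v" by(rule cmod_cinner_mult_le)
   also have "... <= opn b*norm v * norm v" by(intro mult_right_mono norm_op_le) simp
   finally show ?thesis by(simp add: power2_eq_square mult.assoc)
  qed
  define A where "A = {l. ALL v. l*(norm v)^2 <= q v}"
  have Ane: "- opn b:A" unfolding A_def mem_Collect_eq
  proof
   fix v show "- opn b*(norm v)^2 <= q v" using qb[of v] by simp
  qed
  have Abd: "l <= q v / (norm v)^2" if "l:A" "v ~= 0" for l v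
   using that by(simp add: A_def field_simps)
  have bdd: "bdd_above A" using Abd[OF _ x0] by(intro bdd_aboveI) blast
  define l0 where "l0 = Sup A"
  have lower: "l0*(norm v)^2 <= q v" for v
  proof(cases "v = 0")
   case False
   have "l0 <= q v / (norm v)^2" unfolding l0_def by(rule cSup_least) (use Ane Abd False in auto)
   thus ?thesis using False by(simp add: field_simps)
  qed (simp add: q_def)
  have posq: "pos_op (b - cor l*.1) \<longleftrightarrow> l:A" for l
   by(auto simp: pos_op_iff A_def cinner_simps cinner_self qi q_def[symmetric] cinner_scaleR_left)
  have up: "q v <= l*(norm v)^2" if "l > l0" for l v
  proof -
   have "l ~: A" using that cSup_upper[OF _ bdd] unfolding l0_def by(meson not_le)
   moreover have "pos_op (b - cor l*.1) | pos_op (- (b - cor l*.1))"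
    by(rule dich) (use b N in \<open>auto simp: bop_scaleC_simps\<close>)
   ultimately have "pos_op (- (b - cor l*.1))" using posq by blast
   thus ?thesis by(simp add: pos_op_iff q_def cinner_simps cinner_self cinner_scaleR_left)
  qed
  \<comment> \<open>For \<open>l > l0\<close> the element \<open>b - cor l*.1\<close> is not
    positive, hence negative; \<open>l\<close> is taken close to \<open>l0\<close>, depending on
    \<open>v\<close>.\<close>
  have upper: "q v <= l0*(norm v)^2" for v
  proof(rule field_le_epsilon)
   fix e :: real assume e: "0 < e"
   have "q v <= (l0 + e / ((norm v)^2 + 1))*(norm v)^2" by(rule up) (use e in \<open>simp add: add_nonneg_pos\<close>)
   also have "... = l0*(norm v)^2 + e*((norm v)^2 / ((norm v)^2 + 1))" by(simp add: algebra_simps)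
   also have "... <= l0*(norm v)^2 + e*1" proof(intro add_left_mono mult_left_mono)
    show "(norm v)^2 / ((norm v)^2 + 1) <= 1" by(subst divide_le_eq_1) (simp add: add_nonneg_pos)
   qed (use e in simp)
   finally show "q v <= l0*(norm v)^2 + e" by simp
  qed
  define X where "X = b - cor l0*.1"
  have X: "pos_op X" using lower posq[of l0] unfolding X_def A_def by blast
  have "q v = l0*(norm v)^2" for v by(rule order.antisym[OF upper lower])
  hence X0: "Re (cinner (X$$v) v) = 0" for v
   by(simp add: X_def q_def cinner_simps cinner_self cinner_scaleR_left)
  have "X$$v = 0" for v using pos_op_contraction(1)[OF X, of v] X0 by simp
  hence "X = 0" by(intro bop_eqI) simp
  thus ?thesis unfolding X_def by auto
 qed
 have "commutant S \<subseteq> range (%c. c*.1)"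
 proof
  fix a assume "a:commutant S"
  then obtain b c where bc: "b:commutant S" "c:commutant S" "adj b = b" "adj c = c" "a = b + \<i>*.c"
   by(rule self_adjoint_parts[OF SA]) (rule that)
  obtain k l where "b = k*.1" "c = l*.1" using sc bc by metis
  hence "a = (k + \<i>*l)*.1" using bc(5) by(simp add: bop_scaleC_simps)
  thus "a:range (%c. c*.1)" by blast
 qed
 moreover have "range (%c. c*.1) \<subseteq> commutant S" using N(2,7) by auto
 ultimately show False using ns by blast
qed

subsection \<open>Orthonormal families of intertwiners\<close>

text \<open>Indexed variant of \<open>orthonormal_basis\<close>, since rotations and products of
  basis elements are naturally families.\<close>

definition onfam :: "'a::chilbert_space bop set => 'x set => ('x => 'a bop) => bool" where
 "onfam V I f \<longleftrightarrow> finite I & f ` I \<subseteq> V & (ALL i:I. ALL j:I. adj (f i)*f j = (if i = j then 1 else 0)) &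
  (ALL X:V. EX c. X = (SUM i:I. c i*.f i))"

lemma onfamD:
 assumes "onfam V I f"
 shows "finite I" "i:I ==> f i:V" "i:I ==> j:I ==> adj (f i)*f j = (if i = j then 1 else 0)"
  "X:V ==> (SUM i:I. f i*(adj (f i)*X)) = X"
proof -
 show fin: "finite I" and "i:I ==> f i:V" and on: "!!i j. i:I ==> j:I ==> adj (f i)*f j = (if i = j then 1 else 0)"
  using assms by(auto simp: onfam_def)
 assume "X:V"
 then obtain c where c: "X = (SUM i:I. c i*.f i)" using assms unfolding onfam_def by blast
 have "adj (f i)*X = c i*.1" if "i:I" for i
 proof -
  have "adj (f i)*X = (SUM j:I. if j = i then c i*.1 else 0)"
   unfolding c sum_distrib_left by(intro sum.cong) (auto simp: bop_scaleC_simps on that)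
  thus ?thesis using fin that by simp
 qed
 thus "(SUM i:I. f i*(adj (f i)*X)) = X" using c by simp
qed

definition sesq :: "('a::chilbert_space bop => 'a bop => 'b::chilbert_space bop) => bool" where
 "sesq tau \<longleftrightarrow> (ALL x x' y. tau (x + x') y = tau x y + tau x' y) & (ALL x y y'. tau x (y + y') = tau x y + tau x y') &
  (ALL c x y. tau (c*.x) y = c*.tau x y) & (ALL c x y. tau x (c*.y) = cnj c*.tau x y)"

lemma sesqD:
 assumes "sesq tau"
 shows "tau (x + x') y = tau x y + tau x' y" "tau x (y + y') = tau x y + tau x y'"
  "tau (c*.x) y = c*.tau x y" "tau x (c*.y) = cnj c*.tau x y"
  "tau 0 y = 0" "tau x 0 = 0"
  "tau (SUM i:I. g i) y = (SUM i:I. tau (g i) y)" "tau x (SUM i:I. g i) = (SUM i:I. tau x (g i))"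
proof -
 show 1: "tau (x + x') y = tau x y + tau x' y" "tau x (y + y') = tau x y + tau x y'"
  "tau (c*.x) y = c*.tau x y" "tau x (c*.y) = cnj c*.tau x y" for x x' y y' c
  using assms by(simp_all add: sesq_def)
 show z: "tau 0 y = 0" "tau x 0 = 0" for x y using 1(1)[of 0 0 y] 1(2)[of x 0 0] by simp_all
 show "tau (SUM i:I. g i) y = (SUM i:I. tau (g i) y)"
  by(induction I rule: infinite_finite_induct) (simp_all add: 1 z)
 show "tau x (SUM i:I. g i) = (SUM i:I. tau x (g i))"
  by(induction I rule: infinite_finite_induct) (simp_all add: 1 z)
qed

lemma sesq_inner: "sesq (%x y. adj y*x)"
 by(simp add: sesq_def algebra_simps bop_scaleC_simps)

text \<open>The change of basis is unitary and cancels in a sesquilinear diagonal. With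
  \<open>tensor_j\<close> for \<open>tau\<close>, two bases of one space of intertwiners already
  give an identity between sums like \<open>Ttilde\<close>.\<close>

lemma onfam_sesq_unique:
 assumes f: "onfam V I f" and g: "onfam V K g" and tau: "sesq tau"
 shows "(SUM i:I. tau (f i) (f i)) = (SUM k:K. tau (g k) (g k))"
proof -
 note F = onfamD[OF f] and G = onfamD[OF g] and t = sesqD[OF tau]
 have "EX c. ALL k:K. g k = (SUM i:I. c k i*.f i)"
  using f G(2) unfolding onfam_def by(intro bchoice) blast
 then obtain c where c: "!!k. k:K ==> g k = (SUM i:I. c k i*.f i)" by blast
 have fg: "adj (f i)*g k = c k i*.1" if "i:I" "k:K" for i k
 proof -
  have "adj (f i)*g k = (SUM j:I. if j = i then c k i*.1 else 0)"
   unfolding c[OF that(2)] sum_distrib_left by(intro sum.cong) (auto simp: bop_scaleC_simps F(3) that)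
  thus ?thesis using F(1) that by simp
 qed
 have gf: "adj (g k)*f i = cnj (c k i)*.1" if "i:I" "k:K" for i k
  using arg_cong[OF fg[OF that], of adj] by simp
 have fe: "f i = (SUM k:K. cnj (c k i)*.g k)" if "i:I" for i
 proof -
  show ?thesis using G(4)[OF F(2)[OF that]] by(simp add: gf that bop_scaleC_simps)
 qed
 have "(SUM k:K. tau (g k) (g k)) = (SUM k:K. SUM i:I. c k i*.tau (f i) (g k))"
 proof(intro sum.cong refl)
  fix k assume k: "k:K"
  show "tau (g k) (g k) = (SUM i:I. c k i*.tau (f i) (g k))" using c[OF k] by(simp add: t(3,7))
 qed
 also have "... = (SUM i:I. SUM k:K. c k i*.tau (f i) (g k))" by(rule sum.swap)
 also have "... = (SUM i:I. tau (f i) (f i))"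
 proof(intro sum.cong refl)
  fix i assume i: "i:I"
  show "(SUM k:K. c k i*.tau (f i) (g k)) = tau (f i) (f i)" using fe[OF i] by(simp add: t(4,8))
 qed
 finally show ?thesis by simp
qed

text \<open>\<open>Phi\<close> is antilinear and scales inner products by \<open>k\<close> while
  exchanging their arguments; dividing by \<open>sqrt k\<close> restores orthonormality.\<close>

lemma onfam_transfer:
 assumes f: "onfam V I f" and k: "0 < k"
  and on: "!!X Y. X:V ==> Y:V ==> adj (Phi X)*Phi Y = cor k*.(adj Y*X)"
  and add: "!!X Y. X:V ==> Y:V ==> Phi (X + Y) = Phi X + Phi Y"
  and sc: "!!c X. X:V ==> Phi (c*.X) = cnj c*.Phi X" and V: "op_subspace V"
  and into: "!!X. X:V ==> Phi X:V'" and onto: "!!Y. Y:V' ==> EX X:V. Y = Phi X"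
  and V': "op_subspace V'"
 shows "onfam V' I (%i. cor (1 / sqrt k)*.Phi (f i))"
 unfolding onfam_def
proof(intro conjI ballI)
 note F = onfamD[OF f]
 define r where "r = cor (1 / sqrt k)"
 have r: "cnj r*(r * cor k) = 1" "r*(cnj r * cor k) = 1" "r ~= 0"
  using k by(simp_all add: r_def of_real_mult[symmetric] del: of_real_mult of_real_divide)
 show "finite I" by(rule F)
 show "(%i. r*.Phi (f i)) ` I \<subseteq> V'" using op_subspaceD(3)[OF V'] into F(2) by blast
 have sum: "Phi (SUM i:J. X i) = (SUM i:J. Phi (X i))" if "!!i. i:J ==> X i:V" for X and J :: "'b set"
  using that
 proof(induction J rule: infinite_finite_induct)
  show "Phi (sum X {}) = (SUM i:{}. Phi (X i))" using sc[OF op_subspaceD(1)[OF V], of 0] by(simp add: bop_scaleC_simps)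
  thus "infinite J ==> Phi (sum X J) = (SUM i:J. Phi (X i))" for J by simp
 next
  case (insert i J)
  hence "(SUM i:J. X i):V" by(intro op_subspaceD(6)[OF V]) auto
  thus ?case using insert add by simp
 qed
 show "adj (r*.Phi (f i))*r*.Phi (f j) = (if i = j then 1 else 0)" if "i:I" "j:I" for i j
  using r by(auto simp: bop_scaleC_simps on F(2) F(3) that)
 fix Y assume "Y:V'"
 then obtain X where X: "X:V" "Y = Phi X" using onto by blast
 obtain c where c: "X = (SUM i:I. c i*.f i)" using f X(1) unfolding onfam_def by blast
 have "Y = (SUM i:I. cnj (c i)*.Phi (f i))"
  using F(2) by(simp add: X(2) c sum sc op_subspaceD(3)[OF V])
 also have "... = (SUM i:I. (cnj (c i) / r)*.r*.Phi (f i))" using r(3) by(simp add: bop_scaleC_simps)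
 finally show "EX c. Y = (SUM i:I. c i*.r*.Phi (f i))" by(rule exI[of _ "%i. cnj (c i) / r"])
qed

context factor_algebra begin

text \<open>Polarisation turns the trace formula for isometries into orthogonality of the rotated intertwiners.\<close>

lemma polarisation_on:
 assumes V: "op_subspace V"
  and b1: "!!X Y Z. X:V ==> Y:V ==> Z:V ==> be (X + Y) Z = be X Z + be Y Z"
  and b2: "!!X Y Z. X:V ==> Y:V ==> Z:V ==> be Z (X + Y) = be Z X + be Z Y"
  and b3: "!!k X Z. X:V ==> Z:V ==> be (k*.X) Z = k*.be X Z"
  and b4: "!!k X Z. X:V ==> Z:V ==> be Z (k*.X) = cnj k*.be Z X"
  and sc: "!!X. X:V ==> EX c. adj X*X = c*.(1::'a bop)"
  and iso: "!!X. X:V ==> adj X*X = 1 ==> be X X = k*.(1::'a bop)"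
  and X: "X:V" and Y: "Y:V"
 shows "be X Y = k*.(adj Y*X)"
proof -
 note v = op_subspaceD[OF V]
 have diag: "be X X = k*.(adj X*X)" if X: "X:V" for X
 proof(cases "X = 0")
  case False
  obtain c where c: "adj X*X = c*.1" using sc[OF X] by blast
  define r where "r = cor (sqrt (Re c))"
  have c0: "0 < Re c" by(rule adj_mult_scalar(4)[OF c False])
  have cr: "c = cor (Re c)" using adj_mult_scalar(1)[OF c] by(simp add: complex_eq_iff)
  have r: "r ~= 0" "r * cnj r = c" "cnj r = r"
   using c0 cr by(simp_all add: r_def of_real_mult[symmetric] del: of_real_mult)
  define Z where "Z = (1 / r)*.X"
  have XZ: "X = r*.Z" using r(1) by(simp add: Z_def bop_scaleC_simps)
  have "Z:V" unfolding Z_def by(rule v(3)[OF X])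
  moreover have "adj Z*Z = 1" using r c0 cr by(auto simp: Z_def bop_scaleC_simps c power2_eq_square)
  ultimately have "be Z Z = k*.1" by(rule iso)
  thus ?thesis unfolding XZ using \<open>adj Z * Z = 1\<close> \<open>Z \<in> V\<close> by(simp add: b3 b4 v bop_scaleC_simps mult_ac)
 next
  case True
  thus ?thesis using b3[OF X X, of 0] by(simp add: bop_scaleC_simps)
 qed
 define D where "D x y = be x y - k*.(adj y*x)" for x y
 have D0: "D x x = 0" if "x:V" for x using diag[OF that] by(simp add: D_def)
 have "D (X + Y) (X + Y) = 0" by(intro D0 v X Y)
 hence 1: "D X Y + D Y X = 0" using D0[OF X] D0[OF Y] X Y by(simp add: D_def b1 b2 b3 b4 v algebra_simps bop_scaleC_simps)
 have "D (\<i>*.X + Y) (\<i>*.X + Y) = 0" by(intro D0 v X Y)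
 hence "\<i>*.D X Y - \<i>*.D Y X = 0"
  using D0[OF X] D0[OF Y] X Y by(simp add: D_def b1 b2 b3 b4 v algebra_simps bop_scaleC_simps)
 hence "\<i>*.\<i>*.D X Y = \<i>*.\<i>*.D Y X" by simp
 hence "D X Y = D Y X" by(simp add: bop_scaleC_simps)
 hence "(1 + 1)*.D X Y = 0" using 1 by(simp only: bop_scaleC_simps(2,5))
 hence "(1/2)*.(1 + 1)*.D X Y = 0" by(simp only: bop_scaleC_simps(7))
 thus ?thesis by(simp add: bop_scaleC_simps(4,5) D_def)
qed

text \<open>The rotation \<open>X \<mapsto> adj X*a Rb'\<close> is inverted by bending the leg of
  \<open>b\<close> back. Its scale \<open>dc / da\<close> is the partial trace of
  \<open>trace_isometry\<close>, extended from isometries to pairs by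
  \<open>polarisation_on\<close>.\<close>

lemma frobenius_right:
 assumes a: "std a a' Ra Ra' da" and b: "std b b' Rb Rb' db" and c: "std c c' Rc Rc' dc"
  and f: "onfam (Hom c (%x. a (b x))) I f"
 shows "onfam (Hom a (%x. c (b' x))) I (%i. cor (1 / sqrt (dc / da))*.(adj (f i)*a Rb'))"
proof(rule onfam_transfer[OF f])
 note A = conj_eqsD[OF stdD(1)[OF a]] and B = conj_eqsD[OF stdD(1)[OF b]] and C = conj_eqsD[OF stdD(1)[OF c]]
 note Ms [simp] = A(3,4) B(3,4) C(3,4)
 note h = homD[OF A(1)] homD[OF B(1)] homD[OF B(2)] homD[OF C(1)]
 let ?V = "Hom c (%x. a (b x))"
 have Vab: "hom (%x. a (b x))" "hom (%x. c (b' x))" using A B C by(auto intro: hom_comp)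
 show "0 < dc / da" using std_ge_1[OF a] std_ge_1[OF c] by simp
 show "op_subspace ?V" "op_subspace (Hom a (%x. c (b' x)))" by(rule Hom_op_subspace)+
 show "adj (X + Y)*a Rb' = adj X*a Rb' + adj Y*a Rb'" for X Y :: "'a bop" by(simp add: algebra_simps)
 show "adj (k*.X)*a Rb' = cnj k*.(adj X*a Rb')" for k and X :: "'a bop" by simp
 show "adj (adj X*a Rb')*(adj Y*a Rb') = cor (dc / da)*.(adj Y*X)" if X: "X:?V" and Y: "Y:?V" for X Y
 proof -
  have "adj (a Rb')*(X*adj Y)*a Rb' = cor (dc / da)*.(adj Y*X)"
  proof(rule polarisation_on[where be = "%X Y. adj (a Rb')*(X*adj Y)*a Rb'", OF Hom_op_subspace _ _ _ _ _ _ X Y])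
   show "EX c. adj X*X = c*.1" if "X:?V" for X
    using irrD[OF stdD(2)[OF c] Hom_mult[OF Hom_adj[OF that C(1) Vab(1)] that]] .
   show "adj (a Rb')*(X*adj X)*a Rb' = cor (dc / da)*.1" if "X:?V" "adj X*X = 1" for X
    by(rule trace_isometry[OF a b c that])
  qed (simp_all add: algebra_simps bop_scaleC_simps)
  thus ?thesis by(simp add: mult.assoc)
 qed
 have Rb'H: "Rb':Hom (%x. x) (%x. b (b' x))" and RbH: "Rb:Hom (%x. x) (%x. b' (b x))" using stdD(1)[OF b] by(simp_all add: conj_eqs_def)
 show "adj X*a Rb':Hom a (%x. c (b' x))" if X: "X:?V" for X
  using Hom_mult[OF Hom_restrict[OF Hom_adj[OF X C(1) Vab(1)] B(2)] Hom_lift[OF A(1) hom_id hom_comp[OF B(1,2)] Rb'H]] by simp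
 show "EX X:?V. Y = adj X*a Rb'" if Y: "Y:Hom a (%x. c (b' x))" for Y
 proof
  have YM: "Y:M" by(rule HomD[OF Y])
  have "adj (c Rb)*Y:Hom (%x. a (b x)) c"
   by(rule Hom_mult[OF Hom_adj[OF Hom_lift[OF C(1) hom_id hom_comp[OF B(2,1)] RbH] C(1) hom_comp[OF C(1) hom_comp[OF B(2,1)]]] Hom_restrict[OF Y B(1)]])
  from Hom_adj[OF this Vab(1) C(1)] show "adj (adj (c Rb)*Y):?V" .
  have "adj (adj (adj (c Rb)*Y))*a Rb' = adj (c Rb)*(Y*a Rb')" by(simp add: mult.assoc)
  also have "Y*a Rb' = c (b' Rb')*Y" by(rule HomD(2)[OF Y]) simp
  also have "adj (c Rb)*(c (b' Rb')*Y) = c (adj Rb*b' Rb')*Y" by(simp add: h mult.assoc)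
  also have "... = Y" using B(5) by(simp add: h)
  finally show "Y = adj (adj (adj (c Rb)*Y))*a Rb'" by simp
 qed
qed

text \<open>Mirror image of \<open>frobenius_right\<close>, with the scale \<open>dc / db\<close> of
  the left partial trace.\<close>

lemma frobenius_left:
 assumes a: "std a a' Ra Ra' da" and b: "std b b' Rb Rb' db" and c: "std c c' Rc Rc' dc"
  and f: "onfam (Hom c (%x. a (b x))) I f"
 shows "onfam (Hom b (%x. a' (c x))) I (%i. cor (1 / sqrt (dc / db))*.(a' (adj (f i))*Ra))"
proof(rule onfam_transfer[OF f])
 note A = conj_eqsD[OF stdD(1)[OF a]] and B = conj_eqsD[OF stdD(1)[OF b]] and C = conj_eqsD[OF stdD(1)[OF c]]
 note Ms [simp] = A(3,4) B(3,4) C(3,4)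
 note h = homD[OF A(1)] homD[OF A(2)] homD[OF B(1)] homD[OF C(1)]
 let ?V = "Hom c (%x. a (b x))"
 have Vab: "hom (%x. a (b x))" "hom (%x. a' (c x))" using A B C by(auto intro: hom_comp)
 have VM [simp]: "X:M" if "X:?V" for X using HomD[OF that] by simp
 show "0 < dc / db" using std_ge_1[OF b] std_ge_1[OF c] by simp
 show "op_subspace ?V" "op_subspace (Hom b (%x. a' (c x)))" by(rule Hom_op_subspace)+
 show "a' (adj (X + Y))*Ra = a' (adj X)*Ra + a' (adj Y)*Ra" if "X:?V" "Y:?V" for X Y
  using that by(simp add: h algebra_simps)
 show "a' (adj (k*.X))*Ra = cnj k*.(a' (adj X)*Ra)" if "X:?V" for k X using that by(simp add: h)
 show "adj (a' (adj X)*Ra)*(a' (adj Y)*Ra) = cor (dc / db)*.(adj Y*X)" if X: "X:?V" and Y: "Y:?V" for X Y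
 proof -
  define be where "be X Y = adj (a' (adj X)*Ra)*(a' (adj Y)*Ra)" for X Y
  have be: "be X Y = adj Ra*a' (X*adj Y)*Ra" if "X:?V" "Y:?V" for X Y
   using that by(simp add: be_def h mult.assoc)
  show ?thesis
   unfolding be_def[symmetric]
  proof(rule polarisation_on[where be = be, OF Hom_op_subspace _ _ _ _ _ _ X Y])
   show "be (X + Y) Z = be X Z + be Y Z" "be Z (X + Y) = be Z X + be Z Y" if "X:?V" "Y:?V" "Z:?V" for X Y Z
    using that by(simp_all add: be_def h algebra_simps)
   show "be (k*.X) Z = k*.be X Z" "be Z (k*.X) = cnj k*.be Z X" if "X:?V" "Z:?V" for k X Z
    using that by(simp_all add: be_def h algebra_simps)
   show "EX c. adj X*X = c*.1" if "X:?V" for X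
    using irrD[OF stdD(2)[OF c] Hom_mult[OF Hom_adj[OF that C(1) Vab(1)] that]] .
   show "be X X = cor (dc / db)*.1" if "X:?V" "adj X*X = 1" for X
    unfolding be[OF that(1) that(1)] by(rule trace_isometry[OF a b c that])
  qed
 qed
 have RaH: "Ra:Hom (%x. x) (%x. a' (a x))" and Ra'H: "Ra':Hom (%x. x) (%x. a (a' x))" using stdD(1)[OF a] by(simp_all add: conj_eqs_def)
 show "a' (adj X)*Ra:Hom b (%x. a' (c x))" if X: "X:?V" for X
  using Hom_mult[OF Hom_lift[OF A(2) Vab(1) C(1) Hom_adj[OF X C(1) Vab(1)]] Hom_restrict[OF RaH B(1)]] by simp
 show "EX X:?V. Y = a' (adj X)*Ra" if Y: "Y:Hom b (%x. a' (c x))" for Y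
 proof
  have YM [simp]: "Y:M" by(rule HomD[OF Y])
  have "adj Ra'*a Y:Hom (%x. a (b x)) c"
   using Hom_mult[OF Hom_restrict[OF Hom_adj[OF Ra'H hom_id hom_comp[OF A(1,2)]] C(1)] Hom_lift[OF A(1) B(1) Vab(2) Y]] by simp
  from Hom_adj[OF this Vab(1) C(1)] show "adj (adj Ra'*a Y):?V" .
  have "a' (adj (adj (adj Ra'*a Y)))*Ra = adj (a' Ra')*(a' (a Y)*Ra)" by(simp add: h mult.assoc)
  also have "a' (a Y)*Ra = Ra*Y" by(rule A(7)[symmetric]) simp
  also have "adj (a' Ra')*(Ra*Y) = Y" using A(11) by(simp add: mult.assoc[symmetric])
  finally show "Y = a' (adj (adj (adj Ra'*a Y)))*Ra" by simp
 qed
qed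

lemma schur:
 assumes h: "hom rho" "hom sig" and i: "irr rho" "irr sig" and X: "X:Hom rho sig" "X ~= 0"
 obtains u where "u:Hom rho sig" "adj u*u = 1" "u*adj u = 1"
proof -
 obtain c where c: "adj X*X = c*.1" using irrD[OF i(1) Hom_mult[OF Hom_adj[OF X(1) h] X(1)]] by blast
 obtain c' where c': "X*adj X = c'*.1" using irrD[OF i(2) Hom_mult[OF X(1) Hom_adj[OF X(1) h]]] by blast
 have c0: "0 < Re c" "Im c = 0" using adj_mult_scalar(1,4)[OF c] X(2) by auto
 have "c'*.X = X*(adj X*X)" using c' by(simp add: mult.assoc[symmetric])
 hence "(c' - c)*.X = 0" using bop_scaleC_simps(2)[of "c' - c" c X] by(simp add: c bop_scaleC_simps)
 hence "c' = c" using X(2) by(metis bop_scaleC_simps(4,5,7) eq_iff_diff_eq_0 left_inverse)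
 define r where "r = cor (1 / sqrt (Re c))"
 have rc: "cor (Re c) = c" using c0 by(simp add: complex_eq_iff)
 have "r*(r * cor (Re c)) = 1"
  using c0 by(simp add: r_def of_real_mult[symmetric] del: of_real_mult of_real_divide)
 hence r: "cnj r = r" "r*(r * c) = 1" unfolding rc by(simp_all add: r_def del: of_real_divide)
 show thesis
 proof(rule that)
  show "r*.X:Hom rho sig" by(rule op_subspaceD(3)[OF Hom_op_subspace X(1)])
  show "adj (r*.X)*(r*.X) = 1" "r*.X*adj (r*.X) = 1"
   using r by(simp_all add: bop_scaleC_simps c c' \<open>c' = c\<close>)
 qed
qed

lemma conj_vector_unique:
 assumes s: "std rho rho' R R' d" and X: "X:Hom (%x. x) (%x. rho (rho' x))"
 obtains c where "X = c*.R'"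
proof -
 note C = conj_eqsD[OF stdD(1)[OF s]] and h = homD[OF conj_eqsD(1)[OF stdD(1)[OF s]]] homD[OF conj_eqsD(2)[OF stdD(1)[OF s]]]
 note Ms [simp] = C(3,4)
 have [simp]: "X:M" by(rule HomD[OF X])
 have Xa: "adj X:Hom (%x. rho (rho' x)) (%x. x)" by(rule Hom_adj[OF X hom_id hom_comp[OF C(1,2)]])
 have RH: "R:Hom (%x. x) (%x. rho' (rho x))" using stdD(1)[OF s] by(simp add: conj_eqs_def)
 have "adj X*rho R:Hom rho rho"
  using Hom_mult[OF Hom_restrict[OF Xa C(1)] Hom_lift[OF C(1) hom_id hom_comp[OF C(2,1)] RH]] by simp
 then obtain c where c: "adj X*rho R = c*.1" using irrD[OF stdD(2)[OF s]] by blast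
 have "adj X = adj X*rho (adj (rho' R')*R)" using C(11) by(simp add: h)
 also have "... = (adj X*rho (rho' (adj R')))*rho R" by(simp add: h mult.assoc)
 also have "adj X*rho (rho' (adj R')) = adj R'*adj X" by(rule HomD(2)[OF Xa]) simp
 also have "adj R'*adj X*rho R = c*.adj R'" by(simp add: mult.assoc c bop_scaleC_simps)
 finally have "X = cnj c*.R'" by(metis adj_adj adj_scaleC)
 thus thesis by(rule that)
qed

text \<open>\<open>conj_vector_unique\<close> leaves two scalars; a zigzag equation gives
  \<open>cnj c * c' = 1\<close> and the normalisation gives equal moduli, so both are
  phases.\<close>

lemma std_unique:
 assumes s: "std rho rho' R R' d" and s2: "std rho' rho S S' e"
 obtains c c' where "S = c*.R'" "S' = c'*.R" "cmod c = 1" "cmod c' = 1" "e = d"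
proof -
 note C = conj_eqsD[OF stdD(1)[OF s]] and h = homD[OF conj_eqsD(1)[OF stdD(1)[OF s]]] homD[OF conj_eqsD(2)[OF stdD(1)[OF s]]]
 obtain c where c: "S = c*.R'"
  by(rule conj_vector_unique[OF s, of S]) (use stdD(1)[OF s2] in \<open>auto simp: conj_eqs_def\<close>)
 obtain c' where c': "S' = c'*.R"
  by(rule conj_vector_unique[OF std_sym[OF s], of S']) (use stdD(1)[OF s2] in \<open>auto simp: conj_eqs_def\<close>)
 have "(cnj c * c')*.(1::'a bop) = 1*.1" using conj_eqsD(5)[OF stdD(1)[OF s2]] C(6) by(simp add: c c' h C(3) bop_scaleC_simps mult_ac)
 hence one: "cnj c * c' = 1" by(simp only: scalar_inject)
 have d: "1 <= d" "1 <= e" by(rule std_ge_1, fact)+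
 have 1: "cnj c * c*d = cor e" using stdD(4)[OF s2] stdD(5)[OF s] by(simp add: c bop_scaleC_simps mult_ac scalar_inject)
 have 2: "cnj c' * c'*d = cor e" using stdD(5)[OF s2] stdD(4)[OF s] by(simp add: c' bop_scaleC_simps mult_ac scalar_inject)
 have e1: "(cmod c)^2*d = e" "(cmod c')^2*d = e"
  using arg_cong[OF 1, of cmod] arg_cong[OF 2, of cmod] d by(simp_all add: norm_mult power2_eq_square)
 hence "cmod c = cmod c'" using d by auto
 moreover have "cmod c * cmod c' = 1" using arg_cong[OF one, of cmod] by(simp add: norm_mult)
 ultimately have "(cmod c)^2 = 1" by(simp add: power2_eq_square)
 hence "cmod c = 1" by(metis norm_ge_zero one_power2 power2_eq_imp_eq zero_le_one)
 thus thesis using that[OF c c'] \<open>cmod c = cmod c'\<close> e1 by simp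
qed

lemma conjugates_intertwine:
 assumes s: "std rho rho' R R' d" and t: "std rho' sig S S' e"
 obtains u where "u:Hom rho sig" "adj u*u = 1" "u*adj u = 1"
proof -
 note C = conj_eqsD[OF stdD(1)[OF s]] and E = conj_eqsD[OF stdD(1)[OF t]]
 note h = homD[OF C(1)] homD[OF C(2)] homD[OF E(2)]
 note Ms [simp] = C(3,4) E(3,4)
 have RH: "R:Hom (%x. x) (%x. rho' (rho x))" and SH: "S:Hom (%x. x) (%x. sig (rho' x))"
  using stdD(1)[OF s] stdD(1)[OF t] by(simp_all add: conj_eqs_def)
 have X: "sig (adj R)*S:Hom rho sig"
  using Hom_mult[OF Hom_lift[OF E(2) hom_comp[OF C(2,1)] hom_id Hom_adj[OF RH hom_id hom_comp[OF C(2,1)]]] Hom_restrict[OF SH C(1)]] by simp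
 have "adj S'*rho' (sig (adj R)*S) = (adj S'*rho' (sig (adj R)))*rho' S" by(simp add: h mult.assoc)
 also have "adj S'*rho' (sig (adj R)) = adj R*adj S'" by(rule E(10)) simp
 also have "adj R*adj S'*rho' S = adj R" using E(6) by(simp add: mult.assoc)
 finally have *: "adj S'*rho' (sig (adj R)*S) = adj R" .
 have "sig (adj R)*S ~= 0"
 proof
  assume "sig (adj R)*S = 0"
  hence "adj R = 0" using * hom_zero[OF C(2)] by simp
  thus False using C(5) one_neq_zero by simp
 qed
 from schur[OF C(1) E(2) stdD(2)[OF s] stdD(3)[OF t] X this] that show thesis by blast
qed

end

lemma sum_triple:
 assumes "finite A" "!!k. k:A ==> finite (B k)" "!!k. k:A ==> finite (C k)"
 shows "(SUM p:(SIGMA k:A. B k \<times> C k). f (fst p) (fst (snd p)) (snd (snd p))) = (SUM k:A. SUM T:B k. SUM S:C k. f k T S)"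
by(use assms in \<open>simp add: sum.cartesian_product case_prod_beta sum.Sigma\<close>)

context factor_algebra begin

text \<open>Bessel's inequality for \<open>R$$x\<close> and the isometries \<open>rho' v\<close>.
  With \<open>y = rho' (adj v)*R\<close> the zigzag identity \<open>adj R'*rho y = adj v\<close>
  bounds each summand from below, so a conjugate limits the number of orthogonal subobjects.\<close>

lemma isometry_family_bound:
 assumes c: "conj_eqs rho rho' R R'" and fin: "finite A"
  and on: "!!v w. v:A ==> w:A ==> adj v * w = (if v = w then 1 else 0)"
  and A: "!!v. v:A ==> EX sig. hom sig & v:Hom sig rho"
 shows "real (card A) <= (opn (adj R'))^2*(opn R)^2"
proof -
 note C = conj_eqsD[OF c] and h = homD[OF conj_eqsD(1)[OF c]] homD[OF conj_eqsD(2)[OF c]]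
 obtain x :: 'a where x: "norm x = 1"
 proof -
  obtain y :: 'a where y: "y ~= 0" using one_neq_zero by(metis bop_eqI one_op_app zero_op_app)
  thus thesis using that[of "inverse (norm y) *\<^sub>R y"] by simp
 qed
 have each: "1 <= (opn (adj R'))^2*(norm (adj (rho' v)$$R$$x))^2" if v: "v:A" for v
 proof -
  obtain sig where sig: "hom sig" "v:Hom sig rho" using A[OF v] by blast
  have vM [simp]: "v:M" by(rule HomD[OF sig(2)])
  have vv: "adj v * v = 1" using on[OF v v] by simp
  define y where "y = rho' (adj v)*R"
  have "adj R*rho' (v * adj v)*R:Hom (%x. x) (%x. x)" using left_trace_Hom[OF c hom_id] by(metis Hom_mult[OF sig(2) Hom_adj[OF sig(2,1) C(1)]])
  moreover have "adj y*y = adj R*rho' (v * adj v)*R" by(simp add: y_def h mult.assoc)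
  ultimately obtain r where r: "adj y*y = r*.1" using irrD[OF irr_id] by metis
  have "adj (rho y)*rho y = rho (adj y*y)" by(simp add: y_def h C(3))
  hence r': "adj (rho y)*rho y = r*.1" by(simp add: r hom_scalar[OF C(1)])
  have "adj R'*rho y = (adj R'*rho (rho' (adj v)))*rho R" by(simp add: y_def h C(3) mult.assoc)
  also have "adj R'*rho (rho' (adj v)) = adj v * adj R'" by(rule C) simp
  also have "adj v * adj R'*rho R = adj v" using C(6) by(simp add: mult.assoc)
  finally have av: "adj R'*rho y = adj v" .
  have "adj v * v = 1*.1" by(simp add: vv bop_scaleC_simps)
  from adj_mult_scalar(3)[OF this, of x] have nv: "(norm (v$$x))^2 = 1" using x by simp
  have "1 = norm (adj v$$v$$x)" using x vv by(simp flip: times_op_app)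
  also have "... = norm (adj R'$$rho y$$v$$x)" by(simp flip: av)
  also have "... <= opn (adj R')*norm (rho y$$v$$x)" by(rule norm_op_le)
  finally have "1^2 <= (opn (adj R')*norm (rho y$$v$$x))^2" by(intro power_mono) auto
  also have "... = (opn (adj R'))^2*Re r" using adj_mult_scalar(3)[OF r', of "v$$x"] nv by(simp add: power_mult_distrib)
  also have "Re r = (norm (y$$x))^2" using adj_mult_scalar(3)[OF r, of x] x by simp
  also have "y$$x = adj (rho' v)$$R$$x" by(simp add: y_def h)
  finally show ?thesis by simp
 qed
 have "real (card A) = (SUM v:A. 1)" by simp
 also have "... <= (SUM v:A. (opn (adj R'))\<^sup>2*(norm (adj (rho' v)$$R$$x))^2)" by(rule sum_mono) (rule each)
 also have "... = (opn (adj R'))^2*(SUM v:A. (norm (adj (rho' v)$$R$$x))\<^sup>2)" by(simp add: sum_distrib_left)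
 also have "... <= (opn (adj R'))^2*(norm (R$$x))^2"
 proof(intro mult_left_mono bessel fin)
  fix v w assume vw: "v:A" "w:A"
  hence "v:M" "w:M" using A HomD(1) by blast+
  hence "adj (rho' v)*rho' w = rho' (adj v * w)" by(simp add: h)
  thus "adj (rho' v)*rho' w = (if v = w then 1 else 0)" using on[OF vw] by(simp add: h hom_zero[OF C(2)])
 qed simp
 also have "... <= (opn (adj R'))^2*(opn R)^2"
  using norm_op_le[of R x] x by(intro mult_left_mono power_mono) auto
 finally show ?thesis .
qed

text \<open>Commuting with the image of \<open>sig\<close> and with the commutant of
  \<open>M\<close> describes \<open>Hom sig sig\<close> as a commutant.\<close>

lemma nontrivial_projection_Hom:
 assumes "hom sig" "~ irr sig"
 obtains e where "e:Hom sig sig" "adj e = e" "e*e = e" "e ~= 0" "e ~= 1"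
proof -
 define S where "S = commutant M \<union> sig ` M"
 have eq: "commutant S = Hom sig sig"
  using vn_commutant[OF vnM] unfolding S_def Hom_def commutant_def by blast
 have "adj x:S" if "x:S" for x
 proof -
  have "adj (sig y):S" if "y:M" for y using homD(2)[OF assms(1) that] M_sub(3)[OF that] by(metis S_def UnI2 imageI)
  moreover have "adj y:S" if "y:commutant M" for y using commutant_adj[of M y] that by(auto simp: S_def)
  ultimately show ?thesis using that unfolding S_def by blast
 qed
 from nontrivial_projection[OF this, unfolded eq] assms(2) one_neq_zero that show thesis unfolding irr_def by blast
qed

end

section \<open>The category and its fusion coefficients\<close>

locale graded_category =
 fixes D :: "('h::chilbert_space, 'k::chilbert_space, 'i::countable, 'g::group_add) cat"
 assumes type_III: "type_III_factor (alg D)"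
  and state: "faithful_normal_state (alg D) (state D)"
  and rigid: "rigid_tensor_category (alg D) (objects D)"
  and grading: "group_grading (alg D) (objects D) (component D)"
  and irreps: "irr_representatives (alg D) (objects D) (irr_rep D)"
  and conj_data: "conjugation_data D"
  and bases: "basis_data D"
  and conj_tens: "conj_tensor (tens D)"
  and standard: "standard_form (algA D) (mod_conj D) (pos_cone D)"

sublocale graded_category \<subseteq> factor_algebra "alg D"
 by unfold_locales (use type_III in \<open>simp add: type_III_factor_def\<close>)

context graded_category begin

abbreviation "M \<equiv> alg D"
abbreviation "F \<equiv> irr_rep D"
abbreviation "cb \<equiv> irr_bar D"
abbreviation "R \<equiv> conj_R D"
abbreviation "R' \<equiv> conj_Rbar D"
abbreviation "d \<equiv> dim_irr D"
abbreviation "B \<equiv> onb D"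
abbreviation "FF i j \<equiv> (%x. F i (F j x))"

lemmas rigid_unfolded = rigid[unfolded rigid_tensor_category_def]
lemmas objects_finite_index = rigid_unfolded[THEN conjunct1]
lemmas objects_compose = rigid_unfolded[THEN conjunct2, THEN conjunct2, THEN conjunct1, rule_format]
lemmas objects_subobject = rigid_unfolded[THEN conjunct2, THEN conjunct2, THEN conjunct2, THEN conjunct1, rule_format]
lemmas objects_sum = rigid_unfolded[THEN conjunct2, THEN conjunct2, THEN conjunct2, THEN conjunct2, THEN conjunct1, rule_format]
lemmas objects_conj = rigid_unfolded[THEN conjunct2, THEN conjunct2, THEN conjunct2, THEN conjunct2, THEN conjunct2, rule_format]
lemmas grading_unfolded = grading[unfolded group_grading_def]
lemmas component_objects = grading_unfolded[THEN conjunct1, rule_format, THEN subsetD]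
lemmas component_unique = grading_unfolded[THEN conjunct2, THEN conjunct1, rule_format]
lemmas component_iff = grading_unfolded[THEN conjunct2, THEN conjunct2, THEN conjunct1, rule_format]
lemmas component_compose = grading_unfolded[THEN conjunct2, THEN conjunct2, THEN conjunct2, THEN conjunct1, rule_format]
lemmas component_nonempty = grading_unfolded[THEN conjunct2, THEN conjunct2, THEN conjunct2, THEN conjunct2, THEN conjunct2, rule_format]

lemma objects_endos: "rho:objects D ==> rho:endos M"
 using objects_finite_index by(auto simp: finite_index_endos_def)

lemma F_objects: "F i:objects D" and F_irr: "irr (F i)"
 using irreps unfolding irr_representatives_def irreducible_endo_def irr_def intertwiners_Hom(5) by auto

lemma F_endos: "F i:endos M" by(rule objects_endos[OF F_objects])
lemma F_hom: "hom (F i)" by(rule hom_endos[OF F_endos])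
lemmas F_homD [simp] = homD[OF F_hom]
lemmas FF_hom = hom_comp[OF F_hom F_hom]

lemma F_std: "std (F i) (F (cb i)) (R i) (R' i) (d i)"
 using conj_data F_hom F_irr
 unfolding conjugation_data_def std_def conj_eqs_def conjugate_solution_def intertwiners_Hom(3) by blast

lemmas F_conj = stdD(1)[OF F_std]
lemmas F_conjD = conj_eqsD[OF F_conj]
lemma d_ge_1: "1 <= d i" by(rule std_ge_1[OF F_std])
lemma d_pos: "0 < d i" using d_ge_1[of i] by simp
lemma R_M [simp]: "R i:M" "R' i:M" by(rule F_conjD(3), rule F_conjD(4))

lemma B_onfam: "onfam (Hom (F k) (FF i j)) (B i j k) (%T. T)"
by(use bases in \<open>force simp: basis_data_def intertwiners_Hom(1) orthonormal_basis_def onfam_def\<close>)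

lemmas B_onfamD = onfamD[OF B_onfam]
lemma B_Hom: "T:B i j k ==> T:Hom (F k) (FF i j)" by(rule B_onfamD(2))
lemma B_M [simp]: "T:B i j k ==> T:M" using HomD(1)[OF B_Hom] .
lemma B_finite [simp]: "finite (B i j k)" by(rule B_onfamD(1))

lemma rep_unique:
 assumes "X:Hom (F k) (F l)" "X ~= 0"
 shows "k = l"
proof -
 have "EX! m. equivalent_endos M (F k) (F m)" using irreps by(simp add: irr_representatives_def)
 moreover have "equivalent_endos M (F k) (F k)"
  unfolding equivalent_endos_def intertwiners_Hom by(rule bexI[of _ 1]) (simp_all add: Hom_one)
 moreover have "equivalent_endos M (F k) (F l)"
  by(rule schur[OF F_hom F_hom F_irr F_irr assms]) (auto simp: equivalent_endos_def intertwiners_Hom)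
 ultimately show ?thesis by blast
qed

lemma B_orth:
 assumes T: "T:B i j k" and S: "S:B i j l"
 shows "adj T*S = (if k = l & T = S then 1 else 0)"
by(metis B_onfamD(3) assms Hom_mult[OF Hom_adj[OF B_Hom[OF T] F_hom FF_hom] B_Hom[OF S]] rep_unique)

lemma subobject:
 assumes "rho:objects D" "e:Hom rho rho" "adj e = e" "e*e = e" "e ~= 0"
 obtains sig v where "sig:objects D" "v:Hom sig rho" "adj v * v = 1" "v * adj v = e"
by(use assms HomD(1) objects_subobject[OF assms(1), of e] assms(2,5) in \<open>auto simp: projections_def intertwiners_Hom(5) intertwiners_Hom\<close>)

text \<open>By \<open>isometry_family_bound\<close>, orthogonal families of isometries into
  \<open>rho\<close> have bounded size. In one of maximal size every domain is irreducible, since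
  splitting a member would enlarge the family.\<close>

lemma irreducible_subobject:
 assumes rho: "rho:objects D"
 obtains sig v where "sig:objects D" "irr sig" "v:Hom sig rho" "adj v * v = 1"
proof -
 obtain rho' Q Q' where rho': "rho':objects D" "conjugate_solution M rho rho' Q Q'"
  using objects_conj[OF rho] by blast
 have c: "conj_eqs rho rho' Q Q'"
  using rho'(2) hom_endos[OF objects_endos[OF rho]] hom_endos[OF objects_endos[OF rho'(1)]]
  unfolding conj_eqs_def conjugate_solution_def intertwiners_Hom(3) by blast
 define fam where "fam A \<longleftrightarrow> finite A & (ALL v:A. ALL w:A. adj v * w = (if v = w then 1 else 0)) &
  (ALL v:A. EX sig:objects D. v:Hom sig rho)" for A
 have bound: "card A <= nat \<lceil>(opn (adj Q'))\<^sup>2*(opn Q)^2\<rceil>" if "fam A" for A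
 proof -
  have "real (card A) <= (opn (adj Q'))^2*(opn Q)^2"
   by(rule isometry_family_bound[OF c]) (use that hom_endos[OF objects_endos] in \<open>unfold fam_def, blast+\<close>)
  thus ?thesis by linarith
 qed
 have one: "fam {1}" using rho Hom_one by(auto simp: fam_def)
 have "EX A. fam A & (ALL A'. fam A' --> card A' <= card A)"
  by(rule ex_has_greatest_nat[where P = fam and k = "{1}" and f = card, OF one, where b = "Suc (nat \<lceil>(opn (adj Q'))\<^sup>2*(opn Q)^2\<rceil>)"])
   (use bound in \<open>simp add: less_Suc_eq_le\<close>)
 then obtain A where A: "fam A" and mx: "!!A'. fam A' ==> card A' <= card A" by blast
 have fin: "finite A" and on: "!!v w. v:A ==> w:A ==> adj v * w = (if v = w then 1 else 0)"
  and obj: "!!v. v:A ==> EX sig:objects D. v:Hom sig rho" using A unfolding fam_def by blast+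
 have "card {1::'h bop} <= card A" by(rule mx[OF one])
 then obtain v where v: "v:A" by fastforce
 obtain sig where sig: "sig:objects D" "v:Hom sig rho" using obj[OF v] by blast
 have vv: "adj v * v = 1" using on[OF v v] by simp
 have "irr sig"
 proof(rule ccontr)
  assume ni: "~ irr sig"
  obtain e where e: "e:Hom sig sig" "adj e = e" "e*e = e" "e ~= 0" "e ~= 1"
   by(rule nontrivial_projection_Hom[OF hom_endos[OF objects_endos[OF sig(1)]] ni]) (rule that)
  have e': "1 - e:Hom sig sig" "adj (1 - e) = 1 - e" "(1 - e)*(1 - e) = 1 - e" "1 - e ~= 0"
   using e op_subspaceD(5)[OF Hom_op_subspace Hom_one e(1)] by(auto simp: algebra_simps)
  obtain sig1 s1 where s1: "sig1:objects D" "s1:Hom sig1 sig" "adj s1 * s1 = 1" "s1*adj s1 = e"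
   by(rule subobject[OF sig(1) e(1-4)]) (rule that)
  obtain sig2 s2 where s2: "sig2:objects D" "s2:Hom sig2 sig" "adj s2 * s2 = 1" "s2*adj s2 = 1 - e"
   by(rule subobject[OF sig(1) e']) (rule that)
  have "adj s1 * s2 = (adj s1 * s1)*(adj s1 * s2)*(adj s2 * s2)" by(simp add: s1 s2)
  also have "... = adj s1*((s1*adj s1)*(s2*adj s2)) * s2" by(simp add: mult.assoc)
  also have "... = 0" by(simp add: s1(4) s2(4) algebra_simps e)
  finally have s12: "adj s1 * s2 = 0" .
  have "adj s2 * s1 = adj (adj s1 * s2)" by simp
  hence s21: "adj s2 * s1 = 0" by(simp only: s12 adj_zero)
  have vs: "adj (v * s)*(v * t) = adj s*t" for s t
  proof -
   have "adj (v * s)*(v * t) = adj s*((adj v * v)*t)" by(simp add: mult.assoc)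
   thus ?thesis by(simp add: vv)
  qed
  have wz: "adj w*(v * s) = 0" "adj (v * s) * w = 0" if "w:A - {v}" for w s
  proof -
   have z: "adj w * v = 0" "adj v * w = 0" using on[of w v] on[of v w] v that by auto
   have "adj w*(v * s) = (adj w * v) * s" "adj (v * s) * w = adj s*(adj v * w)" by(simp_all add: mult.assoc)
   thus "adj w*(v * s) = 0" "adj (v * s) * w = 0" using z by auto
  qed
  have ne: "v * s1 ~= v * s2" using vs[of s1 s1] vs[of s1 s2] s1(3) s12 one_neq_zero by metis
  have nin: "v * s1 ~: A - {v}" "v * s2 ~: A - {v}"
   using wz(1)[of "v * s1" s1] wz(1)[of "v * s2" s2] vs[of s1 s1] vs[of s2 s2] s1(3) s2(3) one_neq_zero by metis+
  define A' where "A' = insert (v * s1) (insert (v * s2) (A - {v}))"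
  have "card A' = Suc (Suc (card (A - {v})))" unfolding A'_def using ne nin fin by simp
  hence "card A' = Suc (card A)" using fin v by(metis card_Suc_Diff1)
  moreover have "fam A'"
   unfolding fam_def
  proof(intro conjI ballI)
   show "finite A'" using fin by(simp add: A'_def)
   fix w assume w: "w:A'"
   show "EX sig:objects D. w:Hom sig rho"
    using w obj Hom_mult[OF sig(2) s1(2)] Hom_mult[OF sig(2) s2(2)] s1(1) s2(1) unfolding A'_def by blast
   fix w' assume w': "w':A'"
   show "adj w * w' = (if w = w' then 1 else 0)"
   proof -
    have e: "adj (v * s1)*(v * s1) = 1" "adj (v * s2)*(v * s2) = 1" "adj (v * s1)*(v * s2) = 0" "adj (v * s2)*(v * s1) = 0"
     by(simp_all only: vs s12 s21 s1(3) s2(3))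
    have "w = v * s1 | w = v * s2 | w:A - {v}" "w' = v * s1 | w' = v * s2 | w':A - {v}"
     using w w' unfolding A'_def by blast+
    thus ?thesis
     by(elim disjE) (use e ne ne[symmetric] nin in \<open>auto simp: wz on simp del: adj_mult\<close>)
   qed
  qed
  ultimately show False using mx[of A'] by simp
 qed
 thus thesis using that sig vv by blast
qed

lemma irreducible_constituent:
 assumes rho: "rho:objects D"
 obtains k s where "s:Hom (F k) rho" "adj s * s = 1"
proof -
 obtain sig v where sig: "sig:objects D" "irr sig" "v:Hom sig rho" "adj v * v = 1" by(rule irreducible_subobject[OF rho]) (rule that)
 obtain k where "equivalent_endos M sig (F k)"
  using irreps sig(1,2) unfolding irr_representatives_def irreducible_endo_def irr_def intertwiners_Hom(5) by blast
 then obtain u where u: "u:Hom sig (F k)" "adj u*u = 1" "u*adj u = 1" unfolding equivalent_endos_def intertwiners_Hom by blast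
 show thesis
 proof(rule that)
  show "v * adj u:Hom (F k) rho" by(rule Hom_mult[OF sig(3) Hom_adj[OF u(1) hom_endos[OF objects_endos[OF sig(1)]] F_hom]])
  have "adj (v * adj u)*(v * adj u) = u*(adj v * v)*adj u" by(simp add: mult.assoc)
  thus "adj (v * adj u)*(v * adj u) = 1" by(simp add: sig(4) u(3))
 qed
qed

text \<open>Bessel's inequality at \<open>F i (R' j)$$x\<close>, of squared norm \<open>d j\<close>:
  by the right partial trace each basis element contributes \<open>d k / d i\<close>.\<close>

lemma dimension_bound:
 assumes "finite A"
 shows "(SUM k:A. real (card (B i j k))*d k) <= d i*d j"
proof -
 obtain x :: 'h where x: "norm x = 1"
 proof -
  obtain y :: 'h where y: "y ~= 0" using one_neq_zero by(metis bop_eqI one_op_app zero_op_app)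
  thus thesis using that[of "inverse (norm y) *\<^sub>R y"] by simp
 qed
 let ?y = "F i (R' j)$$x"
 have each: "(norm (adj T$$?y))^2 = d k / d i" if T: "T:B i j k" for T k
 proof(rule trace_isometry[OF F_std F_std F_std B_Hom[OF T]])
  show "adj T*T = 1" using B_orth[OF T T] by simp
  assume "adj (F i (R' j))*(T*adj T)*F i (R' j) = cor (d k / d i)*.1"
  hence "adj (adj T*F i (R' j))*(adj T*F i (R' j)) = cor (d k / d i)*.1" by(simp add: mult.assoc)
  from adj_mult_scalar(3)[OF this, of x] show ?thesis using x by simp
 qed
 have y: "(norm ?y)^2 = d j"
 proof -
  have "adj (F i (R' j))*F i (R' j) = F i (adj (R' j)*R' j)" by simp
  also have "... = cor (d j)*.1" by(simp add: stdD(5)[OF F_std] hom_scalar[OF F_hom] del: F_homD(5))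
  finally show ?thesis using adj_mult_scalar(3)[of "F i (R' j)" "cor (d j)" x] x by simp
 qed
 have "(SUM p:Sigma A (B i j). (norm (adj (snd p)$$?y))\<^sup>2) <= (norm ?y)^2"
  by(rule bessel(1)) (use assms B_orth in \<open>auto simp: prod_eq_iff\<close>)
 also have "(SUM p:Sigma A (B i j). (norm (adj (snd p)$$?y))\<^sup>2) = (SUM k:A. SUM T:B i j k. (norm (adj T$$?y))\<^sup>2)"
  using assms by(subst sum.Sigma) (auto simp: case_prod_beta)
 also have "... = (SUM k:A. real (card (B i j k))*d k) / d i"
  unfolding sum_divide_distrib by(intro sum.cong) (simp_all add: each)
 finally show ?thesis using d_pos[of i] by(simp add: y field_simps)
qed

section \<open>Fusion sets and complete systems of intertwiners\<close>

definition fusion :: "'i => 'i => 'i set" where "fusion i j = {k. B i j k ~= {}}"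

lemma fusion_iff: "k:fusion i j \<longleftrightarrow> B i j k ~= {}" by(simp add: fusion_def)

lemma finite_fusion [simp]: "finite (fusion i j)"
proof(rule ccontr)
 assume "infinite (fusion i j)"
 then obtain A where A: "A \<subseteq> fusion i j" "card A = nat \<lceil>d i*d j\<rceil> + 1" "finite A" using infinite_arbitrarily_large by blast
 have "real (card A) = (SUM k:A. 1)" by simp
 also have "... <= (SUM k:A. real (card (B i j k))*d k)"
 proof(rule sum_mono)
  fix k assume "k:A"
  hence "0 < card (B i j k)" using A(1) by(auto simp: card_gt_0_iff fusion_iff)
  thus "1 <= real (card (B i j k))*d k" using d_ge_1[of k] mult_mono[of 1 "real (card (B i j k))" 1 "d k"] by simp
 qed
 also have "... <= d i*d j" by(rule dimension_bound[OF A(3)])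
 finally show False using A(2) by linarith
qed

text \<open>A nonzero complementary projection would contain an irreducible constituent; its
  intertwiner is a combination of basis elements, which \<open>Q\<close> fixes and
  \<open>1 - Q\<close> annihilates.\<close>

lemma B_complete: "(SUM k:fusion i j. SUM T:B i j k. T*adj T) = 1"
proof(rule ccontr)
 define Q where "Q = (SUM k:fusion i j. SUM T:B i j k. T*adj T)"
 assume "(SUM k:fusion i j. SUM T:B i j k. T*adj T) ~= 1"
 hence ne: "1 - Q ~= 0" by(simp add: Q_def)
 have QT: "Q*T = T" if T: "T:B i j k" for T k
 proof -
  have "Q*T = (SUM l:fusion i j. SUM S:B i j l. if l = k then (if S = T then T else 0) else 0)"
   unfolding Q_def sum_distrib_right by(intro sum.cong refl) (simp add: mult.assoc B_orth[OF _ T])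
  also have "... = (SUM l:fusion i j. if l = k then (SUM S:B i j l. if S = T then T else 0) else 0)"
   by(intro sum.cong refl) auto
  also have "... = T" using T by(auto simp: fusion_iff)
  finally show ?thesis .
 qed
 have aQ: "adj Q = Q" by(simp add: Q_def adj_sum)
 have QQ: "Q*Q = Q"
 proof -
  have "Q*Q = (SUM k:fusion i j. SUM T:B i j k. (Q*T)*adj T)"
   by(subst (2) Q_def) (simp add: sum_distrib_left mult.assoc)
  also have "... = (SUM k:fusion i j. SUM T:B i j k. T*adj T)" by(intro sum.cong refl) (simp add: QT)
  finally show ?thesis by(simp only: Q_def[symmetric])
 qed
 have QH: "Q:Hom (FF i j) (FF i j)"
  unfolding Q_def by(intro op_subspaceD(6)[OF Hom_op_subspace] Hom_mult[OF B_Hom Hom_adj[OF B_Hom F_hom FF_hom]])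
 define q where "q = 1 - Q"
 have q: "q:Hom (FF i j) (FF i j)" "adj q = q" "q*q = q" "q ~= 0"
  using op_subspaceD(5)[OF Hom_op_subspace Hom_one QH] aQ QQ ne by(auto simp: q_def algebra_simps)
 have o: "compose M (F i) (F j):objects D" by(rule objects_compose[OF F_objects F_objects])
 have q': "q:Hom (compose M (F i) (F j)) (compose M (F i) (F j))" using q(1) intertwiners_Hom(4,5) by metis
 obtain sig v where sig: "sig:objects D" "v:Hom sig (compose M (F i) (F j))" "adj v * v = 1" "v * adj v = q"
  by(rule subobject[OF o q' q(2-4)]) (rule that)
 obtain k s where s: "s:Hom (F k) sig" "adj s * s = 1" by(rule irreducible_constituent[OF sig(1)]) (rule that)
 have "v * s:Hom (F k) (FF i j)" using Hom_mult[OF sig(2) s(1)] intertwiners_Hom(1,5) by metis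
 hence *: "(SUM T:B i j k. T*(adj T*(v * s))) = v * s" by(rule B_onfamD(4))
 have "Q*(v * s) = (SUM T:B i j k. (Q*T)*(adj T*(v * s)))"
  by(subst *[symmetric]) (simp add: sum_distrib_left mult.assoc)
 also have "... = v * s" using * by(simp add: QT)
 finally have "Q*(v * s) = v * s" .
 hence "q*(v * s) = 0" by(simp add: q_def algebra_simps)
 moreover have "q*(v * s) = v * s"
 proof -
  have "q*(v * s) = v * (adj v * v) * s" by(simp add: sig(4)[symmetric] mult.assoc)
  thus ?thesis by(simp add: sig(3))
 qed
 ultimately have vs: "v * s = 0" by simp
 have "1 = adj s*(adj v * v) * s" by(simp add: s sig(3))
 also have "... = adj s*adj v * (v * s)" by(simp add: mult.assoc)
 finally show False using vs one_neq_zero by simp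
qed

text \<open>Conjugates are unique up to equivalence, and every class is listed once by
  \<open>irr_rep\<close>.\<close>

lemma cb_cb [simp]: "cb (cb i) = i"
proof -
 obtain u where u: "u:Hom (F i) (F (cb (cb i)))" "adj u*u = 1" by(rule conjugates_intertwine[OF F_std F_std]) (rule that)
 have "u ~= 0" using u(2) one_neq_zero by auto
 from rep_unique[OF u(1) this] show ?thesis by simp
qed

lemma cb_data:
 obtains c c' where "R (cb i) = c*.R' i" "R' (cb i) = c'*.R i" "cmod c = 1" "cmod c' = 1" "d (cb i) = d i"
 by(rule std_unique[OF F_std[of i] F_std[of "cb i", unfolded cb_cb]]) (rule that)

lemma d_cb [simp]: "d (cb i) = d i" by(rule cb_data) auto

lemma sesq_phase: "sesq tau ==> cmod c = 1 ==> tau (c*.x) (c*.x) = tau x x"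
 by(simp add: sesqD bop_scaleC_simps complex_norm_square[symmetric] flip: power2_eq_square)

text \<open>The solution chosen for \<open>cb i\<close> differs from the exchanged solution for
  \<open>i\<close> by phases only, and these disappear in a sesquilinear diagonal.\<close>

lemma sesq_R_cb: "sesq tau ==> tau (R (cb i)) (R (cb i)) = tau (R' i) (R' i)" "sesq tau ==> tau (R' (cb i)) (R' (cb i)) = tau (R i) (R i)"
 by(rule cb_data[of i], simp add: sesq_phase)+

lemma sesq_real_scale:
 "sesq tau ==> 0 < k ==> tau (cor (1 / sqrt k)*.x) (cor (1 / sqrt k)*.y) = cor (1 / k)*.tau x y"
 by(simp add: sesqD bop_scaleC_simps of_real_mult[symmetric] del: of_real_mult of_real_divide)

lemma onfam_inner_sum:
 assumes "onfam V I f"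
 shows "(SUM i:I. adj (f i)*f i) = cor (real (card I))*.(1::'h bop)"
proof -
 have "(SUM i:I. adj (f i)*f i) = (SUM i:I. 1)" by(intro sum.cong) (simp_all add: onfamD(3)[OF assms])
 also have "... = cor (real (card I))*.(1::'h bop)"
  by(induction I rule: infinite_finite_induct) (simp_all add: bop_scaleC_simps)
 finally show ?thesis .
qed

lemma onfam_card:
 fixes V :: "'h bop set"
 assumes "onfam V I f" "onfam V K g"
 shows "card I = card K"
by(use onfam_sesq_unique[OF assms sesq_inner] onfam_inner_sum[OF assms(1)] onfam_inner_sum[OF assms(2)] in \<open>simp add: scalar_inject\<close>)

lemma onfam_scaled_sum:
 assumes f: "onfam V I (%i. cor (1 / sqrt q)*.g i)" and h: "onfam V K h" and tau: "sesq tau" and q: "0 < q"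
 shows "(SUM i:I. tau (g i) (g i)) = cor q*.(SUM k:K. tau (h k) (h k))"
proof -
 have "(SUM i:I. cor (1 / q)*.tau (g i) (g i)) = (SUM k:K. tau (h k) (h k))"
  using onfam_sesq_unique[OF f h tau] by(simp only: sesq_real_scale[OF tau q])
 hence "cor q*.cor (1 / q)*.(SUM i:I. tau (g i) (g i)) =
   cor q*.(SUM k:K. tau (h k) (h k))" by(simp only: bop_scaleC_sum)
 thus ?thesis using q by(simp add: bop_scaleC_simps(4,5))
qed

text \<open>Summation over a basis turns the rotation of single intertwiners into an identity that
  does not depend on the chosen bases.\<close>

lemma frobenius_R:
 assumes tau: "sesq tau"
 shows "(SUM T:B i j k. tau (adj T*F i (R' j)) (adj T*F i (R' j))) = cor (d k / d i)*.(SUM Y:B k (cb j) i. tau Y Y)"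
  and frobenius_R_card: "card (B i j k) = card (B k (cb j) i)"
proof -
 note f = frobenius_right[OF F_std[of i] F_std[of j] F_std[of k] B_onfam]
 show "(SUM T:B i j k. tau (adj T*F i (R' j)) (adj T*F i (R' j))) = cor (d k / d i)*.(SUM Y:B k (cb j) i. tau Y Y)"
  by(rule onfam_scaled_sum[OF f B_onfam tau]) (simp add: d_pos)
 show "card (B i j k) = card (B k (cb j) i)" by(rule onfam_card[OF f B_onfam])
qed

lemma frobenius_L:
 assumes tau: "sesq tau"
 shows "(SUM T:B i j k. tau (F (cb i) (adj T)*R i) (F (cb i) (adj T)*R i)) = cor (d k / d j)*.(SUM Y:B (cb i) k j. tau Y Y)"
  and frobenius_L_card: "card (B i j k) = card (B (cb i) k j)"
proof -
 note f = frobenius_left[OF F_std[of i] F_std[of j] F_std[of k] B_onfam]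
 show "(SUM T:B i j k. tau (F (cb i) (adj T)*R i) (F (cb i) (adj T)*R i)) = cor (d k / d j)*.(SUM Y:B (cb i) k j. tau Y Y)"
  by(rule onfam_scaled_sum[OF f B_onfam tau]) (simp add: d_pos)
 show "card (B i j k) = card (B (cb i) k j)" by(rule onfam_card[OF f B_onfam])
qed

text \<open>The two bracketings of the triple product give two orthonormal bases of the intertwiners
  from \<open>F m\<close>, and \<open>onfam_sesq_unique\<close> compares them.\<close>

lemma fusion_assoc:
 assumes tau: "sesq tau"
 shows "(SUM k:fusion j l. SUM T:B j l k. SUM S:B i k m. tau (F i T*S) (F i T*S)) =
  (SUM k:fusion i j. SUM T:B i j k. SUM S:B k l m. tau (T*S) (T*S))"
proof -
 let ?V = "Hom (F m) (%x. F i (F j (F l x)))"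
 let ?I = "Sigma (fusion j l) (%k. B j l k \<times> B i k m)"
 let ?K = "Sigma (fusion i j) (%k. B i j k \<times> B k l m)"
 have 1: "onfam ?V ?I (%(k, T, S). F i T*S)"
  unfolding onfam_def
 proof(intro conjI ballI)
  show "finite ?I" by simp
  show "(%(k, T, S). F i T*S) ` ?I \<subseteq> ?V"
  proof(rule image_subsetI, clarify)
   fix k T S assume T: "T:B j l k" and S: "S:B i k m"
   show "F i T*S:?V" by(rule Hom_mult[OF Hom_lift[OF F_hom F_hom FF_hom B_Hom[OF T]] B_Hom[OF S]])
  qed
  fix p p' assume "p:?I" "p':?I"
  then obtain k T S k' T' S' where p: "p = (k, T, S)" "p' = (k', T', S')" "T:B j l k" "S:B i k m" "T':B j l k'" "S':B i k' m" by auto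
  have "adj (F i T*S)*(F i T'*S') = adj S*(F i (adj T*T')*S')" using p by(simp add: mult.assoc)
  also have "... = (if k = k' & T = T' then adj S*S' else 0)"
   using p by(simp add: B_orth[OF p(3,5)] hom_zero[OF F_hom])
  also have "... = (if p = p' then 1 else 0)" using B_orth[of S i k m S' m] p by auto
  finally show "adj (case p of (k, T, S) => F i T*S)*(case p' of (k, T, S) => F i T*S) = (if p = p' then 1 else 0)" by(simp add: p)
 next
  fix X assume X: "X:?V"
  have HX: "adj (F i T)*X:Hom (F m) (FF i k)" if T: "T:B j l k" for T k
   using Hom_mult[OF Hom_lift[OF F_hom FF_hom F_hom Hom_adj[OF B_Hom[OF T] F_hom FF_hom]] X] T by simp
  have HX2: "adj S*(adj (F i T)*X) = adj (F i T*S)*X" for S T by(simp add: mult.assoc)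
  have "EX c. adj (F i T*S)*X = c*.1" if "T:B j l k" "S:B i k m" for T S k
   using irrD[OF F_irr Hom_mult[OF Hom_adj[OF B_Hom[OF that(2)] F_hom FF_hom] HX[OF that(1)]]] by(simp add: HX2)
  note ex = this
  define c where "c T S = (SOME c. adj (F i T*S)*X = c*.1)" for T S
  have c: "adj (F i T*S)*X = c T S*.1" if "T:B j l k" "S:B i k m" for T S k
   unfolding c_def by(rule someI_ex[OF ex[OF that]])
  have "X = F i (SUM k:fusion j l. SUM T:B j l k. T*adj T)*X" by(simp add: B_complete)
  also have "F i (SUM k:fusion j l. SUM T:B j l k. T*adj T) = (SUM k:fusion j l. SUM T:B j l k. F i T*adj (F i T))"
   by(subst hom_sum[OF F_hom], intro M_sum, simp, intro sum.cong refl, subst hom_sum[OF F_hom], simp_all)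
  also have "...*X = (SUM k:fusion j l. SUM T:B j l k. F i T*(adj (F i T)*X))" by(simp add: sum_distrib_right mult.assoc)
  also have "... = (SUM k:fusion j l. SUM T:B j l k. F i T*(SUM S:B i k m. S*(adj S*(adj (F i T)*X))))"
   by(intro sum.cong refl) (simp add: B_onfamD(4)[OF HX])
  also have "... = (SUM k:fusion j l. SUM T:B j l k. SUM S:B i k m. c T S*.(F i T*S))"
   by(intro sum.cong refl) (simp add: sum_distrib_left HX2 c bop_scaleC_simps del: adj_mult)
  also have "... = (SUM p:?I. (case p of (k, T, S) => c T S)*.(case p of (k, T, S) => F i T*S))"
   by(subst sum_triple[symmetric]) (simp_all add: case_prod_beta)
  finally show "EX c. X = (SUM p:?I. c p*.(case p of (k, T, S) => F i T*S))" by blast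
 qed
 have 2: "onfam ?V ?K (%(k, T, S). T*S)"
  unfolding onfam_def
 proof(intro conjI ballI)
  show "finite ?K" by simp
  show "(%(k, T, S). T*S) ` ?K \<subseteq> ?V"
  proof(rule image_subsetI, clarify)
   fix k T S assume T: "T:B i j k" and S: "S:B k l m"
   show "T*S:?V" by(rule Hom_mult[OF Hom_restrict[OF B_Hom[OF T] F_hom] B_Hom[OF S]])
  qed
  fix p p' assume "p:?K" "p':?K"
  then obtain k T S k' T' S' where p: "p = (k, T, S)" "p' = (k', T', S')" "T:B i j k" "S:B k l m" "T':B i j k'" "S':B k' l m" by auto
  have "adj (T*S)*(T'*S') = adj S*((adj T*T')*S')" using p by(simp add: mult.assoc)
  also have "... = (if k = k' & T = T' then adj S*S' else 0)" by(simp add: B_orth[OF p(3,5)])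
  also have "... = (if p = p' then 1 else 0)" using B_orth[of S k l m S' m] p by auto
  finally show "adj (case p of (k, T, S) => T*S)*(case p' of (k, T, S) => T*S) = (if p = p' then 1 else 0)" by(simp add: p)
 next
  fix X assume X: "X:?V"
  have HX: "adj T*X:Hom (F m) (FF k l)" if T: "T:B i j k" for T k
   using Hom_mult[OF Hom_restrict[OF Hom_adj[OF B_Hom[OF T] F_hom FF_hom] F_hom] X] .
  have HX2: "adj S*(adj T*X) = adj (T*S)*X" for S T by(simp add: mult.assoc)
  have "EX c. adj (T*S)*X = c*.1" if "T:B i j k" "S:B k l m" for T S k
   using irrD[OF F_irr Hom_mult[OF Hom_adj[OF B_Hom[OF that(2)] F_hom FF_hom] HX[OF that(1)]]] by(simp add: HX2)
  note ex = this
  define c where "c T S = (SOME c. adj (T*S)*X = c*.1)" for T S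
  have c: "adj (T*S)*X = c T S*.1" if "T:B i j k" "S:B k l m" for T S k
   unfolding c_def by(rule someI_ex[OF ex[OF that]])
  have "X = (SUM k:fusion i j. SUM T:B i j k. T*adj T)*X" by(simp add: B_complete)
  also have "... = (SUM k:fusion i j. SUM T:B i j k. T*(SUM S:B k l m. S*(adj S*(adj T*X))))" by(simp add: sum_distrib_right mult.assoc B_onfamD(4)[OF HX])
  also have "... = (SUM k:fusion i j. SUM T:B i j k. SUM S:B k l m. c T S*.(T*S))"
   by(intro sum.cong refl) (simp add: sum_distrib_left HX2 c bop_scaleC_simps del: adj_mult)
  also have "... = (SUM p:?K. (case p of (k, T, S) => c T S)*.(case p of (k, T, S) => T*S))"
   by(subst sum_triple[symmetric]) (simp_all add: case_prod_beta)
  finally show "EX c. X = (SUM p:?K. c p*.(case p of (k, T, S) => T*S))" by blast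
 qed
 show ?thesis
  using onfam_sesq_unique[OF 1 2 tau]
   sum_triple[of "fusion j l" "%k. B j l k" "%k. B i k m" "%k T S. tau (F i T*S) (F i T*S)"]
   sum_triple[of "fusion i j" "%k. B i j k" "%k. B k l m" "%k T S. tau (T*S) (T*S)"]
  by(simp add: case_prod_beta)
qed

subsection \<open>Degrees\<close>

definition deg :: "'i => 'g" where "deg i = (THE g. F i:component D g)"

lemma deg_iff: "F i:component D g \<longleftrightarrow> deg i = g"
proof -
 have "EX! g. F i:component D g"
  by(rule component_unique[OF F_objects]) (use irreps in \<open>simp add: irr_representatives_def\<close>)
 thus ?thesis unfolding deg_def by(metis (mono_tags, lifting) the_equality)
qed

lemma irr_component_deg: "irr_component D g = {i. deg i = g}"
 by(simp add: irr_component_def deg_iff)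

lemma constituent_component:
 assumes "rho:component D g" "X:Hom (F k) rho" "X ~= 0"
 shows "deg k = g"
by(use component_iff[OF component_objects[OF assms(1)], of g] assms(1) irreps F_objects[of k] assms(2,3) in \<open>auto simp: irr_representatives_def intertwiners_Hom deg_iff\<close>)

lemma deg_fusion:
 assumes "k:fusion i j"
 shows "deg k = deg i + deg j"
proof -
 obtain T where T: "T:B i j k" using assms by(auto simp: fusion_iff)
 have "compose M (F i) (F j):component D (deg i + deg j)"
  by(rule component_compose) (simp_all add: deg_iff)
 moreover have "T:Hom (F k) (compose M (F i) (F j))" using B_Hom[OF T] intertwiners_Hom(1,5) by metis
 moreover have "T ~= 0" using B_orth[OF T T] one_neq_zero by auto
 ultimately show ?thesis by(rule constituent_component)
qed

lemma deg_surj: "EX i. deg i = g"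
proof -
 obtain rho where rho: "rho:component D g" "rho:objects D" using component_nonempty[of g] component_objects by blast
 obtain k s where s: "s:Hom (F k) rho" "adj s * s = 1" by(rule irreducible_constituent[OF rho(2)]) (rule that)
 show ?thesis using s(2) one_neq_zero constituent_component[OF rho(1) s(1)] by force
qed

end

section \<open>Linear spans of operators\<close>

inductive_set opspan :: "'a::chilbert_space bop set => 'a bop set" for X where
 zero: "0:opspan X"
| gen: "x:X ==> x:opspan X"
| add: "x:opspan X ==> y:opspan X ==> x + y:opspan X"
| scale: "x:opspan X ==> c*.x:opspan X"

lemma op_subspace_opspan: "op_subspace (opspan X)"
 unfolding op_subspace_def by(blast intro: opspan.intros)

lemma opspan_least: "op_subspace V ==> X \<subseteq> V ==> opspan X \<subseteq> V"
proof
 fix x assume V: "op_subspace V" "X \<subseteq> V" and "x:opspan X"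
 from this(3) show "x:V" by induction (use V op_subspaceD[OF V(1)] in auto)
qed

lemma star_alg_opspan:
 assumes one: "1:opspan X" and mult: "!!x y. x:X ==> y:X ==> x*y:opspan X"
  and adj: "!!x. x:X ==> adj x:opspan X"
 shows "star_alg (opspan X)"
proof -
 have 1: "x*y:opspan X" if "x:X" "y:opspan X" for x y
  using that(2) by induction (auto simp: algebra_simps mult that(1) opspan.intros)
 have 2: "x*y:opspan X" if "x:opspan X" "y:opspan X" for x y
  using that(1) by induction (auto simp: algebra_simps 1 that(2) opspan.intros)
 have 3: "adj x:opspan X" if "x:opspan X" for x
  using that by induction (auto simp: adj opspan.intros)
 show ?thesis unfolding star_alg_def using one 2 3 op_subspace_opspan by blast
qed

lemma commutant_opspan: "commutant (opspan X) = commutant X"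
proof
 show "commutant (opspan X) \<subseteq> commutant X" by(rule commutant_antimono) (auto intro: opspan.gen)
 show "commutant X \<subseteq> commutant (opspan X)"
 proof
  fix T assume T: "T:commutant X"
  have "T*x = x*T" if "x:opspan X" for x
   using that by induction (auto simp: algebra_simps commutantD[OF T])
  thus "T:commutant (opspan X)" by(simp add: commutant_def)
 qed
qed

lemma linear_eq_on_opspan:
 assumes "!!x y. x:opspan X ==> y:opspan X ==> f (x + y) = f x + f y" "!!c x. x:opspan X ==> f (c*.x) = c*.f x"
  and "!!x y. x:opspan X ==> y:opspan X ==> g (x + y) = g x + g y" "!!c x. x:opspan X ==> g (c*.x) = c*.g x"
  and eq: "!!x. x:X ==> f x = (g x :: 'b::{scaleC,plus})" and z: "f 0 = g 0" and x: "x:opspan X"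
 shows "f x = g x"
 using x by induction (simp_all add: assms)

lemma total_star_orbit:
 assumes S: "star_alg S" and sep: "!!b. b:commutant S ==> b$$x = 0 ==> b = 0"
 shows "total ((%s. s$$x) ` S)"
 unfolding total_def
proof(intro allI impI)
 fix y assume y: "ALL v:(%s. s$$x) ` S. cinner v y = 0"
 define L where "L = closure ((%s. s$$x) ` S)"
 note L = ccsubspace_orbit[OF S, where x = x, folded L_def]
 have p: "cproj L:commutant S" by(rule cproj_in_commutant[OF L(1) star_algD(4)[OF S] L(3)])
 have "1 - cproj L:commutant S" by(rule op_subspaceD(5)[OF op_subspace_commutant one_in_commutant p])
 moreover have "(1 - cproj L)$$x = 0" by(simp add: cproj_id[OF L(1,2)])
 ultimately have "1 - cproj L = 0" by(rule sep)
 hence yL: "y:L" using cproj_in[OF L(1), of y] by simp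
 have "closed {v. cinner v y = 0}" by(intro closed_Collect_eq continuous_on_cinner continuous_on_id continuous_on_const)
 hence "L \<subseteq> {v. cinner v y = 0}" unfolding L_def by(rule closure_minimal[rotated]) (use y in auto)
 thus "y = 0" using yL by auto
qed

text \<open>\<open>f p\<close> is sent isometrically to the pair \<open>(a p, b p)\<close>, and the
  first component is kept. The defect \<open>b\<close> replaces a norm estimate on linear
  combinations.\<close>

lemma contraction_ext:
 fixes f a b :: "'x => 'a::chilbert_space"
 assumes "!!p q. cinner (a p) (a q) + cinner (b p) (b q) = cinner (f p) (f q)"
 obtains z where "!!p. z$$f p = a p"
proof -
 define f' g' :: "'x => (nat, 'a) ell2" where "f' p = single 0 (f p)" and "g' p = single 0 (a p) + single 1 (b p)" for p
 obtain u where u: "!!p. u$$f' p = g' p"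
 proof(rule gram_ext[of UNIV g' 1 f'])
  show "cinner (g' p) (g' q) = cor 1 * cinner (f' p) (f' q)" for p q
   by(simp add: f'_def g'_def cinner_simps cinner_single coord_single assms)
 qed (auto intro: that)
 obtain z where z: "op_app z = (%v. coord (u$$single 0 v) 0)"
 proof(rule bop_exists[of "%v. coord (u$$single 0 v) 0" "opn u"])
  have s: "single 0 (x + y) = single 0 x + single 0 (y::'a)" "single 0 (c*.x) = c*.single 0 x" for x y c
   by(rule ell2_eqI; simp add: coord_single)+
  show "coord (u$$single 0 (x + y)) 0 = coord (u$$single 0 x) 0 + coord (u$$single 0 y) 0" for x y by(simp add: s)
  show "coord (u$$single 0 (c*.x)) 0 = c*.coord (u$$single 0 x) 0" for x c by(simp add: s)
  have n: "norm (single 0 x) = norm (x::'a)" for x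
  proof -
   have "cor ((norm (single 0 x))^2) = cor ((norm x)^2)"
    by(simp only: cinner_self[symmetric] cinner_single) (simp add: coord_single)
   thus ?thesis by(metis norm_ge_zero of_real_eq_iff power2_eq_imp_eq)
  qed
  show "norm (coord (u$$single 0 x) 0) <= opn u*norm x" for x
   using order_trans[OF norm_coord_le norm_op_le[of u "single 0 x"]] by(simp add: n)
 qed (rule that)
 show thesis by(rule that[of z]) (simp add: z u[unfolded f'_def] g'_def coord_single)
qed

section \<open>The tensor product with the opposite algebra\<close>

context graded_category begin

abbreviation "t \<equiv> tens D"
abbreviation "tj \<equiv> tensor_j (tens D)"
abbreviation "A \<equiv> algA D"

lemma t_simps:
 "t (x + x') y = t x y + t x' y" "t x (y + y') = t x y + t x y'" "t (c*.x) y = c*.t x y" "t x (c*.y) = cnj c*.t x y"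
 "cinner (t x y) (t x' y') = cinner x x' * cnj (cinner y y')"
 using conj_tens unfolding conj_tensor_def by blast+

lemma t_total: "total {t x y | x y. True}"
proof -
 have "closure (span {t x y | x y. True}) = UNIV" using conj_tens unfolding conj_tensor_def by blast
 moreover have "v = 0" if v: "!!x y. cinner (t x y) v = 0" and c: "closure (span {t x y | x y. True}) = UNIV" for v
 proof -
  have cl: "closed {w. cinner w v = 0}" by(intro closed_Collect_eq continuous_on_cinner continuous_on_id continuous_on_const)
  have "span {t x y | x y. True} \<subseteq> {w. cinner w v = 0}"
   by(rule span_minimal) (auto simp: v subspace_def cinner_simps cinner_scaleR_left)
  hence "closure (span {t x y | x y. True}) \<subseteq> {w. cinner w v = 0}" using cl by(rule closure_minimal)
  hence "cinner v v = 0" using c by blast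
  thus ?thesis by simp
 qed
 ultimately show ?thesis unfolding total_def by blast
qed

lemma t_eqI: "(!!x y. S$$t x y = T$$t x y) ==> S = T"
 by(rule bop_eq_on_total[OF t_total]) auto

text \<open>\<open>y\<close> is the square root of \<open>cor (k^2)*.1 - adj x*x\<close>.\<close>

lemma contraction_defect:
 fixes x :: "'h bop"
 obtains y k where "0 < k" "!!xi xi'. cinner (x$$xi) (x$$xi') + cinner (y$$xi) (y$$xi') = cor (k^2) * cinner xi xi'"
proof -
 define k where "k = opn x + 1"
 have k: "0 < k" using opn_ge_0[of x] by(simp add: k_def)
 define T where "T = cor (k^2)*.1 - adj x*x"
 have "pos_op T"
  unfolding pos_op_iff
 proof
  fix v
  have "(norm (x$$v))^2 <= (k*norm v)^2"
   using norm_op_le[of x v] by(intro power_mono order_trans[OF norm_op_le] mult_right_mono) (auto simp: k_def)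
  thus "Im (cinner (T$$v) v) = 0 & 0 <= Re (cinner (T$$v) v)"
   by(simp add: T_def cinner_simps cinner_adj'[symmetric] cinner_scaleR_left cinner_self power_mult_distrib)
 qed
 then obtain y where y: "pos_op y" "y*y = T" by(rule pos_op_sqrt) (rule that)
 have "cinner (x$$xi) (x$$xi') + cinner (y$$xi) (y$$xi') = cor (k^2) * cinner xi xi'" for xi xi'
 proof -
  have "cinner (y$$xi) (y$$xi') = cinner xi ((y*y)$$xi')" by(simp add: cinner_adj pos_op_adj[OF y(1)])
  also have "... = cor (k^2) * cinner xi xi' - cinner (x$$xi) (x$$xi')"
   by(simp add: y(2) T_def cinner_simps cinner_adj cinner_scaleR_right)
  finally show ?thesis by simp
 qed
 thus thesis by(rule that[OF k])
qed

text \<open>\<open>tensor_j\<close> is a definite description, so a bounded operator with these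
  values has to be exhibited: the product of \<open>x \<otimes> 1\<close> and
  \<open>1 \<otimes> y\<close>, each obtained from \<open>contraction_ext\<close>.\<close>

lemma tensor_j_app [simp]: "tj x y$$t xi eta = t (x$$xi) (y$$eta)"
proof -
 obtain x' k where x': "0 < k" "!!xi xi'. cinner (x$$xi) (x$$xi') + cinner (x'$$xi) (x'$$xi') = cor (k^2) * cinner xi xi'"
  by(rule contraction_defect[of x]) (rule that)
 obtain z1 where z1: "!!p. z1$$(k *\<^sub>R t (fst p) (snd p)) = t (x$$fst p) (snd p)"
 proof(rule contraction_ext[of "%p. t (x$$fst p) (snd p)" "%p. t (x'$$fst p) (snd p)" "%p. k *\<^sub>R t (fst p) (snd p)"])
  show "cinner (t (x$$fst p) (snd p)) (t (x$$fst q) (snd q)) + cinner (t (x'$$fst p) (snd p)) (t (x'$$fst q) (snd q)) =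
   cinner (k *\<^sub>R t (fst p) (snd p)) (k *\<^sub>R t (fst q) (snd q))" for p q
   unfolding t_simps cinner_scaleR_left cinner_scaleR_right distrib_right[symmetric] x'(2) by(simp add: power2_eq_square)
 qed (rule that)
 obtain y' l where y': "0 < l" "!!xi xi'. cinner (y$$xi) (y$$xi') + cinner (y'$$xi) (y'$$xi') = cor (l^2) * cinner xi xi'"
  by(rule contraction_defect[of y]) (rule that)
 obtain z2 where z2: "!!p. z2$$(l *\<^sub>R t (fst p) (snd p)) = t (fst p) (y$$snd p)"
 proof(rule contraction_ext[of "%p. t (fst p) (y$$snd p)" "%p. t (fst p) (y'$$snd p)" "%p. l *\<^sub>R t (fst p) (snd p)"])
  show "cinner (t (fst p) (y$$snd p)) (t (fst q) (y$$snd q)) + cinner (t (fst p) (y'$$snd p)) (t (fst q) (y'$$snd q)) =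
   cinner (l *\<^sub>R t (fst p) (snd p)) (l *\<^sub>R t (fst q) (snd q))" for p q
   unfolding t_simps cinner_scaleR_left cinner_scaleR_right distrib_left[symmetric] complex_cnj_add[symmetric] y'(2)
   by(simp add: power2_eq_square)
 qed (rule that)
 have "z1$$t a b = inverse k *\<^sub>R t (x$$a) b" for a b
  using z1[of "(a, b)"] x'(1) by(simp add: divideR_right[symmetric] inverse_eq_divide)
 hence a1: "(cor k*.z1)$$t a b = t (x$$a) b" for a b using x'(1) by simp
 have "z2$$t a b = inverse l *\<^sub>R t a (y$$b)" for a b
  using z2[of "(a, b)"] y'(1) by(simp add: divideR_right[symmetric] inverse_eq_divide)
 hence a2: "(cor l*.z2)$$t a b = t a (y$$b)" for a b using y'(1) by simp
 define z where "z = (cor k*.z1)*(cor l*.z2)"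
 have "EX! z. ALL xi eta. z$$t xi eta = t (x$$xi) (y$$eta)" by(metis z_def times_op_app a1 a2 simp_thms t_eqI)
 from theI'[OF this] show ?thesis unfolding tensor_j_def by blast
qed

lemma tj_mult: "tj x y*tj x' y' = tj (x*x') (y*y')"
 by(rule t_eqI) simp
lemma tj_one [simp]: "tj 1 1 = 1"
 by(rule t_eqI) simp
lemma tj_adj: "adj (tj x y) = tj (adj x) (adj y)"
proof -
 have "adj (tj x y)$$t a b = tj (adj x) (adj y)$$t a b" for a b
 proof -
  have "cinner v (adj (tj x y)$$t a b - tj (adj x) (adj y)$$t a b) = 0" if "v:{t x y | x y. True}" for v
   using that by(auto simp: cinner_simps cinner_adj[symmetric] t_simps)
  thus ?thesis using totalD[OF t_total] by(metis (no_types, lifting) eq_iff_diff_eq_0)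
 qed
 thus ?thesis by(rule t_eqI)
qed
lemma sesq_tj: "sesq tj"
 unfolding sesq_def by(intro conjI allI; rule t_eqI; simp add: t_simps)
lemmas tj_sesq = sesqD[OF sesq_tj]

definition tgen :: "'k bop set" where "tgen = {tj x y | x y. x:M & y:M}"
definition S\<^sub>0 :: "'k bop set" where "S\<^sub>0 = opspan tgen"

lemma tgenI [simp]: "x:M ==> y:M ==> tj x y:tgen" unfolding tgen_def by blast

lemma S0_alg: "star_alg S\<^sub>0"
 unfolding S\<^sub>0_def
proof(rule star_alg_opspan)
 have "tj 1 1:tgen" by(rule tgenI) simp_all
 thus "1:opspan tgen" by(simp add: opspan.gen)
 show "x*y:opspan tgen" if "x:tgen" "y:tgen" for x y
 proof -
  obtain a b a' b' where "x = tj a b" "y = tj a' b'" "a:M" "b:M" "a':M" "b':M" using \<open>x \<in> tgen\<close> \<open>y \<in> tgen\<close> unfolding tgen_def by blast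
  thus ?thesis by(simp add: tj_mult opspan.gen)
 qed
 show "adj x:opspan tgen" if "x:tgen" for x
 proof -
  obtain a b where "x = tj a b" "a:M" "b:M" using \<open>x \<in> tgen\<close> unfolding tgen_def by blast
  thus ?thesis by(simp add: tj_adj opspan.gen)
 qed
qed

lemma A_eq: "A = commutant (commutant S\<^sub>0)"
 unfolding algA_def tensor_op_alg_def S\<^sub>0_def commutant_opspan tgen_def ..

lemma A'_eq: "commutant A = commutant S\<^sub>0" unfolding A_eq by(rule commutant_triple)

lemma vnA: "von_neumann_algebra A"
 unfolding A_eq by(rule von_neumann_bicommutant[OF star_algD(4)[OF S0_alg]])
lemma A_alg: "star_alg A" by(rule vn_star_alg[OF vnA])
lemmas A_sub [simp] = star_algD(2-4)[OF A_alg] star_alg_ops(1-5)[OF A_alg]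
lemmas A_sum = star_alg_ops(6)[OF A_alg]

lemma S0_A: "x:S\<^sub>0 ==> x:A" unfolding A_eq using commutant_commutant by blast
lemma tgen_S0: "x:tgen ==> x:S\<^sub>0" unfolding S\<^sub>0_def by(rule opspan.gen)
lemma tj_A [simp]: "x:M ==> y:M ==> tj x y:A" by(simp add: S0_A tgen_S0)

lemma tj_commutant:
 assumes "x:commutant M" "y:commutant M"
 shows "tj x y:commutant A"
 unfolding A'_eq S\<^sub>0_def commutant_opspan
 unfolding commutant_def tgen_def
 using commutantD[OF assms(1)] commutantD[OF assms(2)] by(auto simp: tj_mult)

lemma nmap_eq_A:
 assumes "nmap_on A f" "nmap_on A g" "!!x y. x:M ==> y:M ==> f (tj x y) = g (tj x y)"
  and f: "!!x y. x:A ==> y:A ==> f (x + y) = f x + f y" "!!c x. x:A ==> f (c*.x) = c*.f x"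
  and g: "!!x y. x:A ==> y:A ==> g (x + y) = g x + g y" "!!c x. x:A ==> g (c*.x) = c*.g x"
  and x: "x:A"
 shows "f x = g x"
proof(rule nmap_on_eq[OF S0_alg assms(1,2)[unfolded A_eq] _ x[unfolded A_eq]])
 fix s assume "s:S\<^sub>0"
 hence s: "s:opspan tgen" by(simp add: S\<^sub>0_def)
 have A: "z:A" if "z:opspan tgen" for z using S0_A that by(simp add: S\<^sub>0_def)
 have "f 0 = f (0*.0)" "g 0 = g (0*.0)" by(simp_all add: bop_scaleC_simps)
 hence z: "f 0 = 0" "g 0 = 0" using f(2)[of 0 0] g(2)[of 0 0] by(simp_all add: bop_scaleC_simps)
 from s show "f s = g s"
  by(rule linear_eq_on_opspan[rotated -1]) (use A f g assms(3) z in \<open>auto simp: tgen_def\<close>)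
qed

lemma nfun_eq_A:
 assumes "!!x y. x:M ==> y:M ==> nfun v w (tj x y) = nfun v' w' (tj x y)" and x: "x:A"
 shows "nfun v w x = nfun v' w' x"
proof(rule nfun_eq[OF S0_alg _ x[unfolded A_eq]])
 fix s assume "s:S\<^sub>0"
 hence s: "s:opspan tgen" by(simp add: S\<^sub>0_def)
 thus "nfun v w s = nfun v' w' s"
  by induction (auto simp: nfun_simps tgen_def assms(1))
qed

text \<open>Slicing an element of the commutant of \<open>\<sigma>(\<M>) \<otimes> j\<sigma>(\<M>)\<close> in \<open>\<A>\<close> gives self-intertwiners of \<open>\<sigma>\<close>.\<close>

lemma irreducible_tensor:
 assumes sig: "hom sig" "irr sig" and z: "z:A" and c: "!!x y. x:M ==> y:M ==> z*tj (sig x) (sig y) = tj (sig x) (sig y)*z"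
 shows "EX k. z = k*.1"
proof -
 \<comment> \<open>\<open>b\<close> stands for a slice of \<open>z\<close> with the vectors of the
   other leg fixed. Commuting with the commutant of \<open>M\<close> puts its operator into
   \<open>M\<close>, commuting with the image of \<open>sig\<close> makes it scalar.\<close>
 have slice: "EX k. ALL xi xi'. b xi xi' = k * cinner xi xi'"
  if b: "!!x x' y. b (x + x') y = b x y + b x' y" "!!x y y'. b x (y + y') = b x y + b x y'"
   "!!c x y. b (c*.x) y = c*b x y" "!!c x y. b x (c*.y) = cnj c*b x y"
   "!!x y. cmod (b x y) <= K*norm x*norm y" "0 <= K"
   "!!m x y. m:commutant M ==> b (m$$x) y = b x (adj m$$y)"
   "!!m x y. m:M ==> b (sig m$$x) y = b x (adj (sig m)$$y)" for b :: "'h => 'h => complex" and K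
 proof -
  obtain T :: "'h bop" where T: "!!x y. cinner x (T$$y) = b x y"
   by(rule bop_form[of b K]) (use b in auto)
  define L where "L = adj T"
  have L: "cinner (L$$x) y = b x y" for x y by(simp add: L_def cinner_adj T)
  have "L*m = m*L" if "m:commutant M" for m
   by(rule bop_cinner_eqI) (simp add: L b(7)[OF that] cinner_adj[of m])
  hence LM: "L:M" by(intro vnI[OF vnM]) auto
  have "L * sig m = sig m*L" if "m:M" for m
   by(rule bop_cinner_eqI) (simp add: L b(8)[OF that] cinner_adj[of "sig m"])
  hence "L:Hom sig sig" using LM by(simp add: Hom_def)
  then obtain k where "L = k*.1" using irrD[OF sig(2)] by blast
  thus ?thesis using L by(intro exI[of _ k]) (auto simp: cinner_scaleC_left simp flip: L)
 qed
 have n: "norm (t x y) = norm x*norm y" for x y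
 proof -
  have "cor ((norm (t x y))^2) = cor ((norm x*norm y)^2)"
   by(simp only: cinner_self[symmetric] t_simps(5)) (simp add: cinner_self power_mult_distrib)
  hence "(norm (t x y))^2 = (norm x*norm y)^2" using of_real_eq_iff by blast
  thus ?thesis by(simp add: power2_eq_iff_nonneg)
 qed
 have bd: "cmod (cinner (z$$t a b) (t a' b')) <= opn z*(norm a*norm b)*(norm a'*norm b')" for a b a' b'
  using order_trans[OF cmod_cinner_mult_le[of "z$$t a b" "t a' b'"] mult_right_mono[OF norm_op_le[of z "t a b"] norm_ge_zero]] by(simp add: n)
 have one': "1:commutant M" by(rule one_in_commutant)
 have comm: "cinner (z$$tj x y$$v) w = cinner (z$$v) (adj (tj x y)$$w)"
  if "z*tj x y = tj x y*z" for x y v w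
 proof -
  have "cinner ((z*tj x y)$$v) w = cinner ((tj x y*z)$$v) w" by(simp only: that)
  thus ?thesis by(simp add: cinner_adj[of "tj x y"])
 qed
 have cA: "z*tj x y = tj x y*z" if "x:commutant M" "y:commutant M" for x y
  using commutantD[OF tj_commutant[OF that] z] by simp
 have s1: "sig 1 = 1" by(rule homD(6)[OF sig(1)])
 have "EX k. ALL xi xi'. cinner (z$$t xi eta) (t xi' eta') = k * cinner xi xi'" for eta eta'
 proof(rule slice[where K = "opn z*norm eta*norm eta'"])
  show "cinner (z$$t (m$$x) eta) (t y eta') = cinner (z$$t x eta) (t (adj m$$y) eta')" if "m:commutant M" for m x y
   using comm[OF cA[OF that one'], of "t x eta" "t y eta'"] by(simp add: tj_adj)
  show "cinner (z$$t (sig m$$x) eta) (t y eta') = cinner (z$$t x eta) (t (adj (sig m)$$y) eta')" if "m:M" for m x y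
   using comm[OF c[OF that M_sub(1)], of "t x eta" "t y eta'"] by(simp add: tj_adj s1)
  show "cmod (cinner (z$$t x eta) (t y eta')) <= opn z*norm eta*norm eta'*norm x*norm y" for x y using bd[of x eta y eta'] by(simp add: mult_ac)
 qed (simp_all add: t_simps cinner_simps opn_ge_0)
 then obtain k where k: "!!eta eta' xi xi'. cinner (z$$t xi eta) (t xi' eta') = k eta eta' * cinner xi xi'" by metis
 have "EX l. ALL eta eta'. cnj (cinner (z$$t xi eta) (t xi' eta')) = l * cinner eta eta'" for xi xi'
 proof(rule slice[where K = "opn z*norm xi*norm xi'"])
  show "cnj (cinner (z$$t xi (m$$x)) (t xi' y)) = cnj (cinner (z$$t xi x) (t xi' (adj m$$y)))" if "m:commutant M" for m x y
   using comm[OF cA[OF one' that], of "t xi x" "t xi' y"] by(simp add: tj_adj)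
  show "cnj (cinner (z$$t xi (sig m$$x)) (t xi' y)) = cnj (cinner (z$$t xi x) (t xi' (adj (sig m)$$y)))" if "m:M" for m x y
   using comm[OF c[OF M_sub(1) that], of "t xi x" "t xi' y"] by(simp add: tj_adj s1)
  show "cmod (cnj (cinner (z$$t xi x) (t xi' y))) <= opn z*norm xi*norm xi'*norm x*norm y" for x y using bd[of xi x xi' y] by(simp add: mult_ac)
 qed (simp_all add: t_simps cinner_simps opn_ge_0)
 then obtain l where l: "!!xi xi' eta eta'. cnj (cinner (z$$t xi eta) (t xi' eta')) = l xi xi' * cinner eta eta'" by metis
 obtain e :: 'h where e: "cinner e e = 1"
 proof -
  obtain y :: 'h where y: "y ~= 0" using one_neq_zero by(metis bop_eqI one_op_app zero_op_app)
  thus thesis using that[of "inverse (norm y) *\<^sub>R y"] by(simp add: cinner_self)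
 qed
 have kl: "k eta eta' = cnj (l e e) * cnj (cinner eta eta')" for eta eta'
  using arg_cong[OF l[of e eta e eta'], of cnj] k[of e eta e eta'] e by simp
 have "z$$t a b = (cnj (l e e)*.1)$$t a b" for a b
 proof -
  have "cinner (t x y) (z$$t a b - cnj (l e e)*.t a b) = 0" for x y
  proof -
   have "cinner (z$$t a b - cnj (l e e)*.t a b) (t x y) = 0" by(simp add: cinner_simps k kl t_simps)
   thus ?thesis by(subst cinner_commute) simp
  qed
  hence "z$$t a b - cnj (l e e)*.t a b = 0" by(intro totalD[OF t_total]) auto
  thus ?thesis by simp
 qed
 hence "z = cnj (l e e)*.1" by(rule t_eqI)
 thus ?thesis ..
qed

subsection \<open>Product functionals\<close>

text \<open>The coordinates are indexed by pairs and re-enumerated by \<open>nat\<close>; the second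
  conclusion keeps the access to single pairs that the re-enumeration hides.\<close>

lemma product_vector:
 fixes tht :: "(nat, 'h) ell2"
 obtains Th :: "(nat, 'k) ell2" where "!!x y. nfun Th Th (tj x y) = nfun tht tht x * cnj (nfun tht tht y)"
  "!!a i j. amp a$$Th = 0 ==> a$$t (coord tht i) (coord tht j) = 0"
proof -
 define f :: "nat \<times> nat => 'k" where "f p = t (coord tht (fst p)) (coord tht (snd p))" for p
 have nf: "(norm (f p))^2 = (norm (coord tht (fst p)))^2*(norm (coord tht (snd p)))^2" for p
 proof -
  have "cor ((norm (f p))^2) = cor ((norm (coord tht (fst p)))^2*(norm (coord tht (snd p)))^2)"
   by(simp only: cinner_self[symmetric] f_def t_simps(5)) (simp add: cinner_self)
  thus ?thesis using of_real_eq_iff by blast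
 qed
 have s: "(%p. (norm (f p))\<^sup>2) summable_on UNIV"
 proof(rule nonneg_bdd_above_summable_on)
  show "bdd_above (sum (%p. (norm (f p))\<^sup>2) ` {F. F \<subseteq> UNIV & finite F})"
  proof(rule bdd_aboveI2)
   fix F :: "(nat \<times> nat) set" assume "F:{F. F \<subseteq> UNIV & finite F}"
   hence F: "finite F" by simp
   have "(SUM p:F. (norm (f p))\<^sup>2) <= (SUM p:fst ` F \<times> snd ` F. (norm (f p))\<^sup>2)"
    by(rule sum_mono2) (use F in \<open>force\<close>)+
   also have "... = (SUM i:fst ` F. (norm (coord tht i))\<^sup>2)*(SUM j:snd ` F. (norm (coord tht j))\<^sup>2)"
    by(simp add: nf sum_product sum.cartesian_product case_prod_beta)
   also have "... <= (norm tht)^2*(norm tht)^2" by(intro mult_mono sum_norm_coord_le sum_nonneg) (use F in auto)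
   finally show "(SUM p:F. (norm (f p))\<^sup>2) <= (norm tht)^2*(norm tht)^2" .
  qed
 qed simp
 define T where "T = Abs_ell2 f"
 have T: "coord T p = f p" for p unfolding T_def using Abs_ell2[OF s] by simp
 have val: "cinner (amp (tj x y)$$T) T = nfun tht tht x * cnj (nfun tht tht y)" for x y
 proof -
  define g where "g i j = cinner (x$$coord tht i) (coord tht i) * cnj (cinner (y$$coord tht j) (coord tht j))" for i j
  have eq: "cinner (coord (amp (tj x y)$$T) p) (coord T p) = (case p of (i, j) => g i j)" for p
   by(simp add: T f_def t_simps g_def case_prod_beta)
  have sm: "(%(i, j). g i j) summable_on UNIV \<times> UNIV"
   using cinner_coord_summable[of "amp (tj x y)$$T" T] by(simp only: eq UNIV_Times_UNIV)
  have "cinner (amp (tj x y)$$T) T = (\<Sum>\<^sub>\<infinity>(i, j)\<in>UNIV \<times> UNIV. g i j)" unfolding cinner_ell2 eq by simp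
  also have "... = (\<Sum>\<^sub>\<infinity>i. \<Sum>\<^sub>\<infinity>j. g i j)" by(rule infsum_Sigma'_banach[symmetric]) (rule sm)
  also have "... = nfun tht tht x * cnj (nfun tht tht y)" by(simp add: g_def infsum_cmult_right' nfun_def cinner_ell2 infsum_cnj infsum_cmult_left')
  finally show ?thesis .
 qed
 define Th where "Th = reindex to_nat T"
 have nf2: "nfun Th Th z = cinner (amp z$$T) T" for z
  by(simp add: Th_def nfun_def amp_reindex cinner_reindex)
 show thesis
 proof(rule that[of Th])
  show "nfun Th Th (tj x y) = nfun tht tht x * cnj (nfun tht tht y)" for x y by(simp only: nf2 val)
  fix a i j assume "amp a$$Th = 0"
  hence "nfun Th Th (adj a*a) = 0" by(simp add: nfun_adj_mult)
  hence "cinner ((adj (amp a)*amp a)$$T) T = 0" unfolding nf2 by(simp add: amp_simps)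
  hence "amp a$$T = 0" by(simp only: adj_mult_self_app) simp
  hence "coord (amp a$$T) (i, j) = 0" by simp
  thus "a$$t (coord tht i) (coord tht j) = 0" by(simp add: T f_def)
 qed
qed

text \<open>Faithfulness makes the commutant orbits of the coordinates of \<open>tht\<close> total,
  so their product vectors are total in the tensor product; \<open>a\<close> commutes with the
  operators that produce them.\<close>

lemma faithful_product:
 fixes tht :: "(nat, 'h) ell2"
 assumes faithful: "!!x. x:M ==> amp x$$tht = 0 ==> x = 0"
  and a: "a:A" and 0: "!!i j. a$$t (coord tht i) (coord tht j) = 0"
 shows "a = 0"
proof -
 define L where "L = {y. ALL m:commutant M. ALL n. cinner (m$$coord tht n) y = 0}"
 have M': "star_alg (commutant M)" by(rule star_alg_commutant) simp
 have L: "ccsubspace L"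
 proof(rule ccsubspaceI)
  have "L = (\<Inter>m\<in>commutant M. \<Inter>n. {y. cinner (m$$coord tht n) y = 0})" by(auto simp: L_def)
  thus "closed L" by(auto intro!: closed_INT closed_Collect_eq continuous_on_cinner continuous_on_id continuous_on_const)
 qed (auto simp: L_def cinner_simps)
 have "cproj L:commutant (commutant M)"
 proof(rule cproj_in_commutant[OF L star_algD(4)[OF M']])
  fix m y assume m: "m:commutant M" and y: "y:L"
  have "cinner (m'$$coord tht n) (m$$y) = 0" if "m':commutant M" for m' n
  proof -
   show ?thesis using y star_algD(3)[OF M' star_algD(4)[OF M' m] that] by(auto simp: L_def cinner_adj)
  qed
  thus "m$$y:L" by(simp add: L_def)
 qed
 hence pM: "cproj L:M" by(simp add: vn_commutant[OF vnM])
 have "cproj L$$coord tht n = 0" for n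
 proof(rule cproj_eq_0[OF L])
  fix k assume "k:L"
  hence "cinner (1$$coord tht n) k = 0" using one_in_commutant unfolding L_def by blast
  thus "cinner k (coord tht n) = 0" by(subst cinner_commute) simp
 qed
 hence "amp (cproj L)$$tht = 0" by(intro ell2_eqI) simp
 hence p0: "cproj L = 0" by(rule faithful[OF pM])
 have tot: "y = 0" if y: "!!m n. m:commutant M ==> cinner (m$$coord tht n) y = 0" for y
  using cproj_id[OF L, of y] y p0 by(simp add: L_def)
 have z: "cinner (a$$t (m$$coord tht i) (m'$$coord tht j)) v = 0" if "m:commutant M" "m':commutant M" for m m' i j v
 proof -
  have "a*tj m m' = tj m m'*a" using commutantD[OF tj_commutant[OF that] a] by simp
  hence "(a*tj m m')$$t (coord tht i) (coord tht j) = tj m m'$$a$$t (coord tht i) (coord tht j)" by simp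
  thus ?thesis by(simp add: 0)
 qed
 have w0: "cinner (t x y) w = 0" if w: "!!m m' i j. m:commutant M ==> m':commutant M ==> cinner (t (m$$coord tht i) (m'$$coord tht j)) w = 0" for w x y
 proof -
  have bt: "norm (t x y) = norm x*norm y" for x y
  proof -
   have "cor ((norm (t x y))^2) = cor ((norm x*norm y)^2)"
    by(simp only: cinner_self[symmetric] t_simps(5)) (simp add: cinner_self power_mult_distrib)
   hence "(norm (t x y))^2 = (norm x*norm y)^2" using of_real_eq_iff by blast
   thus ?thesis by(simp add: power2_eq_iff_nonneg)
  qed
  have bd: "cmod (cinner (t x y) w) <= norm x*norm y*norm w" for x y
   using cmod_cinner_mult_le[of "t x y" w] by(simp add: bt)
  define b where "b x y = cinner (t x y) w" for x y
  have fst0: "b x (m'$$coord tht j) = 0" if m': "m':commutant M" for x m' j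
  proof -
   obtain eta where eta: "!!x. b x (m'$$coord tht j) = cinner x eta"
   proof(rule riesz[of "%x. b x (m'$$coord tht j)" "norm (m'$$coord tht j)*norm w"])
    show "cmod (b x (m'$$coord tht j)) <= norm (m'$$coord tht j)*norm w*norm x" for x
     using bd[of x "m'$$coord tht j"] by(simp add: b_def mult_ac)
   qed (auto simp: b_def t_simps cinner_simps)
   have "eta = 0" by(rule tot) (simp add: eta[symmetric] b_def w m')
   thus ?thesis by(simp add: eta)
  qed
  obtain eta where eta: "!!y. cnj (b x y) = cinner y eta"
  proof(rule riesz[of "%y. cnj (b x y)" "norm x*norm w"])
   show "cmod (cnj (b x y)) <= norm x*norm w*norm y" for y
    using bd[of x y] by(simp add: b_def mult_ac)
  qed (auto simp: b_def t_simps cinner_simps)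
  have "eta = 0" by(rule tot) (simp add: eta[symmetric] fst0)
  thus ?thesis using eta[of y] by(simp add: b_def)
 qed
 have "adj a$$v = 0" for v
 by(use w0 totalD[OF t_total] in \<open>force simp: cinner_adj[symmetric] z\<close>)
 hence "adj a = 0" by(intro bop_eqI) simp
 thus "a = 0" by(metis adj_adj adj_zero)
qed

end

lemma bop_eq_on_total2:
 assumes S: "total S" and eq: "!!x y. x:S ==> y:S ==> cinner (T$$x) y = cinner (T'$$x) y"
 shows "T = T'"
proof(rule bop_eq_on_total[OF S])
 fix x assume x: "x:S"
 have "T$$x - T'$$x = 0"
 proof(rule totalD[OF S])
  fix y assume "y:S"
  hence "cinner (T$$x - T'$$x) y = 0" using eq[OF x] by(simp add: cinner_simps)
  thus "cinner y (T$$x - T'$$x) = 0" by(subst cinner_commute) simp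
 qed
 thus "T$$x = T'$$x" by simp
qed

lemma (in graded_category) one_neq_zero_K: "(1::'k bop) ~= 0"
proof
 assume *: "(1::'k bop) = 0"
 obtain y :: 'h where y: "y ~= 0" using one_neq_zero by(metis bop_eqI one_op_app zero_op_app)
 have "cinner (t y y) (t y y) = 0" using arg_cong[OF *, of "%T. T$$t y y"] by simp
 thus False using y by(simp add: t_simps)
qed

lemma (in graded_category) factor_A: "factor A"
 unfolding factor_def
proof(intro conjI vnA one_neq_zero_K subset_antisym subsetI)
 fix z assume z: "z:A \<inter> commutant A"
 have "EX k. z = k*.1"
 proof(rule irreducible_tensor[OF hom_id irr_id])
  show "z:A" using z by simp
  show "z*tj x y = tj x y*z" if "x:M" "y:M" for x y
   using commutantD[of z A "tj x y"] z that by simp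
 qed
 thus "z:range (%c. c*.1)" by blast
next
 fix z :: "'k bop" assume "z:range (%c. c*.1)"
 thus "z:A \<inter> commutant A" by(auto simp: commutant_def)
qed

sublocale graded_category \<subseteq> AA: factor_algebra "algA D"
 by unfold_locales (rule factor_A)

sublocale graded_category \<subseteq> SF: std_form "algA D" "mod_conj D" "pos_cone D"
 by unfold_locales (rule standard)

context graded_category begin

abbreviation "J \<equiv> mod_conj D"
abbreviation "P \<equiv> pos_cone D"
abbreviation "FA \<equiv> endA D"

section \<open>The endomorphisms of the tensor product\<close>

definition faithful_on :: "'a::chilbert_space bop set => (nat, 'a) ell2 => bool" where
 "faithful_on N tht \<longleftrightarrow> (ALL x:N. amp x$$tht = 0 --> x = 0)"

lemma state_vector:
 obtains tht where "!!x. x:M ==> state D x = nfun tht tht x" "faithful_on M tht"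
proof -
 note st = state[unfolded faithful_normal_state_def]
 obtain v w where vw: "!!x. x:M ==> state D x = nfun v w x"
  by(rule normal_functional_nfun[OF star_algD(1)[OF Malg], of "state D"]) (use st in blast, rule that)
 obtain tht where tht: "!!x. x:M ==> state D x = nfun tht tht x"
 proof(rule vector_representation[OF Malg, of "state D" v w])
  show "state D (adj x*x):\<real>\<^sub>\<ge>\<^sub>0" if "x:M" for x using st that by blast
 qed (use vw in \<open>simp_all add: that\<close>)
 show thesis
 proof(rule that[OF tht])
  show "faithful_on M tht"
   unfolding faithful_on_def
  by(use ballI impI st in \<open>simp add: tht nfun_adj_mult\<close>)
 qed
qed

lemma product_cone_vector:
 assumes tht: "faithful_on M tht"
 obtains ze where "ze:P" "SF.separating ze" "!!x y. x:M ==> y:M ==> vfun ze (tj x y) = nfun tht tht x * cnj (nfun tht tht y)"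
proof -
 obtain Th :: "(nat, 'k) ell2" where Th: "!!x y. nfun Th Th (tj x y) = nfun tht tht x * cnj (nfun tht tht y)"
  "!!a i j. amp a$$Th = 0 ==> a$$t (coord tht i) (coord tht j) = 0" by(rule product_vector) (rule that)
 have f: "a = 0" if "a:A" "amp a$$Th = 0" for a
  by(rule faithful_product[OF _ that(1) Th(2)[OF that(2)]]) (use tht in \<open>auto simp: faithful_on_def\<close>)
 obtain Om where Om: "Om:P" "SF.separating Om"
 proof(rule SF.separating_exists[of Th])
  show "a = 0" if "a:A" "amp a$$Th = 0" for a by(rule f[OF that])
 qed (rule that)
 obtain ze where ze: "ze:P" "!!a. a:A ==> vfun ze a = nfun Th Th a" by(rule SF.cone_vector_exists[OF Om]) (rule that)
 show thesis
 proof(rule that[OF ze(1)])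
  show "SF.separating ze"
   unfolding SF.separating_def
  proof(intro ballI impI)
   fix a assume a: "a:A" and "a$$ze = 0"
   thus "a = 0" using ze(2)[of "adj a*a"] f[OF a] by(simp add: vfun_adj_mult nfun_adj_mult)
  qed
 qed (simp add: ze(2) Th(1))
qed

lemma total_tensor_orbit:
 assumes "Om:P" "SF.separating Om"
 shows "total {tj x y$$Om | x y. x:M & y:M}"
proof -
 have "b = 0" if b: "b:commutant S\<^sub>0" "b$$Om = 0" for b
 proof -
  obtain a where a: "a:A" "b = SF.jop a" using b(1) by(auto simp: A'_eq[symmetric] SF.commutant_eq)
  show ?thesis using b(2) SF.norm_J[of "a$$Om"] SF.separatingD[OF assms(2) a(1)] SF.jop_simps(2)[of a a] by(simp add: a(2) SF.jop_app SF.P_J[OF assms(1)])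
 qed
 hence tot: "total ((%s. s$$Om) ` S\<^sub>0)" by(rule total_star_orbit[OF S0_alg])
 show ?thesis
  unfolding total_def
 proof(intro allI impI)
  fix v assume v: "ALL w:{tj x y$$Om | x y. x:M & y:M}. cinner w v = 0"
  have "cinner (s$$Om) v = 0" if "s:opspan tgen" for s
   using that by induction (use v in \<open>auto simp: tgen_def cinner_simps\<close>)
  thus "v = 0" by(intro totalD[OF tot]) (auto simp: S\<^sub>0_def)
 qed
qed

text \<open>Provides the normal extension behind \<open>endA\<close>. The functional
  \<open>phi\<close> is chosen so that sending \<open>x\<close> to \<open>F (cb i) x\<close> on both
  legs becomes a multiple \<open>u\<close> of an isometry between the orbits of two product vectors;
  by the zigzag equations \<open>adj u*tj (R i) (R i)\<close> is a coisometry and implements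
  \<open>F i\<close>.\<close>

lemma endomorphism_implemented:
 obtains V where "V*adj V = 1" "!!x y. x:M ==> y:M ==> V*tj x y = tj (F i x) (F i y)*V"
proof -
 let ?p = "F i" and ?q = "F (cb i)"
 note C = F_conjD[where i = i]
 obtain tht where tht: "!!x. x:M ==> state D x = nfun tht tht x" "faithful_on M tht" by(rule state_vector) (rule that)
 define phi where "phi x = nfun tht tht (adj (R' i)*?p x*R' i)" for x
 have "nmap_on M (%x. adj (R' i)*?p x*R' i)"
  by(rule nmap_on_sandwich[OF endos_nmap[OF star_algD(1)[OF Malg] F_endos]])
 then obtain v w where vw: "!!x. x:M ==> nfun tht tht (adj (R' i)*?p x*R' i) = nfun v w x"
  by(rule nmap_onE[where v = tht and w = tht]) (rule that)
 have pos: "phi (adj x*x) = cor ((norm (amp (?p x*R' i)$$tht))^2)" if "x:M" for x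
 proof -
  have "adj (R' i)*?p (adj x*x)*R' i = adj (?p x*R' i)*(?p x*R' i)" using that by(simp add: mult.assoc)
  thus ?thesis unfolding phi_def by(simp only: nfun_adj_mult)
 qed
 obtain tht' where tht': "!!x. x:M ==> phi x = nfun tht' tht' x"
 proof(rule vector_representation[OF Malg, of phi v w])
  show "phi x = nfun v w x" if "x:M" for x unfolding phi_def by(rule vw[OF that])
  show "phi (adj x*x):\<real>\<^sub>\<ge>\<^sub>0" if "x:M" for x using pos[OF that] by(simp add: nonneg_Reals_iff)
 qed (rule that)
 have f': "faithful_on M tht'"
  unfolding faithful_on_def
 proof(intro ballI impI)
  fix x assume x: "x:M" and "amp x$$tht' = 0"
  hence "amp (?p x*R' i)$$tht = 0" using pos[OF x] by(simp add: tht' nfun_adj_mult)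
  hence 0: "?p x*R' i = 0" using tht(2) x by(simp add: faithful_on_def)
  have "x = x*(adj (R i)*?q (R' i))" by(simp add: C(5))
  also have "... = adj (R i)*?q (?p x)*?q (R' i)" using C(9)[OF x] by(simp add: mult.assoc)
  also have "... = adj (R i)*?q (?p x*R' i)" using x by(simp add: mult.assoc)
  finally show "x = 0" by(simp only: 0 hom_zero[OF F_hom] mult_zero_right)
 qed
 obtain Om where Om: "Om:P" "SF.separating Om" "!!x y. x:M ==> y:M ==> vfun Om (tj x y) = nfun tht tht x * cnj (nfun tht tht y)"
  by(rule product_cone_vector[OF tht(2)]) (rule that)
 obtain xi where xi': "!!x y. x:M ==> y:M ==> vfun xi (tj x y) = nfun tht' tht' x * cnj (nfun tht' tht' y)"
  by(rule product_cone_vector[OF f']) (rule that)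
 have xi: "vfun xi (tj x y) = phi x * cnj (phi y)" if "x:M" "y:M" for x y
  using that by(simp add: xi' tht')
 have ip: "cinner (tj x y$$ze) (tj x' y'$$ze) = vfun ze (tj (adj x'*x) (adj y'*y))" for x y x' y' ze
  by(simp add: vfun_def tj_mult[symmetric] tj_adj[symmetric] cinner_adj'[symmetric])
 have phiq: "phi (?q (adj b)*m*?q a) = nfun tht tht (adj b*(adj (R' i)*?p m*R' i)*a)" if "a:M" "b:M" "m:M" for a b m
 proof -
  have "adj (R' i)*?p (?q (adj b)*m*?q a)*R' i = (adj (R' i)*?p (?q (adj b)))*?p m*(?p (?q a)*R' i)"
   using that by(simp add: mult.assoc)
  also have "adj (R' i)*?p (?q (adj b)) = adj b*adj (R' i)" by(rule C(10)) (use that in simp)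
  also have "?p (?q a)*R' i = R' i*a" by(rule C(8)[symmetric]) (rule that)
  finally show ?thesis by(simp add: phi_def mult.assoc)
 qed
 define X where "X = M \<times> M"
 define f where "f p = tj (fst p) (snd p)$$Om" for p
 define g where "g p = tj (?q (fst p)) (?q (snd p))$$xi" for p
 obtain u where u: "!!p. p:X ==> u$$f p = g p"
 proof(rule gram_ext[of X g "(d i)^2" f])
  fix p r assume "p:X" "r:X"
  hence m [simp]: "fst p:M" "snd p:M" "fst r:M" "snd r:M" by(auto simp: X_def)
  have s: "phi (adj (?q b)*?q a) = d i*nfun tht tht (adj b*a)" if "a:M" "b:M" for a b
   using phiq[OF that, of 1] that by(simp add: stdD(5)[OF F_std] bop_scaleC_simps nfun_simps)
  show "cinner (g p) (g r) = cor ((d i)^2) * cinner (f p) (f r)"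
   unfolding f_def g_def ip by(simp add: xi Om(3) s power2_eq_square)
 qed (auto intro: that)
 have tot: "total (f ` X)"
 proof -
  have "f ` X = {tj x y$$Om | x y. x:M & y:M}" by(force simp: f_def X_def)
  thus ?thesis using total_tensor_orbit[OF Om(1,2)] by simp
 qed
 have rel: "u*tj x y = tj (?q x) (?q y)*u" if [simp]: "x:M" "y:M" for x y
 proof(rule bop_eq_on_total[OF tot])
  fix v assume "v:f ` X"
  then obtain p where p: "p:X" "v = f p" by blast
  hence m [simp]: "fst p:M" "snd p:M" by(auto simp: X_def)
  have "tj x y$$f p = f (x*fst p, y * snd p)" by(simp add: f_def tj_mult flip: times_op_app)
  hence "u$$tj x y$$f p = g (x*fst p, y * snd p)" using u[of "(x*fst p, y * snd p)"] by(simp add: X_def)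
  also have "... = tj (?q x) (?q y)$$g p" by(simp add: g_def tj_mult flip: times_op_app)
  finally show "(u*tj x y)$$v = (tj (?q x) (?q y)*u)$$v" by(simp add: p u)
 qed
 define V where "V = adj u*tj (R i) (R i)"
 show thesis
 proof(rule that[of V])
  fix x y assume m [simp]: "x:M" "y:M"
  have "adj (u*tj (adj (?p x)) (adj (?p y))) = adj (tj (?q (adj (?p x))) (?q (adj (?p y)))*u)" by(subst rel) simp_all
  hence r: "adj u*tj (?q (?p x)) (?q (?p y)) = tj (?p x) (?p y)*adj u" by(simp add: tj_adj)
  have "V*tj x y = adj u*tj (R i*x) (R i*y)" by(simp add: V_def mult.assoc tj_mult)
  also have "... = adj u*tj (?q (?p x)) (?q (?p y))*tj (R i) (R i)" by(simp add: C(7) mult.assoc tj_mult)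
  finally show "V*tj x y = tj (?p x) (?p y)*V" by(simp add: r V_def mult.assoc)
 next
  show "V*adj V = 1"
  proof(rule bop_eq_on_total2[OF tot])
   fix v w assume "v:f ` X" "w:f ` X"
   then obtain p r where p: "p:X" "v = f p" "r:X" "w = f r" by blast
   hence m [simp]: "fst p:M" "snd p:M" "fst r:M" "snd r:M" by(auto simp: X_def)
   have aV: "adj V$$f p = tj (adj (R i)*?q (fst p)) (adj (R i)*?q (snd p))$$xi" if "p:X" for p
    using u[OF that] by(simp add: V_def tj_adj g_def flip: tj_mult)
   have "cinner ((V*adj V)$$v) w = cinner (adj V$$f p) (adj V$$f r)" by(simp add: p cinner_adj)
   also have "... = vfun xi (tj (adj (adj (R i)*?q (fst r))*(adj (R i)*?q (fst p))) (adj (adj (R i)*?q (snd r))*(adj (R i)*?q (snd p))))"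
    by(simp only: aV p ip)
   also have "... = phi (?q (adj (fst r))*(R i*adj (R i))*?q (fst p)) * cnj (phi (?q (adj (snd r))*(R i*adj (R i))*?q (snd p)))" by(use xi in \<open>simp add: mult.assoc\<close>)
   also have "... = nfun tht tht (adj (fst r)*fst p) * cnj (nfun tht tht (adj (snd r) * snd p))"
   proof -
    have "adj (R' i)*?p (R i*adj (R i))*R' i = (adj (R' i)*?p (R i))*(adj (?p (R i))*R' i)" by(simp add: mult.assoc)
    hence *: "adj (R' i)*?p (R i*adj (R i))*R' i = 1" by(simp only: C(6,12) mult_1)
    show ?thesis by(simp only: phiq m M_sub R_M * mult_1_right)
   qed
   also have "... = cinner (f p) (f r)" by(simp add: f_def ip Om(3))
   finally show "cinner ((V*adj V)$$v) w = cinner (1$$v) w" by(simp add: p)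
  qed
 qed
qed

text \<open>A relation rather than an operation: it is closed under composition, so products of the
  \<open>FA i\<close> are covered as well.\<close>

definition lift :: "('h bop => 'h bop) => ('k bop => 'k bop) => bool" where
 "lift rho f \<longleftrightarrow> hom rho & AA.hom f & nmap_on A f & (ALL x:M. ALL y:M. f (tj x y) = tj (rho x) (rho y))"

lemma liftD:
 assumes "lift rho f"
 shows "hom rho" "AA.hom f" "nmap_on A f" "x:M ==> y:M ==> f (tj x y) = tj (rho x) (rho y)"
 using assms by(auto simp: lift_def)

lemma lift_id: "lift (%x. x) (%x. x)"
 by(simp add: lift_def hom_id AA.hom_id nmap_on_id)

lemma lift_comp:
 assumes "lift rho f" "lift sig g"
 shows "lift (%x. rho (sig x)) (%a. f (g a))"
 unfolding lift_def
 using hom_comp[OF liftD(1)[OF assms(1)] liftD(1)[OF assms(2)]] AA.hom_comp[OF liftD(2)[OF assms(1)] liftD(2)[OF assms(2)]]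
  nmap_on_comp[OF liftD(3)[OF assms(1)] liftD(3)[OF assms(2)] AA.homD(1)[OF liftD(2)[OF assms(2)]]]
  liftD(4)[OF assms(1)] liftD(4)[OF assms(2)] homD(1)[OF liftD(1)[OF assms(2)]]
 by simp

lemma lift_Hom:
 assumes f: "lift rho f" and g: "lift sig g" and T: "T:Hom rho sig" and S: "S:Hom rho sig"
 shows "tj T S:AA.Hom f g"
proof(rule AA.HomI)
 note F = AA.homD[OF liftD(2)[OF f]] and G = AA.homD[OF liftD(2)[OF g]]
 show "tj T S:A" using HomD(1)[OF T] HomD(1)[OF S] by simp
 fix a assume a: "a:A"
 show "tj T S*f a = g a*tj T S"
 by(use nmap_eq_A[OF nmap_on_left[OF liftD(3)[OF f]] nmap_on_right[OF liftD(3)[OF g]] _ _ _ _ _ a] HomD(2)[OF T] HomD(2)[OF S] in \<open>simp add: liftD(4)[OF f] liftD(4)[OF g] tj_mult F G algebra_simps bop_scaleC_simps\<close>)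
qed

text \<open>For the coisometry \<open>V\<close>, the projection \<open>adj V*V\<close> lies in the
  commutant of \<open>A\<close>, which makes \<open>a \<mapsto> V*a*adj V\<close> multiplicative.
  Normality and the values on elementary tensors identify it with the definite description.\<close>

lemma FA_lift: "lift (F i) (FA i)" and FA_endos: "FA i:endos A"
 and FA_implemented: "EX V. V*adj V = 1 & (ALL a:A. FA i a = V*a*adj V)"
proof -
 obtain V where V: "V*adj V = 1" "!!x y. x:M ==> y:M ==> V*tj x y = tj (F i x) (F i y)*V"
  by(rule endomorphism_implemented) (rule that)
 have "adj V*V:commutant tgen"
  unfolding commutant_def
 proof(intro CollectI ballI)
  fix z assume "z:tgen"
  then obtain x y where z: "z = tj x y" "x:M" "y:M" unfolding tgen_def by blast
  have "adj (V*tj (adj x) (adj y)) = adj (tj (F i (adj x)) (F i (adj y))*V)" by(subst V(2)) (use z in simp_all)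
  hence "(tj x y*adj V)*V = adj V*(V*tj x y)" using z V(2)[OF z(2,3)] by(simp add: tj_adj mult.assoc)
  thus "adj V*V*z = z*(adj V*V)" by(simp add: z(1) mult.assoc)
 qed
 hence VV: "adj V*V*a = a*(adj V*V)" if "a:A" for a
  using that A'_eq unfolding S\<^sub>0_def commutant_opspan by(auto simp: commutant_def)
 define G where "G = (\<lambda>z\<in>A. V*z*adj V)"
 have Gtj: "G (tj x y) = tj (F i x) (F i y)" if "x:M" "y:M" for x y
 proof -
  have "G (tj x y) = tj (F i x) (F i y)*(V*adj V)" using that by(simp add: G_def V(2)) (simp add: mult.assoc)
  thus ?thesis by(simp add: V(1))
 qed
 have nm: "nmap_on A (%z. V*z*adj V)" by(rule nmap_on_sandwich[OF nmap_on_id])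
 have Gn: "nmap_on A G" by(rule nmap_on_cong[OF nm]) (simp add: G_def)
 have GA: "G z:A" if z: "z:A" for z
 proof(rule vnI[OF vnA])
  fix c assume c: "c:commutant A"
  have "(V*z*adj V) * c = c*(V*z*adj V)"
  proof(rule nmap_eq_A[OF nmap_on_right[OF nm] nmap_on_left[OF nm] _ _ _ _ _ z])
   fix x y assume m: "x:M" "y:M"
   show "(V*tj x y*adj V) * c = c*(V*tj x y*adj V)"
    using Gtj[OF m] commutantD[OF c, of "tj (F i x) (F i y)"] m by(simp add: G_def)
  qed (simp_all add: algebra_simps bop_scaleC_simps)
  thus "G z * c = c*G z" using z by(simp add: G_def)
 qed
 have Gm: "G (x*y) = G x*G y" if "x:A" "y:A" for x y
 proof -
  have "G x*G y = V*(x*(adj V*V))*(y*adj V)" using that by(simp add: G_def mult.assoc)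
  also have "x*(adj V*V) = adj V*V*x" using VV[OF that(1)] by simp
  also have "V*(adj V*V*x)*(y*adj V) = (V*adj V)*(V*(x*y)*adj V)" by(simp add: mult.assoc)
  finally show ?thesis using that by(simp add: G_def V(1))
 qed
 have Ge: "G:endos A"
  unfolding endos_def clinear_on_def
  using GA Gm nmap_on_continuous[OF Gn] V(1)
  by(auto simp: G_def algebra_simps bop_scaleC_simps)
 have uniq: "H = G" if H: "H:endos A" "ALL x:M. ALL y:M. H (tj x y) = tj (F i x) (F i y)" for H
 proof(rule extensionalityI)
  show "H:extensional A" "G:extensional A" using H(1) Ge by(auto simp: endos_def PiE_def)
  fix z assume z: "z:A"
  show "H z = G z"
   by(rule nmap_eq_A[OF endos_nmap[OF star_algD(1)[OF A_alg] H(1)] Gn _ _ _ _ _ z])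
    (use H(2) Gtj endosD(2,3)[OF H(1)] endosD(2,3)[OF Ge] in auto)
 qed
 have FG: "FA i = G"
  unfolding endA_def tensor_op_endo_def algA_def[symmetric]
 by(smt (verit) the_equality Ge Gtj uniq)
 show "FA i:endos A" using Ge FG by simp
 show "lift (F i) (FA i)" unfolding lift_def FG using F_hom AA.hom_endos[OF Ge] Gn Gtj by auto
 show "EX V. V*adj V = 1 & (ALL a:A. FA i a = V*a*adj V)" using V(1) by(auto simp: FG G_def)
qed

lemma FA_hom: "AA.hom (FA i)" by(rule liftD(2)[OF FA_lift])
lemmas FA_homD [simp] = AA.homD[OF FA_hom]
lemma FA_tj [simp]: "x:M ==> y:M ==> FA i (tj x y) = tj (F i x) (F i y)" by(rule liftD(4)[OF FA_lift])
lemmas FFA_lift = lift_comp[OF FA_lift FA_lift]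

definition Rt :: "'i => 'k bop" where "Rt i = tj (R i) (R i)"
definition Rt' :: "'i => 'k bop" where "Rt' i = tj (R' i) (R' i)"

lemma Rt_A [simp]: "Rt i:A" "Rt' i:A" by(simp_all add: Rt_def Rt'_def)

lemma FA_conj: "AA.conj_eqs (FA i) (FA (cb i)) (Rt i) (Rt' i)"
 unfolding AA.conj_eqs_def
proof(intro conjI FA_hom)
 have R: "R i:Hom (%x. x) (FF (cb i) i)" "R' i:Hom (%x. x) (FF i (cb i))" using F_conj[of i] by(simp_all add: conj_eqs_def)
 show "Rt i:AA.Hom (%x. x) (%x. FA (cb i) (FA i x))" unfolding Rt_def by(rule lift_Hom[OF lift_id FFA_lift R(1) R(1)])
 show "Rt' i:AA.Hom (%x. x) (%x. FA i (FA (cb i) x))" unfolding Rt'_def by(rule lift_Hom[OF lift_id FFA_lift R(2) R(2)])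
 show "adj (Rt i)*FA (cb i) (Rt' i) = 1" "adj (Rt' i)*FA i (Rt i) = 1"
  by(simp_all add: Rt_def Rt'_def tj_adj tj_mult F_conjD(5,6))
qed

lemmas FA_conjD = AA.conj_eqsD[OF FA_conj]

lemma Rt_norm: "adj (Rt i)*Rt i = cor ((d i)^2)*.1" "adj (Rt' i)*Rt' i = cor ((d i)^2)*.1"
 by(simp_all add: Rt_def Rt'_def tj_adj tj_mult stdD(4,5)[OF F_std] tj_sesq power2_eq_square bop_scaleC_simps)

lemma Rt_cb: "Rt (cb i) = Rt' i" "Rt' (cb i) = Rt i"
 unfolding Rt_def Rt'_def by(rule sesq_R_cb[OF sesq_tj])+

end

section \<open>Standard implementations\<close>

context graded_category begin

text \<open>A left inverse of \<open>FA i\<close> up to the factor \<open>(d i)^2\<close>; it is the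
  map that enters the standard implementation.\<close>

definition Phi :: "'i => 'k bop => 'k bop" where "Phi i x = adj (Rt i)*FA (cb i) x*Rt i"

lemma Phi_A [simp]: "x:A ==> Phi i x:A" by(simp add: Phi_def)
lemma Phi_adj: "x:A ==> adj (Phi i x) = Phi i (adj x)" by(simp add: Phi_def mult.assoc)

lemma Phi_bimodule:
 assumes [simp]: "a:A" "b:A" "x:A"
 shows "Phi i (FA i a*x*FA i b) = a*Phi i x*b"
proof -
 have "Phi i (FA i a*x*FA i b) = (adj (Rt i)*FA (cb i) (FA i a))*FA (cb i) x*(FA (cb i) (FA i b)*Rt i)"
  by(simp add: Phi_def mult.assoc)
 also have "adj (Rt i)*FA (cb i) (FA i a) = a*adj (Rt i)" by(rule FA_conjD(9)) simp
 also have "FA (cb i) (FA i b)*Rt i = Rt i*b" by(rule FA_conjD(7)[symmetric]) simp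
 finally show ?thesis by(simp add: Phi_def mult.assoc)
qed

lemma Phi_one: "Phi i 1 = cor ((d i)^2)*.1"
 by(simp add: Phi_def Rt_norm del: of_real_power)

lemma Phi_faithful:
 assumes a: "a:A" and Om: "SF.separating Om" and 0: "vfun Om (Phi i (adj a*a)) = 0"
 shows "a = 0"
proof -
 have "Phi i (adj a*a) = adj (FA (cb i) a*Rt i)*(FA (cb i) a*Rt i)" using a by(simp add: Phi_def mult.assoc)
 hence "(FA (cb i) a*Rt i)$$Om = 0" using 0 by(simp only: vfun_adj_mult) simp
 hence z: "FA (cb i) a*Rt i = 0" using SF.separatingD[OF Om] a by simp
 have "a = (adj (Rt' i)*FA i (FA (cb i) a))*FA i (Rt i)" using FA_conjD(10)[OF a, of i] by(simp add: FA_conjD(6) mult.assoc)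
 also have "... = adj (Rt' i)*FA i (FA (cb i) a*Rt i)" using a by(simp add: mult.assoc)
 finally show "a = 0" by(simp only: z AA.hom_zero[OF FA_hom] mult_zero_right)
qed

text \<open>The base vector \<open>Om\<close> is a parameter, because products
  \<open>U i*U j\<close> are followed from one cone vector to the next;
  \<open>implementation_unique\<close> shows independence of it.\<close>

definition implements :: "'i => 'k bop => 'k => bool" where
 "implements i u Om \<longleftrightarrow> u$$Om:P & SF.separating (u$$Om) & (ALL a:A. u*a = FA i a*u) &
  (ALL x:A. adj u*x*u = Phi i x) & SF.jop u = u"

lemma implementsD:
 assumes "implements i u Om"
 shows "u$$Om:P" "SF.separating (u$$Om)" "a:A ==> u*a = FA i a*u" "a:A ==> adj u*FA i a = a*adj u"
  "x:A ==> adj u*x*u = Phi i x" "SF.jop u = u" "SF.jop (adj u) = adj u"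
  "x:A ==> vfun (u$$Om) x = vfun Om (Phi i x)"
  "a:A ==> u*SF.jop a = SF.jop (FA i a)*u" "a:A ==> adj u*SF.jop (FA i a) = SF.jop a*adj u"
proof -
 note d = assms[unfolded implements_def]
 show 1: "u$$Om:P" "SF.separating (u$$Om)" "SF.jop u = u" using d by auto
 show 2: "u*a = FA i a*u" if "a:A" for a using d that by blast
 show 3: "adj u*x*u = Phi i x" if "x:A" for x using d that by blast
 show 4: "adj u*FA i a = a*adj u" if "a:A" for a
  using arg_cong[OF 2[of "adj a"], of adj] that by simp
 show 5: "SF.jop (adj u) = adj u" using SF.adj_jop[of u] 1(3) by simp
 show "vfun (u$$Om) x = vfun Om (Phi i x)" if "x:A" for x
 proof -
  have "vfun (u$$Om) x = vfun Om (adj u*x*u)" by(simp add: vfun_def cinner_adj')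
  thus ?thesis by(simp only: 3[OF that])
 qed
 show "u*SF.jop a = SF.jop (FA i a)*u" if "a:A" for a
  using arg_cong[OF 2[OF that], of SF.jop] by(simp add: SF.jop_simps 1(3))
 show "adj u*SF.jop (FA i a) = SF.jop a*adj u" if "a:A" for a
  using arg_cong[OF 4[OF that], of SF.jop] by(simp add: SF.jop_simps 5)
qed

text \<open>As \<open>FA (cb i)\<close> is implemented by an operator, the functional of
  \<open>Om\<close> composed with \<open>Phi i\<close> is a vector functional;
  \<open>Phi_faithful\<close> makes its cone vector separating.\<close>

lemma cone_vector_of_state:
 assumes Om: "Om:P" "SF.separating Om"
 obtains xi where "xi:P" "SF.separating xi" "!!x. x:A ==> vfun xi x = vfun Om (Phi i x)"
proof -
 obtain V where V: "!!a. a:A ==> FA (cb i) a = V*a*adj V" using FA_implemented[of "cb i"] by blast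
 define eta where "eta = adj V$$Rt i$$Om"
 have eta: "vfun eta x = vfun Om (Phi i x)" if "x:A" for x
  using V[OF that] by(simp add: eta_def vfun_def Phi_def cinner_adj' mult.assoc)
 obtain xi where xi: "xi:P" "!!a. a:A ==> vfun xi a = nfun (single 0 eta) (single 0 eta) a"
  by(rule SF.cone_vector_exists[OF Om]) (rule that)
 have xi2: "vfun xi x = vfun Om (Phi i x)" if "x:A" for x
  using xi(2)[OF that] eta[OF that] by(simp add: nfun_single vfun_def)
 show thesis
 proof(rule that[OF xi(1) _ xi2])
  show "SF.separating xi"
   unfolding SF.separating_def
  proof(intro ballI impI)
   fix a assume a: "a:A" "a$$xi = 0"
   have "vfun Om (Phi i (adj a*a)) = vfun xi (adj a*a)" using a by(simp add: xi2)
   also have "... = 0" by(simp only: vfun_adj_mult a) simp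
   finally show "a = 0" by(rule Phi_faithful[OF a(1) Om(2)])
  qed
 qed
qed

text \<open>\<open>u\<close> sends \<open>a$$Om\<close> to \<open>FA i a$$xi\<close>, with Gram
  factor \<open>(d i)^2\<close>. It preserves self-adjoint orbits because of \<open>FA i\<close> and
  its adjoint does so because of \<open>Phi i\<close>, which is the situation of
  \<open>takesaki\<close>.\<close>

lemma implementation_exists:
 assumes Om: "Om:P" "SF.separating Om" and xi: "xi:P" "SF.separating xi" "!!x. x:A ==> vfun xi x = vfun Om (Phi i x)"
 obtains u where "implements i u Om" "!!a. a:A ==> u$$a$$Om = FA i a$$xi" "u$$Om = xi"
proof -
 have tot: "total ((%a. a$$Om) ` A)" by(rule SF.total_orbit[OF Om])
 have ip: "cinner (x$$a$$ze) (b$$ze) = vfun ze (adj b*x*a)" for x a b ze by(simp add: vfun_def cinner_adj')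
 obtain u where u: "!!a. a:A ==> u$$a$$Om = FA i a$$xi"
 proof(rule gram_ext[of A "%a. FA i a$$xi" "(d i)^2" "%a. a$$Om"])
  fix a b assume m [simp]: "a:A" "b:A"
  have "cinner (FA i a$$xi) (FA i b$$xi) = vfun Om (Phi i (FA i (adj b)*1*FA i a))"
   using ip[of 1 "FA i a" xi "FA i b"] by(simp add: xi(3))
  also have "... = cor ((d i)^2) * vfun Om (adj b*a)"
   by(subst Phi_bimodule) (simp_all add: Phi_one bop_scaleC_simps vfun_def cinner_scaleC_left cinner_scaleR_left del: of_real_power)
  finally show "cinner (FA i a$$xi) (FA i b$$xi) = cor ((d i)^2) * cinner (a$$Om) (b$$Om)"
   using ip[of 1 a Om b] by simp
 qed (auto intro: that)
 have u1: "u$$Om = xi" using u[of 1] by simp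
 have rel: "u*a = FA i a*u" if "a:A" for a
 proof(rule bop_eq_on_total[OF tot])
  fix v assume "v:(%a. a$$Om) ` A"
  then obtain b where b: "b:A" "v = b$$Om" by blast
  show "(u*a)$$v = (FA i a*u)$$v" using u[of "a*b"] u[OF b(1)] that b by simp
 qed
 have conj: "adj u*x*u = Phi i x" if x [simp]: "x:A" for x
 proof(rule bop_eq_on_total2[OF tot])
  fix v w assume "v:(%a. a$$Om) ` A" "w:(%a. a$$Om) ` A"
  then obtain a b where b [simp]: "a:A" "b:A" and v: "v = a$$Om" "w = b$$Om" by blast
  have "cinner ((adj u*x*u)$$v) w = cinner (x$$FA i a$$xi) (FA i b$$xi)" by(simp add: v cinner_adj u)
  also have "... = vfun Om (Phi i (FA i (adj b)*x*FA i a))" by(simp add: ip xi(3))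
  also have "... = vfun Om (adj b*Phi i x*a)" by(subst Phi_bimodule) simp_all
  finally show "cinner ((adj u*x*u)$$v) w = cinner (Phi i x$$v) w" by(simp add: v ip)
 qed
 have "SF.jop u = u"
 proof(rule SF.takesaki[OF Om xi(1,2)])
  fix a assume a: "a:A" "adj a = a"
  show "EX b:A. adj b = b & u$$a$$Om = b$$xi" using a u[OF a(1)] FA_homD(2)[OF a(1), of i] by(intro bexI[of _ "FA i a"]) auto
  have "adj u$$a$$xi = Phi i a$$Om" using conj[OF a(1)] u1 by(metis times_op_app)
  thus "EX b:A. adj b = b & adj u$$a$$xi = b$$Om" using a by(intro bexI[of _ "Phi i a"]) (auto simp: Phi_adj)
 qed
 hence "implements i u Om" unfolding implements_def u1 using xi(1,2) rel conj by blast
 thus thesis by(rule that[OF _ u u1])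
qed

lemma twisted_unitary_comm:
 assumes u: "implements i u Om"
 shows "b:A ==> (adj u*Rt' i)*b = FA (cb i) b*(adj u*Rt' i)"
  "b:A ==> (adj u*Rt' i)*SF.jop (FA i b) = SF.jop b*(adj u*Rt' i)"
  "(adj u*Rt' i)*adj (adj u*Rt' i) = 1"
proof -
 note U = implementsD[OF u]
 show "(adj u*Rt' i)*b = FA (cb i) b*(adj u*Rt' i)" if b: "b:A"
 proof -
  have "(adj u*Rt' i)*b = (adj u*FA i (FA (cb i) b))*Rt' i" using FA_conjD(8)[OF b, of i] by(simp add: mult.assoc)
  thus ?thesis using U(4)[of "FA (cb i) b"] b by(simp add: mult.assoc)
 qed
 show "(adj u*Rt' i)*SF.jop (FA i b) = SF.jop b*(adj u*Rt' i)" if b: "b:A"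
 proof -
  have "(adj u*Rt' i)*SF.jop (FA i b) = (adj u*SF.jop (FA i b))*Rt' i" using SF.jop_commute[of "FA i b" "Rt' i"] b by(simp add: mult.assoc)
  thus ?thesis using U(10)[OF b] by(simp add: mult.assoc)
 qed
 have "(adj u*Rt' i)*adj (adj u*Rt' i) = adj u*(Rt' i*adj (Rt' i))*u" by(simp add: mult.assoc)
 also have "... = Phi i (Rt' i*adj (Rt' i))" by(rule U) simp
 also have "... = (adj (Rt i)*FA (cb i) (Rt' i))*(adj (FA (cb i) (Rt' i))*Rt i)" by(simp add: Phi_def mult.assoc)
 finally show "(adj u*Rt' i)*adj (adj u*Rt' i) = 1" by(simp only: FA_conjD(5,11) mult_1)
qed

text \<open>\<open>z\<close> is the mirror image of some \<open>y\<close> in \<open>A\<close>, which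
  commutes with the image of \<open>FA i\<close> and is scalar by
  \<open>irreducible_tensor\<close>.\<close>

lemma commutes_with_twisted:
 assumes z: "!!b. b:A ==> z*b = b*z" "!!b. b:A ==> z*SF.jop (FA i b) = SF.jop (FA i b)*z"
 shows "EX k. z = k*.1"
proof -
 have "z:commutant A" using z(1) by(simp add: commutant_def)
 then obtain y where y: "y:A" "z = SF.jop y" by(auto simp: SF.commutant_eq)
 have "y*FA i b = FA i b*y" if "b:A" for b
 proof -
  have "SF.jop (SF.jop (y*FA i b)) = SF.jop (SF.jop (FA i b*y))" using z(2)[OF that] by(simp add: y(2) SF.jop_simps)
  thus ?thesis by(simp only: SF.jop_simps(6))
 qed
 hence "EX k. y = k*.1" by(intro irreducible_tensor[OF F_hom F_irr[of i] y(1)]) (metis FA_tj tj_A)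
 thus ?thesis unfolding y(2) by(auto simp: SF.jop_simps)
qed

text \<open>The product in question is a scalar by \<open>commutes_with_twisted\<close>; as a
  nonzero idempotent it equals \<open>1\<close>.\<close>

lemma twisted_unitary:
 assumes u: "implements i u Om"
 shows "adj (adj u*Rt' i)*(adj u*Rt' i) = 1"
proof -
 define V where "V = adj u*Rt' i"
 note v = twisted_unitary_comm[OF u, folded V_def]
 have va1: "b*adj V = adj V*FA (cb i) b" if "b:A" for b using arg_cong[OF v(1)[of "adj b"], of adj] that by simp
 have va2: "SF.jop (FA i b)*adj V = adj V*SF.jop b" if "b:A" for b
  using arg_cong[OF v(2)[of "adj b"], of adj] that by(simp add: SF.adj_jop)
 have "EX k. adj V*V = k*.1"
 proof(rule commutes_with_twisted)
  fix b assume b: "b:A"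
  show "adj V*V*b = b*(adj V*V)"
   by(simp add: v(1)[OF b] mult.assoc) (simp add: va1[OF b] flip: mult.assoc)
  show "adj V*V*SF.jop (FA i b) = SF.jop (FA i b)*(adj V*V)"
   by(simp add: v(2)[OF b] mult.assoc) (simp add: va2[OF b] flip: mult.assoc)
 qed
 then obtain k where k: "adj V*V = k*.1" by blast
 have "(adj V*V)*(adj V*V) = adj V*(V*adj V)*V" by(simp add: mult.assoc)
 hence "k * k = k" by(simp add: v(3) k bop_scaleC_simps AA.scalar_inject)
 moreover have "k ~= 0"
 proof
  assume "k = 0"
  hence "V*(adj V*V)*adj V = 0" by(simp add: k bop_scaleC_simps)
  moreover have "V*(adj V*V)*adj V = (V*adj V)*(V*adj V)" by(simp add: mult.assoc)
  ultimately show False using one_neq_zero_K by(simp add: v(3))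
 qed
 ultimately have "k = 1" by simp
 thus ?thesis using k by(simp add: V_def bop_scaleC_simps)
qed

lemma separating_inner_pos:
 assumes "Om:P" "SF.separating Om" "Om':P" "SF.separating Om'"
 shows "0 < Re (cinner Om Om')" "Im (cinner Om Om') = 0"
proof -
 show im: "Im (cinner Om Om') = 0" using SF.P_D[OF assms(1,3)] by simp
 have "Re (cinner Om Om') ~= 0"
 proof
  assume "Re (cinner Om Om') = 0"
  hence 0: "cinner Om Om' = 0" using im by(simp add: complex_eq_iff)
  have "(1::'k bop) = 0" by(use totalD[OF SF.total_orbit[OF assms(1,2)]] SF.orth_supports[OF assms(1,3) 0] SF.separatingD[OF assms(4)] in \<open>force\<close>)
  thus False using one_neq_zero_K by simp
 qed
 thus "0 < Re (cinner Om Om')" using SF.P_pos[OF assms(1,3)] by simp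
qed

text \<open>The twisted unitaries intertwine the same irreducible actions, hence differ by a phase.
  Inner products of separating cone vectors are strictly positive, which forces the phase to be
  \<open>1\<close>.\<close>

lemma implementation_unique:
 assumes Om: "Om:P" "SF.separating Om" and Om': "Om':P" "SF.separating Om'"
  and u: "implements i u Om" and u': "implements i u' Om'"
 shows "u = u'"
proof -
 define V V' where "V = adj u*Rt' i" and "V' = adj u'*Rt' i"
 note v = twisted_unitary_comm[OF u, folded V_def] twisted_unitary[OF u, folded V_def]
 note v' = twisted_unitary_comm[OF u', folded V'_def] twisted_unitary[OF u', folded V'_def]
 have va1: "b*adj V' = adj V'*FA (cb i) b" if "b:A" for b using arg_cong[OF v'(1)[of "adj b"], of adj] that by simp
 have va2: "SF.jop (FA i b)*adj V' = adj V'*SF.jop b" if "b:A" for b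
  using arg_cong[OF v'(2)[of "adj b"], of adj] that by(simp add: SF.adj_jop)
 have "EX k. adj V'*V = k*.1"
 proof(rule commutes_with_twisted)
  fix b assume b: "b:A"
  show "adj V'*V*b = b*(adj V'*V)" by(simp add: v(1)[OF b] mult.assoc) (simp add: va1[OF b] flip: mult.assoc)
  show "adj V'*V*SF.jop (FA i b) = SF.jop (FA i b)*(adj V'*V)" by(simp add: v(2)[OF b] mult.assoc) (simp add: va2[OF b] flip: mult.assoc)
 qed
 then obtain k where k: "adj V'*V = k*.1" by blast
 have "V = (V'*adj V')*V" by(simp add: v'(3))
 also have "... = k*.V'" by(simp add: k mult.assoc bop_scaleC_simps)
 finally have Vk: "V = k*.V'" .
 have one: "1 = FA i (adj (Rt i))*Rt' i" using FA_conjD(12)[of i] by simp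
 have "adj u = (adj u*FA i (adj (Rt i)))*Rt' i" using one by(simp add: mult.assoc)
 also have "... = adj (Rt i)*V" using implementsD(4)[OF u, of "adj (Rt i)"] by(simp add: V_def mult.assoc)
 also have "... = k*.(adj (Rt i)*V')" by(simp add: Vk bop_scaleC_simps)
 also have "adj (Rt i)*V' = (adj u'*FA i (adj (Rt i)))*Rt' i" using implementsD(4)[OF u', of "adj (Rt i)"] by(simp add: V'_def mult.assoc)
 also have "... = adj u'" using one by(simp add: mult.assoc)
 finally have "adj u = k*.adj u'" .
 hence uk: "u = cnj k*.u'" by(metis adj_adj adj_scaleC)
 have "(cnj k * k)*.(1::'k bop) = 1*.1" using v(4) v'(4) by(simp add: Vk bop_scaleC_simps mult_ac)
 hence kk: "cnj k * k = 1" by(simp only: AA.scalar_inject)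
 have p1: "0 < Re (cinner Om' Om)" "Im (cinner Om' Om) = 0" by(rule separating_inner_pos; fact)+
 have p2: "0 < Re (cinner (u'$$Om') (u$$Om))" "Im (cinner (u'$$Om') (u$$Om)) = 0"
  by(rule separating_inner_pos; fact implementsD(1,2)[OF u] implementsD(1,2)[OF u'])+
 have uu: "adj u*u = cor ((d i)^2)*.1" using implementsD(5)[OF u, of 1] by(simp add: Phi_one)
 have "cinner (u$$Om') (u$$Om) = cinner ((adj u*u)$$Om') Om" by(simp add: cinner_adj')
 also have "... = cor ((d i)^2) * cinner Om' Om" by(simp add: uu cinner_scaleC_left cinner_scaleR_left del: of_real_power)
 finally have e: "cnj k * cinner (u'$$Om') (u$$Om) = cor ((d i)^2) * cinner Om' Om" by(subst (asm) (1) uk) (simp add: cinner_scaleC_left)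
 define r s where "r = Re (cinner (u'$$Om') (u$$Om))" and "s = (d i)^2*Re (cinner Om' Om)"
 have rs: "0 < r" "0 < s" using p1 p2 d_pos[of i] by(simp_all add: r_def s_def)
 have "cnj k = cor (s / r)" using e p1 p2 rs by(simp add: r_def s_def complex_eq_iff field_simps)
 hence ck: "cnj k = cor (s / r)" "k = cor (s / r)" by(auto simp: complex_eq_iff)
 hence "cor ((s / r)^2) = cor 1" using kk by(simp add: power2_eq_square)
 hence "s / r = 1" using rs by(smt (verit) of_real_eq_iff power2_eq_1_iff divide_pos_pos)
 thus ?thesis using ck uk by(simp add: bop_scaleC_simps)
qed

text \<open>\<open>implA\<close> is defined through the vector of the product state; passing to any
  separating cone vector is what makes products of implementations accessible.\<close>

lemma implA_implements:
 assumes Om': "Om':P" "SF.separating Om'"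
 shows "implements i (implA D i) Om'"
proof -
 obtain tht where tht: "!!x. x:M ==> state D x = nfun tht tht x" "faithful_on M tht" by(rule state_vector) (rule that)
 obtain Om where Om: "Om:P" "SF.separating Om" "!!x y. x:M ==> y:M ==> vfun Om (tj x y) = nfun tht tht x * cnj (nfun tht tht y)"
  by(rule product_cone_vector[OF tht(2)]) (rule that)
 define psi where "psi = (\<lambda>x\<in>A. vfun Om x)"
 have vn: "vfun Om x = nfun (single 0 Om) (single 0 Om) x" for x by(simp add: nfun_single vfun_def)
 have ts: "tensor_op_state t M (state D) = psi"
  unfolding tensor_op_state_def algA_def[symmetric]
 proof(rule the_equality)
  have cl: "clinear_on A psi" by(auto simp: clinear_on_def psi_def vfun_def scaleC_complex_def cinner_simps cinner_scaleC_left)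
  have "continuous_map (subtopology sigma_weak A) euclidean psi"
   by(rule continuous_map_eq[OF continuous_nfun[of A "single 0 Om" "single 0 Om"]]) (simp add: psi_def vn)
  thus "psi:extensional A & normal_functional A psi & (ALL x:M. ALL y:M. psi (tj x y) = state D x * cnj (state D y))"
   using cl by(auto simp: psi_def normal_functional_def Om(3) tht(1))
  fix phi assume phi: "phi:extensional A & normal_functional A phi & (ALL x:M. ALL y:M. phi (tj x y) = state D x * cnj (state D y))"
  then obtain v w where vw: "!!x. x:A ==> phi x = nfun v w x"
   by(metis normal_functional_nfun[OF star_algD(1)[OF A_alg]])
  have eq: "nfun v w x = nfun (single 0 Om) (single 0 Om) x" if "x:A" for x
  proof(rule nfun_eq_A[OF _ that])
   fix x y assume m: "x:M" "y:M"
   show "nfun v w (tj x y) = nfun (single 0 Om) (single 0 Om) (tj x y)"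
    using m phi Om(3)[OF m] vw[of "tj x y"] by(simp add: tht(1) vn)
  qed
  show "phi = psi"
  proof(rule extensionalityI[of _ A])
   show "phi x = psi x" if "x:A" for x using vw[OF that] eq[OF that] that by(simp add: psi_def vn)
  qed (use phi in \<open>auto simp: psi_def\<close>)
 qed
 have cv: "cone_vector A P phi = ze" if "ze:P" "!!x. x:A ==> phi x = vfun ze x" for phi ze
  unfolding cone_vector_def
 proof(rule the_equality)
  show "ze:P & (ALL x:A. phi x = cinner (x$$ze) ze)" using that by(simp add: vfun_def)
  fix ze' assume "ze':P & (ALL x:A. phi x = cinner (x$$ze') ze')"
  thus "ze' = ze" using that by(intro SF.cone_unique) (auto simp: vfun_def)
 qed
 obtain xi where xi: "xi:P" "SF.separating xi" "!!x. x:A ==> vfun xi x = vfun Om (Phi i x)"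
  by(rule cone_vector_of_state[OF Om(1,2)]) (rule that)
 have c1: "cone_vector A P psi = Om" by(rule cv[OF Om(1)]) (simp add: psi_def)
 have c2: "cone_vector A P (%x. psi (adj (Rt i)*FA (cb i) x*Rt i)) = xi"
  by(rule cv[OF xi(1)]) (simp add: psi_def xi(3) Phi_def)
 obtain u where u: "implements i u Om" "!!a. a:A ==> u$$a$$Om = FA i a$$xi"
 proof(rule implementation_exists[OF Om(1,2) xi(1,2), of i])
  show "vfun xi x = vfun Om (Phi i x)" if "x:A" for x by(rule xi(3)[OF that])
 qed (rule that)
 have "implA D i = u"
  unfolding implA_def ts standard_implementation_def Rt_def[symmetric] c1 c2
 proof(rule the_equality)
  show "ALL a:A. u$$a$$Om = FA i a$$xi" using u(2) by blast
  fix w assume "ALL a:A. w$$a$$Om = FA i a$$xi"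
  thus "w = u" by(intro bop_eq_on_total[OF SF.total_orbit[OF Om(1,2)]]) (auto simp: u(2))
 qed
 obtain xi' where xi': "xi':P" "SF.separating xi'" "!!x. x:A ==> vfun xi' x = vfun Om' (Phi i x)"
  by(rule cone_vector_of_state[OF Om']) (rule that)
 obtain u' where u': "implements i u' Om'"
 proof(rule implementation_exists[OF Om' xi'(1,2), of i])
  show "vfun xi' x = vfun Om' (Phi i x)" if "x:A" for x by(rule xi'(3)[OF that])
 qed (rule that)
 show ?thesis using u' \<open>implA D i = u\<close> by(metis implementation_unique[OF Om(1,2) Om' u(1) u'])
qed

abbreviation "U \<equiv> implA D"

lemma separating_cone_vector: obtains Om where "Om:P" "SF.separating Om"
proof -
 obtain tht where tht: "!!x. x:M ==> state D x = nfun tht tht x" "faithful_on M tht" by(rule state_vector) (rule that)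
 show thesis by(rule product_cone_vector[OF tht(2)]) (rule that)
qed

lemma U_rel:
 "a:A ==> U i*a = FA i a*U i" "a:A ==> adj (U i)*FA i a = a*adj (U i)"
 "x:A ==> adj (U i)*x*U i = Phi i x" "SF.jop (U i) = U i" "SF.jop (adj (U i)) = adj (U i)"
 "a:A ==> U i*SF.jop a = SF.jop (FA i a)*U i" "a:A ==> adj (U i)*SF.jop (FA i a) = SF.jop a*adj (U i)"
proof -
 obtain Om where Om: "Om:P" "SF.separating Om" by(rule separating_cone_vector)
 note * = implementsD[OF implA_implements[OF Om]]
 show "a:A ==> U i*a = FA i a*U i" "a:A ==> adj (U i)*FA i a = a*adj (U i)"
  "x:A ==> adj (U i)*x*U i = Phi i x" "SF.jop (U i) = U i" "SF.jop (adj (U i)) = adj (U i)"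
  "a:A ==> U i*SF.jop a = SF.jop (FA i a)*U i" "a:A ==> adj (U i)*SF.jop (FA i a) = SF.jop a*adj (U i)"
  by(rule *; assumption?)+
qed

definition V :: "'i => 'k bop" where "V i = adj (U i)*Rt' i"

lemma V_rel:
 "b:A ==> V i*b = FA (cb i) b*V i" "b:A ==> V i*SF.jop (FA i b) = SF.jop b*V i"
 "V i*adj (V i) = 1" "adj (V i)*V i = 1"
proof -
 obtain Om where Om: "Om:P" "SF.separating Om" by(rule separating_cone_vector)
 note * = twisted_unitary_comm[OF implA_implements[OF Om], folded V_def] twisted_unitary[OF implA_implements[OF Om], folded V_def]
 show "b:A ==> V i*b = FA (cb i) b*V i" "b:A ==> V i*SF.jop (FA i b) = SF.jop b*V i"
  "V i*adj (V i) = 1" "adj (V i)*V i = 1"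
  by(rule *; assumption?)+
qed

text \<open>Both sides of the fusion relation for standard implementations map a cone vector to the cone
 vector of the same functional; the range projection of \<open>T \<otimes> j(T)\<close> commutes with \<open>J\<close> there because it
 lies in the centralizer.\<close>

lemma implementation_fusion_isometry:
 assumes T: "T:B i j k"
 shows "adj (tj T T)*(U i*U j) = SF.jop (tj T T)*U k"
proof -
 have iso: "adj T*T = 1" using B_orth[OF T T] by simp
 obtain W where W: "W:Hom (F (cb k)) (%x. F (cb j) (F (cb i) x))" "adj W*W = 1"
  "F (cb j) (F (cb i) (adj T))*(F (cb j) (R i)*R j) = W*R k" "adj W*(F (cb j) (R i)*R j) = F (cb k) T*R k"
  by(rule trace_isometry[OF F_std[of i] F_std[of j] F_std[of k] B_Hom[OF T] iso]) (rule that)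
 define X where "X = tj T T"
 define Y where "Y = tj W W"
 define S where "S = FA (cb j) (Rt i)*Rt j"
 let ?t = "%x. FA (cb j) (FA (cb i) x)"
 have WM [simp]: "W:M" "T:M" using HomD(1)[OF W(1)] T by simp_all
 have A [simp]: "X:A" "Y:A" "S:A" by(simp_all add: X_def Y_def S_def)
 have XX: "adj X*X = 1" by(simp add: X_def tj_adj tj_mult iso)
 have YY: "adj Y*Y = 1" by(simp add: Y_def tj_adj tj_mult W(2))
 have XH: "X:AA.Hom (FA k) (%a. FA i (FA j a))"
  unfolding X_def by(rule lift_Hom[OF FA_lift FFA_lift B_Hom[OF T] B_Hom[OF T]])
 have YH: "Y:AA.Hom (FA (cb k)) ?t"
  unfolding Y_def by(rule lift_Hom[OF FA_lift FFA_lift W(1) W(1)])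
 have XS: "?t (adj X)*S = Y*Rt k"
  by(simp add: X_def Y_def S_def Rt_def tj_adj tj_mult W(3) del: F_homD(2))
 have YS: "adj Y*S = FA (cb k) X*Rt k"
  by(simp add: X_def Y_def S_def Rt_def tj_adj tj_mult W(4))
 have XSa: "adj S*?t X = adj (Rt k)*adj Y" using arg_cong[OF XS, of adj] by simp
 define w where "w = U i*U j"
 have wx: "adj w*x * w = adj S*?t x*S" if x: "x:A" for x
 proof -
  have "adj w*x * w = adj (U j)*(adj (U i)*x*U i)*U j" by(simp add: w_def mult.assoc)
  also have "... = Phi j (Phi i x)" using x by(simp add: U_rel(3))
  also have "... = adj S*?t x*S" using x by(simp add: Phi_def S_def mult.assoc)
  finally show ?thesis .
 qed
 have wa: "w*a = FA i (FA j a) * w" if a: "a:A" for a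
 proof -
  have "w*a = U i*(FA j a*U j)" using U_rel(1)[OF a, of j] by(simp add: w_def mult.assoc)
  also have "... = FA i (FA j a) * w" using U_rel(1)[of "FA j a" i] a by(simp add: w_def flip: mult.assoc)
  finally show ?thesis .
 qed
 obtain Om where Om: "Om:P" "SF.separating Om" by(rule separating_cone_vector)
 note Uj = implementsD(1,2)[OF implA_implements[OF Om, of j]]
 have xi: "w$$Om:P" "SF.separating (w$$Om)"
  using implementsD(1,2)[OF implA_implements[OF Uj, of i]] by(simp_all add: w_def)
 have vw: "vfun (w$$Om) x = vfun Om (adj S*?t x*S)" if "x:A" for x
 proof -
  have "vfun (w$$Om) x = vfun Om (adj w*x * w)" by(simp add: vfun_def cinner_adj')
  thus ?thesis by(simp only: wx[OF that])
 qed
 define p where "p = X*adj X"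
 have p [simp]: "p:A" "adj p = p" by(simp_all add: p_def)
 have YSR: "Y*(adj Y*S) = ?t p*S"
 proof -
  have "?t p*S = (?t X*Y)*Rt k" using XS by(simp add: p_def mult.assoc)
  also have "?t X*Y = Y*FA (cb k) X" using AA.HomD(2)[OF YH, of X] by simp
  finally show ?thesis by(simp add: YS mult.assoc)
 qed
 have "adj (?t p) = ?t (adj p)" by(simp del: p(2))
 hence tp: "adj (?t p) = ?t p" by(simp only: p(2))
 have SYp: "adj S*?t p = adj S*(Y*adj Y)" using arg_cong[OF YSR, of adj] by(simp add: mult.assoc tp)
 have Yc: "Y*adj Y*?t a = ?t a*(Y*adj Y)" if a: "a:A" for a
 proof -
  have "adj (?t (adj a)*Y) = adj (Y*FA (cb k) (adj a))" using AA.HomD(2)[OF YH, of "adj a"] a by simp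
  hence 1: "adj Y*?t a = FA (cb k) a*adj Y" using a by simp
  have "Y*adj Y*?t a = (Y*FA (cb k) a)*adj Y" by(simp add: 1 mult.assoc)
  also have "Y*FA (cb k) a = ?t a*Y" by(rule AA.HomD(2)[OF YH a])
  finally show ?thesis by(simp add: mult.assoc)
 qed
 \<comment> \<open>Under \<open>S\<close> the image of \<open>p\<close> acts like
   \<open>Y*adj Y\<close>, which commutes with the image of \<open>A\<close>. So \<open>p\<close>
   lies in the centralizer of the functional of \<open>w$$Om\<close>.\<close>
 have cent: "vfun (w$$Om) (p*a) = vfun (w$$Om) (a*p)" if a [simp]: "a:A" for a
 proof -
  have "adj S*?t (p*a)*S = (adj S*?t p)*?t a*S" by(simp add: mult.assoc)
  also have "... = adj S*?t (a*p)*S" by(use SYp Yc[OF a] in \<open>simp add: YSR mult.assoc\<close>)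
  finally show ?thesis by(simp add: vw)
 qed
 have pj: "SF.jop p$$w$$Om = p$$w$$Om" by(metis SF.centralizer[OF xi p(1,2) cent] SF.jop_app SF.P_J[OF xi(1)])
 have tot: "total ((%a. a$$Om) ` A)" by(rule SF.total_orbit[OF Om])
 have Xc: "adj X*FA i (FA j a) = FA k a*adj X" if a: "a:A" for a
 proof -
  have "adj (X*FA k (adj a)) = adj (FA i (FA j (adj a))*X)" using AA.HomD(2)[OF XH, of "adj a"] a by simp
  thus ?thesis using a by simp
 qed
 have pc: "p*FA i (FA j a) = FA i (FA j a)*p" if a: "a:A" for a
 by(metis p_def Xc[OF a] mult.assoc AA.HomD(2)[OF XH a])
 have pw: "p * w = SF.jop p * w"
 proof(rule bop_eq_on_total[OF tot])
  fix v assume "v:(%a. a$$Om) ` A"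
  then obtain a where a: "a:A" "v = a$$Om" by blast
  have a': "FA i (FA j a):A" using a by simp
  show "(p * w)$$v = (SF.jop p * w)$$v" using pc[OF a(1)] by(metis a(2) wa[OF a(1)] mult.assoc pj SF.jop_commute[OF p(1) a', symmetric] times_op_app)
 qed
 \<comment> \<open>\<open>Z$$Om\<close> lies in the cone and induces the same functional as
   \<open>U k$$Om\<close>, so \<open>Z = U k\<close> by uniqueness of cone vectors. Multiplying by
   \<open>SF.jop X\<close> then moves the mirrored factor to the other side.\<close>
 define Z where "Z = adj X*SF.jop (adj X) * w"
 have ZP: "Z$$Om:P" unfolding Z_def times_op_app by(rule SF.P_conj[OF _ xi(1)]) simp
 have Za: "Z*a = FA k a*Z" if a: "a:A" for a
 proof -
  have a': "FA i (FA j a):A" using a by simp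
  have "Z*a = adj X*(SF.jop (adj X)*FA i (FA j a)) * w" by(simp add: Z_def wa[OF a] mult.assoc)
  also have "SF.jop (adj X)*FA i (FA j a) = FA i (FA j a)*SF.jop (adj X)" by(rule SF.jop_commute) (use a' in simp_all)
  also have "adj X*(FA i (FA j a)*SF.jop (adj X)) * w = FA k a*Z" by(simp add: Z_def Xc[OF a] flip: mult.assoc)
  finally show ?thesis .
 qed
 have ZZ: "adj Z*x*Z = Phi k x" if x [simp]: "x:A" for x
 proof -
  have xX: "X*x*adj X:A" by simp
  have "adj Z*x*Z = adj w*(SF.jop X*(X*x*adj X)*SF.jop (adj X)) * w" by(simp add: SF.adj_jop Z_def mult.assoc)
  also have "SF.jop X*(X*x*adj X)*SF.jop (adj X) = (X*x*adj X)*SF.jop p"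
   using SF.jop_commute[OF A(1) xX] by(simp add: p_def SF.jop_simps mult.assoc)
  also have "adj w*(X*x*adj X*SF.jop p) * w = adj w*(X*x*(adj X*p)) * w" using pw by(simp add: mult.assoc)
  also have "adj X*p = adj X" using XX by(simp add: p_def flip: mult.assoc)
  also have "adj w*(X*x*adj X) * w = adj S*?t (X*x*adj X)*S" by(rule wx[OF xX])
  also have "... = (adj S*?t X)*?t x*(?t (adj X)*S)" by(simp add: mult.assoc)
  also have "... = adj (Rt k)*adj Y*(?t x*Y)*Rt k" by(simp only: XS XSa) (simp add: mult.assoc)
  also have "?t x*Y = Y*FA (cb k) x" using AA.HomD(2)[OF YH x] by simp
  also have "adj (Rt k)*adj Y*(Y*FA (cb k) x)*Rt k = adj (Rt k)*(adj Y*Y)*FA (cb k) x*Rt k" by(simp add: mult.assoc)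
  finally show ?thesis by(simp add: YY Phi_def)
 qed
 note Uk = implA_implements[OF Om, of k]
 have "Z$$Om = U k$$Om"
 proof(rule SF.cone_unique[OF ZP implementsD(1)[OF Uk]])
  fix a assume a: "a:A"
  show "vfun (Z$$Om) a = vfun (U k$$Om) a"
   unfolding implementsD(8)[OF Uk a] ZZ[OF a, symmetric] by(simp add: vfun_def cinner_adj')
 qed
 hence "Z = U k"
  using Za U_rel(1) by(intro bop_eq_on_total[OF tot]) (auto simp flip: times_op_app, simp)
 have "SF.jop X*U k = adj X*(SF.jop X*SF.jop (adj X)) * w"
  using SF.jop_commute[of X "adj X"] by(simp add: \<open>Z = U k\<close>[symmetric] Z_def flip: mult.assoc)
 also have "SF.jop X*SF.jop (adj X) = SF.jop p" by(simp add: p_def SF.jop_simps)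
 also have "adj X*SF.jop p * w = adj X*p * w" using pw by(simp add: mult.assoc)
 also have "adj X*p = adj X" using XX by(simp add: p_def flip: mult.assoc)
 finally show ?thesis by(simp add: X_def w_def)
qed

abbreviation "TT \<equiv> Ttilde D"

lemma TT_A [simp]: "TT i j k:A" unfolding Ttilde_def by(rule A_sum) simp

lemma jop_sum: "SF.jop (SUM i:I. f i) = (SUM i:I. SF.jop (f i))"
proof(induction I rule: infinite_finite_induct)
 have "SF.jop 0 = 0" using SF.jop_simps(2)[of 0 0] by simp
 thus "SF.jop (sum f {}) = (SUM i:{}. SF.jop (f i))" "infinite A ==> SF.jop (sum f A) = (SUM i:A. SF.jop (f i))" for A by simp_all
qed (simp add: SF.jop_simps)

lemma implementation_fusion: "adj (TT i j k)*U i*U j = SF.jop (TT i j k)*U k"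
 unfolding Ttilde_def adj_sum jop_sum sum_distrib_right
 by(intro sum.cong refl) (simp add: implementation_fusion_isometry mult.assoc)

subsection \<open>Relations between the fusion operators\<close>

lemma TT_Hom: "TT i j k:AA.Hom (FA k) (%x. FA i (FA j x))"
 unfolding Ttilde_def by(intro op_subspaceD(6)[OF AA.Hom_op_subspace] lift_Hom[OF FA_lift FFA_lift] B_Hom)

lemma TT_orth: "adj (TT i j k)*TT i j l = (if k = l then cor (real (card (B i j k)))*.1 else 0)"
proof -
 have "adj (TT i j k)*TT i j l = (SUM T:B i j k. SUM S:B i j l. tj (adj T*S) (adj T*S))"
  by(simp add: Ttilde_def adj_sum sum_product tj_adj tj_mult)
 also have "... = (SUM T:B i j k. SUM S:B i j l. if k = l & T = S then 1 else 0)"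
  by(intro sum.cong refl) (simp add: B_orth tj_sesq)
 also have "... = (if k = l then (SUM T:B i j k. 1) else 0)"
  by(cases "k = l") (simp_all)
 also have "(SUM T:B i j k. 1) = cor (real (card (B i j k)))*.(1::'k bop)"
  by(induction rule: finite_induct[OF B_finite]) (simp_all add: bop_scaleC_simps)
 finally show ?thesis .
qed

lemma TT_zero: "k ~: fusion i j ==> TT i j k = 0"
 by(simp add: Ttilde_def fusion_iff)

lemma TT_assoc:
 "(SUM k:fusion j l. FA i (TT j l k)*TT i k m) = (SUM k:fusion i j. TT i j k*TT k l m)"
by(use fusion_assoc[OF sesq_tj] in \<open>simp add: Ttilde_def AA.hom_sum[OF FA_hom] sum_product tj_mult\<close>)

lemma adj_TT: "adj (TT i j k) = (SUM T:B i j k. tj (adj T) (adj T))"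
 by(simp add: Ttilde_def adj_sum tj_adj)

lemma TT_frobenius_R:
 "adj (TT i j k)*FA i (Rt' j) = cor (d k / d i)*.TT k (cb j) i"
proof -
 have "adj (TT i j k)*FA i (Rt' j) = (SUM T:B i j k. tj (adj T*F i (R' j)) (adj T*F i (R' j)))"
  by(simp add: adj_TT Rt'_def sum_distrib_right tj_mult)
 thus ?thesis unfolding Ttilde_def[symmetric] frobenius_R[OF sesq_tj] by(simp only: Ttilde_def)
qed

lemma TT_frobenius_R':
 "cor (d i / d k)*.adj (TT i j k) = FA k (adj (Rt j))*TT k (cb j) i"
proof -
 have "FA k (adj (Rt j))*TT k (cb j) i = adj (adj (TT k (cb j) i)*FA k (Rt' (cb j)))" by(simp add: Rt_cb)
 also have "... = adj (cor (d i / d k)*.TT i j k)" unfolding TT_frobenius_R by simp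
 finally show ?thesis by simp
qed

lemma TT_frobenius_LR:
 "cor (d k / d i)*.(adj (Rt' i)*FA i (adj (TT j (cb k) (cb i)))) = adj (Rt' k)*adj (TT i j k)"
proof -
 define S where "S T = F (cb i) (adj T)*R i" for T
 have sq: "sesq (%X Y. tj (adj Y*F (cb i) (R' k)) (adj X*F (cb i) (R' k)))"
  unfolding sesq_def by(simp add: algebra_simps tj_sesq)
 have "(SUM T:B i j k. tj (adj (S T)*F (cb i) (R' k)) (adj (S T)*F (cb i) (R' k))) =
   cor (d k / d j)*.(SUM Y:B (cb i) k j. tj (adj Y*F (cb i) (R' k)) (adj Y*F (cb i) (R' k)))"
  using frobenius_L[OF sq, of i j k] by(simp only: S_def)
 also have "... = cor (d k / d j)*.cor (d j / d (cb i))*.TT j (cb k) (cb i)"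
  unfolding frobenius_R[OF sesq_tj] Ttilde_def ..
 also have "... = cor (d k / d i)*.TT j (cb k) (cb i)"
  using d_pos[of j] by(simp add: bop_scaleC_simps)
 finally have e: "(SUM T:B i j k. tj (adj (S T)*F (cb i) (R' k)) (adj (S T)*F (cb i) (R' k))) = cor (d k / d i)*.TT j (cb k) (cb i)" .
 have each: "adj (Rt' i)*FA i (adj (tj (adj (S T)*F (cb i) (R' k)) (adj (S T)*F (cb i) (R' k)))) = adj (Rt' k)*tj (adj T) (adj T)"
  if T: "T:B i j k" for T
 proof -
  have "adj (R' i)*F i (adj (adj (S T)*F (cb i) (R' k))) = adj (R' i)*F i (F (cb i) (adj (R' k)*adj T))*F i (R i)"
   using T by(simp add: S_def mult.assoc)
  also have "adj (R' i)*F i (F (cb i) (adj (R' k)*adj T)) = adj (R' k)*adj T*adj (R' i)" by(rule F_conjD(10)) (use T in simp)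
  also have "...*F i (R i) = adj (R' k)*adj T" using F_conjD(6)[of i] by(simp add: mult.assoc)
  finally have *: "adj (R' i)*F i (adj (adj (S T)*F (cb i) (R' k))) = adj (R' k)*adj T" .
  have "adj (S T)*F (cb i) (R' k):M" using T by(simp add: S_def)
  thus ?thesis by(simp only: Rt'_def tj_adj FA_tj M_sub * tj_mult)
 qed
 have "cor (d k / d i)*.(adj (Rt' i)*FA i (adj (TT j (cb k) (cb i)))) =
   adj (Rt' i)*FA i (adj (cor (d k / d i)*.TT j (cb k) (cb i)))"
  by(simp add: bop_scaleC_simps)
 also have "... = (SUM T:B i j k. adj (Rt' i)*FA i (adj (tj (adj (S T)*F (cb i) (R' k)) (adj (S T)*F (cb i) (R' k)))))"
  unfolding e[symmetric] adj_sum by(subst AA.hom_sum[OF FA_hom]) (simp_all add: S_def tj_adj sum_distrib_left)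
 also have "... = adj (Rt' k)*adj (TT i j k)" unfolding adj_TT sum_distrib_left by(intro sum.cong refl each)
 finally show ?thesis .
qed

text \<open>The adjoint of this identity says that the right action of \<open>\<lambda>\<^sub>j\<close> is the conjugate of its left action.\<close>

lemma twisted_fusion:
 "cor (d i)*.(SF.jop (TT i j k)*(adj (Rt' k)*U k)) =
 cor (d k)*.(adj (Rt' i)*U i*adj (TT j (cb k) (cb i))*U j)"
proof -
 have "cor (d k / d i)*.(adj (Rt' i)*U i*adj (TT j (cb k) (cb i))*U j) =
   cor (d k / d i)*.(adj (Rt' i)*FA i (adj (TT j (cb k) (cb i))))*U i*U j"
  using U_rel(1)[of "adj (TT j (cb k) (cb i))" i] by(simp add: bop_scaleC_simps mult.assoc)
 also have "... = adj (Rt' k)*(adj (TT i j k)*U i*U j)" unfolding TT_frobenius_LR by(simp add: mult.assoc)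
 also have "... = (adj (Rt' k)*SF.jop (TT i j k))*U k" unfolding implementation_fusion by(simp add: mult.assoc)
 also have "adj (Rt' k)*SF.jop (TT i j k) = SF.jop (TT i j k)*adj (Rt' k)" by(rule SF.jop_commute[symmetric]) simp_all
 finally have "cor (d i)*.cor (d k / d i)*.(adj (Rt' i)*U i*adj (TT j (cb k) (cb i))*U j) =
  cor (d i)*.(SF.jop (TT i j k)*(adj (Rt' k)*U k))" by(simp add: mult.assoc)
 thus ?thesis using d_pos[of i] by(simp add: bop_scaleC_simps)
qed

end

section \<open>The crossed product\<close>

text \<open>A Schur test: for fixed \<open>rho\<close> the ranges are orthogonal, so squared norms
  add up, and after exchanging the sums the column bound \<open>K\<close> applies.\<close>

lemma sum_orthogonal_bound:
 fixes Z :: "'i => 'i => 'k::chilbert_space bop" and v :: "('i, 'k) ell2"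
 assumes S: "!!rho. finite (S rho)" and Z: "!!rho sig sig'. adj (Z rho sig)*Z rho sig' = (if sig = sig' then cor (m rho sig)*.1 else 0)"
  and m: "!!rho sig. 0 <= m rho sig" and K: "!!F sig. finite F ==> (SUM rho:F. m rho sig) <= K" and F: "finite F"
 shows "(SUM rho:F. (norm (SUM sig:S rho. Z rho sig$$coord v sig))\<^sup>2) <= K*(norm v)^2"
proof -
 have n: "(norm (SUM sig:S rho. Z rho sig$$coord v sig))^2 = (SUM sig:S rho. m rho sig*(norm (coord v sig))^2)" for rho
 proof -
  have "cinner (SUM sig:S rho. Z rho sig$$coord v sig) (SUM sig:S rho. Z rho sig$$coord v sig) =
    (SUM sig:S rho. SUM sig':S rho. cinner ((adj (Z rho sig')*Z rho sig)$$coord v sig) (coord v sig'))"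
   unfolding cinner_sum_left unfolding cinner_sum_right by(simp add: cinner_adj')
  also have "... = (SUM sig:S rho. SUM sig':S rho. if sig' = sig then cor (m rho sig*(norm (coord v sig))^2) else 0)"
   by(intro sum.cong refl) (simp add: Z cinner_scaleR_left cinner_self)
  also have "... = cor (SUM sig:S rho. m rho sig*(norm (coord v sig))^2)" using S by simp
  finally show ?thesis by(simp only: cinner_self of_real_eq_iff)
 qed
 define G where "G = (\<Union>rho\<in>F. S rho)"
 have G: "finite G" "!!rho. rho:F ==> S rho \<subseteq> G" using F S by(auto simp: G_def)
 have "(SUM rho:F. (norm (SUM sig:S rho. Z rho sig$$coord v sig))\<^sup>2) <= (SUM rho:F. SUM sig:G. m rho sig*(norm (coord v sig))^2)"
  unfolding n by(intro sum_mono sum_mono2 G) (simp_all add: m)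
 also have "... = (SUM sig:G. (SUM rho:F. m rho sig)*(norm (coord v sig))^2)" by(subst sum.swap) (simp add: sum_distrib_right)
 also have "... <= (SUM sig:G. K*(norm (coord v sig))^2)" by(intro sum_mono mult_right_mono K F) simp
 also have "... = K*(SUM sig:G. (norm (coord v sig))\<^sup>2)" by(simp add: sum_distrib_left)
 also have "... <= K*(norm v)^2" using K[of "{}"] by(intro mult_left_mono sum_norm_coord_le G) simp
 finally show ?thesis .
qed

lemma entries_eqI:
 fixes S T :: "('i, 'k::chilbert_space) ell2 bop"
 assumes "!!rho sig xi. coord (S$$single sig xi) rho = coord (T$$single sig xi) rho"
 shows "S = T"
 by(rule bop_eq_on_total[OF total_single]) (auto intro!: ell2_eqI assms)

context graded_category begin

text \<open>Equality case of \<open>dimension_bound\<close>, by completeness of the basis.\<close>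

lemma dimension_sum: "(SUM k:fusion i j. real (card (B i j k))*d k) = d i*d j"
proof -
 obtain x :: 'h where x: "norm x = 1"
 proof -
  obtain y :: 'h where y: "y ~= 0" using one_neq_zero by(metis bop_eqI one_op_app zero_op_app)
  thus thesis using that[of "inverse (norm y) *\<^sub>R y"] by simp
 qed
 let ?y = "F i (R' j)$$x"
 have each: "(norm (adj T$$?y))^2 = d k / d i" if T: "T:B i j k" for T k
 proof(rule trace_isometry[OF F_std F_std F_std B_Hom[OF T]])
  show "adj T*T = 1" using B_orth[OF T T] by simp
  assume "adj (F i (R' j))*(T*adj T)*F i (R' j) = cor (d k / d i)*.1"
  hence "adj (adj T*F i (R' j))*(adj T*F i (R' j)) = cor (d k / d i)*.1" by(simp add: mult.assoc)
  from adj_mult_scalar(3)[OF this, of x] show ?thesis using x by simp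
 qed
 have y: "(norm ?y)^2 = d j"
 proof -
  have "adj (F i (R' j))*F i (R' j) = F i (adj (R' j)*R' j)" by simp
  also have "... = cor (d j)*.1" by(simp add: stdD(5)[OF F_std] hom_scalar[OF F_hom] del: F_homD(5))
  finally show ?thesis using adj_mult_scalar(3)[of "F i (R' j)" "cor (d j)" x] x by simp
 qed
 have "(norm ?y)^2 = (SUM p:Sigma (fusion i j) (B i j). (norm (adj (snd p)$$?y))\<^sup>2)"
 proof(rule bessel(2))
  show "?y = (SUM p:Sigma (fusion i j) (B i j). snd p$$adj (snd p)$$?y)"
  proof -
   have "?y = (SUM k:fusion i j. SUM T:B i j k. T*adj T)$$?y" by(simp add: B_complete)
   also have "... = (SUM p:Sigma (fusion i j) (B i j). snd p$$adj (snd p)$$?y)" by(simp add: sum_op_app sum.Sigma case_prod_beta)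
   finally show ?thesis .
  qed
 qed (use B_orth in \<open>auto simp: prod_eq_iff\<close>)
 also have "... = (SUM k:fusion i j. SUM T:B i j k. (norm (adj T$$?y))\<^sup>2)"
  by(subst sum.Sigma) (auto simp: case_prod_beta)
 also have "... = (SUM k:fusion i j. real (card (B i j k))*d k) / d i"
  unfolding sum_divide_distrib by(intro sum.cong) (simp_all add: each)
 finally show ?thesis using d_pos[of i] by(simp add: y field_simps)
qed

section \<open>Matrix entries and relations of the left action\<close>

abbreviation "gL \<equiv> gammaL_alg D"
abbreviation "lam \<equiv> gammaL_lambda D"
abbreviation "gR \<equiv> gammaR_alg D"
abbreviation "kap \<equiv> kappa D"
abbreviation "gRl \<equiv> gammaR_lambda D"
abbreviation "s rho sig \<equiv> cor (sqrt (d rho / d sig))"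

lemma s_simps: "s rho sig * s sig tau = s rho tau" "s rho rho = 1" "cnj (s rho sig) = s rho sig"
 "cor (d rho / d sig) * s sig rho = s rho sig" "s rho sig * s rho sig = cor (d rho / d sig)" "s rho sig ~= 0"
 "s sig tau * s rho sig = s rho tau" "s rho sig * s sig rho = 1"
proof -
 have p: "0 < d rho" "0 < d sig" "0 < d tau" by(rule d_pos)+
 show 1: "s rho sig * s sig tau = s rho tau" and 2: "s rho rho = 1" and "cnj (s rho sig) = s rho sig"
  and 3: "s rho sig * s rho sig = cor (d rho / d sig)" and "s rho sig ~= 0" and "s rho sig * s sig rho = 1"
  using p by(simp_all add: real_sqrt_mult[symmetric] of_real_mult[symmetric] del: of_real_mult of_real_divide)
 show "s sig tau * s rho sig = s rho tau" using 1 by(simp only: mult.commute)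
 have "s rho sig * s sig rho = 1" by fact
 thus "cor (d rho / d sig) * s sig rho = s rho sig" by(simp only: 3[symmetric] mult.assoc mult_1_right)
qed

lemma gL_coord [simp]:
 assumes a: "a:A"
 shows "coord (gL a$$v) rho = FA rho a$$coord v rho"
 unfolding gammaL_alg_def
proof(rule ell2_op_coord[where K = "(opn a)^2"])
 fix v :: "('i, 'k) ell2" and F :: "'i set" assume F: "finite F"
 have n: "norm (FA rho a$$x) <= opn a*norm x" for rho x
 proof -
  obtain W where W: "W*adj W = 1" "FA rho a = W*a*adj W" using FA_implemented[of rho] a by blast
  have 1: "norm (adj W$$y) = norm y" for y
  proof -
   have "adj (adj W)*adj W = 1*.1" using W(1) by(simp add: bop_scaleC_simps)
   from AA.adj_mult_scalar(3)[OF this, of y] show ?thesis by(simp add: power2_eq_iff_nonneg)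
  qed
  have 2: "norm (W$$y) <= norm y" for y
  proof(cases "norm (W$$y) = 0")
   case False
   have "(norm (W$$y))^2 = Re (cinner y (adj W$$W$$y))" by(simp add: Re_cinner_self[symmetric] cinner_adj)
   also have "... <= norm y*norm (W$$y)" using Re_cinner_le[of y "adj W$$W$$y"] by(simp add: 1)
   finally show ?thesis using False by(simp add: power2_eq_square)
  qed simp
  have "norm (FA rho a$$x) <= norm (a$$adj W$$x)" unfolding W(2) times_op_app by(rule 2)
  also have "... <= opn a*norm (adj W$$x)" by(rule norm_op_le)
  finally show ?thesis by(simp add: 1)
 qed
 have "(SUM rho:F. (norm (FA rho a$$coord v rho))\<^sup>2) <= (SUM rho:F. (opn a)\<^sup>2*(norm (coord v rho))^2)"
  by(intro sum_mono) (simp add: power_mono[OF n] flip: power_mult_distrib)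
 also have "... <= (opn a)^2*(norm v)^2" unfolding sum_distrib_left[symmetric] by(intro mult_left_mono sum_norm_coord_le F) simp
 finally show "(SUM rho:F. (norm (FA rho a$$coord v rho))\<^sup>2) <= (opn a)^2*(norm v)^2" .
qed simp_all

text \<open>\<open>ell2_op\<close> has the intended coordinates once the matrix is bounded. The
  square root weights turn its column sums into the dimension estimate, with bound
  \<open>d \<pi>\<close> for the squared norm.\<close>

lemma fusion_op_coord:
 fixes Z :: "'i => 'i => 'k bop"
 assumes S: "!!rho. finite (S rho)" and Z: "!!rho sig sig'. adj (Z rho sig)*Z rho sig' = (if sig = sig' then cor (real (n rho sig))*.1 else 0)"
  and n: "!!F sig. finite F ==> (SUM rho:F. real (n rho sig)*d rho) <= d \<pi>*d sig"
 shows "coord (ell2_op (%v rho. SUM sig:S rho. s rho sig*.(Z rho sig$$coord v sig))$$v) rho = (SUM sig:S rho. (s rho sig*.Z rho sig)$$coord v sig)"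
proof(subst ell2_op_coord[where K = "d \<pi>"])
 show "0 <= d \<pi>" using d_pos[of \<pi>] by simp
 fix v :: "('i, 'k) ell2" and F :: "'i set" assume F: "finite F"
 define m where "m rho sig = d rho / d sig*real (n rho sig)" for rho sig
 have "(SUM rho:F. (norm (SUM sig:S rho. (s rho sig*.Z rho sig)$$coord v sig))\<^sup>2) <= d \<pi>*(norm v)^2"
 proof(rule sum_orthogonal_bound[where m = m, OF S _ _ _ F])
  show "adj (s rho sig*.Z rho sig) * s rho sig'*.Z rho sig' = (if sig = sig' then cor (m rho sig)*.1 else 0)" for rho sig sig'
   using s_simps(5)[of rho sig] by(cases "sig = sig'") (simp_all add: Z bop_scaleC_simps m_def flip: mult.assoc)
  show "0 <= m rho sig" for rho sig using d_pos by(simp add: m_def less_imp_le)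
  show "(SUM rho:F. m rho sig) <= d \<pi>" if "finite F" for F sig
  proof -
   have "(SUM rho:F. m rho sig) = (SUM rho:F. real (n rho sig)*d rho) / d sig"
    unfolding sum_divide_distrib m_def by(intro sum.cong refl) simp
   thus ?thesis using n[OF that, of sig] d_pos[of sig] by(simp add: pos_divide_le_eq)
  qed
 qed
 thus "(SUM rho:F. (norm (SUM sig:S rho. s rho sig*.(Z rho sig$$coord v sig)))\<^sup>2) <= d \<pi>*(norm v)^2"
  by(simp only: scaleC_op_app)
qed (simp_all add: scaleC_add_right sum.distrib scaleC_sum_right scaleC_scaleC mult_ac del: scaleC_real)

text \<open>The column sum runs over \<open>rho\<close> with \<open>sig\<close> fixed; Frobenius
  reciprocity exchanges \<open>B rho \<pi> sig\<close> for \<open>B sig (cb \<pi>) rho\<close>, to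
  which \<open>dimension_bound\<close> applies.\<close>

lemma lam_coord: "coord (lam \<pi>$$v) rho = (SUM sig:fusion rho \<pi>. (s rho sig*.TT rho \<pi> sig)$$coord v sig)"
 unfolding gammaL_lambda_def fusion_def[symmetric]
proof(rule fusion_op_coord[where \<pi> = \<pi>])
 show "(SUM rho:F. real (card (B rho \<pi> sig))*d rho) <= d \<pi>*d sig" if "finite F" for F sig
  using dimension_bound[OF that, of sig "cb \<pi>"] by(simp add: frobenius_R_card[OF sesq_tj, of _ \<pi> sig] mult.commute)
qed (simp_all add: TT_orth)

lemma kap_coord: "coord (kap \<pi>$$v) rho = (SUM sig:fusion \<pi> rho. (s rho sig*.TT \<pi> rho sig)$$coord v sig)"
 unfolding kappa_def fusion_def[symmetric]
proof(rule fusion_op_coord[where \<pi> = \<pi>])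
 show "(SUM rho:F. real (card (B \<pi> rho sig))*d rho) <= d \<pi>*d sig" if "finite F" for F sig
  using dimension_bound[OF that, of "cb \<pi>" sig] by(simp add: frobenius_L_card[OF sesq_tj, of \<pi> _ sig])
qed (simp_all add: TT_orth)

lemma gR_coord [simp]: "coord (gR a$$v) rho = SF.jop (adj a)$$coord v rho"
proof -
 have "gR a = amp (SF.jop (adj a))"
  unfolding gammaR_alg_def amp_def by(simp add: SF.jop_app)
 thus ?thesis by simp
qed

lemma gRl_coord: "coord (gRl \<pi>$$v) rho = adj (U \<pi>)$$coord (kap \<pi>$$v) rho"
proof -
 have "ell2_op (%(v :: ('i, 'k) ell2) rho. adj (U \<pi>)$$coord v rho) = amp (adj (U \<pi>))" unfolding amp_def ..
 thus ?thesis unfolding gammaR_lambda_def by simp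
qed

lemma single_entries:
 "a:A ==> gL a$$single sig xi = single sig (FA sig a$$xi)"
 "coord (lam \<pi>$$single sig xi) rho = s rho sig*.TT rho \<pi> sig$$xi"
 "coord (kap \<pi>$$single sig xi) rho = s rho sig*.TT \<pi> rho sig$$xi"
proof -
 show "gL a$$single sig xi = single sig (FA sig a$$xi)" if "a:A"
  by(rule ell2_eqI) (simp add: that coord_single)
 have z: "(SUM tau:S. X tau$$coord (single sig xi) tau) = (if sig:S then X sig$$xi else 0)" if "finite S" for S and X :: "'i => 'k bop"
 proof -
  have "(SUM tau:S. X tau$$coord (single sig xi) tau) = (SUM tau:S. if tau = sig then X sig$$xi else 0)"
   by(intro sum.cong refl) (simp add: coord_single)
  thus ?thesis using that by simp
 qed
 show "coord (lam \<pi>$$single sig xi) rho = s rho sig*.TT rho \<pi> sig$$xi"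
  "coord (kap \<pi>$$single sig xi) rho = s rho sig*.TT \<pi> rho sig$$xi"
  unfolding lam_coord kap_coord by(subst z, simp, simp add: TT_zero del: scaleC_real)+
qed

lemma gL_hom:
 "a:A ==> b:A ==> gL (a*b) = gL a*gL b" "a:A ==> b:A ==> gL (a + b) = gL a + gL b"
 "a:A ==> gL (c*.a) = c*.gL a" "a:A ==> gL (adj a) = adj (gL a)" "gL 1 = 1" "gL 0 = 0"
proof -
 show "gL (a*b) = gL a*gL b" "gL (a + b) = gL a + gL b" if "a:A" "b:A"
  using that by(intro bop_eqI ell2_eqI; simp)+
 show "gL (c*.a) = c*.gL a" if "a:A" using that by(intro bop_eqI ell2_eqI) simp
 show "gL (adj a) = adj (gL a)" if a: "a:A"
 proof(rule entries_eqI)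
  fix rho sig xi
  have "cinner (coord (adj (gL a)$$single sig xi) rho) eta = cinner (coord (gL (adj a)$$single sig xi) rho) eta" for eta
   using a by(simp add: cinner_single_right[symmetric] cinner_adj single_entries(1)) (simp add: cinner_single coord_single cinner_adj)
  thus "coord (gL (adj a)$$single sig xi) rho = coord (adj (gL a)$$single sig xi) rho" by(intro cinner_ext) simp
 qed
 show "gL 1 = 1" by(intro bop_eqI ell2_eqI) simp
 show "gL 0 = 0" by(intro bop_eqI ell2_eqI) (simp add: AA.hom_zero[OF FA_hom])
qed

lemma lam_gL:
 assumes a: "a:A"
 shows "lam \<pi>*gL a = gL (FA \<pi> a)*lam \<pi>"
proof(rule entries_eqI)
 fix rho sig xi
 have "(TT rho \<pi> sig*FA sig a)$$xi = (FA rho (FA \<pi> a)*TT rho \<pi> sig)$$xi" using AA.HomD(2)[OF TT_Hom a] by simp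
 thus "coord ((lam \<pi>*gL a)$$single sig xi) rho = coord ((gL (FA \<pi> a)*lam \<pi>)$$single sig xi) rho"
  using a by(simp add: single_entries del: scaleC_real)
qed

lemma adj_lam_entries: "coord (adj (lam \<pi>)$$single sig xi) rho = s sig rho*.adj (TT sig \<pi> rho)$$xi"
proof(rule cinner_ext_right)
 fix eta
 have "cinner eta (coord (adj (lam \<pi>)$$single sig xi) rho) = cinner (coord (lam \<pi>$$single rho eta) sig) xi"
  unfolding cinner_single[symmetric] by(simp add: cinner_adj[symmetric] cinner_single_right)
 thus "cinner eta (coord (adj (lam \<pi>)$$single sig xi) rho) = cinner eta (s sig rho*.adj (TT sig \<pi> rho)$$xi)"
  by(simp add: single_entries cinner_scaleC_left cinner_scaleC_right cinner_adj del: scaleC_real)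
qed

text \<open>Entrywise this is \<open>TT_frobenius_R'\<close>; its factor
  \<open>d sig / d rho\<close> inverts the square root weight.\<close>

lemma adj_lam: "adj (lam \<pi>) = gL (adj (Rt \<pi>))*lam (cb \<pi>)"
proof(rule entries_eqI)
 fix rho sig xi
 have "coord ((gL (adj (Rt \<pi>))*lam (cb \<pi>))$$single sig xi) rho = s rho sig*.(FA rho (adj (Rt \<pi>))*TT rho (cb \<pi>) sig)$$xi"
  by(simp add: single_entries del: scaleC_real)
 also have "... = (s rho sig * cor (d sig / d rho))*.adj (TT sig \<pi> rho)$$xi"
  by(simp only: TT_frobenius_R'[symmetric] scaleC_op_app scaleC_scaleC)
 also have "s rho sig * cor (d sig / d rho) = s sig rho" using s_simps(4)[of sig rho] by(simp only: mult.commute)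
 finally show "coord (adj (lam \<pi>)$$single sig xi) rho = coord ((gL (adj (Rt \<pi>))*lam (cb \<pi>))$$single sig xi) rho"
  by(simp only: adj_lam_entries)
qed

text \<open>Entrywise associativity of fusion, with the weights \<open>s\<close> multiplying along
  the path.\<close>

lemma lam_lam: "lam \<pi>*lam \<pi>' = (SUM sig:fusion \<pi> \<pi>'. gL (TT \<pi> \<pi>' sig)*lam sig)"
proof(rule entries_eqI)
 fix rho eta xi
 have "coord ((lam \<pi>*lam \<pi>')$$single eta xi) rho = (SUM sig:fusion rho \<pi>. s rho eta*.(TT rho \<pi> sig*TT sig \<pi>' eta)$$xi)"
  unfolding times_op_app lam_coord[of \<pi>]
  by(intro sum.cong refl) (simp add: single_entries scaleC_scaleC s_simps(1,7) del: scaleC_real of_real_mult)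
 also have "... = s rho eta*.(SUM sig:fusion \<pi> \<pi>'. FA rho (TT \<pi> \<pi>' sig)*TT rho sig eta)$$xi" by(simp add: sum_op_app scaleC_sum_right TT_assoc)
 also have "... = coord ((SUM sig:fusion \<pi> \<pi>'. gL (TT \<pi> \<pi>' sig)*lam sig)$$single eta xi) rho"
 proof -
  have "coord (SUM sig:I. f sig) rho = (SUM sig:I. coord (f sig) rho)" for I :: "'i set" and f :: "'i => ('i, 'k) ell2"
   by(induction I rule: infinite_finite_induct) simp_all
  thus ?thesis by(simp add: sum_op_app scaleC_sum_right single_entries del: scaleC_real)
 qed
 finally show "coord ((lam \<pi>*lam \<pi>')$$single eta xi) rho = coord ((SUM sig:fusion \<pi> \<pi>'. gL (TT \<pi> \<pi>' sig)*lam sig)$$single eta xi) rho" .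
qed

text \<open>Orthogonality of the fusion operators kills the entries off the diagonal; those on it
  are a dimension sum divided by \<open>d sig\<close>.\<close>

lemma lam_norm: "adj (lam \<pi>)*lam \<pi> = cor (d \<pi>)*.1"
proof(rule entries_eqI)
 fix tau sig xi
 have "coord ((adj (lam \<pi>)*lam \<pi>)$$single sig xi) tau =
   FA tau (adj (Rt \<pi>))$$(SUM rho:fusion tau (cb \<pi>). s tau sig*.(TT tau (cb \<pi>) rho*TT rho \<pi> sig)$$xi)"
  unfolding adj_lam times_op_app gL_coord[OF A_sub(3)[OF Rt_A(1)]] lam_coord[of "cb \<pi>"]
  by(intro arg_cong[where f = "op_app _"] sum.cong refl) (simp add: single_entries scaleC_scaleC s_simps(1,7) del: scaleC_real of_real_mult)
 also have "... = (SUM rho:fusion tau (cb \<pi>). s tau sig*.((FA tau (adj (Rt \<pi>))*TT tau (cb \<pi>) rho)*TT rho \<pi> sig)$$xi)"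
  by(simp add: op_app_sum del: scaleC_real)
 also have "... = (SUM rho:fusion tau (cb \<pi>). if tau = sig then cor (real (card (B sig (cb \<pi>) rho))*d rho / d sig)*.xi else 0)"
 proof(intro sum.cong refl)
  fix rho
  have "(FA tau (adj (Rt \<pi>))*TT tau (cb \<pi>) rho)*TT rho \<pi> sig = cor (d rho / d tau)*.(adj (TT rho \<pi> tau)*TT rho \<pi> sig)"
   by(simp only: TT_frobenius_R'[symmetric] bop_scaleC_mult)
  thus "s tau sig*.((FA tau (adj (Rt \<pi>))*TT tau (cb \<pi>) rho)*TT rho \<pi> sig)$$xi =
    (if tau = sig then cor (real (card (B sig (cb \<pi>) rho))*d rho / d sig)*.xi else 0)"
   using s_simps(2)[of sig] by(simp add: TT_orth scaleC_scaleC frobenius_R_card[OF sesq_tj, of rho \<pi> sig] mult_ac)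
 qed
 also have "... = (if tau = sig then cor (d \<pi>)*.xi else 0)"
 proof(cases "tau = sig")
  case True
  have "(SUM rho:fusion sig (cb \<pi>). cor (real (card (B sig (cb \<pi>) rho))*d rho / d sig)*.xi) =
    (SUM rho:fusion sig (cb \<pi>). real (card (B sig (cb \<pi>) rho))*d rho / d sig) *\<^sub>R xi"
   unfolding scaleC_of_real scaleR_sum_left ..
  also have "(SUM rho:fusion sig (cb \<pi>). real (card (B sig (cb \<pi>) rho))*d rho / d sig) = d \<pi>"
   unfolding sum_divide_distrib[symmetric] dimension_sum using d_pos[of sig] by simp
  finally show ?thesis using True by simp
 qed simp
 also have "... = coord ((cor (d \<pi>)*.1)$$single sig xi) tau" by(simp add: coord_single)
 finally show "coord ((adj (lam \<pi>)*lam \<pi>)$$single sig xi) tau = coord ((cor (d \<pi>)*.1)$$single sig xi) tau" .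
qed

text \<open>The tensor unit is merely equivalent to a representative. The unitary \<open>u\<close>
  of the equivalence compensates: \<open>TT rho i rho\<close> is the doubled \<open>F rho u\<close>,
  which \<open>gL (tj (adj u) (adj u))\<close> undoes.\<close>

lemma unit_index:
 obtains i a where "a:A" "deg i = 0" "gL a*lam i = 1"
proof -
 have io: "(\<lambda>x\<in>M. x):objects D" by(rule rigid_unfolded[THEN conjunct2, THEN conjunct1])
 have iH: "Hom (\<lambda>x\<in>M. x) rho = Hom (%x. x) rho" "Hom rho (\<lambda>x\<in>M. x) = Hom rho (%x. x)" for rho by(auto simp: Hom_def)
 have ii: "irreducible_endo M (\<lambda>x\<in>M. x)" using irr_id unfolding irreducible_endo_def intertwiners_Hom(5) iH irr_def .
 obtain i u where u: "u:Hom (%x. x) (F i)" "adj u*u = 1" "u*adj u = 1"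
 by(use irreps io ii in \<open>auto simp: irr_representatives_def equivalent_endos_def intertwiners_Hom(5) iH\<close>)
 have uM [simp]: "u:M" by(rule HomD[OF u(1)])
 obtain g where g: "(\<lambda>x\<in>M. x):component D g" using component_unique[OF io ii] by blast
 have "compose M (\<lambda>x\<in>M. x) (\<lambda>x\<in>M. x) = (\<lambda>x\<in>M. x)" by(auto simp: compose_def fun_eq_iff)
 hence "g + g = g" using component_compose[OF g g] component_unique[OF io ii] g by auto
 hence g0: "g = 0" using add_left_cancel[of g g 0] by simp
 have ua: "adj u:Hom (F i) (%x. x)" by(rule Hom_adj[OF u(1) hom_id F_hom])
 have deg: "deg i = 0" using u(2) one_neq_zero constituent_component[OF g, of "adj u" i] ua by(force simp: g0 iH)
 have Fu: "F rho u:Hom (F rho) (FF rho i)" for rho by(rule Hom_lift[OF F_hom hom_id F_hom u(1)])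
 have Fua: "F rho (adj u):Hom (FF rho i) (F rho)" for rho by(rule Hom_lift[OF F_hom F_hom hom_id ua])
 have Fu1: "adj (F rho u)*F rho u = 1" "F rho u*adj (F rho u) = 1" for rho
 proof -
  have "adj (F rho u)*F rho u = F rho (adj u*u)" "F rho u*adj (F rho u) = F rho (u*adj u)" by simp_all
  thus "adj (F rho u)*F rho u = 1" "F rho u*adj (F rho u) = 1" by(simp_all only: u F_homD(6))
 qed
 have z: "TT rho i sig = 0" if "rho ~= sig" for rho sig
 proof -
  have "X = 0" if X: "X:Hom (F sig) (FF rho i)" for X
  proof -
   have "F rho (adj u)*X = 0" using rep_unique \<open>rho \<noteq> sig\<close> by(metis Hom_mult[OF Fua X])
   hence "F rho u*(adj (F rho u)*X) = 0" by simp
   thus "X = 0" using Fu1(2)[of rho] by(simp flip: mult.assoc)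
  qed
  hence "T = 0" if "T:B rho i sig" for T using B_Hom[OF that] by blast
  thus ?thesis unfolding Ttilde_def by(intro sum.neutral ballI) (metis tj_sesq(5))
 qed
 have e: "TT rho i rho = tj (F rho u) (F rho u)" for rho
 proof -
  have "onfam (Hom (F rho) (FF rho i)) {()} (%_. F rho u)"
   unfolding onfam_def
  proof(intro conjI ballI)
   fix X assume X: "X:Hom (F rho) (FF rho i)"
   obtain c where c: "F rho (adj u)*X = c*.1" using irrD[OF F_irr Hom_mult[OF Fua X]] by blast
   have "X = F rho u*(adj (F rho u)*X)" using Fu1(2)[of rho] by(simp flip: mult.assoc)
   also have "adj (F rho u)*X = c*.1" using c by simp
   finally have "X = c*.F rho u" by(simp add: bop_scaleC_simps)
   thus "EX c. X = (SUM i:{()}. c i*.F rho u)" by(intro exI[of _ "%_. c"]) simp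
  qed (use Fu Fu1 in auto)
  from onfam_sesq_unique[OF B_onfam this sesq_tj] show ?thesis by(simp add: Ttilde_def)
 qed
 have "gL (tj (adj u) (adj u))*lam i = 1"
 proof(rule entries_eqI)
  fix rho sig xi
  have "coord ((gL (tj (adj u) (adj u))*lam i)$$single sig xi) rho = s rho sig*.(tj (adj (F rho u)) (adj (F rho u))*TT rho i sig)$$xi"
   by(simp add: single_entries del: scaleC_real)
  also have "... = coord (1$$single sig xi) rho"
   using s_simps(2)[of rho] by(cases "rho = sig") (simp_all add: z e tj_mult Fu1 coord_single)
  finally show "coord ((gL (tj (adj u) (adj u))*lam i)$$single sig xi) rho = coord (1$$single sig xi) rho" .
 qed
 thus thesis using that[of "tj (adj u) (adj u)" i] deg by simp
qed

subsection \<open>The generated algebra\<close>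

abbreviation "BB \<equiv> algB D"

definition bgen :: "'i set => ('i, 'k) ell2 bop set" where "bgen I = {gL a*lam \<pi> | a \<pi>. a:A & \<pi>:I}"

lemma bgenI: "a:A ==> \<pi>:I ==> gL a*lam \<pi>:bgen I" unfolding bgen_def by blast

lemma bgen_mult:
 assumes a: "a:A" and b: "b:A" and I: "fusion \<pi> \<pi>' \<subseteq> I"
 shows "(gL a*lam \<pi>)*(gL b*lam \<pi>'):opspan (bgen I)"
proof -
 have "(gL a*lam \<pi>)*(gL b*lam \<pi>') = gL a*(lam \<pi>*gL b)*lam \<pi>'" by(simp add: mult.assoc)
 also have "... = (SUM sig:fusion \<pi> \<pi>'. gL (a*FA \<pi> b*TT \<pi> \<pi>' sig)*lam sig)" using a b by(simp add: lam_gL gL_hom mult.assoc lam_lam sum_distrib_left)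
 also have "...:opspan (bgen I)"
  using a b I by(intro op_subspaceD(6)[OF op_subspace_opspan] opspan.gen bgenI) auto
 finally show ?thesis .
qed

lemma bgen_adj:
 assumes a: "a:A" and I: "cb \<pi>:I"
 shows "adj (gL a*lam \<pi>):opspan (bgen I)"
proof -
 have "adj (gL a*lam \<pi>) = gL (adj (Rt \<pi>))*(lam (cb \<pi>)*gL (adj a))" using a by(simp add: adj_lam gL_hom(4) mult.assoc)
 also have "... = gL (adj (Rt \<pi>)*FA (cb \<pi>) (adj a))*lam (cb \<pi>)" unfolding lam_gL[OF A_sub(3)[OF a]] using a by(simp add: gL_hom mult.assoc)
 also have "...:opspan (bgen I)" using a I by(intro opspan.gen bgenI) auto
 finally show ?thesis .
qed

definition S\<^sub>B :: "('i, 'k) ell2 bop set" where "S\<^sub>B = opspan (bgen UNIV)"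

lemma S_B_alg: "star_alg S\<^sub>B"
 unfolding S\<^sub>B_def
proof(rule star_alg_opspan)
 obtain i a where "a:A" "gL a*lam i = 1" by(rule unit_index)
 thus "1:opspan (bgen UNIV)" using opspan.gen[OF bgenI[of a i UNIV]] by simp
 show "x*y:opspan (bgen UNIV)" if xy: "x:bgen UNIV" "y:bgen UNIV" for x y
 proof -
  obtain a b \<pi> \<pi>' where "x = gL a*lam \<pi>" "a:A" "y = gL b*lam \<pi>'" "b:A" using xy unfolding bgen_def by blast
  thus ?thesis using bgen_mult[of a b \<pi> \<pi>' UNIV] by simp
 qed
 show "adj x:opspan (bgen UNIV)" if x: "x:bgen UNIV" for x
 proof -
  obtain a \<pi> where "x = gL a*lam \<pi>" "a:A" using x unfolding bgen_def by blast
  thus ?thesis using bgen_adj[of a \<pi> UNIV] by simp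
 qed
qed

lemma gL_S_B: "a:A ==> gL a:S\<^sub>B" and lam_S_B: "lam \<pi>:S\<^sub>B"
proof -
 obtain i b where b: "b:A" "gL b*lam i = 1" by(rule unit_index)
 show "gL a:S\<^sub>B" if a: "a:A"
 by(use a b opspan.gen[OF bgenI[of "a*b" i UNIV]] in \<open>simp add: gL_hom mult.assoc S\<^sub>B_def\<close>)
 show "lam \<pi>:S\<^sub>B" unfolding S\<^sub>B_def using opspan.gen[OF bgenI[of 1 \<pi> UNIV]] by(simp add: gL_hom)
qed

lemma BB_eq: "BB = commutant (commutant S\<^sub>B)"
proof -
 let ?X = "gL ` A \<union> range lam"
 note S = star_algD[OF S_B_alg] star_alg_ops[OF S_B_alg]
 have "x:S\<^sub>B" if "x:star_algebra_gen ?X" for x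
  using that by induction (use gL_S_B lam_S_B S in auto)
 moreover have "x:star_algebra_gen ?X" if "x:opspan (bgen UNIV)" for x
  using that
 proof induction
  case zero
  have "0*.lam undefined:star_algebra_gen ?X" by(intro star_algebra_gen.intros) auto
  thus ?case by(simp add: bop_scaleC_simps)
 next
  case (gen x)
  then obtain a \<pi> where "x = gL a*lam \<pi>" "a:A" unfolding bgen_def by blast
  thus ?case by(auto intro!: star_algebra_gen.mult intro: star_algebra_gen.gen)
 qed (auto intro: star_algebra_gen.intros)
 ultimately have "star_algebra_gen ?X = S\<^sub>B" unfolding S\<^sub>B_def by blast
 thus ?thesis by(simp add: algB_def)
qed

lemma vnB: "von_neumann_algebra BB"
 unfolding BB_eq by(rule von_neumann_bicommutant[OF star_algD(4)[OF S_B_alg]])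
lemma B_alg: "star_alg BB" by(rule vn_star_alg[OF vnB])
lemma S_B_BB: "x:S\<^sub>B ==> x:BB" unfolding BB_eq using commutant_commutant by blast
lemma BB': "commutant BB = commutant S\<^sub>B" unfolding BB_eq by(rule commutant_triple)

end

lemma closure_commute:
 assumes S: "op_subspace S" and x: "x:sigma_weak closure_of S" and c: "!!y. y:S ==> a*y = y * c"
 shows "a*x = x * c"
proof(rule bop_cinner_eqI)
 fix y z
 obtain v w where vw: "!!u. u:UNIV ==> nfun (single 0 y) (single 0 z) (a*u - u * c) = nfun v w u"
  by(rule nmap_onE[OF nmap_on_diff[OF nmap_on_left[OF nmap_on_id] nmap_on_right[OF nmap_on_id]], where v = "single 0 y" and w = "single 0 z"]) (rule that)
 have "nfun (single 0 y) (single 0 z) (a*x - x * c) = 0" using x by(metis sigma_weak_closure_iff[OF S] vw UNIV_I c diff_self nfun_simps(4))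
 thus "cinner ((a*x)$$y) z = cinner ((x * c)$$y) z" by(simp add: nfun_single cinner_simps)
qed

context graded_category begin

section \<open>The right action\<close>

lemma bij_cb: "bij cb" by(rule o_bij[of cb]) auto

lemma norm_V: "norm (V \<pi>$$x) = norm x" "norm (adj (V \<pi>)$$x) = norm x"
proof -
 have "adj (V \<pi>)*V \<pi> = 1*.1" "adj (adj (V \<pi>))*adj (V \<pi>) = 1*.1" by(simp_all add: V_rel bop_scaleC_simps)
 from AA.adj_mult_scalar(3)[OF this(1), of x] AA.adj_mult_scalar(3)[OF this(2), of x]
 show "norm (V \<pi>$$x) = norm x" "norm (adj (V \<pi>)$$x) = norm x" by(simp_all add: power2_eq_iff_nonneg)
qed

text \<open>The twisted conjugation, exchanging \<open>rho\<close> and \<open>cb rho\<close>. Its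
  inverse \<open>Kb\<close> is written out separately, so that involutivity of \<open>Jb\<close> is
  not an issue.\<close>

definition Jb :: "('i, 'k) ell2 => ('i, 'k) ell2" where
 "Jb v = Abs_ell2 (%rho. V (cb rho)$$J (coord v (cb rho)))"
definition Kb :: "('i, 'k) ell2 => ('i, 'k) ell2" where
 "Kb v = Abs_ell2 (%rho. J (adj (V rho)$$coord v (cb rho)))"

lemma Jb_coord [simp]: "coord (Jb v) rho = V (cb rho)$$J (coord v (cb rho))"
 and Kb_coord [simp]: "coord (Kb v) rho = J (adj (V rho)$$coord v (cb rho))"
by(use summable_on_reindex_bij_betw[OF bij_cb, of "%rho. (norm (coord v rho))\<^sup>2"] coord_summable[of v] in \<open>auto simp: Jb_def Abs_ell2 norm_V Kb_def\<close>)

lemma V_cancel [simp]: "V \<pi>$$adj (V \<pi>)$$x = x" "adj (V \<pi>)$$V \<pi>$$x = x"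
 using arg_cong[OF V_rel(3)[of \<pi>], of "%T. T$$x"] arg_cong[OF V_rel(4)[of \<pi>], of "%T. T$$x"] by simp_all

lemma J_J [simp]: "J (J x) = x" using SF.jop_simps(6)[of 1] SF.jop_app[of 1 x] by(simp add: SF.jop_simps)

lemma J_cinner: "cinner (J x) (J y) = cinner y x"
 using standard by(simp add: standard_form_def)
lemma J_scaleC: "J (c*.x) = cnj c*.J x"
 using standard by(simp add: standard_form_def)

lemma Jb_simps: "Jb (Kb v) = v" "Kb (Jb v) = v" "Jb (v + w) = Jb v + Jb w" "Jb (c*.v) = cnj c*.Jb v"
 "Kb (v + w) = Kb v + Kb w" "Kb (c*.v) = cnj c*.Kb v"
 by(rule ell2_eqI; simp add: J_scaleC)+

lemma Jb_cinner: "cinner (Jb v) (Jb w) = cinner w v"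
by(use infsum_reindex_bij_betw[OF bij_cb, of "%rho. cinner (coord w rho) (coord v rho)"] in \<open>simp add: cinner_ell2 Jb_coord cinner_adj' J_cinner\<close>)

lemma Kb_cinner: "cinner (Kb v) (Kb w) = cinner w v"
 using Jb_cinner[of "Kb w" "Kb v"] by(simp add: Jb_simps)

lemma norm_Jb: "norm (Jb v) = norm v" "norm (Kb v) = norm v"
proof -
 have "cor ((norm (Jb v))^2) = cor ((norm v)^2)" "cor ((norm (Kb v))^2) = cor ((norm v)^2)"
  by(simp_all only: cinner_self[symmetric] Jb_cinner Kb_cinner)
 thus "norm (Jb v) = norm v" "norm (Kb v) = norm v" by(simp_all only: of_real_eq_iff power2_eq_iff_nonneg norm_ge_zero)
qed

text \<open>Adjoint followed by conjugation with an antiunitary: linear, antimultiplicative and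
  normal for structural reasons.\<close>

definition rr :: "('i, 'k) ell2 bop => ('i, 'k) ell2 bop" where "rr x = Abs_bop (%v. Jb (adj x$$Kb v))"

lemma rr_app: "rr x$$v = Jb (adj x$$Kb v)"
proof -
 obtain T where T: "op_app T = (%v. Jb (adj x$$Kb v))"
 proof(rule bop_exists[of "%v. Jb (adj x$$Kb v)" "opn (adj x)"])
  show "norm (Jb (adj x$$Kb v)) <= opn (adj x)*norm v" for v
   using norm_op_le[of "adj x" "Kb v"] by(simp add: norm_Jb)
 qed (simp_all add: Jb_simps that)
 show ?thesis by(metis rr_def T[symmetric] op_app_inverse T)
qed

lemma rr_simps: "rr (x*y) = rr y*rr x" "rr (x + y) = rr x + rr y" "rr (c*.x) = c*.rr x" "rr 1 = 1"
 by(rule bop_eqI; simp add: rr_app Jb_simps)+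

lemma cinner_rr: "cinner (rr x$$v) w = cinner (x$$Kb w) (Kb v)"
 using Jb_cinner[of "adj x$$Kb v" "Kb w"] by(simp add: rr_app Jb_simps cinner_adj)

lemma rr_adj: "rr (adj x) = adj (rr x)"
by(metis adj_unique[symmetric] cinner_commute cinner_rr cinner_commute[symmetric] cinner_adj[of x])

lemma rr_nmap: "nmap_on N rr"
 unfolding nmap_on_def
proof(intro allI)
 fix v w :: "(nat, ('i, 'k) ell2) ell2"
 define K where "K v = Abs_ell2 (%n. Kb (coord v n))" for v :: "(nat, ('i, 'k) ell2) ell2"
 have K: "coord (K v) n = Kb (coord v n)" for v n
  unfolding K_def by(subst Abs_ell2) (simp_all add: norm_Jb coord_summable)
 have "nfun v w (rr x) = nfun (K w) (K v) x" for x
  by(simp add: nfun_def cinner_ell2[of "amp _$$_"] K cinner_rr)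
 thus "EX v' w'. ALL x:N. nfun v w (rr x) = nfun v' w' x" by blast
qed

lemma rr_gL: "a:A ==> rr (gL a) = gR a"
proof(rule bop_eqI, rule ell2_eqI)
 fix v rho assume a: "a:A"
 define x where "x = J (adj (V (cb rho))$$coord v rho)"
 have "coord (rr (gL a)$$v) rho = (V (cb rho)*SF.jop (FA (cb rho) (adj a)))$$J x" using a by(simp add: rr_app gL_hom(4)[symmetric] x_def SF.jop_app)
 also have "... = (SF.jop (adj a)*V (cb rho))$$J x" by(subst V_rel(2)) (simp_all add: a)
 also have "... = coord (gR a$$v) rho" by(simp add: x_def)
 finally show "coord (rr (gL a)$$v) rho = coord (gR a$$v) rho" .
qed

lemma rr_lam: "rr (lam \<pi>) = gRl \<pi>"
proof(rule entries_eqI)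
 fix rho sig xi
 define r q where "r = cb rho" and "q = cb sig"
 have rq: "cb r = rho" "cb q = sig" by(simp_all add: r_def q_def)
 define eta where "eta = J (adj (V q)$$xi)"
 have K: "Kb (single sig xi) = single q eta"
  by(rule ell2_eqI) (auto simp: coord_single eta_def q_def)
 have xi: "xi = V q$$J eta" by(simp add: eta_def)
 have s0: "s r q = s rho sig" "s q r = s sig rho" by(simp_all add: r_def q_def)
 have "coord (rr (lam \<pi>)$$single sig xi) rho = s q r*.(V r*SF.jop (adj (TT q \<pi> r)))$$J eta" by(simp add: rr_app K adj_lam_entries r_def J_scaleC SF.jop_app)
 also have "... = s r q*.(adj (U \<pi>)*TT \<pi> (cb r) (cb q)*V q)$$J eta"
 proof -
  \<comment> \<open>The adjoint of \<open>twisted_fusion\<close> carries the factors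
    \<open>d q\<close> and \<open>d r\<close>; division by \<open>sqrt (d q*d r)\<close> turns them
    into the weights \<open>s q r\<close> and \<open>s r q\<close>.\<close>
  have "cor (1 / sqrt (d q*d r))*.cor (d q)*.(V r*SF.jop (adj (TT q \<pi> r))) =
    cor (1 / sqrt (d q*d r))*.cor (d r)*.(adj (U \<pi>)*TT \<pi> (cb r) (cb q)*V q)" using arg_cong[OF twisted_fusion[of q \<pi> r], of adj] by(simp add: V_def SF.adj_jop mult.assoc)
  hence *: "(cor (1 / sqrt (d q*d r)) * cor (d q))*.(V r*SF.jop (adj (TT q \<pi> r))) =
    (cor (1 / sqrt (d q*d r)) * cor (d r))*.(adj (U \<pi>)*TT \<pi> (cb r) (cb q)*V q)" by(simp only: bop_scaleC_simps(4))
  have dq: "1 / sqrt (d q*d r)*d q = sqrt (d q / d r)" "1 / sqrt (d q*d r)*d r = sqrt (d r / d q)"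
   using d_pos[of q] d_pos[of r] by(simp_all add: real_sqrt_mult real_sqrt_divide field_simps flip: power2_eq_square)
  hence "cor (1 / sqrt (d q*d r)) * cor (d q) = s q r" "cor (1 / sqrt (d q*d r)) * cor (d r) = s r q"
   by(simp_all only: of_real_mult[symmetric])
  thus ?thesis using * by(simp only:)
 qed
 also have "... = coord (gRl \<pi>$$single sig xi) rho"
  by(simp add: gRl_coord single_entries s0 rq xi[symmetric] del: scaleC_real)
 finally show "coord (rr (lam \<pi>)$$single sig xi) rho = coord (gRl \<pi>$$single sig xi) rho" .
qed

lemma gR_commute: "b:A ==> a:A ==> gR a*gL b = gL b*gR a" "a:A ==> gR a*lam \<pi> = lam \<pi>*gR a"
proof -
 show "gR a*gL b = gL b*gR a" if "b:A" "a:A"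
 proof(rule bop_eqI, rule ell2_eqI)
  fix v rho
  have "(SF.jop (adj a)*FA rho b)$$coord v rho = (FA rho b*SF.jop (adj a))$$coord v rho" using SF.jop_commute[of "adj a" "FA rho b"] that by simp
  thus "coord ((gR a*gL b)$$v) rho = coord ((gL b*gR a)$$v) rho" using that by simp
 qed
 show "gR a*lam \<pi> = lam \<pi>*gR a" if a: "a:A"
 proof(rule bop_eqI, rule ell2_eqI)
  fix v rho
  have "(SF.jop (adj a)*TT rho \<pi> sig)$$x = (TT rho \<pi> sig*SF.jop (adj a))$$x" for sig x
   using SF.jop_commute[of "adj a" "TT rho \<pi> sig"] a by simp
  thus "coord ((gR a*lam \<pi>)$$v) rho = coord ((lam \<pi>*gR a)$$v) rho"
   by(simp add: lam_coord op_app_sum del: scaleC_real)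
 qed
qed

text \<open>Multiplications from the left and from the right commute by \<open>TT_assoc\<close>;
  \<open>adj (U \<pi>)\<close> absorbs the \<open>FA \<pi>\<close> that appears.\<close>

lemma gRl_commute: "b:A ==> gRl \<pi>*gL b = gL b*gRl \<pi>" "gRl \<pi>*lam \<pi>' = lam \<pi>'*gRl \<pi>"
proof -
 have e: "coord (gRl \<pi>$$single sig xi) rho = s rho sig*.(adj (U \<pi>)*TT \<pi> rho sig)$$xi" for rho sig xi
  by(simp add: gRl_coord single_entries del: scaleC_real)
 show "gRl \<pi>*gL b = gL b*gRl \<pi>" if b: "b:A"
 proof(rule entries_eqI)
  fix rho sig xi
  have "(adj (U \<pi>)*TT \<pi> rho sig)*FA sig b = adj (U \<pi>)*FA \<pi> (FA rho b)*TT \<pi> rho sig"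
   using AA.HomD(2)[OF TT_Hom b, of \<pi> rho sig] by(simp add: mult.assoc)
  also have "adj (U \<pi>)*FA \<pi> (FA rho b) = FA rho b*adj (U \<pi>)" by(rule U_rel(2)) (simp add: b)
  finally have "((adj (U \<pi>)*TT \<pi> rho sig)*FA sig b)$$xi = (FA rho b*(adj (U \<pi>)*TT \<pi> rho sig))$$xi" by(simp add: mult.assoc)
  thus "coord ((gRl \<pi>*gL b)$$single sig xi) rho = coord ((gL b*gRl \<pi>)$$single sig xi) rho"
   using b by(simp add: single_entries(1) e del: scaleC_real)
 qed
 show "gRl \<pi>*lam \<pi>' = lam \<pi>'*gRl \<pi>"
 proof(rule entries_eqI)
  fix rho eta xi
  have "coord ((gRl \<pi>*lam \<pi>')$$single eta xi) rho = adj (U \<pi>)$$(SUM sig:fusion \<pi> rho. s rho eta*.(TT \<pi> rho sig*TT sig \<pi>' eta)$$xi)"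
   unfolding times_op_app gRl_coord kap_coord
   by(intro arg_cong[where f = "op_app _"] sum.cong refl) (simp add: single_entries scaleC_scaleC s_simps(1,7) del: scaleC_real of_real_mult)
  also have "... = s rho eta*.(adj (U \<pi>)*(SUM sig:fusion \<pi> rho. TT \<pi> rho sig*TT sig \<pi>' eta))$$xi"
   by(simp add: op_app_sum sum_op_app scaleC_sum_right del: scaleC_real)
  also have "... = s rho eta*.(SUM sig:fusion rho \<pi>'. (adj (U \<pi>)*FA \<pi> (TT rho \<pi>' sig))*TT \<pi> sig eta)$$xi"
   by(simp only: TT_assoc[symmetric] sum_distrib_left mult.assoc)
  also have "... = s rho eta*.(SUM sig:fusion rho \<pi>'. TT rho \<pi>' sig*(adj (U \<pi>)*TT \<pi> sig eta))$$xi"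
   by(simp only: U_rel(2)[OF TT_A] mult.assoc)
  also have "... = coord ((lam \<pi>'*gRl \<pi>)$$single eta xi) rho"
   unfolding times_op_app lam_coord e
   by(simp add: sum_op_app scaleC_sum_right scaleC_scaleC s_simps(1,7) del: scaleC_real of_real_mult)
  finally show "coord ((gRl \<pi>*lam \<pi>')$$single eta xi) rho = coord ((lam \<pi>'*gRl \<pi>)$$single eta xi) rho" .
 qed
qed

text \<open>Generators commute by computation. Linearity extends this to \<open>S\<^sub>B\<close>,
  normality of \<open>rr\<close> then to the bicommutant in one argument, and the triple commutant
  in the other.\<close>

lemma rr_commute:
 assumes "x:BB" "y:BB"
 shows "rr x*y = y*rr x"
proof -
 have g: "rr (gL a*lam \<pi>):commutant (bgen UNIV)" if a: "a:A" for a \<pi>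
  unfolding commutant_def
 proof(intro CollectI ballI)
  fix z assume "z:bgen UNIV"
  then obtain b \<pi>' where z: "z = gL b*lam \<pi>'" "b:A" unfolding bgen_def by blast
  have c: "gRl \<pi>*gR a * w = w*(gRl \<pi>*gR a)" if "gR a * w = w*gR a" "gRl \<pi> * w = w*gRl \<pi>" for w
   using that by(metis mult.assoc)
  have "gRl \<pi>*gR a*z = z*(gRl \<pi>*gR a)"
  proof(rule c)
   show "gR a*z = z*gR a" using gR_commute(1)[OF z(2) a] gR_commute(2)[OF a] by(smt (verit) z mult.assoc)
   show "gRl \<pi>*z = z*gRl \<pi>" using gRl_commute(1)[OF z(2)] gRl_commute(2) by(smt (verit) z mult.assoc)
  qed
  thus "rr (gL a*lam \<pi>)*z = z*rr (gL a*lam \<pi>)" by(simp only: rr_simps rr_gL[OF a] rr_lam)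
 qed
 have r0: "rr 0 = 0" using rr_simps(3)[of 0 0] by(simp add: bop_scaleC_simps)
 have "rr z:commutant (bgen UNIV)" if "z:opspan (bgen UNIV)" for z
  using that
 proof induction
  case (gen x)
  then obtain a \<pi> where "x = gL a*lam \<pi>" "a:A" unfolding bgen_def by blast
  thus ?case using g by simp
 qed (simp_all add: r0 rr_simps op_subspaceD[OF op_subspace_commutant])
 hence S: "rr z:commutant S\<^sub>B" if "z:S\<^sub>B" for z using that by(simp add: S\<^sub>B_def commutant_opspan)
 have "rr x:commutant S\<^sub>B"
  unfolding commutant_def
 proof(intro CollectI ballI)
  fix w assume w: "w:S\<^sub>B"
  show "rr x * w = w*rr x"
   by(rule nmap_on_eq[OF S_B_alg nmap_on_right[OF rr_nmap] nmap_on_left[OF rr_nmap] _ assms(1)[unfolded BB_eq]])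
    (use commutantD[OF S w] in blast)
 qed
 thus ?thesis using commutantD[OF _ assms(2)] by(simp add: BB')
qed

text \<open>A normal map is determined by its values on \<open>S\<^sub>B\<close>, where linearity
  and antimultiplicativity reduce them to the generators.\<close>

lemma gammaR_eq: "gammaR D = (\<lambda>x\<in>BB. rr x)"
 unfolding gammaR_def
proof(rule the_equality)
 note Bs = star_algD[OF B_alg] star_alg_ops[OF B_alg]
 have l [simp]: "gL a:BB" if "a:A" for a using S_B_BB[OF gL_S_B[OF that]] .
 have m [simp]: "lam \<pi>:BB" for \<pi> using S_B_BB[OF lam_S_B] .
 show "(\<lambda>x\<in>BB. rr x):extensional BB & clinear_on BB (\<lambda>x\<in>BB. rr x) &
  (ALL x:BB. ALL y:BB. (\<lambda>x\<in>BB. rr x) (x*y) = (\<lambda>x\<in>BB. rr x) y*(\<lambda>x\<in>BB. rr x) x) &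
  (ALL x:BB. (\<lambda>x\<in>BB. rr x) (adj x) = adj ((\<lambda>x\<in>BB. rr x) x)) & (\<lambda>x\<in>BB. rr x) 1 = 1 &
  continuous_map (subtopology sigma_weak BB) sigma_weak (\<lambda>x\<in>BB. rr x) &
  (ALL a:A. (\<lambda>x\<in>BB. rr x) (gL a) = gR a) & (ALL \<pi>. (\<lambda>x\<in>BB. rr x) (lam \<pi>) = gRl \<pi>)" by(use nmap_on_continuous nmap_on_cong[OF rr_nmap] in \<open>auto simp: clinear_on_def Bs rr_simps rr_adj rr_gL rr_lam\<close>)
 fix r assume r: "r:extensional BB & clinear_on BB r & (ALL x:BB. ALL y:BB. r (x*y) = r y*r x) &
  (ALL x:BB. r (adj x) = adj (r x)) & r 1 = 1 & continuous_map (subtopology sigma_weak BB) sigma_weak r &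
  (ALL a:A. r (gL a) = gR a) & (ALL \<pi>. r (lam \<pi>) = gRl \<pi>)"
 have rl: "x:BB ==> y:BB ==> r (x + y) = r x + r y" "x:BB ==> r (c*.x) = c*.r x" for x y c
  using r unfolding clinear_on_def by blast+
 have nr: "nmap_on BB r" by(rule nmap_onI_continuous[OF star_algD(1)[OF B_alg]]) (use r in blast)+
 have r0: "r 0 = 0" "rr 0 = 0" using rl(2)[of 0 0] rr_simps(3)[of 0 0] Bs by(simp_all add: bop_scaleC_simps)
 have eqS: "r z = rr z" if z: "z:S\<^sub>B" for z
 proof -
  have m2: "w:BB" if "w:opspan (bgen UNIV)" for w using S_B_BB that unfolding S\<^sub>B_def by blast
  have "z:opspan (bgen UNIV)" using z by(simp add: S\<^sub>B_def)
  thus ?thesis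
  proof(rule linear_eq_on_opspan[rotated -1])
   fix x assume "x:bgen UNIV"
   then obtain a \<pi> where x: "x = gL a*lam \<pi>" "a:A" unfolding bgen_def by blast
   show "r x = rr x" using r x by(simp add: rr_simps rr_gL rr_lam)
  qed (use m2 rl r0 in \<open>simp_all add: rr_simps\<close>)
 qed
 show "r = (\<lambda>x\<in>BB. rr x)"
 proof(rule extensionalityI[of _ BB])
  show "r x = (\<lambda>x\<in>BB. rr x) x" if x: "x:BB" for x
   using nmap_on_eq[OF S_B_alg nr[unfolded BB_eq] rr_nmap eqS x[unfolded BB_eq]] x by simp
 qed (use r in simp_all)
qed

section \<open>The degree-zero part\<close>

definition pdeg :: "'g => ('i, 'k) ell2 bop" where
 "pdeg g = ell2_op (%v rho. if deg rho = g then coord v rho else 0)"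

lemma pdeg_coord [simp]: "coord (pdeg g$$v) rho = (if deg rho = g then coord v rho else 0)"
 unfolding pdeg_def
proof(rule ell2_op_coord[where K = 1])
 fix v :: "('i, 'k) ell2" and F :: "'i set" assume F: "finite F"
 have "(SUM rho:F. (norm (if deg rho = g then coord v rho else 0))\<^sup>2) <= (SUM rho:F. (norm (coord v rho))\<^sup>2)" by(intro sum_mono) simp
 thus "(SUM rho:F. (norm (if deg rho = g then coord v rho else 0))\<^sup>2) <= 1*(norm v)^2" using sum_norm_coord_le[OF F, of v] by simp
qed auto

lemma pdeg_mult: "pdeg g*pdeg h = (if g = h then pdeg g else 0)"
 by(rule bop_eqI, rule ell2_eqI) auto

lemma pdeg_adj [simp]: "adj (pdeg g) = pdeg g"
 by(rule adj_unique) (simp add: cinner_ell2, rule infsum_cong, simp)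

lemma pdeg_gL: "a:A ==> pdeg g*gL a = gL a*pdeg g"
 by(rule bop_eqI, rule ell2_eqI) simp

lemma pdeg_lam: "pdeg g*lam \<pi> = lam \<pi>*pdeg (g + deg \<pi>)"
proof(rule bop_eqI, rule ell2_eqI)
 fix v rho
 have "deg sig = deg rho + deg \<pi>" if "sig:fusion rho \<pi>" for sig by(rule deg_fusion[OF that])
 thus "coord ((pdeg g*lam \<pi>)$$v) rho = coord ((lam \<pi>*pdeg (g + deg \<pi>))$$v) rho"
  by(auto simp: lam_coord intro!: sum.cong)
qed

text \<open>An element of degree \<open>h\<close> thus maps the component of degree
  \<open>g + h\<close> into that of degree \<open>g\<close>, as \<open>lam \<pi>\<close> does, whose
  matrix leads from the constituents of \<open>rho \<pi>\<close> to \<open>rho\<close>.\<close>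

definition Bdeg :: "'g => ('i, 'k) ell2 bop set" where
 "Bdeg h = {x:BB. ALL g. pdeg g*x = x*pdeg (g + h)}"

lemma BdegI: "x:BB ==> (!!g. pdeg g*x = x*pdeg (g + h)) ==> x:Bdeg h" by(simp add: Bdeg_def)
lemma BdegD: "x:Bdeg h ==> x:BB" "x:Bdeg h ==> pdeg g*x = x*pdeg (g + h)" by(simp_all add: Bdeg_def)

lemma gL_Bdeg: "a:A ==> gL a:Bdeg 0"
 by(rule BdegI) (simp_all add: S_B_BB gL_S_B pdeg_gL)

lemma Bdeg_mult:
 assumes "x:Bdeg h" "y:Bdeg k"
 shows "x*y:Bdeg (h + k)"
proof(rule BdegI)
 show "x*y:BB" using star_algD(3)[OF B_alg] BdegD(1) assms by blast
 fix g
 show "pdeg g*(x*y) = x*y*pdeg (g + (h + k))" using BdegD(2)[OF assms(1), of g] BdegD(2)[OF assms(2), of "g + h"] by(smt (verit) mult.assoc add.assoc)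
qed

lemma Bdeg_adj:
 assumes "x:Bdeg h"
 shows "adj x:Bdeg (- h)"
proof(rule BdegI)
 show "adj x:BB" using star_algD(4)[OF B_alg] BdegD(1) assms by blast
 fix g
 have "adj (pdeg (g - h)*x) = adj (x*pdeg g)" using BdegD(2)[OF assms, of "g - h"] by simp
 thus "pdeg g*adj x = adj x*pdeg (g + - h)" by simp
qed

lemma lam_Bdeg: "lam \<pi>:Bdeg (deg \<pi>)"
 by(rule BdegI) (simp_all add: S_B_BB lam_S_B pdeg_lam)

lemma Bdeg_subspace: "op_subspace (Bdeg h)"
 unfolding op_subspace_def Bdeg_def
 using star_alg_ops[OF B_alg] by(auto simp: algebra_simps)

text \<open>Representatives of the degrees allow to index the grading projections by a countable type.\<close>

definition q :: "'i => ('i, 'k) ell2 bop" where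
 "q i = (if i = (SOME j. deg j = deg i) then pdeg (deg i) else 0)"

lemma q_props: "adj (q i) = q i" "q i*q i = q i" "i ~= j ==> q i*q j = 0"
by(auto simp: q_def pdeg_mult)

lemma q_bessel:
 assumes G: "finite G"
 shows "(SUM i:G. (norm (q i$$v))\<^sup>2) <= (norm v)^2"
proof -
 define y where "y = (SUM i:G. q i$$v)"
 have qv: "cinner (q i$$v) (q j$$v) = (if i = j then cor ((norm (q i$$v))^2) else 0)" for i j
 proof(cases "i = j")
  case False
  have "cinner (q i$$v) (q j$$v) = cinner ((q j*q i)$$v) v" by(simp add: cinner_adj' q_props(1))
  thus ?thesis using q_props(3)[of j i] False by simp
 qed (simp add: cinner_self)
 have vy: "cinner v y = cor (SUM i:G. (norm (q i$$v))\<^sup>2)"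
 proof -
  have "cinner v (q i$$v) = cor ((norm (q i$$v))^2)" for i
  by(metis q_props(2) times_op_app cinner_adj[of "q i" v] q_props(1) cinner_self)
  thus ?thesis by(simp add: y_def cinner_sum_right)
 qed
 have "cinner y y = (SUM i:G. SUM j:G. cinner (q i$$v) (q j$$v))" unfolding y_def cinner_sum_left unfolding cinner_sum_right ..
 also have "... = cor (SUM i:G. (norm (q i$$v))\<^sup>2)" using G by(simp add: qv)
 finally have yy: "(norm y)^2 = (SUM i:G. (norm (q i$$v))\<^sup>2)" by(simp only: cinner_self of_real_eq_iff)
 have "0 <= (norm (v - y))^2" by simp
 also have "... = (norm v)^2 - (SUM i:G. (norm (q i$$v))\<^sup>2)" by(simp add: norm_diff_sq yy vy)
 finally show ?thesis by simp
qed

text \<open>The left-hand side is a form bounded by \<open>q_bessel\<close>; it agrees with the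
  inner product on single-coordinate vectors, each of which is seen by exactly one
  \<open>q i\<close>.\<close>

lemma q_decomposition: "(\<Sum>\<^sub>\<infinity>i. cinner (q i$$x) (q i$$y)) = cinner x y"
proof -
 define Q :: "('i, 'k) ell2 => ('i, ('i, 'k) ell2) ell2" where "Q v = Abs_ell2 (%i. q i$$v)" for v
 have s: "(%i. (norm (q i$$v))\<^sup>2) summable_on UNIV" for v
 proof(rule nonneg_bdd_above_summable_on)
  show "bdd_above (sum (%i. (norm (q i$$v))\<^sup>2) ` {F. F \<subseteq> UNIV & finite F})"
   by(rule bdd_aboveI2[of _ _ "(norm v)^2"]) (simp add: q_bessel)
 qed simp
 have Q: "coord (Q v) i = q i$$v" for v i unfolding Q_def by(subst Abs_ell2) (rule s, rule refl)
 have nQ: "norm (Q v) <= norm v" for v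
 proof -
  have "(norm (Q v))^2 = (\<Sum>\<^sub>\<infinity>i. (norm (q i$$v))\<^sup>2)" by(simp add: norm_ell2_sq Q)
  also have "... <= (norm v)^2" by(intro infsum_le_finite_sums[OF s]) (simp add: q_bessel)
  finally show ?thesis by(rule power2_le_imp_le) simp
 qed
 have Ql: "Q (v + w) = Q v + Q w" "Q (c*.v) = c*.Q v" for v w c by(rule ell2_eqI; simp add: Q)+
 obtain T where T: "!!x y. cinner x (T$$y) = cinner (Q x) (Q y)"
 proof(rule bop_form[of "%x y. cinner (Q x) (Q y)" 1])
  show "cmod (cinner (Q x) (Q y)) <= 1*norm x*norm y" for x y
   using order_trans[OF cmod_cinner_mult_le[of "Q x" "Q y"] mult_mono[OF nQ nQ]] by simp
 next
  fix T :: "('i, 'k) ell2 bop" assume "!!x y. cinner x (T$$y) = cinner (Q x) (Q y)"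
  thus thesis by(rule that)
 qed (simp_all add: Ql cinner_simps)
 have Qs: "Q (single sig xi) = single (SOME j. deg j = deg sig) (single sig xi)" for sig xi
 proof(rule ell2_eqI)
  fix i
  define r where "r = (SOME j. deg j = deg sig)"
  have r: "deg r = deg sig" unfolding r_def by(rule someI[of _ sig]) simp
  show "coord (Q (single sig xi)) i = coord (single (SOME j. deg j = deg sig) (single sig xi)) i"
   unfolding r_def[symmetric] Q coord_single
  proof(cases "i = r")
   case True
   hence "q i = pdeg (deg sig)" using r by(simp add: q_def r_def)
   hence "q i$$single sig xi = single sig xi" by(intro ell2_eqI) (auto simp: coord_single)
   thus "q i$$single sig xi = (if i = r then single sig xi else 0)" using True by simp
  next
   case False
   have "q i$$single sig xi = 0"
   proof(cases "deg i = deg sig")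
    case True
    thus ?thesis using False by(simp add: q_def r_def)
   next
    case False
    thus ?thesis by(intro ell2_eqI) (auto simp: q_def coord_single)
   qed
   thus "q i$$single sig xi = (if i = r then single sig xi else 0)" using False by simp
  qed
 qed
 have "adj T = 1"
 proof(rule bop_eq_on_total2[OF total_single])
  fix v w :: "('i, 'k) ell2" assume "v:{single i x | i x. True}" "w:{single i x | i x. True}"
  then obtain sig xi sig' xi' where v: "v = single sig xi" "w = single sig' xi'" by blast
  show "cinner (adj T$$v) w = cinner (1$$v) w"
   by(cases "sig = sig'") (auto simp: v cinner_adj T Qs cinner_single coord_single)
 qed
 hence "T = 1" by(metis adj_adj adj_one)
 thus ?thesis using T[of x y] by(simp add: cinner_ell2[of "Q x"] Q)
qed

text \<open>Compressing both families by all \<open>q i\<close> is the dual form of the conditional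
  expectation onto the degree-zero part.\<close>

lemma expectation_functional:
 fixes v w :: "(nat, ('i, 'k) ell2) ell2"
 obtains v' w' where "!!y. ALL i. q i*y = y*q i ==> nfun v' w' y = nfun v w y"
  "!!y. ALL i. q i*y*q i = 0 ==> nfun v' w' y = 0"
proof -
 define W :: "(nat, ('i, 'k) ell2) ell2 => (nat \<times> 'i, ('i, 'k) ell2) ell2" where
  "W v = Abs_ell2 (%p. q (snd p)$$coord v (fst p))" for v
 have s: "(%p. (norm (q (snd p)$$coord v (fst p)))\<^sup>2) summable_on UNIV" for v :: "(nat, ('i, 'k) ell2) ell2"
 proof(rule nonneg_bdd_above_summable_on)
  show "bdd_above (sum (%p. (norm (q (snd p)$$coord v (fst p)))\<^sup>2) ` {F. F \<subseteq> UNIV & finite F})"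
  proof(rule bdd_aboveI2[of _ _ "(norm v)^2"])
   fix F :: "(nat \<times> 'i) set" assume "F:{F. F \<subseteq> UNIV & finite F}"
   hence F: "finite F" by simp
   have "(SUM p:F. (norm (q (snd p)$$coord v (fst p)))\<^sup>2) <= (SUM p:fst ` F \<times> snd ` F. (norm (q (snd p)$$coord v (fst p)))\<^sup>2)"
    by(rule sum_mono2) (use F in force)+
   also have "... = (SUM n:fst ` F. SUM i:snd ` F. (norm (q i$$coord v n))\<^sup>2)"
    by(simp add: sum.cartesian_product case_prod_beta)
   also have "... <= (SUM n:fst ` F. (norm (coord v n))\<^sup>2)" by(intro sum_mono q_bessel) (use F in simp)
   also have "... <= (norm v)^2" by(intro sum_norm_coord_le) (use F in simp)
   finally show "(SUM p:F. (norm (q (snd p)$$coord v (fst p)))\<^sup>2) <= (norm v)^2" .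
  qed
 qed simp
 have W: "coord (W v) p = q (snd p)$$coord v (fst p)" for v p unfolding W_def by(subst Abs_ell2) (rule s, rule refl)
 obtain v' w' where vw: "!!T. nfun v' w' T = cinner (amp T$$W v) (W w)" by(rule nfun_index) (rule that)
 show thesis
 proof(rule that[of v' w'])
  fix y assume "ALL i. q i*y = y*q i"
  hence c: "q i*y = y*q i" for i by blast
  define g where "g n i = cinner (q i$$y$$coord v n) (q i$$coord w n)" for n i
  have eq: "cinner (coord (amp y$$W v) p) (coord (W w) p) = (case p of (n, i) => g n i)" for p
  proof -
   have "y$$q i$$x = q i$$y$$x" for i x using arg_cong[OF c[of i], of "%T. T$$x"] by simp
   thus ?thesis by(simp add: W g_def case_prod_beta)
  qed
  have sm: "(%(n, i). g n i) summable_on UNIV \<times> UNIV"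
   using cinner_coord_summable[of "amp y$$W v" "W w"] by(simp only: eq UNIV_Times_UNIV)
  have "cinner (amp y$$W v) (W w) = (\<Sum>\<^sub>\<infinity>(n, i)\<in>UNIV \<times> UNIV. g n i)" unfolding cinner_ell2[of "amp y$$W v"] eq by simp
  also have "... = (\<Sum>\<^sub>\<infinity>n. \<Sum>\<^sub>\<infinity>i. g n i)" by(rule infsum_Sigma'_banach[symmetric]) (rule sm)
  also have "... = nfun v w y" by(simp add: g_def q_decomposition nfun_def cinner_ell2[of "amp y$$v"])
  finally show "nfun v' w' y = nfun v w y" by(simp add: vw)
 next
  fix y assume "ALL i. q i*y*q i = 0"
  hence c: "q i*y*q i = 0" for i by blast
  have "cinner (coord (amp y$$W v) p) (coord (W w) p) = 0" for p
  proof -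
   have "cinner (y$$q i$$x) (q i$$z) = cinner ((q i*y*q i)$$x) z" for i x z by(simp add: cinner_adj' q_props(1))
   thus ?thesis by(simp add: W c)
  qed
  thus "nfun v' w' y = 0" by(simp add: vw cinner_ell2)
 qed
qed

lemma algB0_span: "algB0 D = sigma_weak closure_of (opspan (bgen {\<pi>. deg \<pi> = 0}))"
proof -
 let ?S = "{SUM \<pi>:F. gL (a \<pi>)*lam \<pi> | F a. finite F & F \<subseteq> irr_component D 0 & (ALL \<pi>:F. a \<pi>:A)}"
 let ?O = "opspan (bgen {\<pi>. deg \<pi> = 0})"
 have "?S \<subseteq> ?O"
 proof clarify
  fix F and a :: "'i => 'k bop" assume "finite F" "F \<subseteq> irr_component D 0" "ALL \<pi>:F. a \<pi>:A"
  thus "(SUM \<pi>:F. gL (a \<pi>)*lam \<pi>):?O"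
   unfolding irr_component_deg by(intro op_subspaceD(6)[OF op_subspace_opspan] opspan.gen bgenI) auto
 qed
 moreover have "x:?S" if "x:?O" for x
  using that
 proof induction
  case zero
  show ?case by(intro CollectI exI[of _ "{}"] exI[of _ "%_. 0"]) simp
 next
  case (gen x)
  then obtain a \<pi> where "x = gL a*lam \<pi>" "a:A" "deg \<pi> = 0" unfolding bgen_def by blast
  thus ?case by(intro CollectI exI[of _ "{\<pi>}"] exI[of _ "%_. a"]) (simp add: irr_component_deg)
 next
  case (add x y)
  obtain F a where x: "x = (SUM \<pi>:F. gL (a \<pi>)*lam \<pi>)" "finite F" "F \<subseteq> irr_component D 0" "!!\<pi>. \<pi>:F ==> a \<pi>:A" using add.IH(1) by blast
  obtain G b where y: "y = (SUM \<pi>:G. gL (b \<pi>)*lam \<pi>)" "finite G" "G \<subseteq> irr_component D 0" "!!\<pi>. \<pi>:G ==> b \<pi>:A" using add.IH(2) by blast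
  define a' b' where "a' \<pi> = (if \<pi>:F then a \<pi> else 0)" and "b' \<pi> = (if \<pi>:G then b \<pi> else 0)" for \<pi>
  have ab: "a' \<pi>:A" "b' \<pi>:A" for \<pi> using x(4) y(4) by(simp_all add: a'_def b'_def)
  have "x = (SUM \<pi>:F \<union> G. gL (a' \<pi>)*lam \<pi>)" unfolding x(1) using x(2) y(2)
   by(intro sum.mono_neutral_cong_left) (auto simp: a'_def gL_hom)
  moreover have "y = (SUM \<pi>:F \<union> G. gL (b' \<pi>)*lam \<pi>)" unfolding y(1) using x(2) y(2)
   by(intro sum.mono_neutral_cong_left) (auto simp: b'_def gL_hom)
  ultimately have "x + y = (SUM \<pi>:F \<union> G. gL (a' \<pi> + b' \<pi>)*lam \<pi>)" using ab by(simp add: gL_hom distrib_right sum.distrib)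
  thus ?case using x y ab by(intro CollectI exI[of _ "F \<union> G"] exI[of _ "%\<pi>. a' \<pi> + b' \<pi>"]) simp
 next
  case (scale x c)
  obtain F a where x: "x = (SUM \<pi>:F. gL (a \<pi>)*lam \<pi>)" "finite F" "F \<subseteq> irr_component D 0" "!!\<pi>. \<pi>:F ==> a \<pi>:A" using scale.IH by blast
  have "c*.x = (SUM \<pi>:F. gL (c*.a \<pi>)*lam \<pi>)"
   unfolding x(1) bop_scaleC_sum using x(4) by(intro sum.cong refl) (simp add: gL_hom)
  thus ?case using x by(intro CollectI exI[of _ F] exI[of _ "%\<pi>. c*.a \<pi>"]) simp
 qed
 ultimately have "?S = ?O" by blast
 thus ?thesis by(simp add: algB0_def)
qed

lemma algB0_eq: "algB0 D = Bdeg 0"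
proof
 let ?O = "opspan (bgen {\<pi>. deg \<pi> = 0})"
 have "bgen {\<pi>. deg \<pi> = 0} \<subseteq> Bdeg 0"
 proof
  fix x assume "x:bgen {\<pi>. deg \<pi> = 0}"
  then obtain a \<pi> where x: "x = gL a*lam \<pi>" "a:A" "deg \<pi> = 0" unfolding bgen_def by blast
  show "x:Bdeg 0" using Bdeg_mult[OF gL_Bdeg[OF x(2)] lam_Bdeg[of \<pi>]] x by simp
 qed
 hence O: "?O \<subseteq> Bdeg 0" by(rule opspan_least[OF Bdeg_subspace])
 show "algB0 D \<subseteq> Bdeg 0"
 proof
  fix x assume "x:algB0 D"
  hence x: "x:sigma_weak closure_of ?O" by(simp add: algB0_span)
  show "x:Bdeg 0"
  proof(rule BdegI)
   have "y*x = x*y" if "y:commutant BB" for y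
    by(rule closure_commute[OF op_subspace_opspan x]) (use O BdegD(1) commutantD[OF that] in blast)
   thus "x:BB" by(intro vnI[OF vnB]) auto
   show "pdeg g*x = x*pdeg (g + 0)" for g
    by(rule closure_commute[OF op_subspace_opspan x]) (use O BdegD(2) in blast)
  qed
 qed
 show "Bdeg 0 \<subseteq> algB0 D"
 proof
  fix x assume x: "x:Bdeg 0"
  \<comment> \<open>The functional is replaced by its expectation, which vanishes on all generators
    and hence on the bicommutant; at \<open>x\<close>, of degree zero, both have the same
    value.\<close>
  have "nfun v w x = 0" if z: "ALL y:?O. nfun v w y = 0" for v w
  proof -
   obtain v' w' where e: "!!y. ALL i. q i*y = y*q i ==> nfun v' w' y = nfun v w y"
    "!!y. ALL i. q i*y*q i = 0 ==> nfun v' w' y = 0"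
    by(rule expectation_functional[where v = v and w = w]) (rule that)
   have c: "ALL i. q i*y = y*q i" if "y:Bdeg 0" for y using BdegD(2)[OF that] by(simp add: q_def)
   have "nfun v' w' y = 0" if "y:opspan (bgen UNIV)" for y
    using that
   proof induction
    case (gen y)
    then obtain a \<pi> where y: "y = gL a*lam \<pi>" "a:A" unfolding bgen_def by blast
    have yd: "y:Bdeg (deg \<pi>)" using Bdeg_mult[OF gL_Bdeg[OF y(2)] lam_Bdeg[of \<pi>]] y by simp
    show ?case
    proof(cases "deg \<pi> = 0")
     case True
     have "y:?O" unfolding y(1) by(intro opspan.gen bgenI) (use y True in auto)
     thus ?thesis using e(1)[OF c] yd True z by simp
    next
     case False
     have "pdeg g*y*pdeg g = 0" for g
     by(use False add_left_cancel[of g "deg \<pi>" 0] BdegD(2)[OF yd, of g] in \<open>simp add: mult.assoc pdeg_mult\<close>)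
     thus ?thesis by(intro e(2)) (simp add: q_def)
    qed
   qed (simp_all add: nfun_simps)
   thus ?thesis using bicommutant_nfun[OF S_B_alg, of x v' w'] BdegD(1)[OF x] e(1)[OF c[OF x]] by(simp add: BB_eq S\<^sub>B_def)
  qed
  thus "x:algB0 D" unfolding algB0_span sigma_weak_closure_iff[OF op_subspace_opspan] by blast
 qed
qed

section \<open>Unitaries shifting the grading\<close>

text \<open>The joint kernel is invariant under the commutant of \<open>BB\<close>, which puts its
  projection into \<open>BB\<close>, and under the \<open>pdeg g\<close>, because homogeneous
  operators shift these projections.\<close>

lemma kernel_projection_Bdeg:
 assumes Y: "!!y. y:Y ==> EX h. y:Bdeg h"
 shows "ccsubspace {eta. ALL y:Y. y$$eta = 0}" "cproj {eta. ALL y:Y. y$$eta = 0}:Bdeg 0"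
proof -
 let ?L = "{eta. ALL y:Y. y$$eta = 0}"
 show L: "ccsubspace ?L"
 proof(rule ccsubspaceI)
  have "?L = (\<Inter>y\<in>Y. {eta. y$$eta = 0})" by auto
  thus "closed ?L"
   by(auto intro!: closed_INT closed_Collect_eq linear_continuous_on op_app_bounded continuous_on_const)
 qed auto
 have "cproj ?L:commutant (commutant BB)"
 proof(rule cproj_in_commutant[OF L])
  show "adj x:commutant BB" if "x:commutant BB" for x
   using commutant_adj[OF star_algD(4)[OF B_alg] that] .
  fix c eta assume c: "c:commutant BB" and eta: "eta:?L"
  have "y$$c$$eta = 0" if y: "y:Y" for y
  proof -
   have "y$$c$$eta = c$$y$$eta" using Y[OF y] BdegD(1) by(metis commutantD[OF c] times_op_app)
   thus ?thesis using eta y by simp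
  qed
  thus "c$$eta:?L" by simp
 qed
 hence B: "cproj ?L:BB" by(simp add: vn_commutant[OF vnB])
 show "cproj ?L:Bdeg 0"
 proof(rule BdegI[OF B])
  fix g
  have inv: "pdeg g$$eta:?L" if eta: "eta:?L" for eta
  proof -
   have "y$$pdeg g$$eta = 0" if y: "y:Y" for y
   proof -
    obtain h where "y:Bdeg h" using Y[OF y] by blast
    hence "pdeg (g - h)*y = y*pdeg g" using BdegD(2)[of y h "g - h"] by simp
    hence "y$$pdeg g$$eta = pdeg (g - h)$$y$$eta" by(metis times_op_app)
    thus ?thesis using eta y by simp
   qed
   thus ?thesis by simp
  qed
  show "pdeg g * cproj ?L = cproj ?L*pdeg (g + 0)" using cproj_commute[OF L, of "pdeg g"] inv by simp
 qed
qed

text \<open>The direct sum of the tensor unit with itself yields isometries \<open>v\<close> and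
  \<open>w\<close> with complementary ranges; \<open>w ^ n * v\<close> is an infinite orthogonal
  sequence, which \<open>tj\<close> doubles.\<close>

lemma orthogonal_isometries:
 obtains s :: "nat => 'k bop" where "!!n. s n:A" "!!n m. adj (s n) * s m = (if n = m then 1 else 0)"
proof -
 have io: "(\<lambda>x\<in>M. x):objects D" by(rule rigid_unfolded[THEN conjunct2, THEN conjunct1])
 obtain v w where vw: "v:M" "w:M" "adj v * v = 1" "adj w * w = 1" "v * adj v + w*adj w = 1"
  using objects_sum[OF io io] unfolding intertwiners_def by blast
 have "adj v * w = adj v * (v * adj v + w*adj w) * w" by(simp add: vw(5))
 also have "... = (adj v * v)*(adj v * w) + (adj v * w)*(adj w * w)" by(simp add: algebra_simps)
 also have "... = adj v * w + adj v * w" by(simp add: vw)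
 finally have v0: "adj v * w = 0" by simp
 have "adj w * v = adj (adj v * w)" by simp
 hence w0: "adj w * v = 0" by(simp only: v0 adj_zero)
 define x where "x = rec_nat v (%_ y. w*y)"
 have x: "x 0 = v" "x (Suc n) = w*x n" for n by(simp_all add: x_def)
 have xM: "x n:M" for n by(induction n) (simp_all add: x vw)
 have xx: "adj (x n)*x m = (if n = m then 1 else 0)" for n m
 proof(induction n arbitrary: m)
  case 0
  show ?case
  proof(cases m)
   case (Suc k)
   have "adj v * (w*x k) = (adj v * w)*x k" by(simp add: mult.assoc)
   thus ?thesis using Suc by(simp add: x v0)
  qed (simp add: x vw)
 next
  case (Suc n)
  show ?case
  proof(cases m)
   case 0
   have "adj (w*x n) * v = adj (x n)*(adj w * v)" by(simp add: mult.assoc)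
   thus ?thesis using 0 by(simp add: x w0)
  next
   case (Suc k)
   have "adj (w*x n)*(w*x k) = adj (x n)*((adj w * w)*x k)" by(simp add: mult.assoc)
   thus ?thesis using Suc Suc.IH[of k] by(simp add: x vw)
  qed
 qed
 show thesis
 proof(rule that[of "%n. tj (x n) (x n)"])
  show "tj (x n) (x n):A" for n by(simp add: xM)
  show "adj (tj (x n) (x n))*tj (x m) (x m) = (if n = m then 1 else 0)" for n m
   by(simp add: tj_adj tj_mult xx tj_sesq)
 qed
qed

text \<open>The isometry of degree \<open>0\<close> onto the complement of the other ranges comes from the
 Schroeder--Bernstein argument, applied to an isometry \<open>S\<close> into that complement.\<close>

lemma graded_partition:
 obtains T where "!!h. T h:Bdeg h" "!!h k. adj (T h)*T k = (if h = k then 1 else 0)"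
  "!!xi. (!!h. adj (T h)$$xi = 0) ==> xi = 0"
proof -
 obtain s :: "nat => 'k bop" where s: "!!n. s n:A" "!!n m. adj (s n) * s m = (if n = m then 1 else 0)"
  by(rule orthogonal_isometries) (rule that)
 define i where "i h = (SOME j. deg j = h)" for h
 have i: "deg (i h) = h" for h unfolding i_def by(rule someI_ex[OF deg_surj])
 \<comment> \<open>\<open>Suc\<close> keeps \<open>s 0\<close> free for \<open>S\<close>.\<close>
 define n where "n h = Suc (to_nat (i h))" for h
 have n: "n h = n k \<longleftrightarrow> h = k" for h k unfolding n_def by(metis i Suc_inject from_nat_to_nat)
 define X where "X h = cor (1 / sqrt (d (i h)))*.lam (i h)" for h
 have Xd: "X h:Bdeg h" for h
  unfolding X_def using op_subspaceD(3)[OF Bdeg_subspace lam_Bdeg[of "i h"]] by(simp add: i)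
 have XX: "adj (X h)*X h = 1" for h
 by(use d_pos[of "i h"] in \<open>simp add: of_real_mult[symmetric] of_real_1 X_def bop_scaleC_simps lam_norm\<close>)
 have gs: "adj (gL (s k))*gL (s m) = (if k = m then 1 else 0)" for k m
 proof -
  have "adj (gL (s k))*gL (s m) = gL (adj (s k) * s m)" by(simp add: gL_hom s(1))
  thus ?thesis by(simp add: s(2) gL_hom)
 qed
 define T' where "T' h = gL (s (n h))*X h" for h
 have T'd: "T' h:Bdeg h" for h unfolding T'_def using Bdeg_mult[OF gL_Bdeg[OF s(1)] Xd] by simp
 have T'T': "adj (T' h)*T' k = (if h = k then 1 else 0)" for h k
 proof -
  have "adj (T' h)*T' k = adj (X h)*(adj (gL (s (n h)))*gL (s (n k)))*X k" by(simp add: T'_def mult.assoc)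
  thus ?thesis by(simp add: gs n XX)
 qed
 define S where "S = gL (s 0)"
 have Sd: "S:Bdeg 0" unfolding S_def by(rule gL_Bdeg[OF s(1)])
 have SS: "adj S*S = 1" by(simp add: S_def gs)
 have T'S: "adj (T' h)*S = 0" for h
 by(simp add: T'_def S_def mult.assoc gs n_def)
 define Y where "Y = {adj (T' h) | h. h ~= 0}"
 define L where "L = {eta. ALL y:Y. y$$eta = 0}"
 have "EX h. y:Bdeg h" if "y:Y" for y using that Bdeg_adj[OF T'd] unfolding Y_def by blast
 note kL = kernel_projection_Bdeg[of Y, OF this, folded L_def]
 define r f where "r = cproj L" and "f = 1 - r"
 have r: "r:Bdeg 0" "adj r = r" "r*r = r" using kL cproj_adj cproj_idem by(auto simp: r_def)
 have oneB: "1:Bdeg 0" using gL_Bdeg[of 1] by(simp add: gL_hom)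
 have f: "f:Bdeg 0" "adj f = f" "f*f = f"
  using op_subspaceD(5)[OF Bdeg_subspace oneB r(1)] r by(auto simp: f_def algebra_simps)
 have rS: "r*S = S"
 proof(rule bop_eqI)
  fix xi
  have "adj (T' h)$$S$$xi = 0" for h using arg_cong[OF T'S[of h], of "%T. T$$xi"] by simp
  hence "S$$xi:L" unfolding L_def Y_def by auto
  thus "(r*S)$$xi = S$$xi" unfolding r_def by(simp add: cproj_id[OF kL(1)])
 qed
 have rT': "r*T' h = 0" if h: "h ~= 0" for h
 proof(rule bop_eqI)
  fix xi
  have "cinner k (T' h$$xi) = 0" if "k:L" for k
  proof -
   show ?thesis using that h by(auto simp: L_def Y_def cinner_adj')
  qed
  thus "(r*T' h)$$xi = 0$$xi" unfolding r_def by(simp add: cproj_eq_0[OF kL(1)])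
 qed
 have fS: "f*S = 0" "adj S*f = 0"
 proof -
  show 1: "f*S = 0" by(simp add: f_def algebra_simps rS)
  show "adj S*f = 0" using arg_cong[OF 1, of adj] by(simp add: f(2))
 qed
 \<comment> \<open>\<open>N\<close> is the orthogonal complement of the ranges of all
   \<open>S ^ k*f\<close>. \<open>T0\<close> moves these ranges one step up by \<open>S\<close> and
   is the identity on \<open>N\<close>, so that its range omits exactly that of
   \<open>f\<close>.\<close>
 define Z where "Z = {f*adj S ^ k | k. True}"
 define N where "N = {eta. ALL y:Z. y$$eta = 0}"
 have aSd: "adj S ^ k:Bdeg 0" for k
 proof(induction k)
  case (Suc k)
  thus ?case using Bdeg_mult[OF Bdeg_adj[OF Sd] Suc.IH] by simp
 qed (simp add: oneB)
 have "EX h. y:Bdeg h" if "y:Z" for y using that Bdeg_mult[OF f(1) aSd] unfolding Z_def by blast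
 note kN = kernel_projection_Bdeg[of Z, OF this, folded N_def]
 have N_iff: "eta:N \<longleftrightarrow> (ALL k. (f*adj S ^ k)$$eta = 0)" for eta unfolding N_def Z_def by blast
 define e where "e = cproj N"
 have e: "e:Bdeg 0" "adj e = e" "e*e = e" using kN cproj_adj cproj_idem by(auto simp: e_def)
 have SN: "S$$eta:N" if "eta:N" for eta
  unfolding N_iff
 proof
  fix k
  show "(f*adj S ^ k)$$S$$eta = 0"
  proof(cases k)
   case 0
   thus ?thesis using arg_cong[OF fS(1), of "%T. T$$eta"] by simp
  next
   case (Suc m)
   have "(f*adj S ^ k)*S = f*adj S ^ m*(adj S*S)" by(simp add: Suc power_Suc2 mult.assoc del: power_Suc)
   hence "(f*adj S ^ k)*S = f*adj S ^ m" by(simp add: SS)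
   thus ?thesis using that N_iff by(metis times_op_app)
  qed
 qed
 have S'N: "adj S$$eta:N" if "eta:N" for eta
  unfolding N_iff
 proof
  fix k
  have "(f*adj S ^ k)$$adj S$$eta = (f*adj S ^ Suc k)$$eta" by(simp add: power_Suc2 mult.assoc del: power_Suc)
  moreover have "(f*adj S ^ Suc k)$$eta = 0" using N_iff[of eta] that by metis
  ultimately show "(f*adj S ^ k)$$adj S$$eta = 0" by(simp only:)
 qed
 have eS: "S*e = e*S" unfolding e_def by(rule cproj_commute[OF kN(1) SN S'N])
 have eS': "adj S*e = e*adj S" using arg_cong[OF eS, of adj] by(simp add: e(2))
 have fe: "f*e = 0"
 proof(rule bop_eqI)
  fix xi
  have "(f*adj S ^ 0)$$e$$xi = 0" using cproj_in[OF kN(1), of xi] N_iff unfolding e_def by blast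
  thus "(f*e)$$xi = 0$$xi" by simp
 qed
 have "e*f = adj (f*e)" by(simp add: e(2) f(2))
 hence ef: "e*f = 0" by(simp only: fe adj_zero)
 \<comment> \<open>Vectors in the range of \<open>r\<close> that are orthogonal to the range of
   \<open>S\<close> belong to \<open>N\<close>; so the shift loses the range of \<open>f\<close> and
   nothing else.\<close>
 have complement: "e*(r*(1 - S*adj S)) = r*(1 - S*adj S)"
 proof(rule bop_eqI)
  fix xi
  define x where "x = (r*(1 - S*adj S))$$xi"
  have "adj S*(r*(1 - S*adj S)) = adj S*(1 - S*adj S)" using arg_cong[OF rS, of adj] by(simp add: r(2) mult.assoc[symmetric])
  also have "... = 0" using SS by(simp add: algebra_simps flip: mult.assoc)
  finally have S'x: "adj S$$x = 0" unfolding x_def by(metis times_op_app zero_op_app)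
  have "f*(r*(1 - S*adj S)) = (f*r)*(1 - S*adj S)" by(simp add: mult.assoc)
  also have "f*r = 0" by(simp add: f_def algebra_simps r)
  finally have fx: "f$$x = 0" unfolding x_def by(metis times_op_app zero_op_app mult_zero_left)
  have "(f*adj S ^ k)$$x = 0" for k
  proof(cases k)
   case (Suc m)
   have "(f*adj S ^ k)$$x = (f*adj S ^ m)$$adj S$$x" by(simp add: Suc power_Suc2 del: power_Suc)
   thus ?thesis by(simp add: S'x)
  qed (simp add: fx)
  thus "(e*(r*(1 - S*adj S)))$$xi = (r*(1 - S*adj S))$$xi" using cproj_id[OF kN(1)] by(metis N_iff e_def times_op_app[of "cproj N"] x_def)
 qed
 define T0 where "T0 = S*(1 - e) + e"
 have T0d: "T0:Bdeg 0"
  using op_subspaceD(2)[OF Bdeg_subspace Bdeg_mult[OF Sd op_subspaceD(5)[OF Bdeg_subspace oneB e(1)]], of e] e(1) by(simp add: T0_def)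
 have ce: "(1 - e)*e = 0" "e*(1 - e) = 0" "(1 - e)*(1 - e) = 1 - e" by(simp_all add: algebra_simps e)
 have aT0: "adj T0 = (1 - e)*adj S + e" by(simp add: T0_def e)
 have T0T0: "adj T0*T0 = 1"
 proof -
  have "adj T0*T0 = (1 - e)*(adj S*S)*(1 - e) + (1 - e)*(adj S*e) + (e*S)*(1 - e) + e*e"
   unfolding aT0 unfolding T0_def by(simp add: distrib_left distrib_right mult.assoc)
  also have "(1 - e)*(adj S*e) = 0" unfolding eS' using ce(1) by(simp flip: mult.assoc)
  also have "(e*S)*(1 - e) = 0" unfolding eS[symmetric] using ce(2) by(simp add: mult.assoc)
  finally show ?thesis by(simp add: SS ce e(3))
 qed
 have rT0: "T0*adj T0 = r"
 proof -
  have "T0*adj T0 = S*((1 - e)*(1 - e))*adj S + S*((1 - e)*e) + (e*(1 - e))*adj S + e*e"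
   unfolding aT0 unfolding T0_def by(simp add: distrib_left distrib_right mult.assoc)
  also have "... = S*(1 - e)*adj S + e" by(simp add: ce e(3))
  also have "S*(1 - e) = (1 - e)*S" by(simp add: algebra_simps eS)
  also have "(1 - e)*S*adj S + e = 1 - (1 - e)*(1 - S*adj S)" by(simp add: algebra_simps)
  also have "(1 - e)*(1 - S*adj S) = f"
  proof -
   have "(1 - e)*(1 - S*adj S) = (1 - e)*(r*(1 - S*adj S) + f*(1 - S*adj S))" by(simp add: f_def distrib_right[symmetric] mult_1)
   also have "... = (1 - e)*(r*(1 - S*adj S)) + (1 - e)*(f*(1 - S*adj S))"
    by(simp only: distrib_left)
   also have "(1 - e)*(r*(1 - S*adj S)) = 0" using complement by(simp add: left_diff_distrib)
   also have "(1 - e)*(f*(1 - S*adj S)) = f"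
   proof -
    have "f*(1 - S*adj S) = f - (f*S)*adj S" by(simp add: right_diff_distrib mult.assoc)
    thus ?thesis by(simp add: fS left_diff_distrib ef)
   qed
   finally show ?thesis by simp
  qed
  finally show ?thesis by(simp add: f_def)
 qed
 define T where "T h = (if h = 0 then T0 else T' h)" for h
 have T0T': "adj T0*T' h = 0" if "h ~= 0" for h
 proof -
  have "adj T0*T' h = (adj T0*T0)*(adj T0*T' h)" by(simp add: T0T0)
  also have "... = adj T0*((T0*adj T0)*T' h)" by(simp add: mult.assoc)
  finally show ?thesis by(simp add: rT0 rT'[OF that])
 qed
 have T'T0: "adj (T' h)*T0 = 0" if "h ~= 0" for h
 proof -
  have "adj (T' h)*T0 = adj (adj T0*T' h)" by simp
  thus ?thesis by(simp only: T0T'[OF that] adj_zero)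
 qed
 show thesis
 proof(rule that[of T])
  show "T h:Bdeg h" for h using T0d T'd by(simp add: T_def)
  show "adj (T h)*T k = (if h = k then 1 else 0)" for h k
   by(auto simp: T_def T0T0 T'T' T0T' T'T0)
  fix xi assume z: "!!h. adj (T h)$$xi = 0"
  have "adj (T' h)$$xi = 0" if "h ~= 0" for h using z[of h] that by(simp add: T_def)
  hence "xi:L" unfolding L_def Y_def by auto
  hence "xi = r$$xi" unfolding r_def by(simp add: cproj_id[OF kL(1)])
  also have "... = 0" using z[of 0] by(simp add: rT0[symmetric] T_def)
  finally show "xi = 0" .
 qed
qed

text \<open>The left regular representation on the labels of the partition. Membership in
  \<open>BB\<close> and the degree can be tested against the \<open>T h\<close>, whose ranges are
  jointly total.\<close>

lemma shift_unitaries: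
 obtains w where "!!g. w g:Bdeg g" "!!g h. w g * w h = w (g + h)" "w 0 = 1" "!!g. adj (w g) = w (- g)"
proof -
 obtain T where T: "!!h. T h:Bdeg h" "!!h k. adj (T h)*T k = (if h = k then 1 else 0)"
  "!!xi. (!!h. adj (T h)$$xi = 0) ==> xi = 0"
 by(metis graded_partition)
 define f where "f p = T (fst p)$$snd p" for p
 define G where "G g p = T (g + fst p)$$snd p" for g p
 have ip: "cinner (T h$$x) (T k$$y) = (if h = k then cinner x y else 0)" for h k x y
 proof -
  have "cinner (T h$$x) (T k$$y) = cinner ((adj (T k)*T h)$$x) y" by(simp add: cinner_adj')
  thus ?thesis by(simp add: T(2))
 qed
 have "EX w. ALL h x. w$$T h$$x = T (g + h)$$x" for g
 proof -
  obtain u where u: "!!p. p:UNIV ==> u$$f p = G g p"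
   by(rule gram_ext[of UNIV "G g" 1 f]) (auto simp: f_def G_def ip)
  show ?thesis using u[of "(h, x)" for h x] by(intro exI[of _ u]) (simp add: f_def G_def)
 qed
 then obtain w where w: "!!g h x. w g$$T h$$x = T (g + h)$$x" by metis
 have wT: "w g*T h = T (g + h)" for g h by(rule bop_eqI) (simp add: w)
 have tot: "total {T h$$x | h x. True}"
  unfolding total_def
 proof(intro allI impI)
  fix y assume y: "ALL v:{T h$$x | h x. True}. cinner v y = 0"
  have "adj (T h)$$y = 0" for h
  proof -
   have "cinner x (adj (T h)$$y) = 0" for x using y by(auto simp: cinner_adj[symmetric])
   thus ?thesis by(metis cinner_eq_zero_iff)
  qed
  thus "y = 0" by(rule T(3))
 qed
 have eqI: "a = b" if "!!h. a*T h = b*T h" for a b :: "('i, 'k) ell2 bop"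
 proof(rule bop_eq_on_total[OF tot])
  fix v assume "v:{T h$$x | h x. True}"
  then obtain h x where v: "v = T h$$x" by blast
  show "a$$v = b$$v" unfolding v using that[of h] by(metis times_op_app)
 qed
 show thesis
 proof(rule that[of w])
  show ww: "w g * w h = w (g + h)" for g h
   by(rule eqI) (simp add: mult.assoc wT add.assoc)
  show "w 0 = 1" by(rule eqI) (simp add: wT)
  show "adj (w g) = w (- g)" for g
  proof(rule bop_eq_on_total2[OF tot])
   fix v u assume "v:{T h$$x | h x. True}" "u:{T h$$x | h x. True}"
   then obtain h x k y where v: "v = T h$$x" "u = T k$$y" by blast
   show "cinner (adj (w g)$$v) u = cinner (w (- g)$$v) u" by(auto simp: v cinner_adj[of "adj (w g)"] adj_adj w ip)
  qed
  show "w g:Bdeg g" for g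
  proof(rule BdegI)
   show "w g:BB"
   proof(rule vnI[OF vnB])
    fix c assume c: "c:commutant BB"
    have cT: "c*T h = T h * c" for h by(rule commutantD[OF c BdegD(1)[OF T(1)]])
    show "w g * c = c * w g"
    proof(rule eqI)
     fix h
     show "w g * c*T h = c * w g*T h" by(metis cT mult.assoc wT)
    qed
   qed
   fix a
   show "pdeg a * w g = w g*pdeg (a + g)"
   proof(rule eqI)
    fix h
    show "pdeg a * w g*T h = w g*pdeg (a + g)*T h" by(smt (verit) wT mult.assoc BdegD(2)[OF T(1)] add.assoc BdegD(2)[OF T(1), symmetric])
   qed
  qed
 qed
qed

section \<open>The action and the bimodules\<close>

lemma frakH_iff: "v:frakH D g \<longleftrightarrow> pdeg g$$v = v"
proof
 assume "v:frakH D g"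
 thus "pdeg g$$v = v" by(intro ell2_eqI) (auto simp: frakH_def irr_component_deg)
next
 assume *: "pdeg g$$v = v"
 have "coord v i = 0" if "deg i ~= g" for i using arg_cong[OF *, of "%v. coord v i"] that by simp
 thus "v:frakH D g" by(auto simp: frakH_def irr_component_deg)
qed

lemma graded_action_exists:
 "EX be :: 'g => ('i, 'k) ell2 bop => ('i, 'k) ell2 bop. group_action be (algB0 D) &
  (ALL g. bimodule_iso (algB0 D) (frakH D g) (%b. b) (gammaR D) (frakH D 0) (be g) (gammaR D))"
proof -
 obtain w where w: "!!g. w g:Bdeg g" "!!g h. w g * w h = w (g + h)" "w 0 = 1" "!!g. adj (w g) = w (- g)"
  by(rule shift_unitaries) (rule that)
 let ?N = "algB0 D"
 define be where "be g = (\<lambda>b\<in>?N. w g*b * w (- g))" for g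
 have inv: "w g*(w (- g)*x) = x" "w (- g)*(w g*x) = x" for g x by(simp_all add: w flip: mult.assoc)
 have inv_app: "w g$$w (- g)$$v = v" "w (- g)$$w g$$v = v" for g v
  using arg_cong[OF w(2)[of g "- g"], of "%T. T$$v"] arg_cong[OF w(2)[of "- g" g], of "%T. T$$v"] by(simp_all add: w(3))
 have beN: "w g*b * w (- g):?N" if "b:?N" for g b
  using Bdeg_mult[OF Bdeg_mult[OF w(1)[of g] that[unfolded algB0_eq]] w(1)[of "- g"]] by(simp add: algB0_eq)
 have Nsub: "op_subspace ?N" unfolding algB0_eq by(rule Bdeg_subspace)
 have Nm: "x*y:?N" if "x:?N" "y:?N" for x y using Bdeg_mult[of x 0 y 0] that by(simp add: algB0_eq)
 have Na: "adj x:?N" if "x:?N" for x using Bdeg_adj[of x 0] that by(simp add: algB0_eq)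
 have Ns: "x + y:?N" "c*.x:?N" if "x:?N" "y:?N" for x y c using op_subspaceD[OF Nsub] that by auto
 have comp: "be (g + h) = compose ?N (be g) (be h)" for g h
 proof
  fix b show "be (g + h) b = compose ?N (be g) (be h) b"
  proof(cases "b:?N")
   case True
   have "w (- (g + h)) = w (- h) * w (- g)" by(simp only: minus_add w(2))
   thus ?thesis using True beN by(simp add: w(2)[symmetric] mult.assoc be_def compose_def)
  qed (simp add: be_def compose_def)
 qed
 have be0: "be 0 b = b" if "b:?N" for b using that by(simp add: be_def w(3))
 have endo: "be g:endos ?N" for g
 proof -
  have "nmap_on ?N (be g)" by(rule nmap_on_cong[OF nmap_on_sandwich[OF nmap_on_id, of _ "w g" "w (- g)"]]) (simp add: be_def)
  hence c: "continuous_map (subtopology sigma_weak ?N) sigma_weak (be g)" by(rule nmap_on_continuous)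
  have m: "be g (x*y) = be g x*be g y" if "x:?N" "y:?N" for x y
   using that Nm by(simp add: be_def mult.assoc inv)
  have a: "be g (adj x) = adj (be g x)" if "x:?N" for x
   using that Na by(simp add: be_def w(4) mult.assoc)
  have l: "clinear_on ?N (be g)"
   unfolding clinear_on_def using Ns by(auto simp: be_def algebra_simps bop_scaleC_simps)
  show ?thesis using gL_Bdeg[of 1] beN c m a l by(simp add: gL_hom algB0_eq be_def w endos_def)
 qed
 have auto: "be g:autos ?N" for g
  unfolding autos_def
 proof(intro CollectI conjI endo)
  have c: "be g (be (- g) b) = b" "be (- g) (be g b) = b" if b: "b:?N" for b
  proof -
   have "compose ?N (be g) (be (- g)) b = be 0 b" "compose ?N (be (- g)) (be g) b = be 0 b" by(simp_all flip: comp)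
   thus "be g (be (- g) b) = b" "be (- g) (be g b) = b" using b by(simp_all add: compose_eq be0)
  qed
  show "bij_betw (be g) ?N ?N"
   by(rule bij_betw_byWitness[where f' = "be (- g)"]) (use c endosD(1)[OF endo] in auto)
 qed
 \<comment> \<open>Degree \<open>g\<close> means that \<open>w g\<close> carries the
   \<open>g\<close>-component to the zero component; this fixes the direction of the
   equivalence.\<close>
 have shift: "w g$$v:frakH D 0" if "v:frakH D g" for g v
 proof -
  have "pdeg 0 * w g = w g*pdeg g" using BdegD(2)[OF w(1), of 0 g] by simp
  thus ?thesis using that by(metis times_op_app frakH_iff)
 qed
 have shift': "w (- g)$$v:frakH D g" if "v:frakH D 0" for g v
 proof -
  have "pdeg g * w (- g) = w (- g)*pdeg 0" using BdegD(2)[OF w(1), of g "- g"] by simp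
  thus ?thesis using that by(smt (verit) times_op_app frakH_iff)
 qed
 have iso: "bimodule_iso ?N (frakH D g) (%b. b) (gammaR D) (frakH D 0) (be g) (gammaR D)" for g
  unfolding bimodule_iso_def
 proof(intro exI[of _ "op_app (w g)"] conjI ballI)
  show "bij_betw (op_app (w g)) (frakH D g) (frakH D 0)"
   by(rule bij_betw_byWitness[where f' = "op_app (w (- g))"]) (use shift shift' inv_app in auto)
  show "clinear_on (frakH D g) (op_app (w g))" by(simp add: clinear_on_def)
  show "cinner (w g$$v) (w g$$v') = cinner v v'" for v v'
   by(simp add: cinner_adj w(4) inv_app)
  fix b v assume b: "b:?N"
  have bB: "b:BB" using b BdegD(1) by(simp add: algB0_eq)
  show "w g$$b$$v = be g b$$w g$$v" using b by(simp add: be_def inv_app)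
  have "w g$$rr b$$v = rr b$$w g$$v" by(metis rr_commute[OF bB BdegD(1)[OF w(1)]] times_op_app)
  thus "w g$$gammaR D b$$v = gammaR D b$$w g$$v" using bB by(simp add: gammaR_eq)
 qed
 show ?thesis
  by(rule exI[of _ be]) (use auto comp iso in \<open>simp add: group_action_def\<close>)
qed

end

theorem proposition2p4:
  fixes D :: "('h::chilbert_space, 'k::chilbert_space, 'i::countable, 'g::group_add) cat"
  assumes "type_III_factor (alg D)"
    and "faithful_normal_state (alg D) (state D)"
    and "rigid_tensor_category (alg D) (objects D)"
    and "group_grading (alg D) (objects D) (component D)"
    and "irr_representatives (alg D) (objects D) (irr_rep D)"
    and "conjugation_data D"
    and "basis_data D"
    and "conj_tensor (tens D)"
    and "standard_form (algA D) (mod_conj D) (pos_cone D)"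
  shows "\<exists>\<beta> :: 'g \<Rightarrow> ('i, 'k) ell2 bop \<Rightarrow> ('i, 'k) ell2 bop.
    group_action \<beta> (algB0 D) \<and>
    (\<forall>g. bimodule_iso (algB0 D)
           (frakH D g) (\<lambda>b. b) (gammaR D)
           (frakH D 0) (\<beta> g) (gammaR D))"
proof -
 interpret graded_category D by unfold_locales (fact assms)+
 show ?thesis by(rule graded_action_exists)
qed

end
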